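(* Let $n\ge2$ and let $\Lambda,\sigma$ be real constants with $\sigma>\frac{n-1}{n}\Lambda^2$. Define $$\eta(t)=\tfrac{n-1}{n}\Lambda-\sqrt{\tfrac{n-1}{n}\big(\sigma-\tfrac{n-1}{n}\Lambda^2\big)}\,\tan\!\Big(\tfrac{n}{2(n-1)}\sqrt{\tfrac{n-1}{n}\big(\sigma-\tfrac{n-1}{n}\Lambda^2\big)}\;t\Big)$$ on the interval where the argument of $\tan$ lies in $(-\pi/2,\pi/2)$. Let $M=\mathbb{T}^{n-1}\times[-1,1]$ and let $(M,g,k)$ be an initial data set with $\operatorname{tr}_g k\le\Lambda$ and $\mu-|J|\ge\frac12\sigma$ on $M$, such that $\theta_-\le\eta(t_-)$ on $\partial_-M$ and $\theta_+\ge\eta(t_+)$ on $\partial_+M$, where $t_-<t_+$ are two numbers in the domain of $\eta$ with $\eta(t_\pm)>0$. Then $\operatorname{width}(M,g)\le t_+-t_-$.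
   Context: An initial data set $(M,g,k)$: smooth $n$-manifold $M$ with Riemannian metric $g$ and symmetric 2-tensor $k$; $2\mu=R_g-|k|_g^2+(\operatorname{tr}_g k)^2$, $J=\operatorname{div}_g k-\mathrm{d}(\operatorname{tr}_g k)$. For a two-sided hypersurface with unit normal $\nu$, null expansion $\theta=H+\operatorname{tr}_\Sigma k$ with $H=\operatorname{div}_\Sigma\nu$ and $\operatorname{tr}_\Sigma k$ the trace of $k$ restricted to the hypersurface. Band conventions: $M=\mathbb{T}^{n-1}\times[-1,1]$, $\partial_\pm M=\mathbb{T}^{n-1}\times\{\pm1\}$; $\theta_+$ is the null expansion of $\partial_+M$ with respect to the unit normal pointing out of $M$, $\theta_-$ that of $\partial_-M$ with respect to the unit normal pointing into $M$; $\operatorname{width}(M,g)=\operatorname{dist}_g(\partial_-M,\partial_+M)$. *)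

theory Defs
  imports "HOL-Analysis.Analysis"
begin

text \<open>Coordinates: the universal cover R^n of M = T^(n-1) x [-1,1], with points x :: real^'n,
  n = CARD('n), and a distinguished index e for the interval direction. The remaining
  n-1 coordinates are the torus directions (fields are 1-periodic in them).\<close>

definition pd :: "'n::finite \<Rightarrow> (real^'n \<Rightarrow> real) \<Rightarrow> real^'n \<Rightarrow> real" where
  "pd i f x = deriv (\<lambda>t. f (x + t *\<^sub>R axis i 1)) 0"

fun iterpd :: "'n::finite list \<Rightarrow> (real^'n \<Rightarrow> real) \<Rightarrow> real^'n \<Rightarrow> real" where
  "iterpd [] f = f"
| "iterpd (i # is) f = pd i (iterpd is f)"

definition smooth_fun :: "(real^'n::finite \<Rightarrow> real) \<Rightarrow> bool" where
  "smooth_fun f \<longleftrightarrow> (\<forall>is. continuous_on UNIV (iterpd is f) \<and>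
      (\<forall>i x. (\<lambda>t. iterpd is f (x + t *\<^sub>R axis i 1)) differentiable (at 0)))"

definition periodic_in :: "'n::finite \<Rightarrow> (real^'n \<Rightarrow> 'b) \<Rightarrow> bool" where
  "periodic_in e f \<longleftrightarrow> (\<forall>i x. i \<noteq> e \<longrightarrow> f (x + axis i 1) = f x)"

definition band :: "'n::finite \<Rightarrow> (real^'n) set" where
  "band e = {x. -1 \<le> x $ e \<and> x $ e \<le> 1}"

definition smooth_sym_field :: "'n::finite \<Rightarrow> (real^'n \<Rightarrow> real^'n^'n) \<Rightarrow> bool" where
  "smooth_sym_field e h \<longleftrightarrow> (\<forall>x. transpose (h x) = h x) \<and>
     (\<forall>i j. smooth_fun (\<lambda>x. h x $ i $ j)) \<and> periodic_in e h"

definition riem_metric :: "'n::finite \<Rightarrow> (real^'n \<Rightarrow> real^'n^'n) \<Rightarrow> bool" where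
  "riem_metric e g \<longleftrightarrow> smooth_sym_field e g \<and>
     (\<forall>x v. v \<noteq> 0 \<longrightarrow> v \<bullet> (g x *v v) > 0)"

definition ginv :: "(real^'n::finite \<Rightarrow> real^'n^'n) \<Rightarrow> real^'n \<Rightarrow> real^'n^'n" where
  "ginv g x = matrix_inv (g x)"

definition christ :: "(real^'n::finite \<Rightarrow> real^'n^'n) \<Rightarrow> 'n \<Rightarrow> 'n \<Rightarrow> 'n \<Rightarrow> real^'n \<Rightarrow> real" where
  "christ g a i j x = (1/2) * (\<Sum>l\<in>UNIV. ginv g x $ a $ l *
      (pd i (\<lambda>y. g y $ j $ l) x + pd j (\<lambda>y. g y $ i $ l) x - pd l (\<lambda>y. g y $ i $ j) x))"

definition ricci :: "(real^'n::finite \<Rightarrow> real^'n^'n) \<Rightarrow> 'n \<Rightarrow> 'n \<Rightarrow> real^'n \<Rightarrow> real" where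
  "ricci g i j x =
     (\<Sum>a\<in>UNIV. pd a (christ g a i j) x) - (\<Sum>a\<in>UNIV. pd j (christ g a i a) x)
   + (\<Sum>a\<in>UNIV. \<Sum>l\<in>UNIV. christ g a a l x * christ g l i j x)
   - (\<Sum>a\<in>UNIV. \<Sum>l\<in>UNIV. christ g a j l x * christ g l i a x)"

definition scal :: "(real^'n::finite \<Rightarrow> real^'n^'n) \<Rightarrow> real^'n \<Rightarrow> real" where
  "scal g x = (\<Sum>i\<in>UNIV. \<Sum>j\<in>UNIV. ginv g x $ i $ j * ricci g i j x)"

definition trk :: "(real^'n::finite \<Rightarrow> real^'n^'n) \<Rightarrow> (real^'n \<Rightarrow> real^'n^'n) \<Rightarrow> real^'n \<Rightarrow> real" where
  "trk g k x = (\<Sum>i\<in>UNIV. \<Sum>j\<in>UNIV. ginv g x $ i $ j * k x $ i $ j)"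

definition normsq_k :: "(real^'n::finite \<Rightarrow> real^'n^'n) \<Rightarrow> (real^'n \<Rightarrow> real^'n^'n) \<Rightarrow> real^'n \<Rightarrow> real" where
  "normsq_k g k x = (\<Sum>i\<in>UNIV. \<Sum>j\<in>UNIV. \<Sum>a\<in>UNIV. \<Sum>b\<in>UNIV.
      ginv g x $ i $ a * ginv g x $ j $ b * k x $ i $ j * k x $ a $ b)"

definition mu :: "(real^'n::finite \<Rightarrow> real^'n^'n) \<Rightarrow> (real^'n \<Rightarrow> real^'n^'n) \<Rightarrow> real^'n \<Rightarrow> real" where
  "mu g k x = (scal g x - normsq_k g k x + (trk g k x)\<^sup>2) / 2"

text \<open>J_i = (div_g k)_i - d_i (tr_g k), with (div_g k)_i = g^(jl) nabla_l k_(ji).\<close>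
definition Jc :: "(real^'n::finite \<Rightarrow> real^'n^'n) \<Rightarrow> (real^'n \<Rightarrow> real^'n^'n) \<Rightarrow> 'n \<Rightarrow> real^'n \<Rightarrow> real" where
  "Jc g k i x = (\<Sum>j\<in>UNIV. \<Sum>l\<in>UNIV. ginv g x $ j $ l *
       (pd l (\<lambda>y. k y $ j $ i) x - (\<Sum>m\<in>UNIV. christ g m l j x * k x $ m $ i)
                                  - (\<Sum>m\<in>UNIV. christ g m l i x * k x $ j $ m)))
     - pd i (trk g k) x"

definition normJ :: "(real^'n::finite \<Rightarrow> real^'n^'n) \<Rightarrow> (real^'n \<Rightarrow> real^'n^'n) \<Rightarrow> real^'n \<Rightarrow> real" where
  "normJ g k x = sqrt (\<Sum>i\<in>UNIV. \<Sum>j\<in>UNIV. ginv g x $ i $ j * Jc g k i x * Jc g k j x)"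

text \<open>Unit normal field nu = grad(x_e)/|grad(x_e)|; on both boundary components it points
  in the direction of increasing x_e, i.e. out of M at x_e = 1 and into M at x_e = -1.\<close>
definition nu :: "(real^'n::finite \<Rightarrow> real^'n^'n) \<Rightarrow> 'n \<Rightarrow> 'n \<Rightarrow> real^'n \<Rightarrow> real" where
  "nu g e i x = ginv g x $ i $ e / sqrt (ginv g x $ e $ e)"

text \<open>Mean curvature H = div nu (equal to div_Sigma nu on the level sets since |nu| = 1).\<close>
definition meancurv :: "(real^'n::finite \<Rightarrow> real^'n^'n) \<Rightarrow> 'n \<Rightarrow> real^'n \<Rightarrow> real" where
  "meancurv g e x = (\<Sum>i\<in>UNIV. pd i (nu g e i) x)
                   + (\<Sum>i\<in>UNIV. \<Sum>j\<in>UNIV. christ g i i j x * nu g e j x)"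

text \<open>Null expansion theta = H + tr_Sigma k, tr_Sigma k = tr_g k - k(nu,nu).\<close>
definition null_exp :: "(real^'n::finite \<Rightarrow> real^'n^'n) \<Rightarrow> (real^'n \<Rightarrow> real^'n^'n) \<Rightarrow> 'n \<Rightarrow> real^'n \<Rightarrow> real" where
  "null_exp g k e x = meancurv g e x + trk g k x
      - (\<Sum>i\<in>UNIV. \<Sum>j\<in>UNIV. k x $ i $ j * nu g e i x * nu g e j x)"

definition curve_len :: "(real^'n::finite \<Rightarrow> real^'n^'n) \<Rightarrow> (real \<Rightarrow> real^'n) \<Rightarrow> real" where
  "curve_len g \<gamma> = integral {0..1} (\<lambda>t. sqrt (vector_derivative \<gamma> (at t within {0..1}) \<bullet>
        (g (\<gamma> t) *v vector_derivative \<gamma> (at t within {0..1}))))"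

definition width :: "(real^'n::finite \<Rightarrow> real^'n^'n) \<Rightarrow> 'n \<Rightarrow> real" where
  "width g e = Inf {curve_len g \<gamma> | \<gamma>. \<gamma> C1_differentiable_on {0..1} \<and> \<gamma> ` {0..1} \<subseteq> band e
                     \<and> \<gamma> 0 $ e = -1 \<and> \<gamma> 1 $ e = 1}"

definition eta_s :: "real \<Rightarrow> real \<Rightarrow> real \<Rightarrow> real" where
  "eta_s n \<Lambda> \<sigma> = sqrt ((n - 1) / n * (\<sigma> - (n - 1) / n * \<Lambda>\<^sup>2))"

definition eta :: "real \<Rightarrow> real \<Rightarrow> real \<Rightarrow> real \<Rightarrow> real" where
  "eta n \<Lambda> \<sigma> t = (n - 1) / n * \<Lambda>
     - eta_s n \<Lambda> \<sigma> * tan (n / (2 * (n - 1)) * eta_s n \<Lambda> \<sigma> * t)"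

definition eta_dom :: "real \<Rightarrow> real \<Rightarrow> real \<Rightarrow> real set" where
  "eta_dom n \<Lambda> \<sigma> = {t. \<bar>n / (2 * (n - 1)) * eta_s n \<Lambda> \<sigma> * t\<bar> < pi / 2}"

end

theory Submission
  imports Defs "HOL-Library.Function_Algebras"
begin

text \<open>Suppose the width exceeds \<open>tp - tm\<close>. Then there is a function \<open>rho\<close> with \<open>rho = tm\<close> on the bottom,
 \<open>rho = tp\<close> on the top and gradient of length at most \<open>1 - kap\<close>. Consider the Dirac--Witten operator on the
 exterior algebra with the potential \<open>q/2 eta(rho)\<close>, \<open>q = n/(n-1)\<close>, on a long box in the universal cover, with
 a chirality condition on the two faces of the band and a potential \<open>tan\<close> blowing up at the other faces. The
 Weitzenboeck formula, the Riccati equation for \<open>eta\<close>, the energy condition and the bounds on the null expansions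
 show that it is bounded below. It is joined by Fredholm operators to the flat model operator, which is
 onto with a kernel; this contradicts the invariance of the index. The index argument is
 carried out for seminormed spaces with quantitative estimates only, so that no Sobolev spaces and no
 regularity theory are needed.\<close>

text \<open>The obstruction is an index carried by the torus, often detected by twisting with almost
  flat bundles. Here the box of half side \<open>L\<close> does that work: in a torus direction the
  potential is \<open>lam * dl * tan (dl * x)\<close> with \<open>dl = pi / (2 * L)\<close>, its
  flat model annihilates \<open>cos (dl * x) ^ lam\<close>, and the product of these cosines lies in
  the kernel of the model operator. Its square dominates \<open>K\<close> times its derivative up to
  \<open>lam * K * dl^2\<close> once \<open>lam\<close> is at least \<open>K\<close>, so it costs
  only O(1/L^2). What pays is a gap independent of \<open>L\<close>: the factor
  \<open>1 - kap\<close> in the gradient of \<open>rho\<close> and the Riccati equation give, for h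
  = eta(rho), that \<mu> - |J| + (q/2) h^2 - h tr k - |dh| is at least \<open>kap\<close> (q/2) s^2
  with s = \<open>eta_s\<close>. As h > 0, the bound on tr k may be multiplied by h. The factor q =
  n/(n-1) stems from |D psi|^2 \<le> n |nabla psi|^2 for the modified connection. It multiplies the
  energy and boundary terms alike, hence the potential (q/2) eta. The chirality condition removes
  every derivative of psi from the boundary density and leaves a multiple of the null expansion
  minus h.\<close>

abbreviation sum_UNIV :: "('i \<Rightarrow> 'a::comm_monoid_add) \<Rightarrow> 'a" (binder "SUM " 10) where
 "sum_UNIV f \<equiv> sum f UNIV"

notation scaleR (infixr "*R" 75)

section \<open>Partial derivatives and an algebra of smooth functions\<close>

definition has_pd :: "'n::finite => (real^'n => real) => real => real^'n => bool" where
 "has_pd i f d x \<longleftrightarrow> ((%t. f (x + t *R axis i 1)) has_real_derivative d) (at 0)"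

text \<open>The calculus rules are proved for the relation \<open>has_pd\<close>, because the value
  of \<open>deriv\<close> carries no information without differentiability; this is the passage back
  to \<open>pd\<close>.\<close>

lemma has_pd_imp_pd: "has_pd i f d x ==> pd i f x = d"
 unfolding has_pd_def pd_def by (rule DERIV_imp_deriv)

lemma has_pd_const [simp, intro]: "has_pd i (%x. c) 0 x"
 unfolding has_pd_def by simp

lemma has_pd_add: "has_pd i f a x ==> has_pd i g b x ==> has_pd i (%x. f x + g x) (a + b) x"
 unfolding has_pd_def by (rule DERIV_add)

lemma has_pd_diff: "has_pd i f a x ==> has_pd i g b x ==> has_pd i (%x. f x - g x) (a - b) x"
 unfolding has_pd_def by (rule DERIV_diff)

lemma has_pd_minus: "has_pd i f a x ==> has_pd i (%x. - f x) (- a) x"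
 unfolding has_pd_def by (rule DERIV_minus)

lemma has_pd_mult:
 "has_pd i f a x ==> has_pd i g b x ==> has_pd i (%x. f x * g x) (a * g x + f x * b) x"
 unfolding has_pd_def by (auto intro!: derivative_eq_intros)

lemma has_pd_cmult: "has_pd i g b x ==> has_pd i (%x. c * g x) (c * b) x"
 using has_pd_mult[OF has_pd_const, of i g b x c] by simp

lemma has_pd_sum:
 "(!!a. a : A ==> has_pd i (f a) (d a) x) ==> has_pd i (%x. \<Sum>a\<in>A. f a x) (\<Sum>a\<in>A. d a) x"
 unfolding has_pd_def by (rule DERIV_sum)

lemma has_pd_chain:
 assumes "has_pd i f a x" "(h has_real_derivative b) (at (f x))"
 shows "has_pd i (%x. h (f x)) (b * a) x"
 using DERIV_chain2[of h b "%t. f (x + t *R axis i 1)" 0 a] assms unfolding has_pd_def by simp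

lemma has_pd_inverse:
 assumes "has_pd i f a x" "f x ~= 0"
 shows "has_pd i (%x. inverse (f x)) (- (inverse (f x) * inverse (f x)) * a) x"
 using has_pd_chain[OF assms(1) DERIV_inverse[OF assms(2)]] by (simp add: power2_eq_square)

lemma has_pd_sqrt:
 assumes "has_pd i f a x" "f x > 0"
 shows "has_pd i (%x. sqrt (f x)) (inverse (sqrt (f x)) / 2 * a) x"
 using has_pd_chain[OF assms(1) DERIV_real_sqrt[OF assms(2)]] .

lemma has_pd_comp_coord:
 assumes "(h has_real_derivative b) (at (x $ a))"
 shows "has_pd i (%x. h (x $ a)) (if i = a then b else 0) x"
proof -
 have "has_pd i (%x. x $ a) (if i = a then 1 else 0) x"
  unfolding has_pd_def by (auto intro!: derivative_eq_intros simp: axis_def)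
 from has_pd_chain[OF this assms] show ?thesis by (cases "i = a") auto
qed

lemma differentiable_imp_has_pd:
 "(%t. f (x + t *R axis i 1)) differentiable (at 0) ==> has_pd i f (pd i f x) x"
 unfolding has_pd_def pd_def by (simp add: DERIV_deriv_iff_real_differentiable)

lemma has_pd_shift:
 "has_pd i f d (x + s *R axis i 1) \<longleftrightarrow>
  ((%t. f (x + t *R axis i 1)) has_real_derivative d) (at s)"
 unfolding has_pd_def
 using DERIV_shift[of "%t. f (x + t *R axis i 1)" d 0 s]
 by (simp add: scaleR_add_left add.commute add.left_commute)

lemma has_pd_translate: "has_pd i (%y. f (y + w)) d x \<longleftrightarrow> has_pd i f d (x + w)"
proof -
 have "x + t *R axis i 1 + w = x + w + t *R axis i 1" for t by simp
 then show ?thesis unfolding has_pd_def by presburger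
qed

text \<open>Closure of \<open>smooth_fun\<close> under products or inverses does not follow by a
  direct induction on the list of derivatives, since the derivative of a product or of an inverse is
  no longer of that shape. The set generated by all these operations together is closed under every
  \<open>pd\<close>, so all iterated derivatives stay inside it and are continuous.\<close>

inductive_set smooth_alg :: "(real^'n::finite => real) set" where
 base: "smooth_fun f ==> f : smooth_alg"
| const: "(%x. c) : smooth_alg"
| sin: "(%x. sin (d * x $ a)) : smooth_alg"
| cos: "(%x. cos (d * x $ a)) : smooth_alg"
| add: "f : smooth_alg ==> g : smooth_alg ==> (%x. f x + g x) : smooth_alg"
| mult: "f : smooth_alg ==> g : smooth_alg ==> (%x. f x * g x) : smooth_alg"
| inverse: "f : smooth_alg ==> (!!x. f x ~= 0) ==> (%x. inverse (f x)) : smooth_alg"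
| sqrt: "f : smooth_alg ==> (!!x. f x > 0) ==> (%x. sqrt (f x)) : smooth_alg"

lemma smooth_fun_has_pd: "smooth_fun f ==> has_pd i f (pd i f x) x"
 using differentiable_imp_has_pd[of f x i] unfolding smooth_fun_def by (metis iterpd.simps(1))

lemma smooth_fun_continuous: "smooth_fun f ==> continuous_on S f"
 unfolding smooth_fun_def by (metis continuous_on_subset iterpd.simps(1) top_greatest)

lemma iterpd_append: "iterpd (xs @ ys) f = iterpd xs (iterpd ys f)"
 by (induction xs) auto

lemma smooth_fun_pd: "smooth_fun f ==> smooth_fun (pd i f)"
proof -
 assume "smooth_fun f"
 have "iterpd is (pd i f) = iterpd (is @ [i]) f" for "is" by (simp add: iterpd_append)
 with \<open>smooth_fun f\<close> show ?thesis unfolding smooth_fun_def by presburger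
qed

lemma smooth_alg_continuous: "f : smooth_alg ==> continuous_on UNIV f"
proof (induction rule: smooth_alg.induct)
 case (base f) then show ?case by (rule smooth_fun_continuous)
next
 case (sqrt f) then show ?case by (intro continuous_intros) auto
qed (intro continuous_intros; simp)+

lemma smooth_alg_pd: "f : smooth_alg ==> \<exists>f'\<in>smooth_alg. \<forall>x. has_pd i f (f' x) x"
proof (induction rule: smooth_alg.induct)
 case (base f)
 then show ?case using smooth_fun_has_pd smooth_fun_pd smooth_alg.base by blast
next
 case (const c)
 then show ?case using smooth_alg.const[of 0] by (intro bexI[of _ "%x. 0"]) auto
next
 case (sin d a)
 have "((%t. sin (d * t)) has_real_derivative d * cos (d * t)) (at t)" for t
  by (auto intro!: derivative_eq_intros)
 from has_pd_comp_coord[OF this, where a=a and i=i]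
 have "has_pd i (%x. sin (d * x $ a)) ((if i = a then d else 0) * cos (d * x $ a)) x" for x
  by (cases "i = a") auto
 then show ?case
  by (intro bexI[of _ "%x. (if i = a then d else 0) * cos (d * x $ a)"])
   (auto intro!: smooth_alg.mult smooth_alg.const smooth_alg.cos)
next
 case (cos d a)
 have "((%t. cos (d * t)) has_real_derivative (-d) * sin (d * t)) (at t)" for t
  by (auto intro!: derivative_eq_intros)
 from has_pd_comp_coord[OF this, where a=a and i=i]
 have "has_pd i (%x. cos (d * x $ a)) ((if i = a then -d else 0) * sin (d * x $ a)) x" for x
  by (cases "i = a") auto
 then show ?case
  by (intro bexI[of _ "%x. (if i = a then -d else 0) * sin (d * x $ a)"]
    smooth_alg.mult smooth_alg.const smooth_alg.sin) blast
next
 case (add f g)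
 then obtain f' g' where "f' : smooth_alg" "g' : smooth_alg" "!!x. has_pd i f (f' x) x"
   "!!x. has_pd i g (g' x) x" by blast
 then show ?case by (intro bexI[of _ "%x. f' x + g' x"]) (auto intro: has_pd_add smooth_alg.add)
next
 case (mult f g)
 then obtain f' g' where "f' : smooth_alg" "g' : smooth_alg" "!!x. has_pd i f (f' x) x"
   "!!x. has_pd i g (g' x) x" by blast
 then show ?case using mult.hyps
  by (intro bexI[of _ "%x. f' x * g x + f x * g' x"])
   (auto intro!: has_pd_mult smooth_alg.add intro: smooth_alg.mult)
next
 case (inverse f)
 then obtain f' where f': "f' : smooth_alg" "!!x. has_pd i f (f' x) x" by blast
 have "(%x. (-1) * (inverse (f x) * inverse (f x)) * f' x) : smooth_alg"
  by (intro smooth_alg.mult smooth_alg.const smooth_alg.inverse f' inverse)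
 moreover have "has_pd i (%x. inverse (f x)) ((-1) * (inverse (f x) * inverse (f x)) * f' x) x" for x
  using has_pd_inverse[OF f'(2) inverse.hyps(2)] by simp
 ultimately show ?case by (intro bexI allI)
next
 case (sqrt f)
 then obtain f' where f': "f' : smooth_alg" "!!x. has_pd i f (f' x) x" by blast
 have "(%x. inverse (sqrt (f x)) * (1/2) * f' x) : smooth_alg"
  using sqrt.hyps(2)
  by (intro smooth_alg.mult smooth_alg.const smooth_alg.inverse smooth_alg.sqrt f' sqrt)
   (simp add: less_imp_neq[symmetric])
 moreover have "has_pd i (%x. sqrt (f x)) (inverse (sqrt (f x)) * (1/2) * f' x) x" for x
  using has_pd_sqrt[OF f'(2) sqrt.hyps(2)] by simp
 ultimately show ?case by (intro bexI allI)
qed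

lemma smooth_alg_smooth:
 assumes "f : smooth_alg" shows "smooth_fun f"
proof -
 have 1: "iterpd is f : smooth_alg" for "is"
 proof (induction "is")
  case (Cons i "is")
  then obtain f' where "f' : smooth_alg" "!!x. has_pd i (iterpd is f) (f' x) x"
   using smooth_alg_pd by blast
  then have "pd i (iterpd is f) = f'" using has_pd_imp_pd by blast
  with \<open>f' : smooth_alg\<close> show ?case by simp
 qed (use assms in simp)
 have 2: "(%t. iterpd is f (x + t *R axis i 1)) differentiable (at 0)" for "is" i x
  using smooth_alg_pd[OF 1[of "is"], of i] unfolding has_pd_def
  by (metis real_differentiable_def)
 show ?thesis unfolding smooth_fun_def using smooth_alg_continuous[OF 1] 2 by blast
qed

lemma smooth_const [simp, intro]: "smooth_fun (%x. c)"
 and smooth_sin [simp, intro]: "smooth_fun (%x. sin (d * x $ a))"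
 and smooth_cos [simp, intro]: "smooth_fun (%x. cos (d * x $ a))"
 by (rule smooth_alg_smooth[OF smooth_alg.const] smooth_alg_smooth[OF smooth_alg.sin]
   smooth_alg_smooth[OF smooth_alg.cos])+

lemma smooth_add: "smooth_fun f ==> smooth_fun g ==> smooth_fun (%x. f x + g x)"
 by (rule smooth_alg_smooth[OF smooth_alg.add[OF smooth_alg.base smooth_alg.base]])

lemma smooth_mult: "smooth_fun f ==> smooth_fun g ==> smooth_fun (%x. f x * g x)"
 by (rule smooth_alg_smooth[OF smooth_alg.mult[OF smooth_alg.base smooth_alg.base]])

lemma smooth_inverse: "smooth_fun f ==> (!!x. f x ~= 0) ==> smooth_fun (%x. inverse (f x))"
 by (rule smooth_alg_smooth[OF smooth_alg.inverse[OF smooth_alg.base]])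

lemma smooth_sqrt: "smooth_fun f ==> (!!x. f x > 0) ==> smooth_fun (%x. sqrt (f x))"
 by (rule smooth_alg_smooth[OF smooth_alg.sqrt[OF smooth_alg.base]])

lemma smooth_minus: "smooth_fun f ==> smooth_fun (%x. - f x)"
 using smooth_mult[of "%x. -1" f] by simp

lemma smooth_diff: "smooth_fun f ==> smooth_fun g ==> smooth_fun (%x. f x - g x)"
 using smooth_add[of f "%x. - g x"] smooth_minus[of g] by simp

lemma smooth_divide:
 "smooth_fun f ==> smooth_fun g ==> (!!x. g x ~= 0) ==> smooth_fun (%x. f x / g x)"
 using smooth_mult[of f "%x. inverse (g x)"] smooth_inverse[of g] by (simp add: divide_inverse)

lemma smooth_sum: "(!!a. a : A ==> smooth_fun (f a)) ==> smooth_fun (%x. \<Sum>a\<in>A. f a x)"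
 by (induction A rule: infinite_finite_induct) (auto intro: smooth_add)

lemma smooth_prod: "(!!a. a : A ==> smooth_fun (f a)) ==> smooth_fun (%x. \<Prod>a\<in>A. f a x)"
 by (induction A rule: infinite_finite_induct) (auto intro: smooth_mult)

lemma smooth_power: "smooth_fun f ==> smooth_fun (%x. f x ^ n)"
 by (induction n) (auto intro: smooth_mult)

lemmas smooth_intros = smooth_add smooth_mult smooth_minus smooth_diff smooth_sum smooth_prod
 smooth_power smooth_fun_pd smooth_const smooth_sin smooth_cos

lemma pd_add: "smooth_fun f ==> smooth_fun g ==> pd i (%x. f x + g x) x = pd i f x + pd i g x"
 and pd_diff: "smooth_fun f ==> smooth_fun g ==> pd i (%x. f x - g x) x = pd i f x - pd i g x"
 and pd_minus: "smooth_fun f ==> pd i (%x. - f x) x = - pd i f x"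
 and pd_mult: "smooth_fun f ==> smooth_fun g ==>
  pd i (%x. f x * g x) x = pd i f x * g x + f x * pd i g x"
 and pd_cmult: "smooth_fun g ==> pd i (%x. c * g x) x = c * pd i g x"
 and pd_const [simp]: "pd i (%x. c) x = 0"
 by (rule has_pd_imp_pd; intro has_pd_add has_pd_diff has_pd_minus has_pd_mult has_pd_cmult
   has_pd_const smooth_fun_has_pd; assumption)+

lemma pd_sum: "(!!a. a : A ==> smooth_fun (f a)) ==>
  pd i (%x. \<Sum>a\<in>A. f a x) x = (\<Sum>a\<in>A. pd i (f a) x)"
 by (rule has_pd_imp_pd; intro has_pd_sum smooth_fun_has_pd; blast)

lemma axis_mvt:
 assumes "!!x. has_pd i f (f' x) x" "h ~= 0"
 obtains s where "0 < s" "s < 1" "f (x + h *R axis i 1) - f x = h * f' (x + (s * h) *R axis i 1)"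
proof -
 define F where "F s = f (x + (s * h) *R axis i 1)" for s :: real
 have d: "(F has_real_derivative (f' (x + (s * h) *R axis i 1) * h)) (at s)" for s
 proof -
  have "((%t. f (x + t *R axis i 1)) has_real_derivative f' (x + (s*h) *R axis i 1)) (at (s * h))"
   using assms(1) has_pd_shift by blast
  moreover have "((%s. s * h) has_real_derivative h) (at s)" by (auto intro!: derivative_eq_intros)
  ultimately show ?thesis unfolding F_def by (rule DERIV_chain2)
 qed
 obtain s where "0 < s" "s < 1" "F 1 - F 0 = (1 - 0) * (f' (x + (s * h) *R axis i 1) * h)"
  using MVT2[of 0 1 F "%s. f' (x + (s * h) *R axis i 1) * h"] d by auto
 then show ?thesis by (intro that[of s]) (auto simp: F_def)
qed

text \<open>Both iterated partial derivatives are limits of the symmetric second difference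
 \<open>f(x+hi+hj) - f(x+hi) - f(x+hj) + f(x)\<close> over \<open>h\<^sup>2\<close>.\<close>

lemma second_difference:
 assumes f: "smooth_fun f" and h: "h ~= 0"
 obtains s t where "0 < s" "s < 1" "0 < t" "t < 1"
  "f (x + h *R axis i 1 + h *R axis j 1) - f (x + h *R axis i 1) - f (x + h *R axis j 1) + f x
  = h * h * pd j (pd i f) (x + (s * h) *R axis i 1 + (t * h) *R axis j 1)"
proof -
 define G where "G y = f (y + h *R axis j 1) - f y" for y
 have "has_pd i f (pd i f (y + h *R axis j 1)) (y + h *R axis j 1)" for y
  by (rule smooth_fun_has_pd[OF f])
 then have "has_pd i (%y. f (y + h *R axis j 1)) (pd i f (y + h *R axis j 1)) y" for y
  by (simp only: has_pd_translate)
 then have "has_pd i G (pd i f (y + h *R axis j 1) - pd i f y) y" for y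
  unfolding G_def by (intro has_pd_diff smooth_fun_has_pd f)
 from axis_mvt[where x=x, OF this h] obtain s where s: "0 < s" "s < 1"
  "G (x + h *R axis i 1) - G x = h * (pd i f (x + (s * h) *R axis i 1 + h *R axis j 1) - pd i f (x + (s * h) *R axis i 1))"
  by blast
 from axis_mvt[where i=j and x="x + (s * h) *R axis i 1", OF smooth_fun_has_pd[OF smooth_fun_pd[OF f, of i]] h]
 obtain t where t: "0 < t" "t < 1" "pd i f (x + (s * h) *R axis i 1 + h *R axis j 1) - pd i f (x + (s * h) *R axis i 1)
  = h * pd j (pd i f) (x + (s * h) *R axis i 1 + (t * h) *R axis j 1)" by blast
 show ?thesis
  by (rule that[OF s(1,2) t(1,2)]) (use s(3) t(3) in \<open>simp add: G_def algebra_simps\<close>)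
qed

lemma pd_commute:
 assumes f: "smooth_fun f" shows "pd i (pd j f) x = pd j (pd i f) x"
proof -
 have *: "\<bar>pd j (pd i f) x - pd i (pd j f) x\<bar> < eps" if "eps > 0" for eps :: real
 proof -
  have cont: "isCont (pd j (pd i f)) x" "isCont (pd i (pd j f)) x"
   
   using smooth_fun_continuous[OF smooth_fun_pd[OF smooth_fun_pd[OF f]], of UNIV]
   by (simp_all add: continuous_on_eq_continuous_at)
  have "0 < eps / 2" using that by simp
  obtain d1 where d1: "d1 > 0" "!!y. dist y x < d1 ==> dist (pd j (pd i f) y) (pd j (pd i f) x) < eps/2"
   using cont(1) \<open>0 < eps / 2\<close> unfolding continuous_at_eps_delta by blast
  obtain d2 where d2: "d2 > 0" "!!y. dist y x < d2 ==> dist (pd i (pd j f) y) (pd i (pd j f) x) < eps/2"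
   using cont(2) \<open>0 < eps / 2\<close> unfolding continuous_at_eps_delta by blast
  note d = d1(1) d2(1) d1(2) d2(2)
  have "\<bar>pd j (pd i f) x - pd i (pd j f) x\<bar> < eps" if h: "0 < h" "h < min d1 d2 / 2" for h
  proof -
   from second_difference[OF f, of h x i j] h obtain s t where st: "0 < s" "s < 1" "0 < t" "t < 1"
   "f (x + h *R axis i 1 + h *R axis j 1) - f (x + h *R axis i 1) - f (x + h *R axis j 1) + f x
    = h * h * pd j (pd i f) (x + (s * h) *R axis i 1 + (t * h) *R axis j 1)" by auto
   from second_difference[OF f, of h x j i] h obtain s' t' where st': "0 < s'" "s' < 1" "0 < t'" "t' < 1"
   "f (x + h *R axis j 1 + h *R axis i 1) - f (x + h *R axis j 1) - f (x + h *R axis i 1) + f x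
    = h * h * pd i (pd j f) (x + (s' * h) *R axis j 1 + (t' * h) *R axis i 1)" by auto
   have eq: "pd j (pd i f) (x + (s * h) *R axis i 1 + (t * h) *R axis j 1)
     = pd i (pd j f) (x + (s' * h) *R axis j 1 + (t' * h) *R axis i 1)"
    using st(5) st'(5) h by (simp add: algebra_simps)
   have nb: "dist (x + (a * h) *R axis k 1 + (b * h) *R axis l 1) x < min d1 d2"
    if "0 < a" "a < 1" "0 < b" "b < 1" for a b :: real and k l :: 'a
   proof -
    have "norm ((a * h) *R axis k (1::real) + (b * h) *R axis l 1) <= a * h + b * h"
     by (rule norm_triangle_le) (use that h in \<open>simp\<close>)
    also have "... < 2 * h"
     using that h by (smt (verit) mult_less_cancel_right2)
    finally show ?thesis using h by (simp add: dist_norm add.assoc)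
   qed
   let ?u = "pd j (pd i f) (x + (s * h) *R axis i 1 + (t * h) *R axis j 1)"
   have "dist ?u (pd j (pd i f) x) < eps/2"
    by (rule d(3)) (use nb[OF st(1-4)] in simp)
   moreover have "dist ?u (pd i (pd j f) x) < eps/2"
    unfolding eq by (rule d(4)) (use nb[OF st'(1-4)] in simp)
   ultimately show ?thesis unfolding dist_real_def by linarith
  qed
  moreover have "0 < min d1 d2" using d(1,2) by simp
  then have "0 < min d1 d2 / 3" "min d1 d2 / 3 < min d1 d2 / 2" by linarith+
  ultimately show ?thesis by blast
 qed
 show ?thesis
 proof (rule ccontr)
  assume "pd i (pd j f) x ~= pd j (pd i f) x"
  then have "\<bar>pd j (pd i f) x - pd i (pd j f) x\<bar> > 0" by simp
  from *[OF this] show False by simp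
 qed
qed

text \<open>Go from x to x + v one coordinate at a time. Each move is controlled by the mean value
  theorem, and continuity of the partial derivatives makes its error at most eps |v_i|;
  \<open>step\<close> is the induction over the set of coordinates already moved.\<close>

lemma has_derivative_partials:
 fixes f :: "real^'n::finite => real"
 assumes pd: "!!i x. has_pd i f (f' i x) x" and cont: "!!i. continuous_on UNIV (f' i)"
 shows "(f has_derivative (%v. SUM i. v $ i * f' i x)) (at x)"
proof -
 have step: "\<bar>f (x + (\<Sum>i\<in>S. v $ i *R axis i 1)) - f x - (\<Sum>i\<in>S. v $ i * f' i x)\<bar> <= eps * (\<Sum>i\<in>S. \<bar>v $ i\<bar>)"
  if S: "finite S" and eps: "eps > 0" and near: "!!i y. dist y x < d ==> \<bar>f' i y - f' i x\<bar> < eps"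
   and small: "(SUM i. \<bar>v $ i\<bar>) < d" for S eps d v
  using S
 proof (induction S rule: finite_induct)
  case (insert a S)
  let ?y = "x + (\<Sum>i\<in>S. v $ i *R axis i 1)"
  have *: "\<bar>f (?y + v $ a *R axis a 1) - f ?y - v $ a * f' a x\<bar> <= eps * \<bar>v $ a\<bar>"
  proof (cases "v $ a = 0")
   case False
   obtain s where s: "0 < s" "s < 1"
    "f (?y + v $ a *R axis a 1) - f ?y = v $ a * f' a (?y + (s * v $ a) *R axis a 1)"
    using axis_mvt[where f=f and i=a and x="?y" and h="v $ a" and f'="f' a"] pd False by blast
   have "norm ((\<Sum>i\<in>S. v $ i *R axis i (1::real)) + (s * v $ a) *R axis a 1) <= (\<Sum>i\<in>S. \<bar>v $ i\<bar>) + \<bar>v $ a\<bar>"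
   proof (rule norm_triangle_le, rule add_mono)
    show "norm (\<Sum>i\<in>S. v $ i *R axis i (1::real)) <= (\<Sum>i\<in>S. \<bar>v $ i\<bar>)"
     by (rule sum_norm_le) simp
    show "norm ((s * v $ a) *R axis a (1::real)) <= \<bar>v $ a\<bar>"
     using s by (simp add: abs_mult mult_left_le_one_le)
   qed
   also have "... = (\<Sum>i\<in>insert a S. \<bar>v $ i\<bar>)" using insert by simp
   also have "... <= (SUM i. \<bar>v $ i\<bar>)" by (rule sum_mono2) auto
   finally have "dist (?y + (s * v $ a) *R axis a 1) x < d"
    using small by (simp add: dist_norm add.assoc)
   from near[OF this, of a] have "\<bar>v $ a * (f' a (?y + (s * v $ a) *R axis a 1) - f' a x)\<bar> <= \<bar>v $ a\<bar> * eps"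
    unfolding abs_mult by (intro mult_left_mono) auto
   then show ?thesis unfolding s(3) by (simp add: algebra_simps)
  qed simp
  show ?case using insert.IH * insert.hyps
   by (simp add: algebra_simps sum_distrib_left)
 qed simp
 have expand: "(SUM i. v $ i *R axis i 1) = v" for v :: "real^'n"
  by (simp add: vec_eq_iff sum_component axis_def if_distrib cong: if_cong)
 show ?thesis unfolding has_derivative_at_alt
 proof (intro conjI allI impI)
  show "bounded_linear (%v. SUM i. v $ i * f' i x)"
   by (intro bounded_linear_sum bounded_linear_mult_left bounded_linear_compose[OF bounded_linear_mult_left] bounded_linear_vec_nth)
  fix eps :: real assume "eps > 0"
  define n where "n = real CARD('n)"
  have n: "n > 0" by (simp add: n_def)
  have "\<exists>d>0. \<forall>y. dist y x < d \<longrightarrow> \<bar>f' i y - f' i x\<bar> < eps / n" for i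
   using cont[of i] \<open>eps > 0\<close> n unfolding continuous_on_eq_continuous_at[OF open_UNIV] continuous_at_eps_delta dist_real_def by simp
  then obtain D where D: "!!i. D i > 0" "!!i y. dist y x < D i ==> \<bar>f' i y - f' i x\<bar> < eps / n" by metis
  define d where "d = Min (range D)"
  have d: "d > 0" "!!i. d <= D i" using D(1) by (auto simp: d_def)
  show "\<exists>d>0. \<forall>y. norm (y - x) < d \<longrightarrow>
    norm (f y - f x - (SUM i. (y - x) $ i * f' i x)) <= eps * norm (y - x)"
  proof (intro exI[of _ "d / n"] conjI allI impI)
   show "d / n > 0" using d n by simp
   fix y assume y: "norm (y - x) < d / n"
   have sn: "(SUM i. \<bar>(y - x) $ i\<bar>) <= n * norm (y - x)"
    unfolding n_def by (rule sum_bounded_above) (rule component_le_norm_cart)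
   have "\<bar>f (x + (SUM i. (y - x) $ i *R axis i 1)) - f x - (SUM i. (y - x) $ i * f' i x)\<bar>
     <= eps / n * (SUM i. \<bar>(y - x) $ i\<bar>)"
   proof (rule step)
    show "(SUM i. \<bar>(y - x) $ i\<bar>) < d" using sn y n by (simp add: pos_less_divide_eq mult.commute)
    show "\<bar>f' i z - f' i x\<bar> < eps / n" if "dist z x < d" for i z
     using D(2)[of z i] d(2)[of i] that by simp
   qed (use \<open>eps > 0\<close> n in auto)
   also have "... <= eps / n * (n * norm (y - x))" using sn \<open>eps > 0\<close> n by (intro mult_left_mono) auto
   also have "... = eps * norm (y - x)" using n by simp
   finally show "norm (f y - f x - (SUM i. (y - x) $ i * f' i x)) <= eps * norm (y - x)"
    unfolding expand by simp
  qed
 qed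
qed

section \<open>Integration on boxes: divergence theorem, Poincare and Rellich inequalities\<close>

text \<open>The divergence theorem on a box, in one-sided form: it follows by
 differentiating the integral of \<open>f\<close> over the translated box.\<close>

lemma integral_pd_nonneg:
 fixes f f' :: "real^'n::finite => real"
 assumes pd: "!!x. has_pd a f (f' x) x" and cf: "continuous_on UNIV f" and cf': "continuous_on UNIV f'"
  and box: "!!i. lo $ i < hi $ i"
  and top: "!!x. x : cbox lo hi ==> x $ a = hi $ a ==> f x >= 0"
  and bot: "!!x. x : cbox lo hi ==> x $ a = lo $ a ==> f x <= 0"
 shows "integral (cbox lo hi) f' >= 0"
proof -
 let ?e = "axis a 1 :: real^'n"
 have eB: "?e : Basis" by (simp add: axis_in_Basis_iff)
 have int: "f integrable_on cbox u v" for u v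
  by (rule integrable_continuous[OF continuous_on_subset[OF cf]]) simp
 define I where "I s = integral (cbox lo hi) (%x. f (x + s *R ?e))" for s
 have I_shift: "I s = integral (cbox (lo + s *R ?e) (hi + s *R ?e)) f" for s
 proof -
  have "((%x. f (1 *R x + s *R ?e)) has_integral (integral (cbox (lo + s *R ?e) (hi + s *R ?e)) f) /\<^sub>R 1 ^ DIM(real^'n))
   (cbox ((lo + s *R ?e - s *R ?e) /\<^sub>R 1) ((hi + s *R ?e - s *R ?e) /\<^sub>R 1))"
   by (rule has_integral_affinity'[OF integrable_integral[OF int]]) simp
  then show ?thesis unfolding I_def by (simp add: integral_unique)
 qed
 have I': "(I has_real_derivative integral (cbox lo hi) f') (at 0)"
 proof -
  have "((%s. integral (cbox lo hi) (%x. f (x + s *R ?e))) has_field_derivative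
    integral (cbox lo hi) (%x. f' (x + 0 *R ?e))) (at 0 within UNIV)"
  proof (rule leibniz_rule_field_derivative)
   show "((%s. f (x + s *R ?e)) has_field_derivative f' (x + s *R ?e)) (at s within UNIV)" for s x
    using pd[of "x + s *R ?e"] unfolding has_pd_shift by simp
   show "(%x. f (x + s *R ?e)) integrable_on cbox lo hi" for s
    by (rule integrable_continuous, rule continuous_on_compose2[OF cf]) (auto intro!: continuous_intros)
   show "continuous_on (UNIV \<times> cbox lo hi) (%(s, x). f' (x + s *R ?e))"
    unfolding split_def by (rule continuous_on_compose2[OF cf']) (auto intro!: continuous_intros)
  qed auto
  then show ?thesis unfolding I_def by simp
 qed
 define V where "V s = (\<Prod>i\<in>UNIV. (hi + s *R ?e - lo) $ i)" for s
 have "compact (cbox lo (hi + ?e))" by simp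
 then have "bounded (f' ` cbox lo (hi + ?e))"
  by (intro compact_imp_bounded compact_continuous_image continuous_on_subset[OF cf']) auto
 then obtain M where M: "!!x. x : cbox lo (hi + ?e) ==> \<bar>f' x\<bar> <= M" "M > 0"
  unfolding bounded_pos by auto
 \<comment> \<open>The box and its translate by s differ in two slabs, each of volume V s - V 0.
   Every point of a slab is within s of a face along direction a, so f differs there by at most s M
   from a boundary value of known sign.\<close>
 have key: "(I s - I 0) / s >= - 2 * M * (V s - V 0)" if s: "0 < s" "s < min 1 (hi $ a - lo $ a)" for s
 proof -
  let ?B = "cbox lo (hi + s *R ?e)"
  have comp: "(v + c *R ?e) $ i = v $ i + (if i = a then c else 0)" for v :: "real^'n" and c i
   by (simp add: axis_def)
  have ne: "!!i. lo $ i <= (hi + s *R ?e) $ i"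
   unfolding comp using box s by (auto simp: less_imp_le add_increasing2)
  have inB: "x : cbox lo (hi + ?e)" if "x : ?B" for x
  proof -
   have "(hi + s *R ?e) $ i <= (hi + ?e) $ i" for i using s by (simp add: axis_def)
   with that show ?thesis unfolding mem_box_cart by (meson order_trans)
  qed
  have split: "integral ?B f = integral (?B \<inter> {x. x \<bullet> ?e <= c}) f + integral (?B \<inter> {x. x \<bullet> ?e >= c}) f" for c
   by (rule integral_split[OF int eB])
  have cont_split: "measure lborel ?B = measure lborel (?B \<inter> {x. x \<bullet> ?e <= c}) + measure lborel (?B \<inter> {x. x \<bullet> ?e >= c})" for c
   by (rule content_split[OF eB])
  have [simp]: "x \<bullet> ?e = x $ a" for x by (simp add: inner_axis)
  have B_iff: "x : ?B \<longleftrightarrow> (\<forall>i. lo $ i <= x $ i \<and> x $ i <= hi $ i + (if i = a then s else 0))" for x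
   by (simp only: mem_box_cart comp)
  have Bs_iff: "x : cbox (lo + s *R ?e) (hi + s *R ?e) \<longleftrightarrow> (\<forall>i. lo $ i + (if i = a then s else 0) <= x $ i
    \<and> x $ i <= hi $ i + (if i = a then s else 0))" for x
   by (simp only: mem_box_cart comp)
  have Qeq: "?B \<inter> {x. x \<bullet> ?e <= hi $ a} = cbox lo hi"
  proof (intro set_eqI iffI)
   fix x assume x: "x : ?B \<inter> {x. x \<bullet> ?e <= hi $ a}"
   have "lo $ i <= x $ i \<and> x $ i <= hi $ i" for i
    using x B_iff[of x] by (cases "i = a") (auto dest!: spec[of _ i])
   then show "x : cbox lo hi" unfolding mem_box_cart by blast
  next
   fix x assume "x : cbox lo hi"
   then have x: "lo $ i <= x $ i \<and> x $ i <= hi $ i" for i unfolding mem_box_cart by blast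
   then show "x : ?B \<inter> {x. x \<bullet> ?e <= hi $ a}" using s unfolding Int_iff B_iff by (auto simp: add_increasing2)
  qed
  have Qseq: "?B \<inter> {x. x \<bullet> ?e >= lo $ a + s} = cbox (lo + s *R ?e) (hi + s *R ?e)"
  proof (intro set_eqI iffI)
   fix x assume x: "x : ?B \<inter> {x. x \<bullet> ?e >= lo $ a + s}"
   then show "x : cbox (lo + s *R ?e) (hi + s *R ?e)" unfolding Int_iff B_iff Bs_iff by auto
  next
   fix x assume "x : cbox (lo + s *R ?e) (hi + s *R ?e)"
   then have x: "lo $ i + (if i = a then s else 0) <= x $ i \<and> x $ i <= hi $ i + (if i = a then s else 0)" for i
    unfolding Bs_iff by blast
   have "lo $ i <= x $ i" for i using x[of i] s by (auto split: if_splits)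
   then show "x : ?B \<inter> {x. x \<bullet> ?e >= lo $ a + s}" using x x[of a] unfolding Int_iff B_iff by auto
  qed
  let ?T = "?B \<inter> {x. x \<bullet> ?e >= hi $ a}" and ?U = "?B \<inter> {x. x \<bullet> ?e <= lo $ a + s}"
  have cV: "measure lborel ?B = V s" "measure lborel (cbox lo hi) = V 0" "measure lborel (cbox (lo + s *R ?e) (hi + s *R ?e)) = V 0"
  proof -
   have "measure lborel (cbox u v) = (\<Prod>i\<in>UNIV. (v - u) $ i)" if "!!i. u $ i <= v $ i" for u v :: "real^'n"
    using that content_cbox_cart[of u v] by (auto simp: interval_ne_empty_cart)
   from this[of lo "hi + s *R ?e"] this[of lo hi] this[of "lo + s *R ?e" "hi + s *R ?e"] ne box
   show "measure lborel ?B = V s" "measure lborel (cbox lo hi) = V 0" "measure lborel (cbox (lo + s *R ?e) (hi + s *R ?e)) = V 0"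
    unfolding V_def by (auto simp: less_imp_le)
  qed
  have cT: "measure lborel ?T = V s - V 0" using cont_split[of "hi $ a"] unfolding Qeq cV by simp
  have cU: "measure lborel ?U = V s - V 0" using cont_split[of "lo $ a + s"] unfolding Qseq cV by simp
  have Tbox: "\<exists>u v. ?T = cbox u v" and Ubox: "\<exists>u v. ?U = cbox u v"
   using interval_split[OF eB, of lo "hi + s *R ?e"] by blast+
  have drop: "\<bar>f x - f (x + h *R ?e)\<bar> <= s * M" if h: "\<bar>h\<bar> <= s" "x : ?B" "x + h *R ?e : ?B" for x h
  proof (cases "h = 0")
   case True then show ?thesis using s M(2) by simp
  next
   case False
   obtain t where t: "0 < t" "t < 1" "f (x + h *R ?e) - f x = h * f' (x + (t * h) *R ?e)"
    using axis_mvt[where f=f and f'=f' and x=x and i=a, OF pd False] by blast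
   have "x + (t * h) *R ?e = (1 - t) *R x + t *R (x + h *R ?e)" by (simp add: algebra_simps)
   also have "... : ?B" using h(2,3) t by (intro convexD[OF convex_box(1)]) auto
   finally have "\<bar>f' (x + (t * h) *R ?e)\<bar> <= M" using M(1) inB by blast
   then have "\<bar>h * f' (x + (t * h) *R ?e)\<bar> <= s * M"
    unfolding abs_mult using h(1) by (intro mult_mono) auto
   then show ?thesis using t(3) by (simp add: abs_minus_commute)
  qed
  have T: "integral ?T f >= - (s * M) * (V s - V 0)"
  proof -
   obtain u v where uv: "?T = cbox u v" using Tbox by blast
   have low: "f x >= - (s * M)" if "x : ?T" for x
   proof -
    have x: "x : ?B" "x $ a >= hi $ a" "x $ a <= hi $ a + s"
     using that B_iff[of x] by (auto dest!: spec[of _ a])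
    let ?h = "hi $ a - x $ a"
    have y: "x + ?h *R ?e : cbox lo hi"
     using x(1) s box[of a] unfolding mem_box_cart comp B_iff by (auto split: if_splits)
    then have "x + ?h *R ?e : ?B" using Qeq by blast
    from drop[OF _ x(1) this] x top[OF y] show ?thesis by (auto simp: axis_def)
   qed
   have "integral (cbox u v) (%x. - (s * M)) <= integral (cbox u v) f"
    by (rule integral_le[OF integrable_const int]) (use low uv in auto)
   then show ?thesis using cT unfolding uv by (simp add: mult_ac)
  qed
  have U: "integral ?U f <= (s * M) * (V s - V 0)"
  proof -
   obtain u v where uv: "?U = cbox u v" using Ubox by blast
   have up: "f x <= s * M" if "x : ?U" for x
   proof -
    have x: "x : ?B" "x $ a >= lo $ a" "x $ a <= lo $ a + s"
     using that B_iff[of x] by (auto dest!: spec[of _ a])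
    let ?h = "lo $ a - x $ a"
    have y: "x + ?h *R ?e : cbox lo hi"
     using x(1) s box[of a] unfolding mem_box_cart comp B_iff by (auto split: if_splits)
    then have "x + ?h *R ?e : ?B" using Qeq by blast
    from drop[OF _ x(1) this] x bot[OF y] show ?thesis by (auto simp: axis_def)
   qed
   have "integral (cbox u v) f <= integral (cbox u v) (%x. s * M)"
    by (rule integral_le[OF int integrable_const]) (use up uv in auto)
   then show ?thesis using cU unfolding uv by (simp add: mult_ac)
  qed
  have "integral ?B f = I 0 + integral ?T f" using split[of "hi $ a"] unfolding Qeq by (simp add: I_def)
  moreover have "integral ?B f = integral ?U f + I s" using split[of "lo $ a + s"] unfolding Qseq I_shift by simp
  moreover define P where "P = (s * M) * (V s - V 0)"
  have "integral ?T f >= - P" "integral ?U f <= P" using T U by (simp_all add: P_def)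
  ultimately have "I s - I 0 >= - 2 * P" by linarith
  then have "(I s - I 0) / s >= (- 2 * P) / s" using s(1) by (intro divide_right_mono) auto
  moreover have "(- 2 * P) / s = - 2 * M * (V s - V 0)" using s(1) by (simp add: P_def)
  ultimately show ?thesis by simp
 qed
 \<comment> \<open>The lower bound tends to 0 with s, because the volume excess V s - V 0
   does.\<close>
 have "((%s. (I s - I 0) / s) \<longlongrightarrow> integral (cbox lo hi) f') (at_right 0)"
  using I' unfolding DERIV_def by (simp add: filterlim_at_split)
 moreover have "((%s. - 2 * M * (V s - V 0)) \<longlongrightarrow> - 2 * M * (V 0 - V 0)) (at_right 0)"
  unfolding V_def by (intro tendsto_intros)
 moreover have "eventually (%s. - 2 * M * (V s - V 0) <= (I s - I 0) / s) (at_right 0)"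
  unfolding eventually_at_right_field using key box[of a]
  by (intro exI[of _ "min 1 (hi $ a - lo $ a)"]) auto
 ultimately have "- 2 * M * (V 0 - V 0) <= integral (cbox lo hi) f'"
  by (intro tendsto_le[OF trivial_limit_at_right_real])
 then show ?thesis by simp
qed

lemma integral_Cauchy_Schwarz:
 fixes f g :: "'a::euclidean_space => 'b::real_inner"
 assumes f: "continuous_on (cbox a b) f" and g: "continuous_on (cbox a b) g"
 shows "(integral (cbox a b) (%x. f x \<bullet> g x))\<^sup>2
   <= integral (cbox a b) (%x. f x \<bullet> f x) * integral (cbox a b) (%x. g x \<bullet> g x)"
proof -
 define A where "A = integral (cbox a b) (%x. f x \<bullet> f x)"
 define B where "B = integral (cbox a b) (%x. f x \<bullet> g x)"
 define C where "C = integral (cbox a b) (%x. g x \<bullet> g x)"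
 have i: "(%x. f x \<bullet> f x) integrable_on cbox a b" "(%x. f x \<bullet> g x) integrable_on cbox a b"
  "(%x. g x \<bullet> g x) integrable_on cbox a b"
  by (intro integrable_continuous continuous_intros f g)+
 have q: "0 <= s * s * A - 2 * s * t * B + t * t * C" for s t
 proof -
  have "0 <= integral (cbox a b) (%x. (s *R f x - t *R g x) \<bullet> (s *R f x - t *R g x))"
   by (rule integral_nonneg) (auto intro!: integrable_continuous continuous_intros f g)
  also have "(%x. (s *R f x - t *R g x) \<bullet> (s *R f x - t *R g x))
    = (%x. s * s * (f x \<bullet> f x) - 2 * s * t * (f x \<bullet> g x) + t * t * (g x \<bullet> g x))"
   by (auto simp: inner_diff_left inner_diff_right inner_commute algebra_simps)
  also have "integral (cbox a b) ... = s * s * A - 2 * s * t * B + t * t * C"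
  proof -
   have "(%x. s * s * (f x \<bullet> f x)) integrable_on cbox a b" "(%x. 2 * s * t * (f x \<bullet> g x)) integrable_on cbox a b"
    "(%x. t * t * (g x \<bullet> g x)) integrable_on cbox a b"
    by (intro integrable_continuous continuous_intros f g)+
   then show ?thesis unfolding A_def B_def C_def
    by (simp only: integral_add integral_diff integrable_diff integral_mult_right)
  qed
  finally show ?thesis .
 qed
 have C0: "C >= 0" and A0: "A >= 0" using q[of 0 1] q[of 1 0] by simp_all
 show ?thesis
 proof (cases "C = 0")
  case True
  have "B = 0"
  proof (rule ccontr)
   assume B: "B ~= 0"
   have "0 <= A - 2 * ((A + 1) / (2 * B)) * B" using q[of 1 "(A + 1) / (2 * B)"] True by simp
   also have "... = -1" using B by (simp add: field_simps)
   finally show False by simp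
  qed
  then show ?thesis using A0 C0 by (simp add: A_def[symmetric] B_def[symmetric] C_def[symmetric])
 next
  case False
  have "0 <= C * (A * C - B * B)" using q[of C B] by (simp add: algebra_simps)
  then have "B * B <= A * C" using False C0 by (simp add: zero_le_mult_iff)
  then show ?thesis by (simp add: A_def[symmetric] B_def[symmetric] C_def[symmetric] power2_eq_square)
 qed
qed

lemma integral_sq_le:
 fixes f :: "'a::euclidean_space => real"
 assumes f: "continuous_on (cbox a b) f"
 shows "(integral (cbox a b) f)\<^sup>2 <= measure lborel (cbox a b) * integral (cbox a b) (%x. (f x)\<^sup>2)"
 using integral_Cauchy_Schwarz[OF f continuous_on_const[of _ 1]]
 by (simp add: power2_eq_square mult.commute)

text \<open>Expand the double integral of (u x - u y)^2 and insert the midpoint of x and y. On the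
  half of the segment near x the point is y + s (x - y) with s \<ge> 1/2, so the change of variables
  in x costs at most 2^n; using the whole segment would let the Jacobian degenerate at s = 0. The
  other half is treated with the roles of x and y exchanged.\<close>

lemma poincare_box:
 fixes u :: "real^'n::finite => real"
 assumes pd: "!!i x. has_pd i u (u' i x) x" and cu: "continuous_on UNIV u"
  and cont: "!!i. continuous_on UNIV (u' i)"
  and diam: "!!x y. x : cbox lo hi ==> y : cbox lo hi ==> norm (x - y) <= r"
 shows "measure lborel (cbox lo hi) * integral (cbox lo hi) (%x. (u x)\<^sup>2) <= (integral (cbox lo hi) u)\<^sup>2
  + measure lborel (cbox lo hi) * (r\<^sup>2 * 2 ^ CARD('n) * integral (cbox lo hi) (%x. SUM i. (u' i x)\<^sup>2))"
proof -
 let ?K = "cbox lo hi"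
 define D where "D x = (SUM i. (u' i x)\<^sup>2)" for x
 have cD: "continuous_on S D" for S
  unfolding D_def by (intro continuous_intros continuous_on_subset[OF cont]) simp
 have D0: "D x >= 0" for x by (simp add: D_def sum_nonneg)
 have D0': "integral ?K D >= 0" by (rule integral_nonneg) (auto intro: integrable_continuous cD D0)
 have cc: "continuous_on S (%z. u (h z))" if "continuous_on S h" for S and h :: "'z::topological_space => _"
  by (rule continuous_on_compose2[OF cu that]) simp
 have cDc: "continuous_on S (%z. D (h z))" if "continuous_on S h" for S and h :: "'z::topological_space => _"
  by (rule continuous_on_compose2[OF cD[of UNIV] that]) simp
 have line: "(u x - u ((1/2) *R (x + y)))\<^sup>2 <= r\<^sup>2 / 2 * integral {1/2..1} (%s. D (y + s *R (x - y)))"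
  if xy: "x : ?K" "y : ?K" for x y
 proof -
  define psi where "psi s = (SUM i. (x - y) $ i * u' i (y + s *R (x - y)))" for s
  have cpsi: "continuous_on S psi" for S
   unfolding psi_def by (intro continuous_intros continuous_on_compose2[OF cont]) auto
  have "((%s. u (y + s *R (x - y))) has_vector_derivative psi s) (at s within {1/2..1})" for s
  proof -
   have "((%s. y + s *R (x - y)) has_derivative (%h. h *R (x - y))) (at s within {1/2..1})"
    by (auto intro!: derivative_eq_intros)
   from has_derivative_in_compose[OF this has_derivative_at_withinI[OF has_derivative_partials[OF pd cont]]]
   show ?thesis unfolding has_vector_derivative_def psi_def
    by (simp add: sum_distrib_left mult_ac)
  qed
  then have "(psi has_integral u (y + 1 *R (x - y)) - u (y + (1/2) *R (x - y))) {1/2..1}"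
   by (intro fundamental_theorem_of_calculus) auto
  moreover have "y + (1/2) *R (x - y) = (1/2) *R (x + y)" by (simp add: algebra_simps flip: scaleR_add_left)
  ultimately have eq: "u x - u ((1/2) *R (x + y)) = integral {1/2..1} psi" by (simp add: integral_unique)
  have "(integral {1/2..1} psi)\<^sup>2 <= 1/2 * integral {1/2..1} (%s. (psi s)\<^sup>2)"
   using integral_sq_le[of "1/2" 1 psi] cpsi by simp
  also have "integral {1/2..1} (%s. (psi s)\<^sup>2) <= integral {1/2..1} (%s. r\<^sup>2 * D (y + s *R (x - y)))"
  proof (rule integral_le)
   show "(%s. (psi s)\<^sup>2) integrable_on {1/2..1}" "(%s. r\<^sup>2 * D (y + s *R (x - y))) integrable_on {1/2..1}"
    by (intro integrable_continuous_real continuous_intros cpsi cDc)+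
   fix s
   have "(psi s)\<^sup>2 <= (SUM i. ((x - y) $ i)\<^sup>2) * D (y + s *R (x - y))"
    unfolding psi_def D_def by (rule Cauchy_Schwarz_ineq_sum)
   also have "(SUM i. ((x - y) $ i)\<^sup>2) = (norm (x - y))\<^sup>2"
    unfolding power2_norm_eq_inner by (simp add: inner_vec_def power2_eq_square)
   also have "... * D (y + s *R (x - y)) <= r\<^sup>2 * D (y + s *R (x - y))"
    using diam[OF xy] by (intro mult_right_mono power_mono D0) auto
   finally show "(psi s)\<^sup>2 <= r\<^sup>2 * D (y + s *R (x - y))" .
  qed
  finally show ?thesis unfolding eq by (simp add: power2_eq_square mult_ac)
 qed
 \<comment> \<open>The homothety with centre y and ratio s maps the box into itself by convexity, so
   the only loss is the factor s^(-n).\<close>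
 have scale: "integral ?K (%x. D (y + s *R (x - y))) <= 2 ^ CARD('n) * integral ?K D"
  if y: "y : ?K" and s: "1/2 <= s" "s <= 1" for y s
 proof -
  let ?c = "(1 - s) *R y"
  let ?a = "s *R lo + ?c" and ?b = "s *R hi + ?c"
  have "((%x. D (s *R x + ?c)) has_integral (integral (cbox ?a ?b) D /\<^sub>R s ^ DIM(real^'n)))
    (cbox ((?a - ?c) /\<^sub>R s) ((?b - ?c) /\<^sub>R s))"
   by (rule has_integral_affinity'[OF integrable_integral[OF integrable_continuous[OF cD]]]) (use s in simp)
  moreover have "(?a - ?c) /\<^sub>R s = lo" "(?b - ?c) /\<^sub>R s = hi" using s by simp_all
  ultimately have "((%x. D (s *R x + ?c)) has_integral (integral (cbox ?a ?b) D /\<^sub>R s ^ DIM(real^'n))) ?K"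
   by simp
  from integral_unique[OF this] have "integral ?K (%x. D (s *R x + ?c)) = integral (cbox ?a ?b) D / s ^ CARD('n)"
   by (simp only: real_scaleR_def DIM_cart DIM_real mult_1_right mult_1_left divide_inverse mult.commute)
  moreover have "s *R x + ?c = y + s *R (x - y)" for x by (simp add: algebra_simps)
  ultimately have "integral ?K (%x. D (y + s *R (x - y))) = integral (cbox ?a ?b) D / s ^ CARD('n)" by simp
  also have "... <= integral ?K D / s ^ CARD('n)"
  proof (rule divide_right_mono, rule integral_subset_le)
   show "cbox ?a ?b \<subseteq> ?K"
   proof
    fix z assume z: "z : cbox ?a ?b"
    have "lo $ i <= z $ i \<and> z $ i <= hi $ i" for i
    proof -
     have "(1 - s) * lo $ i <= (1 - s) * y $ i" "(1 - s) * y $ i <= (1 - s) * hi $ i"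
      using y s unfolding mem_box_cart by (auto intro!: mult_left_mono)
     moreover have "s * lo $ i + (1 - s) * y $ i <= z $ i" "z $ i <= s * hi $ i + (1 - s) * y $ i"
      using z unfolding mem_box_cart by auto
     ultimately show ?thesis by (simp add: algebra_simps)
    qed
    then show "z : ?K" unfolding mem_box_cart by blast
   qed
  qed (use s D0 in \<open>auto intro: integrable_continuous cD\<close>)
  also have "... <= 2 ^ CARD('n) * integral ?K D"
  proof -
   have "1 / s ^ CARD('n) <= 2 ^ CARD('n)"
   proof -
    have "1 <= (2 * s) ^ CARD('n)" using s by (intro one_le_power) simp
    then show ?thesis using s by (simp add: power_mult_distrib divide_le_eq)
   qed
   from mult_right_mono[OF this D0'] show ?thesis by simp
  qed
  finally show ?thesis .
 qed
 define C where "C = r\<^sup>2 / 4 * 2 ^ CARD('n) * integral ?K D"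
 have half: "integral ?K (%x. (u x - u ((1/2) *R (x + y)))\<^sup>2) <= C" if y: "y : ?K" for y
 proof -
  have cont2: "continuous_on S (%(x, s). D (y + s *R (x - y)))" for S :: "((real^'n) \<times> real) set"
   unfolding split_def by (intro cDc continuous_intros)
  have "integral ?K (%x. (u x - u ((1/2) *R (x + y)))\<^sup>2)
    <= integral ?K (%x. r\<^sup>2 / 2 * integral (cbox (1/2) 1) (%s. D (y + s *R (x - y))))"
  proof (rule integral_le)
   show "(%x. (u x - u ((1/2) *R (x + y)))\<^sup>2) integrable_on ?K"
    by (intro integrable_continuous continuous_intros cc)
   show "(%x. r\<^sup>2 / 2 * integral (cbox (1/2) 1) (%s. D (y + s *R (x - y)))) integrable_on ?K"
    by (intro integrable_continuous continuous_intros integral_continuous_on_param cont2)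
  qed (use line y in auto)
  also have "... = r\<^sup>2 / 2 * integral ?K (%x. integral (cbox (1/2) 1) (%s. D (y + s *R (x - y))))"
   by simp
  also have "integral ?K (%x. integral (cbox (1/2) 1) (%s. D (y + s *R (x - y))))
    = integral (cbox (1/2) 1) (%s. integral ?K (%x. D (y + s *R (x - y))))"
   by (rule integral_swap_continuous[OF cont2])
  also have "r\<^sup>2 / 2 * ... <= r\<^sup>2 / 2 * integral (cbox (1/2) (1::real)) (%s. 2 ^ CARD('n) * integral ?K D)"
  proof (rule mult_left_mono, rule integral_le)
   have "continuous_on (cbox (1/2) 1 \<times> ?K) (%(s, x). D (y + s *R (x - y)))"
    unfolding split_def by (intro cDc continuous_intros)
   then show "(%s. integral ?K (%x. D (y + s *R (x - y)))) integrable_on cbox (1/2) 1"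
    by (intro integrable_continuous integral_continuous_on_param)
  qed (use scale[OF y] in auto)
  also have "... = C" by (simp add: C_def)
  finally show ?thesis .
 qed
 have c1: "continuous_on S (%(x, y). (u x - u ((1/2) *R (x + y)))\<^sup>2)" for S
  unfolding split_def by (intro continuous_intros cc)
 have c2: "continuous_on S (%(x, y). (u y - u ((1/2) *R (x + y)))\<^sup>2)" for S
  unfolding split_def by (intro continuous_intros cc)
 have c3: "continuous_on S (%(x, y). (u x - u y)\<^sup>2)" for S
  unfolding split_def by (intro continuous_intros cc)
 have c3': "continuous_on S (%y. (u x - u y)\<^sup>2)" for S x by (intro continuous_intros cc)
 have c12': "continuous_on S (%y. (u x - u ((1/2) *R (x + y)))\<^sup>2)"
  "continuous_on S (%y. (u y - u ((1/2) *R (x + y)))\<^sup>2)" for S x by (intro continuous_intros cc)+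
 define k where "k = measure lborel ?K"
 define I where "I = integral ?K u"
 define J where "J = integral ?K (%x. (u x)\<^sup>2)"
 have k0: "k >= 0" by (simp add: k_def)
 have iu: "u integrable_on ?K" "(%x. (u x)\<^sup>2) integrable_on ?K"
  by (intro integrable_continuous continuous_intros continuous_on_subset[OF cu]; simp)+
 have inner: "integral ?K (%y. (u x - u y)\<^sup>2) = k * (u x)\<^sup>2 - 2 * I * u x + J" for x
 proof -
  have "(%y. (u x - u y)\<^sup>2) = (%y. (u x)\<^sup>2 - 2 * u x * u y + (u y)\<^sup>2)"
   by (auto simp: power2_eq_square algebra_simps)
  moreover have "((%y. (u x)\<^sup>2 - 2 * u x * u y + (u y)\<^sup>2) has_integral
    k *R (u x)\<^sup>2 - 2 * u x * I + J) ?K"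
   unfolding k_def I_def J_def
   by (intro has_integral_add has_integral_diff has_integral_mult_right has_integral_const
     integrable_integral iu)
  ultimately show ?thesis by (simp add: integral_unique)
 qed
 have "((%x. k * (u x)\<^sup>2 - 2 * I * u x + J) has_integral k * J - 2 * I * I + k *R J) ?K"
  unfolding k_def I_def J_def
  by (intro has_integral_add has_integral_diff has_integral_mult_right has_integral_const
    integrable_integral iu)
 then have "integral ?K (%x. integral ?K (%y. (u x - u y)\<^sup>2)) = 2 * k * J - 2 * I\<^sup>2"
  unfolding inner by (simp add: integral_unique power2_eq_square)
 moreover have "integral ?K (%x. integral ?K (%y. (u x - u y)\<^sup>2))
  <= integral ?K (%x. 2 * integral ?K (%y. (u x - u ((1/2) *R (x + y)))\<^sup>2)
    + 2 * integral ?K (%y. (u y - u ((1/2) *R (x + y)))\<^sup>2))"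
 proof (rule integral_le)
  show "(%x. integral ?K (%y. (u x - u y)\<^sup>2)) integrable_on ?K"
   by (intro integrable_continuous integral_continuous_on_param c3)
  show "(%x. 2 * integral ?K (%y. (u x - u ((1/2) *R (x + y)))\<^sup>2)
    + 2 * integral ?K (%y. (u y - u ((1/2) *R (x + y)))\<^sup>2)) integrable_on ?K"
   by (intro integrable_continuous continuous_intros integral_continuous_on_param c1 c2)
  fix x
  have "integral ?K (%y. (u x - u y)\<^sup>2) <= integral ?K (%y. 2 * (u x - u ((1/2) *R (x + y)))\<^sup>2
    + 2 * (u y - u ((1/2) *R (x + y)))\<^sup>2)"
  proof (rule integral_le)
   fix y
   have "(a - b)\<^sup>2 <= 2 * (a - c)\<^sup>2 + 2 * (b - c)\<^sup>2" for a b c :: real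
    using zero_le_power2[of "a + b - 2 * c"] by (simp add: power2_eq_square algebra_simps)
   then show "(u x - u y)\<^sup>2 <= 2 * (u x - u ((1/2) *R (x + y)))\<^sup>2 + 2 * (u y - u ((1/2) *R (x + y)))\<^sup>2" .
  qed (intro integrable_continuous continuous_intros c3' c12' cc)+
  also have "... = 2 * integral ?K (%y. (u x - u ((1/2) *R (x + y)))\<^sup>2)
    + 2 * integral ?K (%y. (u y - u ((1/2) *R (x + y)))\<^sup>2)"
   by (subst integral_add) (auto intro!: integrable_continuous continuous_intros c12')
  finally show "integral ?K (%y. (u x - u y)\<^sup>2) <= 2 * integral ?K (%y. (u x - u ((1/2) *R (x + y)))\<^sup>2)
    + 2 * integral ?K (%y. (u y - u ((1/2) *R (x + y)))\<^sup>2)" .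
 qed
 moreover have "integral ?K (%x. 2 * integral ?K (%y. (u x - u ((1/2) *R (x + y)))\<^sup>2)
    + 2 * integral ?K (%y. (u y - u ((1/2) *R (x + y)))\<^sup>2))
   = 2 * integral ?K (%x. integral ?K (%y. (u x - u ((1/2) *R (x + y)))\<^sup>2))
   + 2 * integral ?K (%x. integral ?K (%y. (u y - u ((1/2) *R (x + y)))\<^sup>2))"
  by (subst integral_add) (auto intro!: integrable_continuous continuous_intros integral_continuous_on_param c1 c2)
 moreover have "integral ?K (%x. integral ?K (%y. (u x - u ((1/2) *R (x + y)))\<^sup>2)) <= k * C"
 proof -
  have "integral ?K (%x. integral ?K (%y. (u x - u ((1/2) *R (x + y)))\<^sup>2))
   = integral ?K (%y. integral ?K (%x. (u x - u ((1/2) *R (x + y)))\<^sup>2))"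
   by (rule integral_swap_continuous[OF c1])
  also have "... <= integral ?K (%y. C)"
  proof (rule integral_le)
   have "continuous_on (?K \<times> ?K) (%(y, x). (u x - u ((1/2) *R (x + y)))\<^sup>2)"
    unfolding split_def by (intro continuous_intros cc)
   then show "(%y. integral ?K (%x. (u x - u ((1/2) *R (x + y)))\<^sup>2)) integrable_on ?K"
    by (intro integrable_continuous integral_continuous_on_param)
  qed (use half in auto)
  finally show ?thesis by (simp add: k_def)
 qed
 moreover have "integral ?K (%x. integral ?K (%y. (u y - u ((1/2) *R (x + y)))\<^sup>2)) <= k * C"
 proof -
  have "integral ?K (%x. integral ?K (%y. (u y - u ((1/2) *R (x + y)))\<^sup>2)) <= integral ?K (%y. C)"
  proof (rule integral_le)
   show "(%x. integral ?K (%y. (u y - u ((1/2) *R (x + y)))\<^sup>2)) integrable_on ?K"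
    by (intro integrable_continuous integral_continuous_on_param c2)
  qed (use half in \<open>auto simp: add.commute\<close>)
  then show ?thesis by (simp add: k_def)
 qed
 ultimately have "k * J <= I\<^sup>2 + 2 * (k * C)" by linarith
 also have "2 * (k * C) <= k * (r\<^sup>2 * 2 ^ CARD('n) * integral ?K D)"
  using k0 D0' by (simp add: C_def mult_left_mono)
 finally show ?thesis unfolding k_def I_def J_def D_def by simp
qed

text \<open>A quantitative substitute for the compact embedding of H^1 into L^2: cut the box into
  pieces of diameter at most r, with r^2 2^n = eps, and apply the Poincare inequality on each piece.
  The integrals over the pieces are the finitely many functionals. The pieces and \<open>c\<close>
  are chosen before u.\<close>

lemma rellich:
 fixes lo hi :: "real^'n::finite"
 assumes "eps > 0"
 obtains m :: nat and K :: "nat => (real^'n) set" and c :: real where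
  "c > 0" "!!i. \<exists>a b. K i = cbox a b" "!!i. K i \<subseteq> cbox lo hi"
  "!!u u'. (!!i x. has_pd i u (u' i x) x) ==> continuous_on UNIV u ==> (!!i. continuous_on UNIV (u' i)) ==>
   integral (cbox lo hi) (%x. (u x)\<^sup>2) <= eps * integral (cbox lo hi) (%x. SUM i. (u' i x)\<^sup>2)
     + c * (\<Sum>i<m. (integral (K i) u)\<^sup>2)"
proof -
 define r where "r = sqrt (eps / 2 ^ CARD('n))"
 have r: "r > 0" "r\<^sup>2 * 2 ^ CARD('n) = eps" using assms by (simp_all add: r_def)
 obtain p where p: "p tagged_division_of cbox lo hi" "(%x. ball x (r / 2)) fine p"
  using fine_division_exists[of "%x. ball x (r/2)" lo hi] r by (auto simp: gauge_ball)
 have fp: "finite p" using p(1) by blast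
 then obtain q where q: "bij_betw q {..<card p} p" using ex_bij_betw_nat_finite by (metis atLeast0LessThan)
 define m where "m = card p"
 \<comment> \<open>Indices beyond the number of pieces get the empty box, so that every
   \<open>K i\<close> is a box contained in the given one.\<close>
 define K where "K i = (if i < m then snd (q i) else {})" for i
 have qi: "q i : p" if "i < m" for i using q that unfolding m_def bij_betw_def by blast
 have box: "\<exists>a b. k = cbox a b" "k \<subseteq> cbox lo hi" "k \<subseteq> ball x (r/2)" if "(x, k) : p" for x k
  using tagged_division_ofD(3,4)[OF p(1) that] p(2) that unfolding fine_def by auto
 \<comment> \<open>Larger than all reciprocal volumes of the pieces. A degenerate piece contributes
   1/0 = 0 to the sum; it is treated separately below, since every integral over it
   vanishes.\<close>
 define c where "c = 1 + (\<Sum>(x, k)\<in>p. 1 / measure lborel k)"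
 have c0: "c > 0" unfolding c_def by (intro add_pos_nonneg sum_nonneg) auto
 have cge: "1 / measure lborel k <= c" if "(x, k) : p" for x k
 proof -
  have "(case (x, k) of (x, k) => 1 / measure lborel k) <= (\<Sum>(x, k)\<in>p. 1 / measure lborel k)"
   by (rule member_le_sum[OF that _ fp]) auto
  then show ?thesis by (simp add: c_def)
 qed
 show ?thesis
 proof (rule that[of c K m])
  show "\<exists>a b. K i = cbox a b" for i
  proof (cases "i < m")
   case True then show ?thesis using box(1)[of "fst (q i)" "snd (q i)"] qi by (simp add: K_def)
  next
   case False
   have "cbox (1 :: real^'n) 0 = {}" unfolding interval_eq_empty_cart by simp
   then show ?thesis using False by (metis K_def)
  qed
  show "K i \<subseteq> cbox lo hi" for i using box(2)[of "fst (q i)" "snd (q i)"] qi by (auto simp: K_def)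
  fix u and u' :: "'n => real^'n => real"
  assume pd: "!!i x. has_pd i u (u' i x) x" and cu: "continuous_on UNIV u" and cont: "!!i. continuous_on UNIV (u' i)"
  let ?D = "%x. SUM i. (u' i x)\<^sup>2"
  have cD: "continuous_on S ?D" and cu2: "continuous_on S (%x. (u x)\<^sup>2)" for S
   by (intro continuous_intros continuous_on_subset[OF cont] continuous_on_subset[OF cu]; simp)+
  have piece: "integral k (%x. (u x)\<^sup>2) <= eps * integral k ?D + c * (integral k u)\<^sup>2" if xk: "(x, k) : p" for x k
  proof -
   obtain a b where ab: "k = cbox a b" using box(1)[OF xk] by blast
   have D0: "integral (cbox a b) ?D >= 0"
    by (rule integral_nonneg) (auto intro!: integrable_continuous cD sum_nonneg)
   have "norm (y - z) <= r" if "y : cbox a b" "z : cbox a b" for y z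
   proof -
    have "dist x y < r / 2" "dist x z < r / 2" using box(3)[OF xk] that ab by auto
    then show ?thesis using dist_triangle2[of y z x] by (simp add: dist_norm norm_minus_commute)
   qed
   from poincare_box[OF pd cu cont this]
   have P: "measure lborel k * integral k (%x. (u x)\<^sup>2) <= (integral k u)\<^sup>2 + measure lborel k * (eps * integral k ?D)"
    unfolding ab r(2) by blast
   show ?thesis
   proof (cases "measure lborel k = 0")
    case True
    then have "integral k (%x. (u x)\<^sup>2) = 0" unfolding ab by (rule integral_null)
    then show ?thesis using D0 assms c0 unfolding ab by simp
   next
    case False
    then have k: "measure lborel k > 0" unfolding ab by (simp add: less_le)
    have "integral k (%x. (u x)\<^sup>2) <= ((integral k u)\<^sup>2 + measure lborel k * (eps * integral k ?D)) / measure lborel k"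
     using P k by (simp add: pos_le_divide_eq mult.commute)
    also have "... = (1 / measure lborel k) * (integral k u)\<^sup>2 + eps * integral k ?D" using k by (simp add: add_divide_distrib)
    also have "... <= c * (integral k u)\<^sup>2 + eps * integral k ?D"
     by (intro add_right_mono mult_right_mono cge[OF xk]) auto
    finally show ?thesis by simp
   qed
  qed
  have "integral (cbox lo hi) (%x. (u x)\<^sup>2) = (\<Sum>(x, k)\<in>p. integral k (%x. (u x)\<^sup>2))"
   by (rule integral_combine_tagged_division_topdown[OF integrable_continuous[OF cu2] p(1)])
  also have "... <= (\<Sum>(x, k)\<in>p. eps * integral k ?D + c * (integral k u)\<^sup>2)"
   using piece by (intro sum_mono) auto
  also have "... = eps * (\<Sum>(x, k)\<in>p. integral k ?D) + c * (\<Sum>(x, k)\<in>p. (integral k u)\<^sup>2)"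
   by (simp add: split_def sum.distrib sum_distrib_left)
  also have "(\<Sum>(x, k)\<in>p. integral k ?D) = integral (cbox lo hi) ?D"
   by (rule integral_combine_tagged_division_topdown[OF integrable_continuous[OF cD] p(1), symmetric])
  also have "(\<Sum>(x, k)\<in>p. (integral k u)\<^sup>2) = (\<Sum>i<m. (integral (K i) u)\<^sup>2)"
   using sum.reindex_bij_betw[OF q, of "%(x, k). (integral k u)\<^sup>2"]
   by (simp add: K_def m_def split_def)
  finally show "integral (cbox lo hi) (%x. (u x)\<^sup>2) <= eps * integral (cbox lo hi) ?D + c * (\<Sum>i<m. (integral (K i) u)\<^sup>2)" .
 qed (rule c0)
qed

section \<open>Seminormed spaces, approximate codimension and the index argument\<close>

instantiation "fun" :: (type, scaleR) scaleR
begin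
definition scaleR_fun_def: "a *R f = (%x. a *R f x)"
instance ..
end

lemma scaleR_fun_apply [simp]: "(a *R f) x = a *R f x"
 by (simp add: scaleR_fun_def)

instance "fun" :: (type, real_vector) real_vector
 by standard (auto simp: fun_eq_iff algebra_simps)

text \<open>The axioms are imposed on a subspace only: the intended elements are functions on all of
  R^n, while the L^2 seminorm looks only at a box and is well behaved on the fields continuous
  there.\<close>

locale seminorm_on =
 fixes C :: "'z::real_vector set" and N :: "'z => real"
 assumes C: "subspace C"
  and N_add: "x : C ==> y : C ==> N (x + y) <= N x + N y"
  and N_scale: "x : C ==> N (a *R x) = \<bar>a\<bar> * N x"
begin

lemma N_0 [simp]: "N 0 = 0"
 using N_scale[of 0 0] subspace_0[OF C] by simp

lemma N_minus: "x : C ==> N (- x) = N x"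
 using N_scale[of x "-1"] by simp

lemma N_diff: "x : C ==> y : C ==> N (x - y) <= N x + N y"
 using N_add[of x "- y"] N_minus[of y] subspace_neg[OF C] by auto

lemma N_nonneg: "x : C ==> 0 <= N x"
 using N_diff[of x x] by simp

definition approx :: "'z set => 'z => bool" where
 "approx W z \<longleftrightarrow> (\<forall>eps>0. \<exists>w\<in>W. N (z - w) < eps)"

definition adjoin :: "'z set => 'z => 'z set" where
 "adjoin W e = {w + a *R e | w a. w : W}"

text \<open>The closure of \<open>W\<close> has codimension at most d, said without quotients or
  completions: adjoining d suitable vectors makes \<open>W\<close> dense.\<close>

fun codim_le :: "nat => 'z set => bool" where
 "codim_le 0 W \<longleftrightarrow> (\<forall>z\<in>C. approx W z)"
| "codim_le (Suc d) W \<longleftrightarrow> (\<exists>e\<in>C. codim_le d (adjoin W e))"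

text \<open>The directed gap between two subspaces, in the sense of perturbation theory, measured
  relative to the seminorm of the vector.\<close>

definition near :: "real => 'z set => 'z set => bool" where
 "near kap W W' \<longleftrightarrow> (\<forall>w\<in>W. \<exists>w'\<in>W'. N (w - w') <= kap * N w)"

lemma adjoin_subspace: "subspace W ==> subspace (adjoin W e)"
proof (rule subspaceI)
 assume W: "subspace W"
 show "0 : adjoin W e" unfolding adjoin_def using subspace_0[OF W] by (auto intro!: exI[of _ 0])
 fix x y c assume "x : adjoin W e"
 then obtain w a where x: "x = w + a *R e" "w : W" unfolding adjoin_def by blast
 have "c *R x = c *R w + (c * a) *R e" by (simp add: x(1) scaleR_add_right)
 then show "c *R x : adjoin W e" unfolding adjoin_def using subspace_scale[OF W x(2), of c] by blast
 assume "y : adjoin W e"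
 then obtain w' a' where y: "y = w' + a' *R e" "w' : W" unfolding adjoin_def by blast
 have "x + y = (w + w') + (a + a') *R e" by (simp add: x(1) y(1) algebra_simps)
 then show "x + y : adjoin W e" unfolding adjoin_def
  using subspace_add[OF W x(2) y(2)] by blast
qed

lemma adjoin_C: "W \<subseteq> C ==> e : C ==> adjoin W e \<subseteq> C"
 unfolding adjoin_def using subspace_add[OF C] subspace_scale[OF C] by blast

text \<open>Approximate z by w in \<open>W\<close> up to a tenth of N z, and w by w' in
  \<open>W'\<close>: the error is at most 1/10 + (11/10)(1/3) < 1/2 of N z. Repeating this on the
  remainder gives geometric decay.\<close>

lemma dense_near:
 assumes W: "W \<subseteq> C" "\<forall>z\<in>C. approx W z" and W': "subspace W'" "W' \<subseteq> C"
  and near: "near kap W W'" "kap <= 1/3" and z: "z : C"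
 shows "approx W' z"
proof -
 have step: "\<exists>w'\<in>W'. N (z - w') <= N z / 2" if z: "z : C" for z
 proof (cases "N z = 0")
  case True
  then show ?thesis using subspace_0[OF W'(1)] by (intro bexI[of _ 0]) auto
 next
  case False
  with N_nonneg[OF z] have p: "N z > 0" by simp
  then have "N z / 10 > 0" by simp
  with W(2) z obtain w where w: "w : W" "N (z - w) < N z / 10" unfolding approx_def by blast
  from near(1) w(1) obtain w' where w': "w' : W'" "N (w - w') <= kap * N w" unfolding near_def by blast
  have inC: "w : C" "w' : C" "z - w : C" "w - w' : C"
   using w w' W W' z subspace_diff[OF C] by blast+
  have "N w <= N z + N (z - w)" using N_diff[OF z inC(3)] by simp
  moreover have "kap * N w <= 1/3 * N w" using near(2) N_nonneg[OF inC(1)] by (rule mult_right_mono)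
  ultimately have "N (w - w') <= 11/30 * N z" using w'(2) w(2) by simp
  moreover have "N (z - w') <= N (z - w) + N (w - w')" using N_add[OF inC(3,4)] by simp
  ultimately have "N (z - w') <= N z / 2" using w(2) p by linarith
  with w'(1) show ?thesis by blast
 qed
 have iter: "\<exists>w'\<in>W'. N (z - w') <= (1/2)^k * N z" for k :: nat
 proof (induction k)
  case 0 show ?case using subspace_0[OF W'(1)] by (intro bexI[of _ 0]) auto
 next
  case (Suc k)
  then obtain w where w: "w : W'" "N (z - w) <= (1/2)^k * N z" by blast
  have "z - w : C" using z w W'(2) subspace_diff[OF C] by blast
  from step[OF this] obtain u where u: "u : W'" "N (z - w - u) <= N (z - w) / 2" by blast
  have "N (z - (w + u)) <= (1/2)^Suc k * N z" using u(2) w(2) by (simp add: diff_diff_add)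
  then show ?case using subspace_add[OF W'(1) w(1) u(1)] by blast
 qed
 show ?thesis unfolding approx_def
 proof (intro allI impI)
  fix eps :: real assume "eps > 0"
  moreover have "N z + 1 > 0" using N_nonneg[OF z] by simp
  ultimately obtain k where "(1/2)^k < eps / (N z + 1)"
   using real_arch_pow_inv[of "eps / (N z + 1)" "1/2"] by auto
  then have "(1/2)^k * (N z + 1) < eps" using \<open>N z + 1 > 0\<close> by (simp add: pos_less_divide_eq)
  moreover have "(1/2)^k * N z <= (1/2)^k * (N z + 1)" by simp
  ultimately have "(1/2)^k * N z < eps" by linarith
  with iter[of k] show "\<exists>w\<in>W'. N (z - w) < eps" by (meson le_less_trans)
 qed
qed

lemma adjoin_0: "adjoin W 0 = W"
 unfolding adjoin_def by auto

lemma near_adjoin_approx: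
 assumes "subspace W" "approx W e" "e : C" "kap > 0" "W \<subseteq> C"
 shows "near kap (adjoin W e) W"
 unfolding near_def
proof
 fix u assume "u : adjoin W e"
 then obtain w a where u: "u = w + a *R e" "w : W" unfolding adjoin_def by blast
 have uC: "u : C" using u assms subspace_add[OF C] subspace_scale[OF C] by blast
 show "\<exists>w'\<in>W. N (u - w') <= kap * N u"
 proof (cases "N u = 0")
  case True then show ?thesis using subspace_0[OF assms(1)] by (intro bexI[of _ 0]) auto
 next
  case False
  then have "kap * N u / (\<bar>a\<bar> + 1) > 0" using N_nonneg[OF uC] assms(4) by simp
  then obtain w' where w': "w' : W" "N (e - w') < kap * N u / (\<bar>a\<bar> + 1)"
   using assms(2) unfolding approx_def by blast
  have "u - (w + a *R w') = a *R (e - w')" by (simp add: u algebra_simps)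
  then have "N (u - (w + a *R w')) = \<bar>a\<bar> * N (e - w')"
   using N_scale[of "e - w'" a] w'(1) assms subspace_diff[OF C] by auto
  also have "... <= (\<bar>a\<bar> + 1) * N (e - w')"
   using N_nonneg[of "e - w'"] w'(1) assms subspace_diff[OF C] by (intro mult_right_mono) auto
  also have "... <= kap * N u" using w'(2) by (simp add: pos_less_divide_eq mult.commute add_pos_nonneg)
  finally show ?thesis using subspace_add[OF assms(1) u(2) subspace_scale[OF assms(1) w'(1)]] by blast
 qed
qed

lemma far_bound:
 assumes "subspace W" "W \<subseteq> C" "e : C" "!!w. w : W ==> m <= N (e - w)" "w : W"
 shows "\<bar>a\<bar> * m <= N (w + a *R e)"
proof (cases "a = 0")
 case True then show ?thesis using N_nonneg[of w] assms by auto
next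
 case False
 have inW: "(- 1 / a) *R w : W" by (rule subspace_scale[OF assms(1,5)])
 have "w + a *R e = a *R (e - (- 1 / a) *R w)" using False by (simp add: algebra_simps)
 then have "N (w + a *R e) = \<bar>a\<bar> * N (e - (- 1 / a) *R w)"
  using N_scale inW assms(2,3) subspace_diff[OF C] by (metis subsetD)
 then show ?thesis using assms(4)[OF inW] by (simp add: mult_left_mono)
qed

text \<open>Small perturbations do not increase the codimension. In the induction step the adjoined
  vector e is replaced by e' = e - w0, whose seminorm is less than twice its distance m from
  \<open>W\<close>. The component in \<open>W\<close> of a vector u of the enlarged space then has
  seminorm at most 3 N u, so each adjoined vector multiplies the admissible gap by 3; this is the
  origin of \<open>3^d * kap\<close>.\<close>

lemma codim_near:
 "codim_le d W ==> subspace W ==> W \<subseteq> C ==> subspace W' ==> W' \<subseteq> C ==>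
  near kap W W' ==> 3^d * kap <= 1/3 ==> 0 < kap ==> codim_le d W'"
proof (induction d arbitrary: W W' kap)
 case 0
 then show ?case using dense_near[of W W' kap] by auto
next
 case (Suc d)
 from Suc.prems(1) obtain e where e: "e : C" "codim_le d (adjoin W e)" by auto
 have small: "3^d * kap <= 1/3" 
  using Suc.prems(7,8) by (simp add: field_simps)
 show ?case
 proof (cases "approx W e")
  case True
  have "codim_le d W"
   using Suc.IH[OF e(2) adjoin_subspace adjoin_C _ _ near_adjoin_approx small] Suc.prems True e(1) by blast
  then have "codim_le d W'" using Suc.IH[of W W' kap] Suc.prems small by blast
  \<comment> \<open>Here e was already in the closure of \<open>W\<close>, so d vectors suffice; the
    zero vector fills the additional place.\<close>
  then have "codim_le d (adjoin W' 0)" by (simp only: adjoin_0)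
  then show ?thesis using subspace_0[OF C] by auto
 next
  case False
  then obtain eps where eps: "eps > 0" "!!w. w : W ==> eps <= N (e - w)" unfolding approx_def by force
  define m where "m = Inf ((%w. N (e - w)) ` W)"
  have ne: "(%w. N (e - w)) ` W ~= {}" using subspace_0[OF Suc.prems(2)] by blast
  have bdd: "bdd_below ((%w. N (e - w)) ` W)" using eps(2) by (intro bdd_belowI[of _ eps]) auto
  have meps: "eps <= m" unfolding m_def by (rule cInf_greatest[OF ne]) (use eps in auto)
  have mle: "m <= N (e - w)" if "w : W" for w
   unfolding m_def by (rule cInf_lower[OF _ bdd]) (use that in auto)
  have "m < 2 * m" using meps eps by simp
  then obtain w0 where w0: "w0 : W" "N (e - w0) < 2 * m"
   using cInf_lessD[OF ne] unfolding m_def by blast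
  define e' where "e' = e - w0"
  have e': "e' : C" using e w0 Suc.prems(3) subspace_diff[OF C] unfolding e'_def by blast
  have far: "m <= N (e' - w)" if "w : W" for w
   using mle[OF subspace_add[OF Suc.prems(2) w0(1) that]] by (simp add: e'_def diff_diff_add)
  have "near (3 * kap) (adjoin W e) (adjoin W' e')" unfolding near_def
  proof
   fix u assume "u : adjoin W e"
   then obtain w1 a where u1: "u = w1 + a *R e" "w1 : W" unfolding adjoin_def by blast
   define w where "w = w1 + a *R w0"
   have u: "u = w + a *R e'" "w : W"
    using u1 subspace_add[OF Suc.prems(2) u1(2) subspace_scale[OF Suc.prems(2) w0(1)]]
    by (auto simp: w_def e'_def algebra_simps)
   have C': "w : C" "a *R e' : C" "u : C"
    using u Suc.prems(3) e' subspace_scale[OF C] subspace_add[OF C] by blast+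
   have "\<bar>a\<bar> * m <= N u" unfolding u(1) by (rule far_bound[OF Suc.prems(2,3) e' far u(2)])
   moreover have "N (a *R e') <= \<bar>a\<bar> * (2 * m)"
    using w0(2) N_scale[OF e', of a] unfolding e'_def by (simp add: mult_left_mono)
   moreover have "N w <= N u + N (a *R e')" using N_diff[OF C'(3,2)] u by simp
   ultimately have Nw: "N w <= 3 * N u" by simp
   from Suc.prems(6) u(2) obtain w' where w': "w' : W'" "N (w - w') <= kap * N w" unfolding near_def by blast
   have "w' + a *R e' : adjoin W' e'" unfolding adjoin_def using w'(1) by blast
   moreover have "N (u - (w' + a *R e')) <= 3 * kap * N u"
   proof -
    have "kap * N w <= kap * (3 * N u)" using Nw Suc.prems(8) by (intro mult_left_mono) auto
    moreover have "u - (w' + a *R e') = w - w'" by (simp add: u)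
    moreover have "kap * (3 * N u) = 3 * kap * N u" by simp
    ultimately show ?thesis using w'(2) by (metis order_trans)
   qed
   ultimately show "\<exists>w'\<in>adjoin W' e'. N (u - w') <= 3 * kap * N u" by blast
  qed
  moreover have "3 ^ d * (3 * kap) <= 1/3" using Suc.prems(7) by simp
  ultimately have "codim_le d (adjoin W' e')"
   using Suc.prems(2-5,8) e(1) e'
   by (intro Suc.IH[where kap="3 * kap" and W="adjoin W e", OF e(2)] adjoin_subspace adjoin_C) auto
  then show ?thesis using e' by auto
 qed
qed

lemma codim_le_family:
 fixes f :: "nat => 'z"
 assumes "!!i. i < d ==> f i : C"
  and "!!z eps. z : C ==> 0 < eps ==> \<exists>w\<in>W. \<exists>a. N (z - (w + (\<Sum>i<d. a i *R f i))) < eps"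
 shows "codim_le d W"
 using assms
proof (induction d arbitrary: W)
 case 0 then show ?case unfolding codim_le.simps approx_def by fastforce
next
 case (Suc d)
 have "codim_le d (adjoin W (f d))"
 proof (rule Suc.IH)
  fix z eps assume "z : C" "(0::real) < eps"
  with Suc.prems(2) obtain w a where wa: "w : W" "N (z - (w + (\<Sum>i<Suc d. a i *R f i))) < eps" by blast
  then have "w + a d *R f d : adjoin W (f d)" "N (z - (w + a d *R f d + (\<Sum>i<d. a i *R f i))) < eps"
   unfolding adjoin_def by (auto simp: algebra_simps)
  then show "\<exists>w\<in>adjoin W (f d). \<exists>a. N (z - (w + (\<Sum>i<d. a i *R f i))) < eps" by blast
 qed (use Suc.prems(1) in auto)
 then show ?case using Suc.prems(1) by auto
qed

lemma approx_lincomb: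
 assumes "subspace W" "W \<subseteq> C" "approx W x" "approx W y" "x : C" "y : C"
 shows "approx W (a *R x + b *R y)"
 unfolding approx_def
proof (intro allI impI)
 fix eps :: real assume "eps > 0"
 then have p: "eps / (\<bar>a\<bar> + \<bar>b\<bar> + 1) > 0" by (simp add: add_nonneg_pos)
 obtain u v where u: "u : W" "N (x - u) < eps / (\<bar>a\<bar> + \<bar>b\<bar> + 1)" and
  v: "v : W" "N (y - v) < eps / (\<bar>a\<bar> + \<bar>b\<bar> + 1)"
  using assms(3,4) p unfolding approx_def by blast
 have C': "x - u : C" "y - v : C" using assms u v subspace_diff[OF C] by blast+
 have "a *R x + b *R y - (a *R u + b *R v) = a *R (x - u) + b *R (y - v)" by (simp add: algebra_simps)
 then have "N (a *R x + b *R y - (a *R u + b *R v)) <= \<bar>a\<bar> * N (x - u) + \<bar>b\<bar> * N (y - v)"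
  using N_add[of "a *R (x - u)" "b *R (y - v)"] N_scale C' subspace_scale[OF C] by simp
 also have "... <= \<bar>a\<bar> * (eps / (\<bar>a\<bar> + \<bar>b\<bar> + 1)) + \<bar>b\<bar> * (eps / (\<bar>a\<bar> + \<bar>b\<bar> + 1))"
  using u v by (intro add_mono mult_left_mono) auto
 also have "... = (\<bar>a\<bar> + \<bar>b\<bar>) * (eps / (\<bar>a\<bar> + \<bar>b\<bar> + 1))" by (rule distrib_right[symmetric])
 also have "... < (\<bar>a\<bar> + \<bar>b\<bar> + 1) * (eps / (\<bar>a\<bar> + \<bar>b\<bar> + 1))" using p by (intro mult_strict_right_mono) auto
 also have "... = eps" by (simp add: add_nonneg_pos less_imp_neq[symmetric])
 finally show "\<exists>w\<in>W. N (a *R x + b *R y - w) < eps"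
  using subspace_add[OF assms(1) subspace_scale[OF assms(1) u(1)] subspace_scale[OF assms(1) v(1)]] by blast
qed

text \<open>The sum of a closed subspace and a line is closed. As e stays at distance m from
  \<open>W\<close>, \<open>far_bound\<close> makes the coefficients of e in a sequence of
  approximants of u a Cauchy sequence, and c is its limit.\<close>

lemma approx_adjoin:
 assumes W: "subspace W" "W \<subseteq> C" and e: "e : C" "\<not> approx W e" and u: "u : C" "approx (adjoin W e) u"
 obtains c where "approx W (u - c *R e)"
proof -
 obtain m where m: "m > 0" "!!w. w : W ==> m <= N (e - w)" using e(2) unfolding approx_def by force
 have "\<exists>w a. w : W \<and> N (u - (w + a *R e)) < inverse (real (Suc k))" for k
 proof -
  have "\<exists>v\<in>adjoin W e. N (u - v) < inverse (real (Suc k))" using u(2) unfolding approx_def by simp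
  then show ?thesis unfolding adjoin_def by blast
 qed
 then obtain w a where wa: "!!k. w k : W" "!!k. N (u - (w k + a k *R e)) < inverse (real (Suc k))"
  by metis
 have wC: "w k + a k *R e : C" "u - (w k + a k *R e) : C" for k
  using wa(1) W(2) e(1) u(1) subspace_add[OF C] subspace_diff[OF C] subspace_scale[OF C] by blast+
 have "Cauchy a"
 proof (rule CauchyI)
  fix eps :: real assume "eps > 0"
  then obtain K where K: "inverse (real (Suc K)) < eps * m / 2" using m(1) reals_Archimedean[of "eps * m / 2"] by auto
  show "\<exists>M. \<forall>p\<ge>M. \<forall>q\<ge>M. norm (a p - a q) < eps"
  proof (intro exI allI impI)
   fix p q assume pq: "p >= K" "q >= K"
   have "\<bar>a p - a q\<bar> * m <= N ((w p - w q) + (a p - a q) *R e)"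
    by (rule far_bound[OF W e(1) m(2) subspace_diff[OF W(1) wa(1) wa(1)]])
   also have "(w p - w q) + (a p - a q) *R e = (u - (w q + a q *R e)) - (u - (w p + a p *R e))"
    by (simp add: algebra_simps)
   also have "N ... <= N (u - (w q + a q *R e)) + N (u - (w p + a p *R e))"
    by (rule N_diff[OF wC(2) wC(2)])
   also have "... < inverse (real (Suc q)) + inverse (real (Suc p))" using wa(2)[of q] wa(2)[of p] by linarith
   also have "... <= inverse (real (Suc K)) + inverse (real (Suc K))"
    using pq by (intro add_mono) (auto simp: field_simps)
   also have "... < eps * m" using K by simp
   finally show "norm (a p - a q) < eps" using m(1) by simp
  qed
 qed
 then obtain c where c: "a \<longlonglongrightarrow> c" using Cauchy_convergent convergent_def by blast
 have "approx W (u - c *R e)" unfolding approx_def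
 proof (intro allI impI)
  fix eps :: real assume "eps > 0"
  then have "eps / 2 / (N e + 1) > 0" "eps / 2 > 0" using N_nonneg[OF e(1)] by auto
  obtain K1 where K1: "!!k. k >= K1 ==> \<bar>a k - c\<bar> < eps / 2 / (N e + 1)"
   using LIMSEQ_D[OF c \<open>eps / 2 / (N e + 1) > 0\<close>] by auto
  obtain K2 where K2: "inverse (real (Suc K2)) < eps / 2"
   using reals_Archimedean[OF \<open>eps / 2 > 0\<close>] by blast
  define k where "k = max K1 K2"
  have "u - c *R e - w k = (u - (w k + a k *R e)) + (a k - c) *R e" by (simp add: algebra_simps)
  then have "N (u - c *R e - w k) <= N (u - (w k + a k *R e)) + \<bar>a k - c\<bar> * N e"
   using N_add[OF wC(2) subspace_scale[OF C e(1)]] N_scale[OF e(1)] by metis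
  also have "... <= N (u - (w k + a k *R e)) + \<bar>a k - c\<bar> * (N e + 1)" by (simp add: mult_left_mono)
  also have "... < inverse (real (Suc k)) + eps / 2"
  proof (rule add_strict_mono[OF wa(2)])
   have "0 < N e + 1" "k >= K1" using N_nonneg[OF e(1)] by (auto simp: k_def)
   with K1[of k] show "\<bar>a k - c\<bar> * (N e + 1) < eps / 2" by (simp only: pos_less_divide_eq)
  qed
  also have "inverse (real (Suc k)) <= inverse (real (Suc K2))" by (auto simp: k_def field_simps)
  finally have "N (u - c *R e - w k) < eps" using K2 by linarith
  then show "\<exists>w\<in>W. N (u - c *R e - w) < eps" using wa(1) by blast
 qed
 then show ?thesis by (rule that)
qed

text \<open>The dimension count: d + 1 vectors are dependent modulo a closure of codimension at most
  d. By induction, leaving out one index at a time, there are two combinations a and b that are good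
  modulo e, with a i0 nonzero and b i0 = 0. Eliminating e between them keeps the coefficient at i0
  nonzero.\<close>

lemma codim_le_combination:
 fixes g :: "nat => 'z"
 assumes "codim_le d W" "subspace W" "W \<subseteq> C" "finite I" "card I = Suc d" "!!i. i : I ==> g i : C"
 shows "\<exists>a. (\<exists>i\<in>I. a i ~= 0) \<and> approx W (\<Sum>i\<in>I. a i *R g i)"
 using assms
proof (induction d arbitrary: W I)
 case 0
 then have "I ~= {}" by auto
 moreover have "(\<Sum>i\<in>I. 1 *R g i) : C" using 0 by (intro subspace_sum[OF C] subspace_scale[OF C]) auto
 ultimately show ?case using 0 by (intro exI[of _ "%i. 1"]) auto
next
 case (Suc d)
 from Suc.prems(1) obtain e where e: "e : C" "codim_le d (adjoin W e)" by auto
 note W = Suc.prems(2,3)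
 have ext: "\<exists>a. (\<exists>i\<in>J. a i ~= 0) \<and> (\<forall>i. i \<notin> J \<longrightarrow> a i = 0) \<and> approx (adjoin W e) (\<Sum>i\<in>I. a i *R g i)"
  if J: "J \<subseteq> I" "card J = Suc d" for J
 proof -
  have "finite J" using J Suc.prems(4) finite_subset by blast
  from Suc.IH[OF e(2) adjoin_subspace[OF W(1)] adjoin_C[OF W(2) e(1)] this J(2)] Suc.prems(6) J(1)
  obtain a where a: "\<exists>i\<in>J. a i ~= 0" "approx (adjoin W e) (\<Sum>i\<in>J. a i *R g i)" by blast
  have "(\<Sum>i\<in>I. (if i : J then a i else 0) *R g i) = (\<Sum>i\<in>J. a i *R g i)"
   by (rule sum.mono_neutral_cong_right) (use J Suc.prems(4) in auto)
  then show ?thesis using a by (intro exI[of _ "%i. if i : J then a i else 0"]) auto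
 qed
 have IC: "(\<Sum>i\<in>I. a i *R g i) : C" for a
  using Suc.prems(6) by (intro subspace_sum[OF C] subspace_scale[OF C]) auto
 obtain i1 where "i1 : I" using Suc.prems(5) by fastforce
 with ext[of "I - {i1}"] Suc.prems(4,5) obtain a where
  a: "\<exists>i\<in>I - {i1}. a i ~= 0" "approx (adjoin W e) (\<Sum>i\<in>I. a i *R g i)" by auto
 then obtain i0 where i0: "i0 : I" "a i0 ~= 0" by blast
 with ext[of "I - {i0}"] Suc.prems(4,5) obtain b where
  b: "\<exists>i\<in>I - {i0}. b i ~= 0" "b i0 = 0" "approx (adjoin W e) (\<Sum>i\<in>I. b i *R g i)" by auto
 show ?case
 proof (cases "approx W e")
  case True
  have "near (1/3) (adjoin W e) W" by (rule near_adjoin_approx[OF W(1) True e(1) _ W(2)]) simp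
  have "approx W (\<Sum>i\<in>I. a i *R g i)" unfolding approx_def
  proof (intro allI impI)
   fix eps :: real assume "eps > 0"
   then have "eps / 2 > 0" by simp
   then obtain v where v: "v : adjoin W e" "N ((\<Sum>i\<in>I. a i *R g i) - v) < eps / 2"
    using a(2) unfolding approx_def by blast
   have vC: "v : C" using v(1) adjoin_C[OF W(2) e(1)] by blast
   have "eps / 2 / (N v + 1) > 0" using \<open>eps / 2 > 0\<close> N_nonneg[OF vC] by auto
   from near_adjoin_approx[OF W(1) True e(1) this W(2)] v(1) obtain w where
    w: "w : W" "N (v - w) <= eps / 2 / (N v + 1) * N v" unfolding near_def by blast
   have "eps / 2 / (N v + 1) * N v <= eps / 2 / (N v + 1) * (N v + 1)"
    using \<open>eps / 2 / (N v + 1) > 0\<close> by (intro mult_left_mono) auto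
   also have "... = eps / 2"
   proof -
    have *: "c ~= 0 ==> eps / 2 / c * c = eps / 2" for c :: real by simp
    show ?thesis by (rule *) (use N_nonneg[OF vC] in simp)
   qed
   finally have "N (v - w) <= eps / 2" using w by linarith
   moreover have "N ((\<Sum>i\<in>I. a i *R g i) - w) <= N ((\<Sum>i\<in>I. a i *R g i) - v) + N (v - w)"
    using N_add[of "(\<Sum>i\<in>I. a i *R g i) - v" "v - w"] IC vC w(1) W(2) subspace_diff[OF C]
    by (simp add: subset_iff)
   ultimately show "\<exists>w\<in>W. N ((\<Sum>i\<in>I. a i *R g i) - w) < eps" using v(2) w(1) by (intro bexI[of _ w]) auto
  qed
  then show ?thesis using i0 by blast
 next
  case False
  obtain c1 where c1: "approx W ((\<Sum>i\<in>I. a i *R g i) - c1 *R e)"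
   using approx_adjoin[OF W e(1) False IC a(2)] by blast
  obtain c2 where c2: "approx W ((\<Sum>i\<in>I. b i *R g i) - c2 *R e)"
   using approx_adjoin[OF W e(1) False IC b(3)] by blast
  show ?thesis
  proof (cases "c2 = 0")
   case True then show ?thesis using b c2 by auto
  next
   case False
   have "approx W (c2 *R ((\<Sum>i\<in>I. a i *R g i) - c1 *R e) + (- c1) *R ((\<Sum>i\<in>I. b i *R g i) - c2 *R e))"
    using IC e(1) subspace_diff[OF C] subspace_scale[OF C] by (intro approx_lincomb[OF W c1 c2]) auto
   also have "c2 *R ((\<Sum>i\<in>I. a i *R g i) - c1 *R e) + (- c1) *R ((\<Sum>i\<in>I. b i *R g i) - c2 *R e)
     = (\<Sum>i\<in>I. (c2 * a i - c1 * b i) *R g i)"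
    by (simp add: scaleR_diff_right scaleR_diff_left scaleR_sum_right sum_subtractf sum_negf mult.commute)
   finally have "approx W (\<Sum>i\<in>I. (c2 * a i - c1 * b i) *R g i)" .
   moreover have "c2 * a i0 - c1 * b i0 ~= 0" using i0(2) b(2) False by simp
   ultimately show ?thesis using i0(1) by (intro exI[of _ "%i. c2 * a i - c1 * b i"]) blast
  qed
 qed
qed

end

definition lin_on :: "'x::real_vector set => ('x => 'y::real_vector) => bool" where
 "lin_on X T \<longleftrightarrow> (\<forall>x\<in>X. \<forall>y\<in>X. T (x + y) = T x + T y) \<and> (\<forall>x\<in>X. \<forall>a. T (a *R x) = a *R T x)"

lemma subspace_image_lin_on: "subspace X ==> lin_on X T ==> subspace (T ` X)"
proof (rule subspaceI)
 assume X: "subspace X" and T: "lin_on X T"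
 have "T 0 = T (0 *R 0)" by simp
 also have "... = 0" using T subspace_0[OF X] unfolding lin_on_def by (metis scaleR_zero_left)
 finally show "0 : T ` X" using subspace_0[OF X] by force
 show "x + y : T ` X" if "x : T ` X" "y : T ` X" for x y
  using that T subspace_add[OF X] unfolding lin_on_def by (metis (no_types, lifting) image_iff)
 show "c *R x : T ` X" if "x : T ` X" for c x
  using that T subspace_scale[OF X] unfolding lin_on_def by (metis (no_types, lifting) image_iff)
qed

text \<open>Homotopy invariance of the index: \<open>T0\<close> is onto with a kernel, \<open>T1\<close> is bounded below, and along the
 segment the operators are uniformly bounded below modulo finitely many functionals \<open>F i\<close>.\<close>

lemma index_obstruction:
 fixes X :: "'x::real_vector set" and C :: "'y::real_vector set" and T0 T1 :: "'x => 'y"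
  and F :: "nat => 'x => real" and NX :: "'x => real"
 assumes X: "subspace X" and sem: "seminorm_on C N"
  and lin: "lin_on X T0" "lin_on X T1" "!!i. i < m ==> lin_on X (F i)"
  and into: "!!x. x : X ==> T0 x : C" "!!x. x : X ==> T1 x : C"
  and K: "K > 0"
  and fred: "!!t x. 0 <= t ==> t <= 1 ==> x : X ==>
   NX x <= K * (N ((1 - t) *R T0 x + t *R T1 x) + (\<Sum>i<m. \<bar>F i x\<bar>))"
  and diff: "!!x. x : X ==> N (T1 x - T0 x) <= K * NX x"
  and Fb: "!!i x. i < m ==> x : X ==> \<bar>F i x\<bar> <= K * NX x"
  and dense: "!!y eps. y : C ==> 0 < eps ==> \<exists>x\<in>X. N (y - T0 x) < eps"
  and ker: "x0 : X" "T0 x0 = 0" "NX x0 > 0"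
  and inj: "!!x. x : X ==> NX x <= K * N (T1 x)"
 shows False
proof -
 define C2 where "C2 = C \<times> (UNIV :: (nat => real) set)"
 define M :: "'y \<times> (nat => real) => real" where "M z = N (fst z) + (\<Sum>i<m. \<bar>snd z i\<bar>)" for z
 \<comment> \<open>Appending the functionals makes the operators bounded below for every t, so that
   only the codimension of the range has to be followed along the segment.\<close>
 define G where "G t x = ((1 - t) *R T0 x + t *R T1 x, %i. if i < m then F i x else 0)" for t x
 interpret N: seminorm_on C N by (rule sem)
 interpret M: seminorm_on C2 M
 proof
  show "subspace C2" unfolding C2_def by (rule subspace_Times[OF N.C subspace_UNIV])
  fix x y assume xy: "x : C2" "y : C2"
  then have "N (fst x + fst y) <= N (fst x) + N (fst y)" by (intro N.N_add) (auto simp: C2_def)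
  moreover have "(\<Sum>i<m. \<bar>snd x i + snd y i\<bar>) <= (\<Sum>i<m. \<bar>snd x i\<bar> + \<bar>snd y i\<bar>)"
   by (intro sum_mono) simp
  ultimately show "M (x + y) <= M x + M y" by (simp add: M_def sum.distrib)
 next
  fix x a assume "x : C2"
  then show "M (a *R x) = \<bar>a\<bar> * M x"
   using N.N_scale[of "fst x" a] by (auto simp: M_def C2_def abs_mult sum_distrib_left distrib_left)
 qed
 have linG: "lin_on X (G t)" for t
  using lin unfolding lin_on_def G_def by (auto simp: algebra_simps fun_eq_iff)
 have sub: "subspace (G t ` X)" for t by (rule subspace_image_lin_on[OF X linG])
 have GC: "G t ` X \<subseteq> C2" for t
  unfolding G_def C2_def using into subspace_add[OF N.C] subspace_scale[OF N.C] by auto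
 have MG: "M (G t x) = N ((1 - t) *R T0 x + t *R T1 x) + (\<Sum>i<m. \<bar>F i x\<bar>)" for t x
  by (simp add: M_def G_def)
 have x0: "(\<Sum>i<m. \<bar>F i x0\<bar>) > 0"
 proof -
  have "NX x0 <= K * (\<Sum>i<m. \<bar>F i x0\<bar>)" using fred[of 0 x0] ker by simp
  with ker(3) K show ?thesis by (smt (verit) mult_nonneg_nonpos sum_nonneg)
 qed
 then obtain i0 where i0: "i0 < m" "F i0 x0 ~= 0"
  by (metis (mono_tags, lifting) abs_zero lessThan_iff less_irrefl sum.neutral)
 define d where "d = m - 1"
 have m: "m = Suc d" using i0(1) by (simp add: d_def)
 \<comment> \<open>Enumerates the coordinates other than i0 by j < d: the value i0 is redirected to
   the last coordinate d.\<close>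
 define swap where "swap j = (if j = i0 then d else j)" for j
 define unit :: "nat => 'y \<times> (nat => real)" where "unit j = (0, %i. if i = j then 1 else 0)" for j
 have unitC: "unit j : C2" for j by (simp add: unit_def C2_def subspace_0[OF N.C])
 have sum_unit: "(\<Sum>i\<in>I. a i *R unit (f i)) = (0, %k. \<Sum>i\<in>I. if k = f i then a i else 0)"
  if "finite I" for I :: "nat set" and a and f :: "nat => nat"
  using that by (induction I rule: finite_induct) (auto simp: unit_def fun_eq_iff zero_prod_def)
 \<comment> \<open>The range of \<open>G 0\<close> has codimension at most m - 1 instead of m:
   adding multiples of the kernel vector adjusts the coordinate i0 without changing
   \<open>T0 x\<close>, so only the other coordinates have to be adjoined.\<close>
 have start: "M.codim_le d (G 0 ` X)"
 proof (rule M.codim_le_family[where f="%j. unit (swap j)"])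
  fix z eps assume z: "z : C2" and eps: "(0::real) < eps"
  obtain y s where ys: "z = (y, s)" "y : C" using z unfolding C2_def by blast
  obtain x where x: "x : X" "N (y - T0 x) < eps" using dense[OF ys(2) eps] by blast
  define c where "c = (s i0 - F i0 x) / F i0 x0"
  define x' where "x' = x + c *R x0"
  have x': "x' : X" unfolding x'_def using x(1) ker(1) subspace_add[OF X] subspace_scale[OF X] by blast
  have T0: "T0 x' = T0 x" and Fx': "!!i. i < m ==> F i x' = F i x + c * F i x0"
   using lin x(1) ker subspace_scale[OF X] unfolding x'_def lin_on_def by auto
  have i0': "F i0 x' = s i0" using Fx'[OF i0(1)] i0(2) by (simp add: c_def)
  define a where "a j = s (swap j) - F (swap j) x'" for j
  have "(\<Sum>i<d. if k = swap i then a i else 0) = s k - F k x'" if "k < m" for k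
  proof (cases "k = i0")
   case True
   then have "k ~= swap i" if "i < d" for i using that by (auto simp: swap_def)
   then show ?thesis using True i0' by simp
  next
   case False
   define l where "l = (if k = d then i0 else k)"
   have l: "l < d" "swap l = k" using False that m i0(1) by (auto simp: l_def swap_def split: if_splits)
   have "k = swap i \<longleftrightarrow> i = l" if "i < d" for i using that False by (auto simp: l_def swap_def)
   then have "(\<Sum>i<d. if k = swap i then a i else 0) = (\<Sum>i<d. if i = l then a i else 0)"
    by (intro sum.cong) auto
   also have "... = a l" using l(1) by simp
   finally show ?thesis using l by (simp add: a_def)
  qed
  then have "M (z - (G 0 x' + (\<Sum>i<d. a i *R unit (swap i)))) = N (y - T0 x)"
   by (simp add: M_def G_def ys(1) sum_unit T0 m)
  then have "M (z - (G 0 x' + (\<Sum>i<d. a i *R unit (swap i)))) < eps" using x(2) by simp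
  then show "\<exists>w\<in>G 0 ` X. \<exists>a. M (z - (w + (\<Sum>i<d. a i *R unit (swap i)))) < eps" using x' by blast
 qed (rule unitC)
 \<comment> \<open>The number of steps along the segment. Consecutive ranges have gap at most K^2/p,
   which must be small enough for \<open>codim_near\<close> at dimension d.\<close>
 obtain p :: nat where p: "p > 0" "real p >= K * K * 3 ^ Suc d"
  using real_arch_simple[of "K * K * 3 ^ Suc d"] K
  by (metis gr0I less_eq_real_def mult_pos_pos not_less of_nat_0 zero_less_numeral zero_less_power)
 define kap where "kap = K * K / p"
 have kap: "kap > 0" "3 ^ d * kap <= 1/3" using p K by (auto simp: kap_def field_simps)
 have "M.codim_le d (G (real k / p) ` X)" if "k <= p" for k
  using that
 proof (induction k)
  case 0 then show ?case using start by simp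
 next
  case (Suc k)
  have "M.near kap (G (real k / p) ` X) (G (real (Suc k) / p) ` X)"
   unfolding M.near_def
  proof (rule ballI, erule imageE)
   fix w x assume w: "w = G (real k / p) x" and x: "x : X"
   define t where "t = real k / p"
   define t' where "t' = real (Suc k) / p"
   have t': "t' = t + 1 / p" by (simp add: t_def t'_def add_divide_distrib)
   have "G t x - G t' x = ((- 1 / p) *R (T1 x - T0 x), 0)"
    by (auto simp: G_def t' algebra_simps fun_eq_iff)
   then have "M (G t x - G t' x) = N ((- 1 / p) *R (T1 x - T0 x))" by (simp add: M_def)
   also have "... = 1 / p * N (T1 x - T0 x)"
    using N.N_scale[OF subspace_diff[OF N.C into(2)[OF x] into(1)[OF x]], of "- 1 / p"] by simp
   also have "... <= 1 / p * (K * NX x)" using diff[OF x] by (intro mult_left_mono) auto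
   also have "... <= 1 / p * (K * (K * M (G t x)))"
    unfolding MG using fred[of t x] x K Suc.prems p by (intro mult_left_mono) (auto simp: t_def)
   also have "... = kap * M (G t x)" by (simp add: kap_def)
   finally show "\<exists>w'\<in>G (real (Suc k) / p) ` X. M (w - w') <= kap * M w"
    using x unfolding w t_def t'_def by blast
  qed
  then show ?case using M.codim_near[OF _ sub GC sub GC _ kap(2,1)] Suc by simp
 qed
 from this[of p] p(1) have "M.codim_le d (G 1 ` X)" by simp
 \<comment> \<open>At t = 1 the m unit vectors of the functional coordinates exceed the codimension
   m - 1, so a nontrivial combination of them is approximated by some \<open>G 1 x\<close>. There
   \<open>T1 x\<close> is small, hence so are x and all \<open>F j x\<close>, while
   \<open>F i x\<close> ought to be near a i. The choice of eps below gives |a i| \<le> |a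
   i|/2.\<close>
 from M.codim_le_combination[OF this sub GC, of "{..<m}" unit] m unitC
 obtain a where a: "\<exists>i\<in>{..<m}. a i ~= 0" "M.approx (G 1 ` X) (\<Sum>i<m. a i *R unit i)" by auto
 from a(1) obtain i where i: "i < m" "a i ~= 0" by auto
 define eps where "eps = \<bar>a i\<bar> / (2 * (1 + K * K))"
 have eps: "eps > 0" unfolding eps_def using i(2) K by (intro divide_pos_pos) (auto intro: add_pos_pos)
 from a(2) eps obtain x where x: "x : X" "M ((\<Sum>i<m. a i *R unit i) - G 1 x) < eps"
  unfolding M.approx_def by blast
 have comp: "(\<Sum>j<m. if k = j then a j else 0) = a k" if "k < m" for k
  using that by simp
 have "M ((\<Sum>i<m. a i *R unit i) - G 1 x) = N (- T1 x) + (\<Sum>j<m. \<bar>a j - F j x\<bar>)"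
  using sum_unit[of "{..<m}" a "%i. i"] comp by (simp add: M_def G_def)
 also have "N (- T1 x) = N (T1 x)" by (rule N.N_minus[OF into(2)[OF x(1)]])
 finally have *: "N (T1 x) + (\<Sum>j<m. \<bar>a j - F j x\<bar>) < eps" using x(2) by simp
 have "\<bar>a i - F i x\<bar> <= (\<Sum>j<m. \<bar>a j - F j x\<bar>)" using i(1) by (intro member_le_sum) auto
 then have 1: "\<bar>a i - F i x\<bar> <= eps" using * N.N_nonneg[OF into(2)[OF x(1)]] by linarith
 have "N (T1 x) <= eps" using * sum_nonneg[of "{..<m}" "%j. \<bar>a j - F j x\<bar>"] by (smt (verit) abs_ge_zero)
 then have "K * (K * N (T1 x)) <= K * (K * eps)" using K by (intro mult_left_mono) auto
 moreover have "\<bar>F i x\<bar> <= K * (K * N (T1 x))"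
  using Fb[OF i(1) x(1)] mult_left_mono[OF inj[OF x(1)], of K] K by linarith
 ultimately have "\<bar>a i\<bar> <= eps * (1 + K * K)" using 1 by (simp add: algebra_simps)
 also have "... = \<bar>a i\<bar> / 2"
 proof -
  have *: "c > 0 ==> \<bar>a i\<bar> / (2 * c) * c = \<bar>a i\<bar> / 2" for c :: real by simp
  show ?thesis unfolding eps_def by (rule *) (use K in \<open>simp add: add_pos_pos\<close>)
 qed
 finally show False using i(2) by simp
qed

section \<open>The Clifford module of the exterior algebra\<close>

definition flip :: "'n => 'n set => 'n set" where
 "flip j S = (if j : S then S - {j} else insert j S)"

text \<open>The Koszul sign of moving the j-th basis vector to its place in S, the indices being
  ordered by \<open>to_nat\<close>.\<close>

definition sg :: "'n::finite => 'n set => real" where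
 "sg j S = (if even (card {i\<in>S. to_nat i < to_nat j}) then 1 else -1)"

definition mem_sign :: "'n => 'n set => real" where
 "mem_sign j S = (if j : S then 1 else -1)"

text \<open>Spinors are elements of the exterior algebra on \<open>'n\<close>, indexed by subsets of \<open>'n\<close>; \<open>cl j\<close> is
 the exterior minus the interior product by the \<open>j\<close>-th basis vector, \<open>ch j\<close> is their sum.\<close>

definition cl :: "'n::finite => real^('n set) => real^('n set)" where
 "cl j u = (\<chi> S. mem_sign j S * sg j S * u $ flip j S)"

definition ch :: "'n::finite => real^('n set) => real^('n set)" where
 "ch j u = (\<chi> S. sg j S * u $ flip j S)"

lemma flip_flip [simp]: "flip j (flip j S) = S"
 unfolding flip_def by auto

lemma flip_commute: "flip i (flip j S) = flip j (flip i S)"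
 unfolding flip_def by auto

lemma mem_flip [simp]: "i : flip j S \<longleftrightarrow> (if i = j then i \<notin> S else i : S)"
 unfolding flip_def by auto

lemma sg_flip: "sg j (flip i S) = (if to_nat i < to_nat j then - sg j S else sg j S)"
proof (cases "to_nat i < to_nat j")
 case True
 let ?A = "{k : S. to_nat k < to_nat j}"
 show ?thesis
 proof (cases "i : S")
  case in_S: True
  have "?A = insert i {k : flip i S. to_nat k < to_nat j}" "i \<notin> {k : flip i S. to_nat k < to_nat j}"
   using True in_S by (auto simp: flip_def)
  then have "card ?A = Suc (card {k : flip i S. to_nat k < to_nat j})"
   by (metis card_insert_disjoint finite_code)
  with True show ?thesis by (simp add: sg_def)
 next
  case False
  have "{k : flip i S. to_nat k < to_nat j} = insert i ?A" "i \<notin> ?A"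
   using True False by (auto simp: flip_def)
  then have "card {k : flip i S. to_nat k < to_nat j} = Suc (card ?A)"
   by (metis card_insert_disjoint finite_code)
  with True show ?thesis by (simp add: sg_def)
 qed
next
 case False
 then have "{k : flip i S. to_nat k < to_nat j} = {k : S. to_nat k < to_nat j}"
  by (auto simp: flip_def)
 with False show ?thesis by (simp add: sg_def)
qed

lemma sg_flip_self [simp]: "sg j (flip j S) = sg j S"
 by (simp add: sg_flip)

lemma sg_sq [simp]: "sg j S * sg j S = 1" by (simp add: sg_def)
lemma mem_sign_sq [simp]: "mem_sign j S * mem_sign j S = 1" by (simp add: mem_sign_def)
lemma sg_mem_sign_sq [simp]: "mem_sign i S * (sg i S * (mem_sign i S * sg i S)) = 1"
 by (simp add: mem_sign_def sg_def)
lemma abs_sg [simp]: "\<bar>sg j S\<bar> = 1" by (simp add: sg_def)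
lemma abs_mem_sign [simp]: "\<bar>mem_sign j S\<bar> = 1" by (simp add: mem_sign_def)

lemma mem_sign_flip: "mem_sign j (flip i S) = (if i = j then - mem_sign j S else mem_sign j S)"
 by (auto simp: mem_sign_def)

lemma cl_cl: "i ~= j ==> cl i (cl j u) = - cl j (cl i u)"
 by (auto simp: vec_eq_iff cl_def mem_sign_flip flip_commute[of i j] sg_flip dest: injD[OF inj_to_nat])

lemma ch_ch: "i ~= j ==> ch i (ch j u) = - ch j (ch i u)"
 by (auto simp: vec_eq_iff ch_def flip_commute[of i j] sg_flip dest: injD[OF inj_to_nat])

lemma cl_sq [simp]: "cl i (cl i u) = - u"
 by (auto simp: vec_eq_iff cl_def mem_sign_flip)

lemma ch_sq [simp]: "ch i (ch i u) = u"
 by (auto simp: vec_eq_iff ch_def)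

lemma cl_ch: "cl i (ch j u) = - ch j (cl i u)"
proof (cases "i = j")
 case True then show ?thesis by (auto simp: vec_eq_iff ch_def cl_def mem_sign_flip)
next
 case False
 then show ?thesis
  by (auto simp: vec_eq_iff cl_def ch_def mem_sign_flip flip_commute[of i j] sg_flip
    dest: injD[OF inj_to_nat])
qed

lemma cl_linear: "linear (cl j)" and ch_linear: "linear (ch j)"
 by (auto intro!: linearI simp: cl_def ch_def vec_eq_iff algebra_simps)

lemmas cl_simps = linear_add[OF cl_linear] linear_scale[OF cl_linear] linear_neg[OF cl_linear]
 linear_diff[OF cl_linear] linear_0[OF cl_linear]
lemmas ch_simps = linear_add[OF ch_linear] linear_scale[OF ch_linear] linear_neg[OF ch_linear]
 linear_diff[OF ch_linear] linear_0[OF ch_linear]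
lemmas cl_sum = linear_sum[OF cl_linear]
lemmas ch_sum = linear_sum[OF ch_linear]

lemma sum_flip: "(SUM S. f (flip j S)) = (\<Sum>S\<in>(UNIV::'n::finite set set). f S)"
 by (rule sum.reindex_bij_witness[of _ "flip j" "flip j"]) auto

lemma inner_cl: "cl j u \<bullet> w = - (u \<bullet> cl j w)"
proof -
 have "cl j u \<bullet> w = (SUM S. mem_sign j S * sg j S * u $ flip j S * w $ S)"
  by (simp add: inner_vec_def cl_def)
 also have "... = (SUM S. mem_sign j (flip j S) * sg j (flip j S) * u $ flip j (flip j S) * w $ flip j S)"
  by (rule sum_flip[symmetric])
 also have "... = - (u \<bullet> cl j w)"
  by (simp add: inner_vec_def cl_def mem_sign_flip sum_negf[symmetric] mult_ac)
 finally show ?thesis .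
qed

lemma inner_ch: "ch j u \<bullet> w = u \<bullet> ch j w"
proof -
 have "ch j u \<bullet> w = (SUM S. sg j S * u $ flip j S * w $ S)"
  by (simp add: inner_vec_def ch_def)
 also have "... = (SUM S. sg j (flip j S) * u $ flip j (flip j S) * w $ flip j S)"
  by (rule sum_flip[symmetric])
 also have "... = u \<bullet> ch j w"
  by (simp add: inner_vec_def ch_def mult_ac)
 finally show ?thesis .
qed

lemma norm_cl [simp]: "norm (cl j u) = norm u"
 by (simp add: norm_eq_sqrt_inner inner_cl)

lemma norm_ch [simp]: "norm (ch j u) = norm u"
 by (simp add: norm_eq_sqrt_inner inner_ch)

lemma inner_cl_self [simp]: "u \<bullet> cl j u = 0"
 using inner_cl[of j u u] by (simp add: inner_commute)

lemma inner_cl_cl: "u \<bullet> cl i (cl j u) = (if i = j then - (u \<bullet> u) else 0)"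
proof (cases "i = j")
 case False
 have "u \<bullet> cl i (cl j u) = - (cl i u \<bullet> cl j u)" by (simp add: inner_cl)
 also have "... = - (cl j u \<bullet> cl i u)" by (simp add: inner_commute)
 also have "... = u \<bullet> cl j (cl i u)" by (simp add: inner_cl)
 also have "... = - (u \<bullet> cl i (cl j u))" using cl_cl[OF False, of u] by simp
 finally show ?thesis using False by simp
qed simp

text \<open>\<open>parity True\<close> describes even forms and \<open>parity False\<close> odd
  forms. Both \<open>cl\<close> and \<open>ch\<close> exchange them, which is what splits the
  operator and makes a nonzero index possible.\<close>

definition parity :: "bool => real^('n::finite set) => bool" where
 "parity p u \<longleftrightarrow> (\<forall>S. even (card S) ~= p \<longrightarrow> u $ S = 0)"

lemma even_card_flip: "even (card (flip j S)) \<longleftrightarrow> odd (card (S::'n::finite set))"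
proof (cases "j : S")
 case True
 then have "card S = Suc (card (S - {j}))" by (metis card_Suc_Diff1 finite_code)
 moreover have "flip j S = S - {j}" using True by (simp add: flip_def)
 ultimately show ?thesis by (metis even_Suc)
qed (simp add: flip_def)

lemma parity_cl: "parity p u ==> parity (\<not> p) (cl j u)"
 unfolding parity_def by (auto simp: cl_def even_card_flip)

lemma parity_ch: "parity p u ==> parity (\<not> p) (ch j u)"
 unfolding parity_def by (auto simp: ch_def even_card_flip)

lemma parity_add: "parity p u ==> parity p w ==> parity p (u + w)"
 and parity_scale: "parity p u ==> parity p (a *R u)"
 and parity_0 [simp]: "parity p 0"
 unfolding parity_def by auto

lemma parity_sum: "(!!a. a : A ==> parity p (f a)) ==> parity p (\<Sum>a\<in>A. f a)"
 by (induction A rule: infinite_finite_induct) (auto intro: parity_add)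

text \<open>The local boundary condition: as \<open>cl e\<close> and \<open>ch e\<close> differ by
  twice the interior product with the e-th vector, the condition says that this interior product
  annihilates u.\<close>

definition chi :: "'n::finite => real^('n set) => bool" where "chi e u \<longleftrightarrow> cl e u = ch e u"

lemma chi_iff: "chi e u \<longleftrightarrow> (\<forall>S. e : S \<longrightarrow> u $ S = 0)"
proof
 assume "chi e u"
 then have *: "mem_sign e S * sg e S * u $ flip e S = sg e S * u $ flip e S" for S
  unfolding chi_def cl_def ch_def vec_eq_iff by simp
 show "\<forall>S. e : S \<longrightarrow> u $ S = 0"
 proof (intro allI impI)
  fix S assume "e : S"
  then have "e \<notin> flip e S" by simp
  then have "- (sg e (flip e S) * u $ S) = sg e (flip e S) * u $ S" using *[of "flip e S"] by (simp add: mem_sign_def)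
  then show "u $ S = 0" by (auto simp: sg_def split: if_splits)
 qed
next
 assume *: "\<forall>S. e : S \<longrightarrow> u $ S = 0"
 have "mem_sign e S * u $ flip e S = u $ flip e S" for S
  using * by (cases "e : S") (auto simp: mem_sign_def)
 then show "chi e u" unfolding chi_def cl_def ch_def vec_eq_iff by (simp add: mult.assoc mult.left_commute)
qed

text \<open>Trading \<open>cl e\<close> for \<open>ch e\<close> on u, moving it across and trading
  back on w reverses the sign. Applied with w a tangential derivative, this kills the derivative
  terms at the two faces of the band.\<close>

lemma chi_cl_cl:
 assumes "chi e u" "chi e w" "i ~= e" shows "u \<bullet> cl e (cl i w) = 0"
proof -
 have "u \<bullet> cl e (cl i w) = - (cl e u \<bullet> cl i w)" by (simp add: inner_cl)
 also have "... = - (ch e u \<bullet> cl i w)" using assms(1) by (simp add: chi_def)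
 also have "... = u \<bullet> cl i (ch e w)" by (simp add: inner_ch cl_ch)
 also have "... = u \<bullet> cl i (cl e w)" using assms(2) by (simp add: chi_def)
 also have "... = - (u \<bullet> cl e (cl i w))" using cl_cl[OF assms(3), of w] by simp
 finally show ?thesis by simp
qed

text \<open>The same exchange for a potential in another direction: the tangent potentials do not
  contribute at the faces of the band.\<close>

lemma chi_cl_ch:
 assumes "chi e u" "j ~= e" shows "u \<bullet> cl e (ch j u) = 0"
proof -
 have "u \<bullet> cl e (ch j u) = - (cl e u \<bullet> ch j u)" by (simp add: inner_cl)
 also have "... = - (u \<bullet> ch e (ch j u))" using assms(1) by (simp add: chi_def inner_ch)
 finally have 1: "u \<bullet> cl e (ch j u) = - (u \<bullet> ch e (ch j u))" .
 have "u \<bullet> ch e (ch j u) = ch e u \<bullet> ch j u" by (simp add: inner_ch)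
 also have "... = ch j u \<bullet> ch e u" by (rule inner_commute)
 also have "... = u \<bullet> ch j (ch e u)" by (simp add: inner_ch)
 also have "... = - (u \<bullet> ch e (ch j u))" using ch_ch[OF assms(2), of u] by simp
 finally show ?thesis using 1 by simp
qed

section \<open>Derivative of a determinant\<close>

lemma smooth_det:
 assumes "!!i j. smooth_fun (%x. A x $ i $ j)"
 shows "smooth_fun (%x. det (A x :: real^'m::finite^'m))"
 unfolding det_def by (intro smooth_sum smooth_mult smooth_const smooth_prod assms)

lemma pd_prod:
 assumes "finite I" "!!i. i : I ==> smooth_fun (f i)"
 shows "pd a (%x. \<Prod>i\<in>I. f i x) x = (\<Sum>k\<in>I. \<Prod>i\<in>I. if i = k then pd a (f i) x else f i x)"
 using assms
proof (induction I rule: finite_induct)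
 case (insert j I)
 have "pd a (%x. \<Prod>i\<in>insert j I. f i x) x = pd a (%x. f j x * (\<Prod>i\<in>I. f i x)) x"
  using insert by simp
 also have "... = pd a (f j) x * (\<Prod>i\<in>I. f i x) + f j x * (\<Sum>k\<in>I. \<Prod>i\<in>I. if i = k then pd a (f i) x else f i x)"
  using insert by (subst pd_mult) (auto intro: smooth_prod)
 also have "(\<Prod>i\<in>I. f i x) = (\<Prod>i\<in>I. if i = j then pd a (f i) x else f i x)"
  using insert.hyps by (intro prod.cong) auto
 also have "f j x * (\<Sum>k\<in>I. \<Prod>i\<in>I. if i = k then pd a (f i) x else f i x)
   = (\<Sum>k\<in>I. (if j = k then pd a (f j) x else f j x) * (\<Prod>i\<in>I. if i = k then pd a (f i) x else f i x))"
  unfolding sum_distrib_left using insert.hyps by (intro sum.cong) auto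
 finally show ?case using insert.hyps by simp
qed simp

text \<open>Jacobi's formula in a form free of inverse matrices: when the differentiated rows are
  combinations of the rows themselves, multilinearity leaves only the trace of the
  coefficients.\<close>

lemma pd_det:
 fixes A :: "real^'n::finite => real^'m::finite^'m"
 assumes A: "!!i j. smooth_fun (%x. A x $ i $ j)"
  and kap: "!!i j. pd a (%x. A x $ i $ j) x = (SUM k. kap i k * A x $ k $ j)"
 shows "pd a (%x. det (A x)) x = (SUM i. kap i i) * det (A x)"
proof -
 have "pd a (%x. det (A x)) x = (\<Sum>p | p permutes UNIV. of_int (sign p) *
   (SUM k. \<Prod>i\<in>UNIV. if i = k then pd a (%x. A x $ i $ p i) x else A x $ i $ p i))"
  unfolding det_def
  by (subst pd_sum) (auto intro!: smooth_intros A sum.cong simp: pd_cmult smooth_prod A pd_prod)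
 also have "... = (SUM k. \<Sum>p | p permutes UNIV. of_int (sign p) *
   (\<Prod>i\<in>UNIV. if i = k then pd a (%x. A x $ i $ p i) x else A x $ i $ p i))"
  unfolding sum_distrib_left by (rule sum.swap)
 also have "... = (SUM k. det (\<chi> i. if i = k then (SUM j. kap i j *s A x $ j) else A x $ i))"
  unfolding det_def by (intro sum.cong refl arg_cong2[where f="(*)"] prod.cong) (auto simp: kap)
 also have "... = (SUM k. kap k k * det (A x))"
 proof (rule sum.cong[OF refl])
  fix k
  have "det (\<chi> i. if i = k then (SUM j. kap i j *s A x $ j) else A x $ i)
    = (SUM j. det (\<chi> i. if i = k then kap i j *s A x $ j else A x $ i))"
   by (rule det_linear_row_sum) simp
  also have "... = (SUM j. kap k j * det (\<chi> i. if i = k then A x $ j else A x $ i))"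
  proof (rule sum.cong[OF refl])
   fix j
   have "(\<chi> i. if i = k then kap i j *s A x $ j else A x $ i) = (\<chi> i. if i = k then kap k j *s A x $ j else A x $ i)"
    by (simp add: vec_eq_iff)
   then show "det (\<chi> i. if i = k then kap i j *s A x $ j else A x $ i) = kap k j * det (\<chi> i. if i = k then A x $ j else A x $ i)"
    by (simp only: det_row_mul)
  qed
  also have "... = (SUM j. if j = k then kap k k * det (A x) else 0)"
  proof (rule sum.cong[OF refl])
   fix j
   show "kap k j * det (\<chi> i. if i = k then A x $ j else A x $ i) = (if j = k then kap k k * det (A x) else 0)"
   proof (cases "j = k")
    case True
    have "(\<chi> i. if i = k then A x $ k else A x $ i) = A x" by (simp add: vec_eq_iff)
    then show ?thesis unfolding True by simp
   next
    case False
    have "det (\<chi> i. if i = k then A x $ j else A x $ i) = 0"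
     by (rule det_identical_rows[OF False]) (use False in \<open>simp add: row_def vec_eq_iff\<close>)
    then show ?thesis using False by simp
   qed
  qed
  finally show "det (\<chi> i. if i = k then (SUM j. kap i j *s A x $ j) else A x $ i) = kap k k * det (A x)" by simp
 qed
 finally show ?thesis by (simp add: sum_distrib_right)
qed

subsection \<open>Cholesky frames\<close>

definition posdef_on :: "'n set => ('n::finite => 'n => real^'n => real) => bool" where
 "posdef_on S h \<longleftrightarrow> (\<forall>a b x. h a b x = h b a x) \<and>
  (\<forall>x v. (\<exists>a\<in>S. v a ~= 0) \<longrightarrow> (\<Sum>a\<in>S. \<Sum>b\<in>S. v a * v b * h a b x) > 0)"

text \<open>The last clause says that (1 - t) I + t E is injective for every t in [0,1]. It joins
  the frame to the coordinate frame through invertible matrices, which is what makes the whole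
  segment of operators elliptic later on.\<close>

definition frame_on :: "'n set => ('n::finite => 'n => real^'n => real) => ('n => 'n => real^'n => real) => bool" where
 "frame_on S h E \<longleftrightarrow> (\<forall>i a. smooth_fun (E i a)) \<and> (\<forall>i a x. i \<notin> S \<or> a \<notin> S \<longrightarrow> E i a x = 0) \<and>
  (\<forall>a\<in>S. \<forall>b\<in>S. \<forall>x. (\<Sum>i\<in>S. E i a x * E i b x) = h a b x) \<and>
  (\<forall>t\<in>{0..1}. \<forall>x v. (\<forall>i\<in>S. (1 - t) * v i + t * (\<Sum>a\<in>S. E i a x * v a) = 0) \<longrightarrow> (\<forall>a\<in>S. v a = 0))"

lemma posdef_on_diag:
 assumes "posdef_on S h" "p : S" shows "h p p x > 0"
proof -
 have "(\<Sum>a\<in>S. \<Sum>b\<in>S. (if a = p then 1 else 0) * (if b = p then 1 else 0) * h a b x) > 0"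
  using assms unfolding posdef_on_def by (elim conjE allE[of _ "%a. if a = p then 1 else 0"]) auto
 also have "(\<Sum>a\<in>S. \<Sum>b\<in>S. (if a = p then 1 else 0) * (if b = p then 1 else 0) * h a b x)
   = (\<Sum>a\<in>S. if a = p then h p p x else 0)"
  using assms(2) finite[of S] by (intro sum.cong refl) (auto simp: if_distrib[of "%z. z * _"] cong: if_cong)
 finally show ?thesis using assms(2) by simp
qed

text \<open>Eliminating p leaves the Schur complement h', again positive definite, and the new row
  of E is h_p / sqrt(h_pp). The resulting matrix is triangular with positive diagonal for a suitable
  order of the indices, so its segment to the identity stays invertible; its column p has a single
  nonzero entry.\<close>

lemma cholesky_step:
 assumes pS: "p \<notin> S" and pos: "posdef_on (insert p S) h" and sm: "!!a b. smooth_fun (h a b)"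
  and IH: "!!h'. posdef_on S h' ==> (!!a b. smooth_fun (h' a b)) ==> \<exists>E'. frame_on S h' E'"
 shows "\<exists>E. frame_on (insert p S) h E \<and> (\<forall>i x. i ~= p \<longrightarrow> E i p x = 0)"
proof -
 have fS: "finite S" by simp
 have hpp: "h p p x > 0" for x by (rule posdef_on_diag[OF pos]) simp
 have sym: "h a b x = h b a x" for a b x using pos unfolding posdef_on_def by blast
 define h' where "h' a b x = h a b x - h p a x * h p b x * inverse (h p p x)" for a b x
 have sm': "smooth_fun (h' a b)" for a b
  unfolding h'_def by (intro smooth_diff smooth_mult smooth_inverse sm) (use hpp in \<open>simp add: less_imp_neq[symmetric]\<close>)
 have "posdef_on S h'" unfolding posdef_on_def
 proof (intro conjI allI impI)
  show "h' a b x = h' b a x" for a b x by (simp add: h'_def sym[of a b])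
  fix x and v :: "'a => real" assume v: "\<exists>a\<in>S. v a ~= 0"
  define s where "s = (\<Sum>a\<in>S. v a * h p a x)"
  \<comment> \<open>This value at p minimises the quadratic form of h for given v on S; the minimum
    is the form of h'.\<close>
  define w where "w a = (if a = p then - s / h p p x else v a)" for a
  have w: "w a = v a" if "a : S" for a using that pS by (auto simp: w_def)
  have "0 < (\<Sum>a\<in>insert p S. \<Sum>b\<in>insert p S. w a * w b * h a b x)"
  proof -
   have "\<exists>a\<in>insert p S. w a ~= 0" using v w by auto
   then show ?thesis using pos unfolding posdef_on_def by blast
  qed
  also have "... = w p * w p * h p p x + (\<Sum>b\<in>S. w p * v b * h p b x)
    + (\<Sum>a\<in>S. v a * w p * h a p x + (\<Sum>b\<in>S. v a * v b * h a b x))"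
   using pS w fS by (simp cong: sum.cong)
  also have "... = w p * w p * h p p x + 2 * w p * s + (\<Sum>a\<in>S. \<Sum>b\<in>S. v a * v b * h a b x)"
  proof -
   have "(\<Sum>b\<in>S. w p * v b * h p b x) = w p * s" by (simp add: s_def sum_distrib_left mult_ac)
   moreover have "(\<Sum>a\<in>S. v a * w p * h a p x) = w p * s" unfolding s_def sum_distrib_left
   proof (rule sum.cong[OF refl])
    show "v a * w p * h a p x = w p * (v a * h p a x)" for a using sym[of a p x] by simp
   qed
   ultimately show ?thesis unfolding sum.distrib by simp
  qed
  also have "w p * w p * h p p x + 2 * w p * s = - (s * s * inverse (h p p x))"
   using hpp[of x] by (simp add: w_def field_simps)
  also have "s * s * inverse (h p p x) = (\<Sum>a\<in>S. \<Sum>b\<in>S. v a * v b * (h p a x * h p b x * inverse (h p p x)))"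
  proof -
   have "s * s = (\<Sum>a\<in>S. \<Sum>b\<in>S. (v a * h p a x) * (v b * h p b x))" unfolding s_def by (rule sum_product)
   then have "s * s * inverse (h p p x) = (\<Sum>a\<in>S. \<Sum>b\<in>S. (v a * h p a x) * (v b * h p b x) * inverse (h p p x))"
    by (simp only: sum_distrib_right)
   also have "... = (\<Sum>a\<in>S. \<Sum>b\<in>S. v a * v b * (h p a x * h p b x * inverse (h p p x)))"
    by (intro sum.cong refl) (simp add: mult_ac)
   finally show ?thesis .
  qed
  also have "- ... + (\<Sum>a\<in>S. \<Sum>b\<in>S. v a * v b * h a b x) = (\<Sum>a\<in>S. \<Sum>b\<in>S. v a * v b * h' a b x)"
   by (simp add: h'_def algebra_simps sum_subtractf)
  finally show "0 < (\<Sum>a\<in>S. \<Sum>b\<in>S. v a * v b * h' a b x)" .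
 qed
 from IH[OF this sm'] obtain E' where E': "frame_on S h' E'" by blast
 define q where "q x = sqrt (h p p x)" for x
 have q: "q x > 0" "q x * q x = h p p x" for x using hpp[of x] by (auto simp: q_def)
 define E where "E i a x = (if i = p then (if a : insert p S then h p a x * inverse (q x) else 0) else E' i a x)" for i a x
 have E'0: "E' i a x = 0" if "i \<notin> S \<or> a \<notin> S" for i a x using E' that unfolding frame_on_def by blast
 have E'h: "(\<Sum>i\<in>S. E' i a x * E' i b x) = h' a b x" if "a : S" "b : S" for a b x
  using E' that unfolding frame_on_def by blast
 have Sp: "i ~= p" if "i : S" for i using that pS by blast
 have "frame_on (insert p S) h E" unfolding frame_on_def
 proof (intro conjI allI ballI impI)
  have "smooth_fun (%x. h p a x * inverse (q x))" for a
   unfolding q_def by (intro smooth_mult smooth_inverse smooth_sqrt sm hpp) (use hpp in \<open>simp add: less_imp_neq[symmetric]\<close>)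
  then show "smooth_fun (E i a)" for i a
   unfolding E_def using E' unfolding frame_on_def by (cases "i = p"; cases "a : insert p S") auto
  show "E i a x = 0" if "i \<notin> insert p S \<or> a \<notin> insert p S" for i a x
   using that E'0[of i a x] by (auto simp: E_def)
  show "(\<Sum>i\<in>insert p S. E i a x * E i b x) = h a b x" if ab: "a : insert p S" "b : insert p S" for a b x
  proof -
   have "(\<Sum>i\<in>insert p S. E i a x * E i b x) = h p a x * h p b x * inverse (q x * q x) + (\<Sum>i\<in>S. E' i a x * E' i b x)"
    using pS ab fS Sp by (simp add: E_def mult_ac cong: sum.cong)
   also have "... = h a b x"
   proof (cases "a = p \<or> b = p")
    case True
    then have "(\<Sum>i\<in>S. E' i a x * E' i b x) = 0" using E'0 pS by (intro sum.neutral) auto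
    then show ?thesis using True hpp[of x] sym[of a p x] by (auto simp: q(2) field_simps)
   next
    case False
    then show ?thesis using ab E'h[of a b x] by (simp add: h'_def q(2))
   qed
   finally show ?thesis .
  qed
  fix t :: real and x v a
  assume t: "t : {0..1}" and a: "a : insert p S"
   and eq: "\<forall>i\<in>insert p S. (1 - t) * v i + t * (\<Sum>a\<in>insert p S. E i a x * v a) = 0"
  have "(1 - t) * v i + t * (\<Sum>a\<in>S. E' i a x * v a) = 0" if "i : S" for i
  proof -
   have "(\<Sum>a\<in>insert p S. E i a x * v a) = (\<Sum>a\<in>S. E' i a x * v a)"
    using pS Sp[OF that] E'0[of i p x] fS by (simp add: E_def)
   then show ?thesis using eq that by auto
  qed
  then have vS: "\<forall>a\<in>S. v a = 0" using E' t unfolding frame_on_def by blast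
  then have "(\<Sum>a\<in>insert p S. E p a x * v a) = q x * v p"
   using pS fS q[of x] by (simp add: E_def flip: q(2))
  moreover have "(1 - t) * v p + t * (\<Sum>a\<in>insert p S. E p a x * v a) = 0" using eq by blast
  ultimately have "((1 - t) + t * q x) * v p = 0" by (simp add: algebra_simps)
  moreover have "(1 - t) + t * q x > 0"
   using t q(1)[of x] by (cases "t = 1") (auto intro: add_pos_nonneg)
  ultimately have "v p = 0" by simp
  with vS a show "v a = 0" by blast
 qed
 moreover have "\<forall>i x. i ~= p \<longrightarrow> E i p x = 0" using E'0 pS by (simp add: E_def)
 ultimately show ?thesis by blast
qed

lemma cholesky:
 "finite S ==> posdef_on S h ==> (!!a b. smooth_fun (h a b)) ==> \<exists>E. frame_on S h E"
proof (induction S arbitrary: h rule: finite_induct)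
 case empty
 show ?case by (intro exI[of _ "%i a x. 0"]) (auto simp: frame_on_def)
next
 case (insert p S)
 show ?case using cholesky_step[OF insert.hyps(2) insert.prems] insert.IH by blast
qed

subsection \<open>Metric and connection\<close>

locale riemannian =
 fixes e :: "'n::finite" and g :: "real^'n => real^'n^'n"
 assumes metric: "riem_metric e g"
begin

abbreviation "G a b x \<equiv> ginv g x $ a $ b"
abbreviation "\<Gamma> a i j x \<equiv> christ g a i j x"

lemma g_smooth: "smooth_fun (%x. g x $ i $ j)"
 using metric unfolding riem_metric_def smooth_sym_field_def by blast

lemma g_sym: "g x $ i $ j = g x $ j $ i"
 using metric unfolding riem_metric_def smooth_sym_field_def transpose_def by (metis vec_lambda_beta)

lemma g_pos: "v ~= 0 ==> v \<bullet> (g x *v v) > 0"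
 using metric unfolding riem_metric_def by blast

lemma g_invertible: "invertible (g x)"
proof -
 have "g x *v v = 0 \<longrightarrow> v = 0" for v using g_pos[of v x] by (metis inner_zero_right less_irrefl)
 then show ?thesis using matrix_left_invertible_ker invertible_left_inverse by blast
qed

lemma ginv_mult: "g x ** ginv g x = mat 1" "ginv g x ** g x = mat 1"
proof -
 have "\<exists>A'. g x ** A' = mat 1 \<and> A' ** g x = mat 1" using g_invertible[of x] unfolding invertible_def .
 from someI_ex[OF this] show "g x ** ginv g x = mat 1" "ginv g x ** g x = mat 1"
  unfolding ginv_def matrix_inv_def by auto
qed

lemma G_g: "(SUM b. G a b x * g x $ b $ c) = (if a = c then 1 else 0)"
 using ginv_mult(2)[of x] unfolding vec_eq_iff matrix_matrix_mult_def mat_def by simp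

lemma g_G: "(SUM b. g x $ a $ b * G b c x) = (if a = c then 1 else 0)"
 using ginv_mult(1)[of x] unfolding vec_eq_iff matrix_matrix_mult_def mat_def by simp

lemma transpose_g: "transpose (g x) = g x"
 using g_sym by (simp add: transpose_def vec_eq_iff)

lemma G_sym: "G a b x = G b a x"
proof -
 have "transpose (ginv g x) ** g x = mat 1"
  using arg_cong[OF ginv_mult(1)[of x], of transpose] by (simp add: matrix_transpose_mul transpose_g transpose_mat)
 then have "transpose (ginv g x) ** (g x ** ginv g x) = ginv g x"
  unfolding matrix_mul_assoc by (simp only: matrix_mul_lid)
 then have "transpose (ginv g x) $ b $ a = ginv g x $ b $ a"
  by (simp only: ginv_mult matrix_mul_rid)
 then show ?thesis by (simp add: transpose_def)
qed

text \<open>\<open>matrix_inv\<close> is a choice and reveals nothing about regularity; Cramer's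
  rule writes its entries as quotients of determinants.\<close>

lemma G_smooth: "smooth_fun (%x. G a b x)"
proof -
 have nz: "det (g x) ~= 0" for x using g_invertible invertible_det_nz by blast
 have "ginv g x *v axis b 1 = (\<chi> k. det (\<chi> i j. if j = k then axis b 1 $ i else g x $ i $ j) / det (g x))" for x
 proof -
  have "g x *v (ginv g x *v axis b 1) = axis b 1" by (simp add: matrix_vector_mul_assoc ginv_mult)
  then show ?thesis using cramer[OF nz] by blast
 qed
 moreover have "G a b x = (ginv g x *v axis b 1) $ a" for x
  by (simp add: matrix_vector_mult_basis column_def)
 ultimately have "G a b x = det (\<chi> i j. if j = a then axis b 1 $ i else g x $ i $ j) / det (g x)" for x
  by simp
 moreover have "smooth_fun (%x. det (\<chi> i j. if j = a then axis b 1 $ i else g x $ i $ j) / det (g x))"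
 proof (intro smooth_divide smooth_det nz g_smooth)
  fix i j show "smooth_fun (%x. (\<chi> i j. if j = a then axis b 1 $ i else g x $ i $ j) $ i $ j)"
   using g_smooth by (cases "j = a") auto
 qed
 ultimately show ?thesis by presburger
qed

lemma G_posdef: "posdef_on UNIV (%a b x. G a b x)"
 unfolding posdef_on_def
proof (intro conjI allI impI)
 show "G a b x = G b a x" for a b x by (rule G_sym)
 fix x and v :: "'n => real" assume v: "\<exists>a\<in>UNIV. v a ~= 0"
 define w where "w = ginv g x *v (\<chi> a. v a)"
 have gw: "g x *v w = (\<chi> a. v a)" by (simp add: w_def matrix_vector_mul_assoc ginv_mult)
 have "w ~= 0"
 proof
  assume "w = 0"
  then have "(\<chi> a. v a) = 0" using gw by simp
  then show False using v by (simp add: vec_eq_iff)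
 qed
 then have "0 < w \<bullet> (g x *v w)" by (rule g_pos)
 also have "... = (SUM a. SUM b. v a * v b * G a b x)"
  unfolding gw by (simp add: w_def inner_vec_def matrix_vector_mult_def sum_distrib_left sum_distrib_right mult_ac)
 finally show "0 < (SUM a. SUM b. v a * v b * G a b x)" .
qed

lemma christ_smooth: "smooth_fun (christ g a i j)"
 unfolding christ_def[abs_def] by (intro smooth_intros G_smooth g_smooth)

lemma pd_g_sym: "pd l (%y. g y $ i $ j) x = pd l (%y. g y $ j $ i) x"
 by (simp add: g_sym[of _ i j])

lemma christ_sym: "\<Gamma> a i j x = \<Gamma> a j i x"
 unfolding christ_def by (simp add: pd_g_sym[of _ i j] add.commute)

lemma g_christ: "(SUM m. g x $ c $ m * \<Gamma> m i j x) =
 (pd i (%y. g y $ j $ c) x + pd j (%y. g y $ i $ c) x - pd c (%y. g y $ i $ j) x) / 2"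
proof -
 define P where "P l = pd i (%y. g y $ j $ l) x + pd j (%y. g y $ i $ l) x - pd l (%y. g y $ i $ j) x" for l
 have "(SUM m. g x $ c $ m * \<Gamma> m i j x) = 1/2 * (SUM m. SUM l. g x $ c $ m * G m l x * P l)"
  unfolding christ_def P_def[symmetric] by (simp add: sum_distrib_left mult_ac)
 also have "(SUM m. SUM l. g x $ c $ m * G m l x * P l) = (SUM l. (SUM m. g x $ c $ m * G m l x) * P l)"
  unfolding sum_distrib_right by (rule sum.swap)
 also have "... = P c" by (simp add: g_G if_distrib[of "%z. z * _"] cong: if_cong)
 finally show ?thesis by (simp add: P_def)
qed

lemma pd_g: "pd l (%y. g y $ i $ j) x = (SUM m. g x $ j $ m * \<Gamma> m l i x) + (SUM m. g x $ i $ m * \<Gamma> m l j x)"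
 unfolding g_christ using pd_g_sym[of l i j x] pd_g_sym[of i l j x] pd_g_sym[of j l i x]
 by (simp add: field_simps)

text \<open>Metric compatibility for the inverse metric: differentiate G g = 1 and contract with
  G.\<close>

lemma pd_G: "pd l (%y. G a c y) x = - (SUM m. \<Gamma> a l m x * G m c x) - (SUM m. \<Gamma> c l m x * G a m x)"
proof -
 let ?d = "%a c. pd l (%y. G a c y) x"
 have 1: "(SUM b. ?d a b * g x $ b $ d) = - (SUM b. G a b x * pd l (%y. g y $ b $ d) x)" for d
 proof -
  have "0 = pd l (%y. SUM b. G a b y * g y $ b $ d) x" unfolding G_g by simp
  also have "... = (SUM b. ?d a b * g x $ b $ d + G a b x * pd l (%y. g y $ b $ d) x)"
   by (subst pd_sum) (auto intro!: smooth_mult G_smooth g_smooth simp: pd_mult G_smooth g_smooth)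
  finally show ?thesis by (simp add: sum.distrib eq_neg_iff_add_eq_0)
 qed
 have 2: "(SUM b. G a b x * pd l (%y. g y $ b $ d) x) =
   (SUM m. g x $ d $ m * (SUM b. G a b x * \<Gamma> m l b x)) + \<Gamma> a l d x" for d
 proof -
  have "(SUM b. G a b x * pd l (%y. g y $ b $ d) x) =
    (SUM b. SUM m. g x $ d $ m * (G a b x * \<Gamma> m l b x)) + (SUM b. SUM m. (G a b x * g x $ b $ m) * \<Gamma> m l d x)"
   unfolding pd_g by (simp add: distrib_left sum.distrib sum_distrib_left mult_ac)
  also have "(SUM b. SUM m. g x $ d $ m * (G a b x * \<Gamma> m l b x)) = (SUM m. g x $ d $ m * (SUM b. G a b x * \<Gamma> m l b x))"
   unfolding sum_distrib_left by (rule sum.swap)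
  also have "(SUM b. SUM m. (G a b x * g x $ b $ m) * \<Gamma> m l d x) = (SUM m. (SUM b. G a b x * g x $ b $ m) * \<Gamma> m l d x)"
   unfolding sum_distrib_right by (rule sum.swap)
  also have "... = \<Gamma> a l d x" by (simp add: G_g if_distrib[of "%z. z * _"] cong: if_cong)
  finally show ?thesis .
 qed
 define U where "U m = (SUM b. G a b x * \<Gamma> m l b x)" for m
 have "?d a c = (SUM b. ?d a b * (SUM d. g x $ b $ d * G d c x))"
  by (simp add: g_G if_distrib[of "%z. _ * z"] cong: if_cong)
 also have "... = (SUM b. SUM d. ?d a b * g x $ b $ d * G d c x)"
  by (simp add: sum_distrib_left mult.assoc)
 also have "... = (SUM d. (SUM b. ?d a b * g x $ b $ d) * G d c x)"
  unfolding sum_distrib_right by (rule sum.swap)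
 also have "... = (SUM d. - ((SUM m. g x $ d $ m * U m) * G d c x) - \<Gamma> a l d x * G d c x)"
  unfolding 1 2 U_def[symmetric] by (intro sum.cong refl) (simp add: algebra_simps)
 also have "... = - (SUM d. (SUM m. g x $ d $ m * U m) * G d c x) - (SUM d. \<Gamma> a l d x * G d c x)"
  by (simp add: sum_subtractf sum_negf)
 also have "(SUM d. (SUM m. g x $ d $ m * U m) * G d c x)
   = (SUM d. SUM m. U m * (g x $ m $ d * G d c x))"
 proof (unfold sum_distrib_right, intro sum.cong refl)
  fix d m show "g x $ d $ m * U m * G d c x = U m * (g x $ m $ d * G d c x)"
   using g_sym[of x d m] by simp
 qed
 also have "... = (SUM m. U m * (SUM d. g x $ m $ d * G d c x))"
  unfolding sum_distrib_left by (rule sum.swap)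
 also have "... = U c" by (simp add: g_G if_distrib[of "%z. _ * z"] cong: if_cong)
 finally show ?thesis by (simp add: U_def mult.commute)
qed

end

section \<open>Orthonormal frames: connection forms, curvature and volume\<close>

lemma sum_delta_left [simp]:
 fixes f :: "'n::finite => real"
 shows "(SUM b. (if a = b then 1 else 0) * f b) = f a" "(SUM b. (if b = a then 1 else 0) * f b) = f a"
  "(SUM b. f b * (if a = b then 1 else 0)) = f a" "(SUM b. f b * (if b = a then 1 else 0)) = f a"
 by (simp_all add: if_distrib[of "%z. z * _"] if_distrib[of "%z. _ * z"] cong: if_cong)

lemma sum3_rotate:
 fixes F :: "'a => 'b => 'c => 'd::comm_monoid_add"
 shows "(\<Sum>a\<in>A. \<Sum>b\<in>B. \<Sum>d\<in>D. F a b d) = (\<Sum>d\<in>D. \<Sum>a\<in>A. \<Sum>b\<in>B. F a b d)"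
proof -
 have "(\<Sum>a\<in>A. \<Sum>b\<in>B. \<Sum>d\<in>D. F a b d) = (\<Sum>a\<in>A. \<Sum>d\<in>D. \<Sum>b\<in>B. F a b d)"
  by (intro sum.cong refl sum.swap)
 also have "... = (\<Sum>d\<in>D. \<Sum>a\<in>A. \<Sum>b\<in>B. F a b d)" by (rule sum.swap)
 finally show ?thesis .
qed

text \<open>\<open>E i a\<close> is the a-th coordinate of the i-th vector of an orthonormal frame.
  By \<open>E_e\<close> all frame vectors except the e-th are tangent to the level sets of x_e, so
  the e-th one is normal to them.\<close>

locale framed = riemannian e g for e :: "'n::finite" and g :: "real^'n => real^'n^'n" +
 fixes E :: "'n => 'n => real^'n => real"
 assumes frame: "frame_on UNIV (%a b x. ginv g x $ a $ b) E"
  and E_e: "!!i x. i ~= e ==> E i e x = 0"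
begin

lemma E_smooth: "smooth_fun (E i a)"
 using frame unfolding frame_on_def by blast

lemma E_E: "(SUM i. E i a x * E i b x) = G a b x"
 using frame unfolding frame_on_def by blast

text \<open>The coframe dual to \<open>E\<close>, obtained by lowering the index; it is unrelated to
  the null expansion.\<close>

definition theta :: "'n => 'n => real^'n => real" where
 "theta j b x = (SUM c. g x $ b $ c * E j c x)"

lemma theta_smooth: "smooth_fun (theta j b)"
 unfolding theta_def[abs_def] by (intro smooth_intros g_smooth E_smooth)

lemma E_theta: "(SUM j. E j b x * theta j d x) = (if b = d then 1 else 0)"
proof -
 have "(SUM j. E j b x * theta j d x) = (SUM j. SUM c. g x $ d $ c * (E j b x * E j c x))"
  unfolding theta_def by (simp add: sum_distrib_left mult_ac)
 also have "... = (SUM c. g x $ d $ c * (SUM j. E j b x * E j c x))"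
  unfolding sum_distrib_left by (rule sum.swap)
 also have "... = (SUM c. g x $ d $ c * G c b x)" 
 proof (unfold E_E, rule sum.cong[OF refl])
  show "g x $ d $ c * G b c x = g x $ d $ c * G c b x" for c using G_sym[where a=b and b=c and x=x] by simp
 qed
 also have "... = (if b = d then 1 else 0)" unfolding g_G by auto
 finally show ?thesis .
qed

lemma theta_E: "(SUM b. theta i b x * E j b x) = (if i = j then 1 else 0)"
proof -
 define M T where "M = (\<chi> i b. E i b x)" and "T = (\<chi> b i. theta i b x)"
 have "transpose M ** transpose T = mat 1"
  unfolding vec_eq_iff matrix_matrix_mult_def transpose_def M_def T_def mat_def by (simp add: E_theta)
 then have "transpose T ** transpose M = mat 1" using matrix_left_right_inverse by blast
 then have "(transpose T ** transpose M) $ i $ j = mat 1 $ i $ j" by simp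
 then show ?thesis unfolding matrix_matrix_mult_def transpose_def M_def T_def mat_def by simp
qed

lemma E_cancel:
 assumes "!!b. (SUM j. E j b x * f j) = (SUM j. E j b x * h j)" shows "f j = h j"
proof -
 have *: "(SUM b. theta i b x * (SUM j. E j b x * k j)) = k i" for k i
 proof -
  have "(SUM b. theta i b x * (SUM j. E j b x * k j)) = (SUM j. (SUM b. theta i b x * E j b x) * k j)"
   unfolding sum_distrib_left sum_distrib_right by (subst sum.swap) (simp add: mult_ac)
  then show ?thesis by (simp add: theta_E)
 qed
 show ?thesis using *[of j f] *[of j h] assms by simp
qed

text \<open>The connection forms of the frame: the covariant derivative of the m-th frame vector in
  direction a is the sum of \<open>om a m j\<close> times the j-th one.\<close>

definition om :: "'n => 'n => 'n => real^'n => real" where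
 "om a m j x = (SUM b. theta j b x * (pd a (E m b) x + (SUM c. \<Gamma> b a c x * E m c x)))"

lemma om_smooth: "smooth_fun (om a m j)"
 unfolding om_def[abs_def] by (intro smooth_intros theta_smooth E_smooth christ_smooth)

lemma E_om: "(SUM j. E j b x * om a m j x) = pd a (E m b) x + (SUM c. \<Gamma> b a c x * E m c x)"
proof -
 define W where "W b = pd a (E m b) x + (SUM c. \<Gamma> b a c x * E m c x)" for b
 have "(SUM j. E j b x * om a m j x) = (SUM j. SUM d. (E j b x * theta j d x) * W d)"
  unfolding om_def W_def[symmetric] by (simp add: sum_distrib_left mult_ac)
 also have "... = (SUM d. (SUM j. E j b x * theta j d x) * W d)"
  unfolding sum_distrib_right by (rule sum.swap)
 also have "... = W b" by (simp add: E_theta)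
 finally show ?thesis unfolding W_def .
qed

lemma pd_E: "pd a (E m b) x = (SUM j. E j b x * om a m j x) - (SUM c. \<Gamma> b a c x * E m c x)"
 unfolding E_om by simp

text \<open>Differentiate the identity expressing the inverse metric by the frame, compare with
  \<open>pd_G\<close>, and cancel the frame twice.\<close>

lemma om_antisym: "om a m j x = - om a j m x"
proof -
 have *: "(SUM m. E m c x * (SUM j. E j b x * (om a m j x + om a j m x))) = 0" for b c
 proof -
  have "pd a (%y. G b c y) x = pd a (%y. SUM m. E m b y * E m c y) x" unfolding E_E ..
  also have "... = (SUM m. pd a (E m b) x * E m c x + E m b x * pd a (E m c) x)"
   by (subst pd_sum) (auto intro!: smooth_mult E_smooth simp: pd_mult E_smooth)
  also have "... = (SUM m. E m c x * (SUM j. E j b x * om a m j x))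
    + (SUM m. E m b x * (SUM j. E j c x * om a m j x))
    - (SUM m. SUM d. \<Gamma> b a d x * (E m d x * E m c x))
    - (SUM m. SUM d. \<Gamma> c a d x * (E m b x * E m d x))"
   unfolding pd_E by (simp add: algebra_simps sum.distrib sum_subtractf sum_distrib_left)
  also have "(SUM m. SUM d. \<Gamma> b a d x * (E m d x * E m c x)) = (SUM d. \<Gamma> b a d x * G d c x)"
   unfolding E_E[symmetric] sum_distrib_left by (rule sum.swap)
  also have "(SUM m. SUM d. \<Gamma> c a d x * (E m b x * E m d x)) = (SUM d. \<Gamma> c a d x * G b d x)"
   unfolding E_E[symmetric] sum_distrib_left by (rule sum.swap)
  also have "(SUM m. E m b x * (SUM j. E j c x * om a m j x)) = (SUM m. E m c x * (SUM j. E j b x * om a j m x))"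
   unfolding sum_distrib_left by (subst sum.swap) (simp add: mult_ac)
  finally show ?thesis unfolding pd_G by (simp add: distrib_left sum.distrib)
 qed
 have "(SUM j. E j b x * (om a m j x + om a j m x)) = 0" for b m
  using E_cancel[of x "%m. SUM j. E j b x * (om a m j x + om a j m x)" "%_. 0" m] * by simp
 then have "om a m j x + om a j m x = 0"
  using E_cancel[of x "%j. om a m j x + om a j m x" "%_. 0" j] by simp
 then show ?thesis by simp
qed

definition rho :: "'n => 'n => 'n => 'n => real^'n => real" where
 "rho a b m j x = pd a (om b m j) x - pd b (om a m j) x
  + (SUM l. om b m l x * om a l j x - om a m l x * om b l j x)"

definition Rm :: "'n => 'n => 'n => 'n => real^'n => real" where
 "Rm c d a b x = pd a (christ g c b d) x - pd b (christ g c a d) x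
  + (SUM l. \<Gamma> c a l x * \<Gamma> l b d x - \<Gamma> c b l x * \<Gamma> l a d x)"

text \<open>The curvature of the connection forms and the coordinate curvature tensor agree.
  Differentiating \<open>E_om\<close> once more, the second derivatives of the frame and the terms
  \<open>X\<close> are symmetric in a and b and cancel after antisymmetrisation.\<close>

lemma E_rho: "(SUM j. E j c x * rho a b m j x) = (SUM d. Rm c d a b x * E m d x)"
proof -
 define X where "X a b = (SUM d. SUM l. \<Gamma> c b d x * E l d x * om a m l x)" for a b
 define Y where "Y a b = (SUM d. SUM l. \<Gamma> c b d x * \<Gamma> d a l x * E m l x)" for a b
 define U where "U a b = (SUM j. SUM l. E l c x * om a j l x * om b m j x)" for a b
 have Q: "(SUM j. E j c x * pd a (om b m j) x) = pd a (pd b (E m c)) x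
   + (SUM d. pd a (christ g c b d) x * E m d x) + X a b - Y a b - U a b + X b a" for a b
 proof -
  have "pd a (%y. SUM j. E j c y * om b m j y) x
    = pd a (%y. pd b (E m c) y + (SUM d. \<Gamma> c b d y * E m d y)) x" unfolding E_om ..
  also have "... = pd a (pd b (E m c)) x + (SUM d. pd a (christ g c b d) x * E m d x + \<Gamma> c b d x * pd a (E m d) x)"
   by (subst pd_add) (auto intro!: smooth_intros E_smooth christ_smooth simp: pd_sum pd_mult smooth_mult E_smooth christ_smooth)
  also have "pd a (%y. SUM j. E j c y * om b m j y) x
    = (SUM j. pd a (E j c) x * om b m j x + E j c x * pd a (om b m j) x)"
   by (subst pd_sum) (auto intro!: smooth_mult E_smooth om_smooth simp: pd_mult E_smooth om_smooth)
  finally have "(SUM j. E j c x * pd a (om b m j) x) = pd a (pd b (E m c)) x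
   + (SUM d. pd a (christ g c b d) x * E m d x) + (SUM d. \<Gamma> c b d x * pd a (E m d) x)
   - (SUM j. pd a (E j c) x * om b m j x)" by (simp add: sum.distrib)
  moreover have "(SUM d. \<Gamma> c b d x * pd a (E m d) x) = X a b - Y a b"
   unfolding pd_E X_def Y_def by (simp add: right_diff_distrib sum_subtractf sum_distrib_left mult_ac)
  moreover have "(SUM j. pd a (E j c) x * om b m j x) = U a b - X b a"
  proof -
   have "(SUM j. SUM d. \<Gamma> c a d x * E j d x * om b m j x) = X b a"
    unfolding X_def by (rule sum.swap)
   then show ?thesis unfolding pd_E U_def
    by (simp add: left_diff_distrib sum_subtractf sum_distrib_right)
  qed
  ultimately show ?thesis by simp
 qed
 have U: "(SUM j. SUM l. E j c x * (om b m l x * om a l j x)) = U a b" for a b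
  unfolding U_def by (subst sum.swap) (simp add: mult_ac)
 have "(SUM j. E j c x * rho a b m j x) = (SUM j. E j c x * pd a (om b m j) x)
   - (SUM j. E j c x * pd b (om a m j) x) + (U a b - U b a)"
  unfolding rho_def U[symmetric]
  by (simp add: algebra_simps sum.distrib sum_subtractf sum_distrib_left)
 also have "... = (SUM d. pd a (christ g c b d) x * E m d x) - (SUM d. pd b (christ g c a d) x * E m d x)
   - Y a b + Y b a"
  unfolding Q using pd_commute[OF E_smooth, of a b m c x] by simp
 also have "... = (SUM d. Rm c d a b x * E m d x)"
 proof -
  have "(SUM d. SUM l. \<Gamma> c b l x * \<Gamma> l a d x * E m d x) = Y a b" for a b
   unfolding Y_def by (rule sum.swap)
  then show ?thesis unfolding Rm_def
   by (simp add: left_diff_distrib distrib_right sum.distrib sum_subtractf sum_distrib_right)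
 qed
 finally show ?thesis .
qed

lemma rho_antisym: "rho a b m j x = - rho a b j m x"
proof -
 have "pd a (om b m j) x = - pd a (om b j m) x" for a b
 proof -
  have "om b m j = (%y. - om b j m y)" using om_antisym by blast
  then show ?thesis using pd_minus[OF om_smooth] by metis
 qed
 moreover have "(SUM l. om b m l x * om a l j x - om a m l x * om b l j x)
   = - (SUM l. om b j l x * om a l m x - om a j l x * om b l m x)"
 proof (unfold sum_negf[symmetric], rule sum.cong[OF refl])
  fix l
  show "om b m l x * om a l j x - om a m l x * om b l j x = - (om b j l x * om a l m x - om a j l x * om b l m x)"
   using om_antisym[of b m l x] om_antisym[of a m l x] om_antisym[of b j l x] om_antisym[of a j l x] by simp
 qed
 ultimately show ?thesis unfolding rho_def by simp
qed

lemma rho_antisym': "rho a b m j x = - rho b a m j x"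
 unfolding rho_def by (simp add: sum_subtractf)

lemma Rm_bianchi: "Rm c d a b x + Rm c a b d x + Rm c b d a x = 0"
proof -
 have s: "christ g c i j = christ g c j i" for i j by (rule ext) (rule christ_sym)
 have "pd a (christ g c b d) x = pd a (christ g c d b) x" "pd b (christ g c a d) x = pd b (christ g c d a) x"
  "pd d (christ g c b a) x = pd d (christ g c a b) x" using s by metis+
 moreover have "\<Gamma> l b d x = \<Gamma> l d b x" "\<Gamma> l a d x = \<Gamma> l d a x" "\<Gamma> l b a x = \<Gamma> l a b x" for l
  using christ_sym by blast+
 ultimately show ?thesis unfolding Rm_def by (simp add: sum_subtractf)
qed

definition R4 :: "'n => 'n => 'n => 'n => real^'n => real" where
 "R4 p q i j x = (SUM a. SUM b. E p a x * E q b x * rho a b i j x)"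

definition T4 :: "'n => 'n => 'n => 'n => real^'n => real" where
 "T4 j d a b x = (SUM c. theta j c x * Rm c d a b x)"

lemma rho_T4: "rho a b i j x = (SUM d. T4 j d a b x * E i d x)"
proof -
 have "(SUM j. E j c x * (SUM d. T4 j d a b x * E i d x)) = (SUM j. E j c x * rho a b i j x)" for c
 proof -
  have "(SUM j. E j c x * (SUM d. T4 j d a b x * E i d x))
    = (SUM j. SUM d. \<Sum>c'\<in>UNIV. E j c x * theta j c' x * (Rm c' d a b x * E i d x))"
   unfolding T4_def by (simp add: sum_distrib_left sum_distrib_right mult_ac)
  also have "... = (SUM d. \<Sum>c'\<in>UNIV. SUM j. E j c x * theta j c' x * (Rm c' d a b x * E i d x))"
   by (rule sum3_rotate[symmetric])
  also have "... = (SUM d. Rm c d a b x * E i d x)"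
   unfolding sum_distrib_right[symmetric] E_theta by simp
  finally show ?thesis unfolding E_rho .
 qed
 from E_cancel[OF this, of j] show ?thesis by simp
qed

lemma R4_T4: "R4 p q i j x = (SUM a. SUM b. SUM d. E p a x * E q b x * E i d x * T4 j d a b x)"
 unfolding R4_def rho_T4 by (simp add: sum_distrib_left mult_ac)

lemma R4_bianchi: "R4 p q i j x + R4 q i p j x + R4 i p q j x = 0"
proof -
 have 1: "R4 q i p j x = (SUM a. SUM b. SUM d. E p a x * E q b x * E i d x * T4 j a b d x)"
  unfolding R4_T4 by (subst sum3_rotate) (simp add: mult_ac)
 have 2: "R4 i p q j x = (SUM a. SUM b. SUM d. E p a x * E q b x * E i d x * T4 j b d a x)"
  unfolding R4_T4 by (subst sum3_rotate[symmetric]) (simp add: mult_ac)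
 have T: "T4 j d a b x + T4 j a b d x + T4 j b d a x = 0" for a b d
 proof -
  have "T4 j d a b x + T4 j a b d x + T4 j b d a x = (SUM c. theta j c x * (Rm c d a b x + Rm c a b d x + Rm c b d a x))"
   unfolding T4_def by (simp add: distrib_left sum.distrib)
  then show ?thesis by (simp add: Rm_bianchi)
 qed
 have "R4 p q i j x + R4 q i p j x + R4 i p q j x
   = (SUM a. SUM b. SUM d. E p a x * E q b x * E i d x * (T4 j d a b x + T4 j a b d x + T4 j b d a x))"
  unfolding 1 2 unfolding R4_T4 by (simp add: distrib_left sum.distrib)
 then show ?thesis by (simp add: T)
qed

lemma R4_antisym: "R4 p q i j x = - R4 q p i j x" "R4 p q i j x = - R4 p q j i x"
proof -
 show "R4 p q i j x = - R4 p q j i x"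
  unfolding R4_def sum_negf[symmetric] by (intro sum.cong refl) (subst rho_antisym, simp)
 have "R4 p q i j x = (SUM b. SUM a. E p a x * E q b x * rho a b i j x)"
  unfolding R4_def by (rule sum.swap)
 also have "... = - R4 q p i j x"
  unfolding R4_def sum_negf[symmetric] by (intro sum.cong refl) (subst rho_antisym', simp add: mult_ac)
 finally show "R4 p q i j x = - R4 q p i j x" .
qed

text \<open>Identifies the frame contraction that the Weitzenboeck formula will produce, with its
  sign, with the coordinate expression \<open>scal\<close>.\<close>

lemma R4_scal: "(SUM p. SUM q. R4 p q q p x) = scal g x"
proof -
 have Ric: "(SUM a. Rm a d a b x) = ricci g d b x" for d b
 proof -
  have s: "christ g c i j = christ g c j i" for c i j by (rule ext) (rule christ_sym)
  have A: "pd b (christ g a a d) x = pd b (christ g a d a) x" for a by (simp only: s[of a a d])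
  have B: "\<Gamma> l a d x = \<Gamma> l d a x" for l a by (rule christ_sym)
  show ?thesis unfolding Rm_def ricci_def
   by (simp only: sum.distrib sum_subtractf A B s[of _ b d])
 qed
 have "(SUM q. R4 p q q p x) = (SUM a. SUM b. SUM d. G b d x * (E p a x * T4 p d a b x))" for p
 proof -
  have "(SUM q. R4 p q q p x) = (SUM q. SUM a. SUM b. SUM d. (E q b x * E q d x) * (E p a x * T4 p d a b x))"
   unfolding R4_T4 by (simp add: mult_ac)
  also have "... = (SUM a. SUM q. SUM b. SUM d. (E q b x * E q d x) * (E p a x * T4 p d a b x))"
   by (rule sum.swap)
  also have "... = (SUM a. SUM b. SUM d. SUM q. (E q b x * E q d x) * (E p a x * T4 p d a b x))"
   by (rule sum.cong[OF refl], rule sum3_rotate[symmetric])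
  finally show ?thesis unfolding sum_distrib_right[symmetric] E_E .
 qed
 then have "(SUM p. SUM q. R4 p q q p x)
   = (SUM p. SUM a. SUM b. SUM d. G b d x * (E p a x * T4 p d a b x))" by simp
 also have "... = (SUM a. SUM p. SUM b. SUM d. G b d x * (E p a x * T4 p d a b x))"
  by (rule sum.swap)
 also have "... = (SUM a. SUM b. SUM d. SUM p. G b d x * (E p a x * T4 p d a b x))"
  by (rule sum.cong[OF refl], rule sum3_rotate[symmetric])
 also have "... = (SUM a. SUM b. SUM d. G b d x * Rm a d a b x)"
 proof (intro sum.cong refl)
  fix a b d
  have "(SUM p. E p a x * T4 p d a b x) = (SUM p. SUM c. (E p a x * theta p c x) * Rm c d a b x)"
   unfolding T4_def by (simp add: sum_distrib_left mult_ac)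
  also have "... = (SUM c. (SUM p. E p a x * theta p c x) * Rm c d a b x)"
   unfolding sum_distrib_right by (rule sum.swap)
  also have "... = Rm a d a b x" by (simp add: E_theta)
  finally show "(SUM p. G b d x * (E p a x * T4 p d a b x)) = G b d x * Rm a d a b x"
   by (simp add: sum_distrib_left[symmetric])
 qed
 also have "... = (SUM b. SUM d. SUM a. G b d x * Rm a d a b x)"
  by (rule sum3_rotate[symmetric])
 also have "... = (SUM b. SUM d. G d b x * ricci g d b x)"
  unfolding sum_distrib_left[symmetric] Ric by (simp add: G_sym)
 also have "... = scal g x" unfolding scal_def by (rule sum.swap)
 finally show ?thesis .
qed

text \<open>The Riemannian density: the frame matrix has squared determinant det(g)^(-1). The
  absolute value of the determinant is written as the root of a square to stay within the smooth
  algebra.\<close>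

definition vol :: "real^'n => real" where
 "vol x = inverse (sqrt (det (\<chi> i a. E i a x) * det (\<chi> i a. E i a x)))"

lemma det_E_nz: "det (\<chi> i a. E i a x) ~= 0"
proof -
 have "(\<chi> b i. theta i b x) ** (\<chi> i a. E i a x) = mat 1"
  unfolding vec_eq_iff matrix_matrix_mult_def mat_def
  using E_theta by (simp add: mult.commute)
 then have "invertible (\<chi> i a. E i a x)" using invertible_left_inverse by blast
 then show ?thesis using invertible_det_nz by blast
qed

lemma vol_pos: "vol x > 0"
 unfolding vol_def using det_E_nz[of x] by (simp add: power2_eq_square[symmetric])

lemma vol_smooth: "smooth_fun vol"
proof -
 have "smooth_fun (%x. det (\<chi> i a. E i a x))" by (rule smooth_det) (simp add: E_smooth)
 then show ?thesis unfolding vol_def[abs_def] using det_E_nz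
  by (intro smooth_inverse smooth_sqrt smooth_mult) (auto simp: power2_eq_square[symmetric])
qed

text \<open>By Jacobi's formula the logarithmic derivative of the frame determinant is the trace of
  the connection forms, which vanishes by antisymmetry, minus the trace of the Christoffel
  symbols.\<close>

lemma pd_vol: "pd a vol x = vol x * (SUM b. \<Gamma> b b a x)"
proof -
 define d where "d x = det (\<chi> i a. E i a x)" for x
 have sd: "smooth_fun d" unfolding d_def[abs_def] by (rule smooth_det) (simp add: E_smooth)
 define kap where "kap i k = (SUM b. pd a (E i b) x * theta k b x)" for i k
 have "pd a (E i j) x = (SUM k. kap i k * E k j x)" for i j
 proof -
  have "(SUM k. kap i k * E k j x) = (SUM k. SUM b. pd a (E i b) x * (E k j x * theta k b x))"
   unfolding kap_def by (simp add: sum_distrib_left sum_distrib_right mult_ac)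
  also have "... = (SUM b. pd a (E i b) x * (SUM k. E k j x * theta k b x))"
   unfolding sum_distrib_left by (rule sum.swap)
  finally show ?thesis by (simp add: E_theta)
 qed
 then have "pd a d x = (SUM i. kap i i) * d x"
  unfolding d_def[abs_def] by (intro pd_det) (auto simp: E_smooth)
 also have "(SUM i. kap i i) = - (SUM b. \<Gamma> b b a x)"
 proof -
  have "kap i i = om a i i x - (SUM b. SUM c. theta i b x * (\<Gamma> b a c x * E i c x))" for i
   unfolding kap_def om_def by (simp add: algebra_simps sum.distrib sum_distrib_left)
  moreover have "om a i i x = 0" for i using om_antisym[of a i i x] by simp
  ultimately have "(SUM i. kap i i) = - (SUM i. SUM b. SUM c. theta i b x * (\<Gamma> b a c x * E i c x))"
   by (simp add: sum_negf)
  also have "(SUM i. SUM b. SUM c. theta i b x * (\<Gamma> b a c x * E i c x))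
    = (SUM b. SUM c. SUM i. theta i b x * (\<Gamma> b a c x * E i c x))"
   by (rule sum3_rotate[symmetric])
  also have "... = (SUM b. SUM c. \<Gamma> b a c x * (SUM i. E i c x * theta i b x))"
   by (simp add: sum_distrib_left mult_ac)
  also have "... = (SUM b. \<Gamma> b b a x)" by (simp add: E_theta christ_sym[of _ a])
  finally show ?thesis .
 qed
 finally have pd_d: "pd a d x = - (SUM b. \<Gamma> b b a x) * d x" .
 have dnz: "d x ~= 0" using det_E_nz by (simp add: d_def)
 then have dd: "d x * d x > 0" by (simp add: power2_eq_square[symmetric])
 have "has_pd a (%x. d x * d x) (pd a d x * d x + d x * pd a d x) x"
  by (intro has_pd_mult smooth_fun_has_pd sd)
 note 1 = has_pd_sqrt[OF this dd]
 have "sqrt (d x * d x) ~= 0" using dnz by simp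
 from has_pd_inverse[OF 1 this]
 have "has_pd a (%x. inverse (sqrt (d x * d x))) (- (inverse (sqrt (d x * d x)) * inverse (sqrt (d x * d x)))
   * (inverse (sqrt (d x * d x)) / 2 * (pd a d x * d x + d x * pd a d x))) x" .
 moreover have "vol = (%x. inverse (sqrt (d x * d x)))" by (simp add: vol_def[abs_def] d_def)
 ultimately have "pd a vol x = - (inverse (sqrt (d x * d x)) * inverse (sqrt (d x * d x)))
   * (inverse (sqrt (d x * d x)) / 2 * (pd a d x * d x + d x * pd a d x))"
  using has_pd_imp_pd by simp
 also have "... = vol x * (SUM b. \<Gamma> b b a x)"
 proof -
  define r where "r = sqrt (d x * d x)"
  have r: "r > 0" "r * r = d x * d x" using dd by (auto simp: r_def)
  define S where "S = (SUM b. \<Gamma> b b a x)"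
  have "- (inverse r * inverse r) * (inverse r / 2 * (- S * d x * d x + d x * (- S * d x)))
    = inverse r * inverse r * inverse r * S * (r * r)" unfolding r(2) by (simp add: field_simps)
  also have "... = inverse r * S" using r(1) by (simp add: field_simps)
  finally show ?thesis unfolding pd_d by (simp add: vol_def d_def[symmetric] r_def S_def)
 qed
 finally show ?thesis .
qed

end

section \<open>Spinor fields and the spin representation\<close>

definition pv :: "'n::finite => (real^'n => real^'m::finite) => real^'n => real^'m" where
 "pv a psi x = (\<chi> S. pd a (%y. psi y $ S) x)"

definition smooth_map :: "(real^'n::finite => real^'m::finite) => bool" where
 "smooth_map psi \<longleftrightarrow> (\<forall>S. smooth_fun (%x. psi x $ S))"

lemma smooth_map_component: "smooth_map psi ==> smooth_fun (%x. psi x $ S)"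
 unfolding smooth_map_def by blast

lemma smooth_map_add: "smooth_map psi ==> smooth_map phi ==> smooth_map (%x. psi x + phi x)"
 and smooth_map_diff: "smooth_map psi ==> smooth_map phi ==> smooth_map (%x. psi x - phi x)"
 and smooth_map_minus: "smooth_map psi ==> smooth_map (%x. - psi x)"
 and smooth_map_scale: "smooth_fun f ==> smooth_map psi ==> smooth_map (%x. f x *R psi x)"
 and smooth_map_const: "smooth_map (%x. c)"
 and smooth_map_pv: "smooth_map psi ==> smooth_map (pv a psi)"
 unfolding smooth_map_def pv_def by (auto intro: smooth_intros)

lemma smooth_map_sum: "(!!i. i : I ==> smooth_map (psi i)) ==> smooth_map (%x. \<Sum>i\<in>I. psi i x)"
 by (induction I rule: infinite_finite_induct) (auto intro: smooth_map_add smooth_map_const)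

lemma smooth_map_cl: "smooth_map psi ==> smooth_map (%x. cl i (psi x))"
 and smooth_map_ch: "smooth_map psi ==> smooth_map (%x. ch i (psi x))"
 unfolding smooth_map_def cl_def ch_def by (auto intro!: smooth_mult)

lemmas smooth_map_intros = smooth_map_add smooth_map_diff smooth_map_minus smooth_map_scale
 smooth_map_const smooth_map_pv smooth_map_sum smooth_map_cl smooth_map_ch

lemma smooth_inner: "smooth_map psi ==> smooth_map phi ==> smooth_fun (%x. psi x \<bullet> phi x)"
 unfolding inner_vec_def smooth_map_def inner_real_def by (intro smooth_sum smooth_mult) auto

lemma pv_add: "smooth_map psi ==> smooth_map phi ==> pv a (%x. psi x + phi x) x = pv a psi x + pv a phi x"
 and pv_scale: "smooth_fun f ==> smooth_map psi ==>
  pv a (%x. f x *R psi x) x = pd a f x *R psi x + f x *R pv a psi x"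
 unfolding smooth_map_def pv_def vec_eq_iff by (auto simp: pd_add pd_mult)

lemma pv_const [simp]: "pv a (%x. c) x = 0"
 by (simp add: pv_def vec_eq_iff)

lemma pv_sum: "(!!i. i : I ==> smooth_map (psi i)) ==> pv a (%x. \<Sum>i\<in>I. psi i x) x = (\<Sum>i\<in>I. pv a (psi i) x)"
 by (induction I rule: infinite_finite_induct) (auto simp: pv_add smooth_map_sum)

lemma pv_cl: "smooth_map psi ==> pv a (%x. cl i (psi x)) x = cl i (pv a psi x)"
 and pv_ch: "smooth_map psi ==> pv a (%x. ch i (psi x)) x = ch i (pv a psi x)"
 unfolding smooth_map_def pv_def cl_def ch_def vec_eq_iff by (auto simp: pd_cmult)

lemma pd_inner:
 assumes "smooth_map psi" "smooth_map phi"
 shows "pd a (%x. psi x \<bullet> phi x) x = pv a psi x \<bullet> phi x + psi x \<bullet> pv a phi x"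
proof -
 have "pd a (%x. psi x \<bullet> phi x) x = (SUM S. pd a (%x. psi x $ S * phi x $ S) x)"
  unfolding inner_vec_def inner_real_def using assms
  by (intro pd_sum) (auto simp: smooth_map_def intro: smooth_mult)
 also have "... = (SUM S. pd a (%x. psi x $ S) x * phi x $ S + psi x $ S * pd a (%x. phi x $ S) x)"
  using assms by (intro sum.cong refl pd_mult) (auto simp: smooth_map_def)
 finally show ?thesis by (simp add: sum.distrib inner_vec_def pv_def)
qed

lemma pv_commute: "smooth_map psi ==> pv a (pv b psi) x = pv b (pv a psi) x"
 unfolding pv_def vec_eq_iff by (auto simp: smooth_map_def intro: pd_commute)

text \<open>The spin representation of the Lie algebra of skew matrices on the Clifford
  module.\<close>

definition bil :: "('n::finite => 'n => real) => real^('n set) => real^('n set)" where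
 "bil f u = (1/4) *R (SUM i. SUM j. f i j *R cl i (cl j u))"

lemma bil_linear: "linear (bil f)"
 by (rule linearI) (simp_all add: bil_def cl_simps scaleR_add_right sum.distrib scaleR_sum_right mult_ac)

lemmas bil_simps = linear_add[OF bil_linear] linear_scale[OF bil_linear] linear_neg[OF bil_linear]
 linear_diff[OF bil_linear] linear_0[OF bil_linear]

lemma bil_diff: "bil f u - bil h u = bil (%i j. f i j - h i j) u"
 unfolding bil_def by (simp add: scaleR_diff_left sum_subtractf scaleR_diff_right)

lemma bil_add: "bil f u + bil h u = bil (%i j. f i j + h i j) u"
 unfolding bil_def by (simp add: scaleR_add_left sum.distrib scaleR_add_right)

lemma cl_cl_cases: "cl i (cl j u) = - cl j (cl i u) - (if i = j then 2 else 0) *R u"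
 using cl_cl[of i j u] by (cases "i = j") (auto simp: scaleR_2)

lemma sum_scaleR_delta [simp]:
 fixes f :: "'n::finite => 'v::real_vector"
 shows "(SUM b. (if a = b then c else 0) *R f b) = c *R f a"
  "(SUM b. (if b = a then c else 0) *R f b) = c *R f a"
 by (simp_all add: if_distrib[of "%z. z *R _"] cong: if_cong)

text \<open>The infinitesimal equivariance of Clifford multiplication. It is the reason why the spin
  connection is compatible with Clifford multiplication in \<open>nab_A\<close>.\<close>

lemma bil_cl:
 assumes f: "!!i j. f i j = - f j i"
 shows "bil f (cl m u) = cl m (bil f u) + (SUM j. f m j *R cl j u)"
proof -
 have *: "cl i (cl j (cl m u)) = cl m (cl i (cl j u)) + (if i = m then 2 else 0) *R cl j u - (if j = m then 2 else 0) *R cl i u" for i j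
 proof -
  have "cl i (cl j (cl m u)) = cl i (- cl m (cl j u) - (if j = m then 2 else 0) *R u)"
   by (subst cl_cl_cases) simp
  also have "... = - cl i (cl m (cl j u)) - (if j = m then 2 else 0) *R cl i u" by (simp add: cl_simps)
  also have "cl i (cl m (cl j u)) = - cl m (cl i (cl j u)) - (if i = m then 2 else 0) *R cl j u" by (rule cl_cl_cases)
  finally show ?thesis by simp
 qed
 have "(SUM i. SUM j. f i j *R cl i (cl j (cl m u)))
   = (SUM i. SUM j. f i j *R cl m (cl i (cl j u)))
   + (SUM i. SUM j. (if i = m then 2 else 0) *R f i j *R cl j u)
   - (SUM i. SUM j. (if j = m then 2 else 0) *R f i j *R cl i u)"
  unfolding * by (simp add: scaleR_diff_right scaleR_add_right sum.distrib sum_subtractf mult.commute)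
 also have "(SUM i. SUM j. (if i = m then 2 else 0) *R f i j *R cl j u) = 2 *R (SUM j. f m j *R cl j u)"
  unfolding scaleR_sum_right[symmetric] sum_scaleR_delta ..
 also have "(SUM i. SUM j. (if j = m then 2 else 0) *R f i j *R cl i u) = - 2 *R (SUM j. f m j *R cl j u)"
  unfolding sum_scaleR_delta by (subst f) (simp add: scaleR_sum_right sum_negf)
 finally show ?thesis unfolding bil_def
  by (simp add: cl_simps cl_sum scaleR_add_right flip: scaleR_add_left)
qed

lemma bil_ch: "bil f (ch m u) = ch m (bil f u)"
 unfolding bil_def by (simp add: cl_ch cl_simps ch_simps ch_sum)

text \<open>\<open>bil f\<close> acts on the products of two Clifford multiplications as a
  derivation, so commutators of matrices become commutators of operators, in reversed order.\<close>

lemma bil_bil: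
 assumes f: "!!i j. f i j = - f j i"
 shows "bil f (bil h u) - bil h (bil f u) = bil (%i j. SUM l. h i l * f l j - f i l * h l j) u"
proof -
 have *: "bil f (cl i (cl j u)) = cl i (cl j (bil f u)) + (SUM k. f j k *R cl i (cl k u)) + (SUM k. f i k *R cl k (cl j u))" for i j
  using bil_cl[where f=f and m=i and u="cl j u", OF f] bil_cl[where f=f and m=j and u=u, OF f] by (simp add: cl_simps cl_sum)
 have "bil f (bil h u) = (1/4) *R (SUM i. SUM j. h i j *R bil f (cl i (cl j u)))"
  by (simp add: bil_def[of h] bil_simps linear_sum[OF bil_linear])
 also have "... = bil h (bil f u) + (1/4) *R ((SUM i. SUM j. SUM k. (h i j * f j k) *R cl i (cl k u))
   + (SUM i. SUM j. SUM k. (h i j * f i k) *R cl k (cl j u)))"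
  unfolding * bil_def[of h] by (simp add: scaleR_add_right sum.distrib scaleR_sum_right)
 also have "(SUM i. SUM j. SUM k. (h i j * f j k) *R cl i (cl k u))
   = (SUM i. SUM k. (SUM j. h i j * f j k) *R cl i (cl k u))"
  unfolding scaleR_sum_left by (rule sum.cong[OF refl], rule sum.swap)
 also have "(SUM i. SUM j. SUM k. (h i j * f i k) *R cl k (cl j u))
   = (SUM k. SUM j. SUM i. (h i j * f i k) *R cl k (cl j u))"
  by (subst sum3_rotate) (rule sum.cong[OF refl], rule sum.swap)
 also have "... = - (SUM k. SUM j. (SUM i. f k i * h i j) *R cl k (cl j u))"
 proof (unfold sum_negf[symmetric] scaleR_sum_left, intro sum.cong refl)
  show "(h i j * f i k) *R cl k (cl j u) = - ((f k i * h i j) *R cl k (cl j u))" for i j k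
   using f[of i k] by simp
 qed
 finally show ?thesis unfolding bil_def[of "%i j. SUM l. h i l * f l j - f i l * h l j"]
  by (simp add: sum_subtractf scaleR_diff_left)
qed

lemma inner_bil:
 assumes f: "!!i j. f i j = - f j i"
 shows "bil f u \<bullet> w = - (u \<bullet> bil f w)"
proof -
 have "(SUM i. SUM j. f i j * (cl i (cl j u) \<bullet> w)) = (SUM i. SUM j. f i j * (u \<bullet> cl j (cl i w)))"
  by (simp add: inner_cl)
 also have "... = (SUM i. SUM j. f j i * (u \<bullet> cl i (cl j w)))" by (rule sum.swap)
 also have "... = - (SUM i. SUM j. f i j * (u \<bullet> cl i (cl j w)))"
  unfolding sum_negf[symmetric] by (intro sum.cong refl) (subst f, simp)
 finally show ?thesis by (simp add: bil_def inner_sum_left inner_sum_right)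
qed

text \<open>This is where the curvature term collapses to a scalar. Moving one Clifford factor
  around the other two costs a contraction: X1 = X0 + 2 Z and X2 = X0 + 4 Z. By the Bianchi identity
  X0 + X1 + X2 = 0, hence 3 X0 = -6 Z.\<close>

lemma clifford_bianchi:
 fixes R :: "'n::finite => 'n => 'n => real"
 assumes cyc: "!!p q i. R p q i + R q i p + R i p q = 0" and anti: "!!p q i. R p q i = - R q p i"
 shows "(SUM p. SUM q. SUM i. R p q i *R cl p (cl q (cl i w))) = (-2) *R (SUM p. SUM q. R p q q *R cl p w)"
proof -
 define Z where "Z = (SUM p. SUM q. R p q q *R cl p w)"
 define X0 where "X0 = (SUM p. SUM q. SUM i. R p q i *R cl p (cl q (cl i w)))"
 define X1 where "X1 = (SUM p. SUM q. SUM i. R p q i *R cl q (cl i (cl p w)))"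
 define X2 where "X2 = (SUM p. SUM q. SUM i. R p q i *R cl i (cl p (cl q w)))"
 have Rpp: "R p p i = 0" for p i using anti[of p p i] by simp
 have rot: "cl p (cl q (cl i w)) = cl q (cl i (cl p w)) + (if p = i then 2 else 0) *R cl q w - (if p = q then 2 else 0) *R cl i w" for p q i
 proof -
  have "cl p (cl q (cl i w)) = - cl q (cl p (cl i w)) - (if p = q then 2 else 0) *R cl i w" by (rule cl_cl_cases)
  also have "cl p (cl i w) = - cl i (cl p w) - (if p = i then 2 else 0) *R w" by (rule cl_cl_cases)
  finally show ?thesis by (simp add: cl_simps)
 qed
 have t0: "R p q i *R cl p (cl q (cl i w)) = R p q i *R cl q (cl i (cl p w))
   + (if p = i then 2 else 0) *R R p q i *R cl q w - (if p = q then 2 else 0) *R R p q i *R cl i w" for p q i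
  by (subst rot) (simp add: scaleR_add_right scaleR_diff_right)
 have t1: "R p q i *R cl q (cl i (cl p w)) = R p q i *R cl i (cl p (cl q w))
   + (if q = p then 2 else 0) *R R p q i *R cl i w - (if q = i then 2 else 0) *R R p q i *R cl p w" for p q i
  by (subst rot) (simp add: scaleR_add_right scaleR_diff_right)
 have "X0 = (SUM p. SUM q. SUM i. R p q i *R cl q (cl i (cl p w))
   + (if p = i then 2 else 0) *R R p q i *R cl q w - (if p = q then 2 else 0) *R R p q i *R cl i w)"
  unfolding X0_def by (rule sum.cong[OF refl])+ (rule t0)
 also have "... = X1 + (SUM p. SUM q. 2 *R R p q p *R cl q w) - (SUM p. SUM q. SUM i. (if p = q then 2 else 0) *R R p q i *R cl i w)"
  unfolding X1_def by (simp only: sum.distrib sum_subtractf sum_scaleR_delta)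
 also have "(SUM p. SUM q. SUM i. (if p = q then 2 else 0) *R R p q i *R cl i w) = 0"
  by (intro sum.neutral ballI) (auto simp: Rpp)
 also have "(SUM p. SUM q. 2 *R R p q p *R cl q w) = - 2 *R Z"
 proof -
  have "2 *R R q p q *R cl p w = - 2 *R R p q q *R cl p w" for p q
   using anti[of q p q] by simp
  then show ?thesis unfolding Z_def scaleR_sum_right by (subst sum.swap) (simp only:)
 qed
 finally have A: "X0 = X1 - 2 *R Z" by simp
 have "X1 = (SUM p. SUM q. SUM i. R p q i *R cl i (cl p (cl q w))
   + (if q = p then 2 else 0) *R R p q i *R cl i w - (if q = i then 2 else 0) *R R p q i *R cl p w)"
  unfolding X1_def by (rule sum.cong[OF refl])+ (rule t1)
 also have "... = X2 + (SUM p. SUM q. SUM i. (if q = p then 2 else 0) *R R p q i *R cl i w) - (SUM p. SUM q. 2 *R R p q q *R cl p w)"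
  unfolding X2_def by (simp only: sum.distrib sum_subtractf sum_scaleR_delta)
 also have "(SUM p. SUM q. SUM i. (if q = p then 2 else 0) *R R p q i *R cl i w) = 0"
  by (intro sum.neutral ballI) (auto simp: Rpp)
 also have "(SUM p. SUM q. 2 *R R p q q *R cl p w) = 2 *R Z"
  unfolding Z_def scaleR_sum_right ..
 finally have B: "X1 = X2 - 2 *R Z" by simp
 have X1': "X1 = (SUM p. SUM q. SUM i. R i p q *R cl p (cl q (cl i w)))"
  unfolding X1_def by (rule sum3_rotate[symmetric])
 have X2': "X2 = (SUM p. SUM q. SUM i. R q i p *R cl p (cl q (cl i w)))"
  unfolding X2_def by (rule sum3_rotate)
 have "X0 + X2 + X1 = (SUM p. SUM q. SUM i. (R p q i + R q i p + R i p q) *R cl p (cl q (cl i w)))"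
  unfolding X1' X2' X0_def by (simp add: scaleR_add_left sum.distrib)
 then have C: "X0 + X2 + X1 = 0" by (simp add: cyc)
 have "3 *R X0 = 3 *R ((-2) *R Z)"
 proof -
  have "X1 = X0 + 2 *R Z" using A by simp
  moreover have "X2 = X0 + 4 *R Z"
  proof -
   have "X2 = X1 + 2 *R Z" using B by simp
   then show ?thesis using A by (simp add: flip: scaleR_add_left)
  qed
  ultimately have "X0 + (X0 + 4 *R Z) + (X0 + 2 *R Z) = 0" using C by simp
  moreover have "X0 + (X0 + 4 *R Z) + (X0 + 2 *R Z) = 3 *R X0 + 6 *R Z"
   by (simp add: vec_eq_iff)
  ultimately show ?thesis by (simp add: eq_neg_iff_add_eq_0)
 qed
 then show ?thesis unfolding X0_def Z_def by (simp only: scaleR_cancel_left) simp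
qed

section \<open>The Dirac operator and the Lichnerowicz formula\<close>

context framed begin

text \<open>Clifford multiplication by the coordinate covector dx^a.\<close>

definition A :: "'n => real^'n => real^('n set) => real^('n set)" where
 "A a x u = (SUM i. E i a x *R cl i u)"

lemma A_linear: "linear (A a x)"
 by (rule linearI) (simp_all add: A_def cl_simps scaleR_add_right sum.distrib scaleR_sum_right mult.commute)

lemmas A_simps = linear_add[OF A_linear] linear_scale[OF A_linear] linear_neg[OF A_linear]
 linear_diff[OF A_linear] linear_0[OF A_linear]
lemmas A_sum = linear_sum[OF A_linear]

lemma inner_A: "A a x u \<bullet> w = - (u \<bullet> A a x w)"
 unfolding A_def by (simp add: inner_sum_left inner_sum_right inner_cl sum_negf)

lemma A_ch: "A a x (ch j u) = - ch j (A a x u)"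
 unfolding A_def by (simp add: cl_ch ch_sum ch_simps sum_negf)

lemma A_A: "A a x (A b x u) = - A b x (A a x u) - (2 * G a b x) *R u"
proof -
 have "A a x (A b x u) = (SUM i. SUM j. (E i a x * E j b x) *R cl i (cl j u))"
  unfolding A_def by (simp add: cl_sum cl_simps scaleR_sum_right)
 also have "... = - (SUM i. SUM j. (E i a x * E j b x) *R cl j (cl i u))
   - (SUM i. SUM j. (if i = j then 2 else 0) *R (E i a x * E j b x) *R u)"
 proof -
  have "(E i a x * E j b x) *R cl i (cl j u) = - ((E i a x * E j b x) *R cl j (cl i u))
    - (if i = j then 2 else 0) *R (E i a x * E j b x) *R u" for i j
   by (subst cl_cl_cases) (simp add: scaleR_diff_right)
  then show ?thesis by (simp only: sum_subtractf sum_negf)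
 qed
 also have "(SUM i. SUM j. (E i a x * E j b x) *R cl j (cl i u)) = A b x (A a x u)"
  unfolding A_def by (subst sum.swap) (simp add: cl_sum cl_simps scaleR_sum_right mult.commute)
 also have "(SUM i. SUM j. (if i = j then 2 else 0) *R (E i a x * E j b x) *R u) = (2 * G a b x) *R u"
  unfolding sum_scaleR_delta by (simp flip: scaleR_sum_left sum_distrib_left add: E_E)
 finally show ?thesis .
qed

lemma A_inner_A: "A a x u \<bullet> A b x u = G a b x * (u \<bullet> u)"
proof -
 have "A a x u \<bullet> A b x u = (SUM i. SUM j. E i a x * (E j b x * (cl i u \<bullet> cl j u)))"
  unfolding A_def[of a] inner_sum_left inner_scaleR_left
  unfolding A_def inner_sum_right inner_scaleR_right sum_distrib_left ..
 also have "... = (SUM i. SUM j. (if i = j then 1 else 0) * (E i a x * E j b x * (u \<bullet> u)))"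
  by (intro sum.cong refl) (simp add: inner_cl inner_cl_cl)
 finally show ?thesis unfolding sum_delta_left by (simp add: E_E flip: sum_distrib_right)
qed

definition nab :: "'n => (real^'n => real^('n set)) => real^'n => real^('n set)" where
 "nab a psi x = pv a psi x + bil (%i j. om a i j x) (psi x)"

definition Dirac :: "(real^'n => real^('n set)) => real^'n => real^('n set)" where
 "Dirac psi x = (SUM a. A a x (nab a psi x))"

lemma smooth_A: "smooth_map psi ==> smooth_map (%x. A a x (psi x))"
 unfolding A_def by (intro smooth_map_intros E_smooth)

lemma smooth_bil: "smooth_map psi ==> (!!i j. smooth_fun (%x. f x i j)) ==> smooth_map (%x. bil (f x) (psi x))"
 unfolding bil_def by (intro smooth_map_intros smooth_const)

lemma smooth_nab: "smooth_map psi ==> smooth_map (nab a psi)"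
 unfolding nab_def[abs_def] by (intro smooth_map_intros smooth_bil om_smooth)

lemma smooth_Dirac: "smooth_map psi ==> smooth_map (Dirac psi)"
 unfolding Dirac_def[abs_def] by (intro smooth_map_intros smooth_A smooth_nab)

lemma inner_bil_om: "bil (%i j. om a i j x) u \<bullet> w = - (u \<bullet> bil (%i j. om a i j x) w)"
 by (rule inner_bil) (rule om_antisym)

lemma pd_inner_nab:
 assumes "smooth_map psi" "smooth_map phi"
 shows "pd a (%x. psi x \<bullet> phi x) x = nab a psi x \<bullet> phi x + psi x \<bullet> nab a phi x"
 unfolding pd_inner[OF assms] nab_def by (simp add: inner_add_left inner_add_right inner_bil_om)

lemma nab_scale: "smooth_fun f ==> smooth_map psi ==>
  nab a (%x. f x *R psi x) x = pd a f x *R psi x + f x *R nab a psi x"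
 unfolding nab_def by (simp add: pv_scale bil_simps scaleR_add_right)

lemma nab_ch: "smooth_map psi ==> nab a (%x. ch j (psi x)) x = ch j (nab a psi x)"
 unfolding nab_def by (simp add: pv_ch bil_ch ch_simps)

lemma nab_sum: "(!!i. i : I ==> smooth_map (psi i)) ==> nab a (%x. \<Sum>i\<in>I. psi i x) x = (\<Sum>i\<in>I. nab a (psi i) x)"
 unfolding nab_def by (simp add: pv_sum linear_sum[OF bil_linear] sum.distrib)

lemma nab_A:
 assumes psi: "smooth_map psi"
 shows "nab a (%x. A b x (psi x)) x = A b x (nab a psi x) - (SUM c. \<Gamma> b a c x *R A c x (psi x))"
proof -
 let ?u = "psi x"
 have "pv a (%x. A b x (psi x)) x = (SUM m. pd a (E m b) x *R cl m ?u) + A b x (pv a psi x)"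
  unfolding A_def using psi by (subst pv_sum) (auto intro!: smooth_map_intros E_smooth
   simp: pv_scale pv_cl E_smooth smooth_map_cl sum.distrib)
 moreover have "bil (%i j. om a i j x) (A b x ?u) = A b x (bil (%i j. om a i j x) ?u)
   + (SUM m. SUM j. (E m b x * om a m j x) *R cl j ?u)"
  unfolding A_def linear_sum[OF bil_linear] bil_simps bil_cl[of "%i j. om a i j x", OF om_antisym]
  by (simp add: scaleR_add_right sum.distrib scaleR_sum_right)
 moreover have "(SUM m. SUM j. (E m b x * om a m j x) *R cl j ?u)
   = - (SUM j. (pd a (E j b) x + (SUM c. \<Gamma> b a c x * E j c x)) *R cl j ?u)"
 proof -
  have "(SUM m. SUM j. (E m b x * om a m j x) *R cl j ?u) = (SUM j. (SUM m. E m b x * om a m j x) *R cl j ?u)"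
   unfolding scaleR_sum_left by (rule sum.swap)
  also have "... = (SUM j. - (SUM m. E m b x * om a j m x) *R cl j ?u)"
  proof (rule sum.cong[OF refl])
   fix j
   have "(SUM m. E m b x * om a m j x) = - (SUM m. E m b x * om a j m x)"
    unfolding sum_negf[symmetric] by (rule sum.cong[OF refl]) (subst om_antisym, simp)
   then show "(SUM m. E m b x * om a m j x) *R cl j ?u = - (SUM m. E m b x * om a j m x) *R cl j ?u" by simp
  qed
  finally show ?thesis unfolding E_om by (simp only: scaleR_minus_left sum_negf)
 qed
 moreover have "(SUM j. (SUM c. \<Gamma> b a c x * E j c x) *R cl j ?u) = (SUM c. \<Gamma> b a c x *R A c x ?u)"
  unfolding A_def scaleR_sum_left scaleR_sum_right by (subst sum.swap) simp
 ultimately show ?thesis unfolding nab_def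
  by (simp add: A_simps scaleR_add_left sum.distrib)
qed

lemma nab_nab:
 assumes psi: "smooth_map psi"
 shows "nab a (nab b psi) x - nab b (nab a psi) x = bil (%i j. rho a b i j x) (psi x)"
proof -
 have *: "nab a (nab b psi) x = pv a (pv b psi) x + bil (%i j. pd a (om b i j) x) (psi x)
   + bil (%i j. om b i j x) (pv a psi x) + bil (%i j. om a i j x) (pv b psi x)
   + bil (%i j. om a i j x) (bil (%i j. om b i j x) (psi x))" for a b
 proof -
  have "pv a (%x. bil (%i j. om b i j x) (psi x)) x = bil (%i j. pd a (om b i j) x) (psi x) + bil (%i j. om b i j x) (pv a psi x)"
   unfolding bil_def using psi
   by (simp add: pv_scale pv_sum pv_cl om_smooth smooth_map_intros sum.distrib scaleR_add_right)
  then show ?thesis unfolding nab_def[abs_def] using psi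
   by (simp add: pv_add smooth_map_pv smooth_bil om_smooth bil_simps)
 qed
 show ?thesis unfolding * using bil_bil[of "%i j. om a i j x" "%i j. om b i j x" "psi x", OF om_antisym]
  by (simp add: pv_commute[OF psi, of a b] rho_def flip: bil_add bil_diff)
qed

text \<open>In the frame the curvature term carries four Clifford factors.
  \<open>clifford_bianchi\<close> contracts the first three to one, and in the pairing with u only
  equal indices of the remaining two survive by \<open>inner_cl_cl\<close>.\<close>

lemma scal_clifford:
 "(SUM a. SUM b. u \<bullet> A a x (A b x (bil (%i j. rho a b i j x) u))) = 1/2 * scal g x * (u \<bullet> u)"
proof -
 have "(SUM a. SUM b. A a x (A b x (bil (%i j. rho a b i j x) u)))
  = (1/4) *R (SUM j. SUM p. SUM q. SUM i. R4 p q i j x *R cl p (cl q (cl i (cl j u))))"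
 proof -
  have "A a x (A b x w) = (SUM p. SUM q. (E p a x * E q b x) *R cl p (cl q w))" for a b w
   unfolding A_def by (simp add: cl_sum cl_simps scaleR_sum_right)
  then have "(SUM a. SUM b. A a x (A b x (bil (%i j. rho a b i j x) u)))
   = (SUM a. SUM b. SUM p. SUM q. SUM i. SUM j. (1/4) *R (E p a x * E q b x * rho a b i j x) *R cl p (cl q (cl i (cl j u))))"
   unfolding bil_def by (simp add: cl_sum cl_simps scaleR_sum_right mult_ac)
  also have "... = (SUM p. SUM q. SUM a. SUM b. SUM i. SUM j. (1/4) *R (E p a x * E q b x * rho a b i j x) *R cl p (cl q (cl i (cl j u))))"
   by (subst sum3_rotate, rule sum.cong[OF refl], rule sum3_rotate)
  also have "... = (SUM p. SUM q. SUM i. SUM j. SUM a. SUM b. (1/4) *R (E p a x * E q b x * rho a b i j x) *R cl p (cl q (cl i (cl j u))))"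
   by (rule sum.cong[OF refl], rule sum.cong[OF refl], subst sum3_rotate, rule sum.cong[OF refl], rule sum3_rotate)
  also have "... = (SUM p. SUM q. SUM i. SUM j. (1/4) *R R4 p q i j x *R cl p (cl q (cl i (cl j u))))"
   unfolding R4_def by (simp add: scaleR_sum_left scaleR_sum_right)
  also have "... = (SUM p. SUM j. SUM q. SUM i. (1/4) *R R4 p q i j x *R cl p (cl q (cl i (cl j u))))"
   by (rule sum.cong[OF refl], rule sum3_rotate)
  also have "... = (SUM j. SUM p. SUM q. SUM i. (1/4) *R R4 p q i j x *R cl p (cl q (cl i (cl j u))))"
   by (rule sum.swap)
  finally show ?thesis by (simp add: scaleR_sum_right)
 qed
 also have "... = (1/4) *R (SUM j. (-2) *R (SUM p. SUM q. R4 p q q j x *R cl p (cl j u)))"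
  by (intro arg_cong[where f="%z. (1/4) *R z"] sum.cong refl clifford_bianchi R4_bianchi R4_antisym(1))
 finally have "(SUM a. SUM b. u \<bullet> A a x (A b x (bil (%i j. rho a b i j x) u)))
   = u \<bullet> (1/4) *R (SUM j. (-2) *R (SUM p. SUM q. R4 p q q j x *R cl p (cl j u)))"
  by (simp only: inner_sum_right[symmetric])
 also have "... = - 1/2 * (SUM j. SUM p. SUM q. R4 p q q j x * (u \<bullet> cl p (cl j u)))"
  by (simp add: inner_sum_right sum_distrib_left sum_negf mult_ac)
 also have "(SUM j. SUM p. SUM q. R4 p q q j x * (u \<bullet> cl p (cl j u)))
  = (SUM j. SUM p. (if p = j then 1 else 0) * (SUM q. R4 p q q j x * (- (u \<bullet> u))))"
  by (intro sum.cong refl) (simp add: inner_cl_cl)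
 also have "... = - (SUM j. SUM q. R4 j q q j x) * (u \<bullet> u)"
  unfolding sum_delta_left by (simp add: sum_distrib_right sum_negf)
 finally show ?thesis unfolding R4_scal by simp
qed

text \<open>Formal self-adjointness of the Dirac operator with the divergence kept explicit; the
  Christoffel terms from the density cancel those from \<open>nab_A\<close> after summation.\<close>

lemma divergence_A:
 assumes psi: "smooth_map psi" and phi: "smooth_map phi"
 shows "(SUM a. pd a (%x. vol x * (psi x \<bullet> A a x (phi x))) x)
  = vol x * (psi x \<bullet> Dirac phi x - Dirac psi x \<bullet> phi x)"
proof -
 have "pd a (%x. vol x * (psi x \<bullet> A a x (phi x))) x = vol x * ((SUM b. \<Gamma> b b a x * (psi x \<bullet> A a x (phi x)))
   - (SUM c. \<Gamma> a a c x * (psi x \<bullet> A c x (phi x)))) + vol x * (psi x \<bullet> A a x (nab a phi x) - A a x (nab a psi x) \<bullet> phi x)" for a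
  using psi phi by (simp add: pd_mult vol_smooth smooth_inner smooth_A pd_vol pd_inner_nab nab_A
    inner_diff_right inner_sum_right inner_A sum_distrib_right sum_distrib_left algebra_simps)
 moreover have "(SUM a. SUM b. \<Gamma> b b a x * (psi x \<bullet> A a x (phi x))) = (SUM a. SUM c. \<Gamma> a a c x * (psi x \<bullet> A c x (phi x)))"
  by (rule sum.swap)
 ultimately show ?thesis unfolding Dirac_def
  by (simp add: sum.distrib sum_subtractf inner_sum_left inner_sum_right flip: sum_distrib_left)
qed

definition Hess :: "'n => 'n => (real^'n => real^('n set)) => real^'n => real^('n set)" where
 "Hess a b psi x = nab a (nab b psi) x - (SUM c. \<Gamma> c a b x *R nab c psi x)"

lemma divergence_nab:
 assumes psi: "smooth_map psi"
 shows "(SUM a. pd a (%x. vol x * (SUM b. G a b x * (psi x \<bullet> nab b psi x))) x)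
  = vol x * ((SUM a. SUM b. G a b x * (nab a psi x \<bullet> nab b psi x))
   + (SUM a. SUM b. G a b x * (psi x \<bullet> Hess a b psi x)))"
proof -
 define P where "P b = psi x \<bullet> nab b psi x" for b
 have *: "pd a (%x. vol x * (SUM b. G a b x * (psi x \<bullet> nab b psi x))) x =
   vol x * ((SUM c. \<Gamma> c c a x) * (SUM b. G a b x * P b)
    + (SUM b. pd a (%y. G a b y) x * P b)
    + (SUM b. G a b x * (nab a psi x \<bullet> nab b psi x)) + (SUM b. G a b x * (psi x \<bullet> nab a (nab b psi) x)))" for a
 proof -
  have "pd a (%x. SUM b. G a b x * (psi x \<bullet> nab b psi x)) x
   = (SUM b. pd a (%y. G a b y) x * P b + G a b x * (nab a psi x \<bullet> nab b psi x + psi x \<bullet> nab a (nab b psi) x))"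
   using psi by (subst pd_sum) (auto intro!: smooth_mult G_smooth smooth_inner smooth_nab
     simp: pd_mult G_smooth smooth_inner smooth_nab pd_inner_nab P_def)
  moreover have "smooth_fun (%x. SUM b. G a b x * (psi x \<bullet> nab b psi x))"
   using psi by (intro smooth_sum smooth_mult G_smooth smooth_inner smooth_nab)
  ultimately show ?thesis
   by (simp add: pd_mult vol_smooth pd_vol P_def algebra_simps sum.distrib)
 qed
 have "(SUM a. (SUM c. \<Gamma> c c a x) * (SUM b. G a b x * P b)) + (SUM a. SUM b. pd a (%y. G a b y) x * P b)
   = - (SUM a. SUM b. SUM c. G a b x * (\<Gamma> c a b x * P c))"
 proof -
  have 1: "(SUM a. SUM b. pd a (%y. G a b y) x * P b)
   = - (SUM a. SUM b. SUM m. \<Gamma> a a m x * G m b x * P b) - (SUM a. SUM b. SUM m. \<Gamma> b a m x * G a m x * P b)"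
   unfolding pd_G by (simp add: left_diff_distrib sum_subtractf sum_negf sum_distrib_right)
  have 2: "(SUM a. SUM b. SUM m. \<Gamma> a a m x * G m b x * P b)
    = (SUM m. (SUM a. \<Gamma> a a m x) * (SUM b. G m b x * P b))"
   unfolding sum_product by (subst sum3_rotate) (simp add: mult_ac)
  have 3: "(SUM a. SUM b. SUM m. \<Gamma> b a m x * G a m x * P b) = (SUM a. SUM b. SUM c. G a b x * (\<Gamma> c a b x * P c))"
   by (rule sum.cong[OF refl], subst sum.swap) (simp add: mult_ac)
  show ?thesis unfolding 1 2 3 by simp
 qed
 moreover have "(SUM a. SUM b. G a b x * (psi x \<bullet> Hess a b psi x))
   = (SUM a. SUM b. G a b x * (psi x \<bullet> nab a (nab b psi) x)) - (SUM a. SUM b. SUM c. G a b x * (\<Gamma> c a b x * P c))"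
  unfolding Hess_def P_def by (simp add: inner_diff_right inner_sum_right right_diff_distrib sum_subtractf sum_distrib_left)
 ultimately show ?thesis unfolding * by (simp add: sum.distrib flip: sum_distrib_left)
qed

lemma Hess_commutator:
 assumes "smooth_map psi" shows "Hess a b psi x - Hess b a psi x = bil (%i j. rho a b i j x) (psi x)"
 using nab_nab[OF assms, of a b x] christ_sym[of _ a b x] unfolding Hess_def by simp

text \<open>Double the sum and exchange a and b in one copy: the Clifford relation yields the
  Laplacian, and the commutator of second derivatives yields the curvature term.\<close>

lemma Dirac_Dirac:
 assumes psi: "smooth_map psi"
 shows "psi x \<bullet> Dirac (Dirac psi) x = - (SUM a. SUM b. G a b x * (psi x \<bullet> Hess a b psi x)) + 1/4 * scal g x * (psi x \<bullet> psi x)"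
proof -
 define S where "S a b = bil (%i j. rho a b i j x) (psi x)" for a b
 have "Dirac (Dirac psi) x = (SUM a. SUM b. A a x (A b x (nab a (nab b psi) x))) - (SUM a. SUM b. SUM c. \<Gamma> b a c x *R A a x (A c x (nab b psi x)))"
  unfolding Dirac_def[of "Dirac psi"] unfolding Dirac_def[abs_def] using psi
  by (simp add: nab_sum smooth_A smooth_nab nab_A A_sum A_simps sum_subtractf)
 also have "(SUM a. SUM b. SUM c. \<Gamma> b a c x *R A a x (A c x (nab b psi x))) = (SUM a. SUM b. SUM c. \<Gamma> c a b x *R A a x (A b x (nab c psi x)))"
  by (rule sum.cong[OF refl], rule sum.swap)
 also have "(SUM a. SUM b. A a x (A b x (nab a (nab b psi) x))) - (SUM a. SUM b. SUM c. \<Gamma> c a b x *R A a x (A b x (nab c psi x)))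
   = (SUM a. SUM b. A a x (A b x (Hess a b psi x)))"
  unfolding Hess_def by (simp add: A_simps A_sum sum_subtractf)
 finally have D: "psi x \<bullet> Dirac (Dirac psi) x = (SUM a. SUM b. psi x \<bullet> A a x (A b x (Hess a b psi x)))" (is "_ = ?H")
  by (simp add: inner_sum_right)
 have t: "psi x \<bullet> A a x (A b x (Hess a b psi x)) + psi x \<bullet> A b x (A a x (Hess b a psi x))
   = - 2 * (G a b x * (psi x \<bullet> Hess a b psi x)) + psi x \<bullet> A b x (A a x (S b a))" for a b
 proof -
  have "Hess b a psi x = Hess a b psi x + S b a"
   using Hess_commutator[OF psi, of b a x] by (simp add: S_def algebra_simps)
  then show ?thesis using A_A[of a x b "Hess a b psi x"]
   by (simp add: A_simps inner_add_right inner_diff_right)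
 qed
 have "2 * ?H = ?H + (SUM a. SUM b. psi x \<bullet> A b x (A a x (Hess b a psi x)))"
  by (subst sum.swap[of _ UNIV UNIV, symmetric]) simp
 also have "... = (SUM a. SUM b. - 2 * (G a b x * (psi x \<bullet> Hess a b psi x)) + psi x \<bullet> A b x (A a x (S b a)))"
  unfolding t[symmetric] by (simp add: sum.distrib)
 also have "... = - 2 * (SUM a. SUM b. G a b x * (psi x \<bullet> Hess a b psi x)) + (SUM a. SUM b. psi x \<bullet> A b x (A a x (S b a)))"
  by (simp only: sum.distrib sum_distrib_left[symmetric])
 also have "(SUM a. SUM b. psi x \<bullet> A b x (A a x (S b a))) = 1/2 * scal g x * (psi x \<bullet> psi x)"
  by (subst sum.swap) (simp only: S_def scal_clifford)
 finally show ?thesis unfolding D by simp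
qed

lemma Lichnerowicz:
 assumes psi: "smooth_map psi"
 shows "vol x * (Dirac psi x \<bullet> Dirac psi x) = vol x * ((SUM a. SUM b. G a b x * (nab a psi x \<bullet> nab b psi x))
   + 1/4 * scal g x * (psi x \<bullet> psi x))
  - (SUM a. pd a (%x. vol x * (psi x \<bullet> A a x (Dirac psi x))) x)
  - (SUM a. pd a (%x. vol x * (SUM b. G a b x * (psi x \<bullet> nab b psi x))) x)"
 unfolding divergence_A[OF psi smooth_Dirac[OF psi]] divergence_nab[OF psi] Dirac_Dirac[OF psi]
 by (simp add: algebra_simps)

text \<open>\<open>ch j\<close> anticommutes with the Dirac operator, so the cross term of a
  potential f \<open>ch j\<close> with the operator is a divergence up to the derivative of f. The
  factor f is assumed only to have partial derivatives at x: it will be the C^1 potential h, or a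
  tangent that is singular on the side faces. Hence \<open>has_pd\<close> with an existential
  derivative.\<close>

lemma divergence_A_ch:
 assumes psi: "smooth_map psi" and f: "!!a. has_pd a f (df a) x"
 shows "\<exists>d. (\<forall>a. has_pd a (%x. vol x * (f x * (psi x \<bullet> A a x (ch j (psi x))))) (d a) x) \<and>
  (SUM a. d a) = vol x * ((SUM a. df a * (psi x \<bullet> A a x (ch j (psi x)))) - 2 * f x * (Dirac psi x \<bullet> ch j (psi x)))"
proof -
 define F where "F a x = vol x * (psi x \<bullet> A a x (ch j (psi x)))" for a x
 have sF: "smooth_fun (F a)" for a unfolding F_def[abs_def]
  using psi by (intro smooth_mult vol_smooth smooth_inner smooth_A smooth_map_ch)
 have "has_pd a (%x. f x * F a x) (df a * F a x + f x * pd a (F a) x) x" for a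
  by (intro has_pd_mult f smooth_fun_has_pd sF)
 moreover have "f x * F a x = vol x * (f x * (psi x \<bullet> A a x (ch j (psi x))))" for a x by (simp add: F_def)
 ultimately have 1: "has_pd a (%x. vol x * (f x * (psi x \<bullet> A a x (ch j (psi x))))) (df a * F a x + f x * pd a (F a) x) x" for a
  by simp
 have "Dirac (%x. ch j (psi x)) x = - ch j (Dirac psi x)"
  unfolding Dirac_def using psi by (simp add: nab_ch A_ch ch_sum sum_negf)
 then have "(SUM a. pd a (F a) x) = - 2 * vol x * (Dirac psi x \<bullet> ch j (psi x))"
  unfolding F_def[abs_def] divergence_A[OF psi smooth_map_ch[OF psi]]
  by (simp add: inner_ch[symmetric] inner_commute)
 moreover have "(SUM a. df a * F a x + f x * pd a (F a) x) = (SUM a. df a * F a x) + f x * (SUM a. pd a (F a) x)"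
  by (simp add: sum.distrib sum_distrib_left)
 moreover have "(SUM a. df a * F a x) = vol x * (SUM a. df a * (psi x \<bullet> A a x (ch j (psi x))))"
  by (simp add: F_def sum_distrib_left mult_ac)
 ultimately have "(SUM a. df a * F a x + f x * pd a (F a) x)
   = vol x * ((SUM a. df a * (psi x \<bullet> A a x (ch j (psi x)))) - 2 * f x * (Dirac psi x \<bullet> ch j (psi x)))"
  by (simp add: right_diff_distrib)
 with 1 show ?thesis by (intro exI[of _ "%a. df a * F a x + f x * pd a (F a) x"] conjI allI)
qed

lemma A_bound: "\<bar>SUM a. xi a * (u \<bullet> A a x w)\<bar> <= sqrt (SUM a. SUM b. G a b x * xi a * xi b) * (norm u * norm w)"
proof -
 define z where "z = (SUM a. xi a *R A a x w)"
 have "z \<bullet> z = (SUM a. SUM b. G a b x * xi a * xi b) * (w \<bullet> w)"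
  unfolding z_def inner_sum_left inner_scaleR_left
  unfolding inner_sum_right inner_scaleR_right A_inner_A by (simp add: sum_distrib_left sum_distrib_right mult_ac)
 then have nz: "norm z = sqrt (SUM a. SUM b. G a b x * xi a * xi b) * norm w"
  by (simp add: norm_eq_sqrt_inner real_sqrt_mult)
 have "(SUM a. xi a * (u \<bullet> A a x w)) = u \<bullet> z" by (simp add: z_def inner_sum_right)
 also have "\<bar>...\<bar> <= norm u * norm z" by (rule Cauchy_Schwarz_ineq2)
 finally show ?thesis unfolding nz by (simp add: mult_ac)
qed

text \<open>The Clifford trace of n frame components has square norm at most n times the sum of
  theirs; applied to the modified connection this is the source of q = n/(n-1).\<close>

lemma Dirac_Cauchy_Schwarz:
 "(SUM a. A a x (phi a)) \<bullet> (SUM a. A a x (phi a)) <= real CARD('n) * (SUM a. SUM b. G a b x * (phi a \<bullet> phi b))"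
proof -
 define p where "p i = (SUM a. E i a x *R phi a)" for i
 have "(SUM a. A a x (phi a)) = (SUM i. cl i (p i))"
  unfolding A_def p_def cl_sum cl_simps by (rule sum.swap)
 then have "(norm (SUM a. A a x (phi a)))\<^sup>2 <= (SUM i. norm (p i))\<^sup>2"
  by (intro power_mono) (auto intro: sum_norm_le)
 also have "... <= real CARD('n) * (SUM i. (norm (p i))\<^sup>2)"
  using Cauchy_Schwarz_ineq_sum[of "%_. 1" "%i. norm (p i)" UNIV] by simp
 also have "(SUM i. (norm (p i))\<^sup>2) = (SUM a. SUM b. G a b x * (phi a \<bullet> phi b))"
 proof -
  have "(SUM i. (norm (p i))\<^sup>2) = (SUM i. SUM a. SUM b. (E i a x * E i b x) * (phi a \<bullet> phi b))"
   unfolding power2_norm_eq_inner p_def inner_sum_left inner_scaleR_left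
   unfolding inner_sum_right inner_scaleR_right by (simp add: sum_distrib_left mult_ac)
  also have "... = (SUM a. SUM b. SUM i. (E i a x * E i b x) * (phi a \<bullet> phi b))"
   by (rule sum3_rotate[symmetric])
  finally show ?thesis by (simp add: E_E flip: sum_distrib_right)
 qed
 finally show ?thesis by (simp add: power2_norm_eq_inner)
qed

end

section \<open>Initial data: the Dirac--Witten operator and its boundary term\<close>

locale initial_data = framed e g E for e :: "'n::finite" and g and E +
 fixes k :: "real^'n => real^'n^'n"
 assumes k: "smooth_sym_field e k"
begin

lemma k_smooth: "smooth_fun (%x. k x $ i $ j)"
 using k unfolding smooth_sym_field_def by blast

lemma k_sym: "k x $ i $ j = k x $ j $ i"
 using k unfolding smooth_sym_field_def transpose_def by (metis vec_lambda_beta)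

abbreviation "tau x \<equiv> trk g k x"

lemma tau_smooth: "smooth_fun (trk g k)"
 unfolding trk_def[abs_def] by (intro smooth_intros G_smooth k_smooth)

definition Kc :: "'n => 'n => real^'n => real" where
 "Kc a c x = (SUM b. G a b x * k x $ b $ c)"

lemma Kc_smooth: "smooth_fun (Kc a c)"
 unfolding Kc_def[abs_def] by (intro smooth_intros G_smooth k_smooth)

text \<open>Plays the part of Clifford multiplication by the timelike normal: an isometric
  involution that anticommutes with all \<open>A a x\<close> and is parallel. The sign is chosen so
  that \<open>chi_A_sig\<close> comes out positive on the boundary condition.\<close>

definition sig :: "real^('n set) => real^('n set)" where "sig u = - ch e u"

lemma norm_sig [simp]: "norm (sig u) = norm u" by (simp add: sig_def)
lemma inner_sig_sig [simp]: "sig u \<bullet> sig u = u \<bullet> u" by (simp add: sig_def inner_ch)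
lemma A_sig: "A a x (sig u) = - sig (A a x u)" by (simp add: sig_def A_simps A_ch)
lemma inner_sig: "sig u \<bullet> w = u \<bullet> sig w" by (simp add: sig_def inner_ch)
lemma sig_sig [simp]: "sig (sig u) = u" by (simp add: sig_def ch_simps)
lemma smooth_sig: "smooth_map psi ==> smooth_map (%x. sig (psi x))"
 unfolding sig_def by (intro smooth_map_intros)
lemma nab_sig: "smooth_map psi ==> nab a (%x. sig (psi x)) x = sig (nab a psi x)"
 using nab_scale[of "%_. -1" "%x. ch e (psi x)" a x] by (simp add: sig_def nab_ch smooth_map_ch)
lemma inner_A_sig: "u \<bullet> A a x (sig w) = A a x (sig u) \<bullet> w"
 by (simp add: A_sig inner_sig inner_A)

text \<open>The Dirac--Witten operator. By \<open>sum_A_nabt\<close> it is the Clifford trace of the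
  connection \<open>nabt\<close>: only the trace of the symmetric tensor k survives.\<close>

definition Dt :: "(real^'n => real^('n set)) => real^'n => real^('n set)" where
 "Dt psi x = Dirac psi x - (tau x / 2) *R sig (psi x)"

definition nabt :: "'n => (real^'n => real^('n set)) => real^'n => real^('n set)" where
 "nabt a psi x = nab a psi x + (1/2) *R (SUM b. k x $ a $ b *R A b x (sig (psi x)))"

definition Qk :: "(real^'n => real^('n set)) => real^'n => real" where
 "Qk psi x = (SUM a. SUM c. Kc a c x * (nab a psi x \<bullet> A c x (sig (psi x))))"

definition divK :: "'n => real^'n => real" where
 "divK c x = (SUM a. pd a (Kc a c) x + (SUM b. \<Gamma> b b a x) * Kc a c x - (SUM d. \<Gamma> d a c x * Kc a d x))"

lemma sum_A_nabt: "(SUM a. A a x (nabt a psi x)) = Dt psi x"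
proof -
 let ?w = "sig (psi x)"
 define X where "X = (SUM a. SUM b. k x $ a $ b *R A a x (A b x ?w))"
 have "X = (SUM a. SUM b. - (k x $ a $ b *R A b x (A a x ?w)) - (2 * (G a b x * k x $ a $ b)) *R ?w)"
  unfolding X_def by (intro sum.cong refl) (subst A_A, simp add: scaleR_diff_right mult_ac)
 also have "... = - (SUM a. SUM b. k x $ a $ b *R A b x (A a x ?w)) - (2 * tau x) *R ?w"
  unfolding trk_def by (simp add: sum_subtractf sum_negf scaleR_sum_left sum_distrib_left)
 also have "(SUM a. SUM b. k x $ a $ b *R A b x (A a x ?w)) = X"
  unfolding X_def by (subst sum.swap) (intro sum.cong refl, metis k_sym)
 finally have "X + X = X + (- X - (2 * tau x) *R ?w)" by (rule arg_cong)
 then have "2 *R X = - (2 * tau x) *R ?w" unfolding scaleR_2 by simp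
 then have "(1/4) *R (2 *R X) = (1/4) *R (- (2 * tau x) *R ?w)" by (rule arg_cong)
 then have "(1/2) *R X = - (tau x / 2) *R ?w" by simp
 then show ?thesis unfolding nabt_def Dt_def Dirac_def X_def
  by (simp add: A_simps A_sum sum.distrib flip: scaleR_sum_right)
qed

lemma inner_nabt:
 "(SUM a. SUM b. G a b x * (nabt a psi x \<bullet> nabt b psi x))
 = (SUM a. SUM b. G a b x * (nab a psi x \<bullet> nab b psi x)) + Qk psi x + 1/4 * normsq_k g k x * (psi x \<bullet> psi x)"
proof -
 define w where "w = sig (psi x)"
 define kap where "kap a = (SUM b. k x $ a $ b *R A b x w)" for a
 have 1: "G a b x * (nabt a psi x \<bullet> nabt b psi x) = G a b x * (nab a psi x \<bullet> nab b psi x)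
   + 1/2 * (G a b x * (nab a psi x \<bullet> kap b)) + 1/2 * (G a b x * (nab b psi x \<bullet> kap a)) + 1/4 * (G a b x * (kap a \<bullet> kap b))" for a b
  unfolding nabt_def w_def[symmetric] kap_def[symmetric]
  by (simp add: inner_add_left inner_add_right inner_commute algebra_simps)
 have 2: "(SUM a. SUM b. G a b x * (nab a psi x \<bullet> kap b)) = Qk psi x"
 proof -
  have "(SUM b. G a b x * (nab a psi x \<bullet> kap b)) = (SUM c. Kc a c x * (nab a psi x \<bullet> A c x w))" for a
   unfolding kap_def Kc_def inner_sum_right inner_scaleR_right sum_distrib_left sum_distrib_right
   by (subst sum.swap) (simp add: mult_ac)
  then show ?thesis unfolding Qk_def w_def by simp
 qed
 have 3: "(SUM a. SUM b. G a b x * (nab b psi x \<bullet> kap a)) = Qk psi x"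
  unfolding 2[symmetric] by (subst sum.swap) (intro sum.cong refl, metis G_sym)
 have 4: "(SUM a. SUM b. G a b x * (kap a \<bullet> kap b)) = normsq_k g k x * (psi x \<bullet> psi x)"
 proof -
  have "kap a \<bullet> kap b = (SUM c. SUM d. k x $ a $ c * k x $ b $ d * G c d x * (psi x \<bullet> psi x))" for a b
   unfolding kap_def inner_sum_left inner_scaleR_left
   unfolding inner_sum_right inner_scaleR_right A_inner_A w_def by (simp add: sum_distrib_left mult_ac)
  then have "(SUM a. SUM b. G a b x * (kap a \<bullet> kap b))
   = (SUM a. SUM b. SUM c. SUM d. G a b x * G c d x * k x $ a $ c * k x $ b $ d) * (psi x \<bullet> psi x)"
   by (simp add: sum_distrib_left sum_distrib_right mult_ac)
  also have "(SUM a. SUM b. SUM c. SUM d. G a b x * G c d x * k x $ a $ c * k x $ b $ d) = normsq_k g k x"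
   unfolding normsq_k_def by (rule sum.cong[OF refl], rule sum.swap)
  finally show ?thesis .
 qed
 show ?thesis unfolding 1 sum.distrib sum_distrib_left[symmetric] 2 3 4 by simp
qed

lemma inner_Dt: "Dt psi x \<bullet> Dt psi x = Dirac psi x \<bullet> Dirac psi x - tau x * (Dirac psi x \<bullet> sig (psi x)) + 1/4 * (tau x)\<^sup>2 * (psi x \<bullet> psi x)"
 unfolding Dt_def by (simp add: inner_diff_left inner_diff_right inner_commute power2_eq_square algebra_simps)

text \<open>The cross term \<open>Qk\<close> in the square of \<open>nabt\<close> has no sign. Since
  \<open>A c x\<close> composed with \<open>sig\<close> is self-adjoint, the product rule gives
  \<open>Qk\<close> twice, so it is half a divergence up to the divergence of k.\<close>

lemma divergence_Kc:
 assumes psi: "smooth_map psi"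
 shows "(SUM a. pd a (%x. vol x * (SUM c. Kc a c x * (psi x \<bullet> A c x (sig (psi x))))) x)
  = vol x * (2 * Qk psi x + (SUM c. divK c x * (psi x \<bullet> A c x (sig (psi x)))))"
proof -
 define P where "P c = psi x \<bullet> A c x (sig (psi x))" for c
 have pP: "pd a (%x. psi x \<bullet> A c x (sig (psi x))) x = 2 * (nab a psi x \<bullet> A c x (sig (psi x))) - (SUM d. \<Gamma> c a d x * P d)" for a c
 proof -
  have "pd a (%x. psi x \<bullet> A c x (sig (psi x))) x = nab a psi x \<bullet> A c x (sig (psi x)) + psi x \<bullet> nab a (%x. A c x (sig (psi x))) x"
   using psi by (intro pd_inner_nab smooth_A smooth_sig)
  also have "nab a (%x. A c x (sig (psi x))) x = A c x (sig (nab a psi x)) - (SUM d. \<Gamma> c a d x *R A d x (sig (psi x)))"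
   using nab_A[OF smooth_sig[OF psi]] nab_sig[OF psi] by simp
  also have "psi x \<bullet> ... = nab a psi x \<bullet> A c x (sig (psi x)) - (SUM d. \<Gamma> c a d x * P d)"
   unfolding inner_diff_right inner_A_sig[of "psi x" c x "nab a psi x"] P_def
   by (simp only: inner_sum_right inner_scaleR_right inner_commute)
  finally show ?thesis by simp
 qed
 have *: "pd a (%x. vol x * (SUM c. Kc a c x * (psi x \<bullet> A c x (sig (psi x))))) x =
   vol x * ((SUM b. \<Gamma> b b a x) * (SUM c. Kc a c x * P c) + (SUM c. pd a (Kc a c) x * P c)
   + 2 * (SUM c. Kc a c x * (nab a psi x \<bullet> A c x (sig (psi x)))) - (SUM c. SUM d. Kc a c x * (\<Gamma> c a d x * P d)))" for a
 proof -
  have s: "smooth_fun (%x. psi x \<bullet> A c x (sig (psi x)))" for c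
   using psi by (intro smooth_inner smooth_A smooth_sig)
  define f where "f = (%x. SUM c. Kc a c x * (psi x \<bullet> A c x (sig (psi x))))"
  define s1 where "s1 = (SUM c. Kc a c x * P c)"
  define s2 where "s2 = (SUM c. pd a (Kc a c) x * P c)"
  define s3 where "s3 = (SUM c. Kc a c x * (nab a psi x \<bullet> A c x (sig (psi x))))"
  define s4 where "s4 = (SUM c. SUM d. Kc a c x * (\<Gamma> c a d x * P d))"
  have "pd a f x
   = (SUM c. pd a (Kc a c) x * P c + Kc a c x * (2 * (nab a psi x \<bullet> A c x (sig (psi x))) - (SUM d. \<Gamma> c a d x * P d)))"
   unfolding f_def
   by (subst pd_sum) (auto intro!: smooth_mult Kc_smooth s simp: pd_mult Kc_smooth s pP P_def)
  also have "... = s2 + 2 * s3 - s4"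
   unfolding s2_def s3_def s4_def
   by (simp add: right_diff_distrib sum.distrib sum_subtractf sum_distrib_left mult_ac)
  finally have pf: "pd a f x = s2 + 2 * s3 - s4" .
  have "smooth_fun f" unfolding f_def by (intro smooth_sum smooth_mult Kc_smooth s)
  then have "pd a (%x. vol x * f x) x = pd a vol x * f x + vol x * pd a f x" by (rule pd_mult[OF vol_smooth])
  also have "f x = s1" by (simp add: f_def s1_def P_def)
  also have "pd a vol x * s1 + vol x * pd a f x = vol x * ((SUM b. \<Gamma> b b a x) * s1 + s2 + 2 * s3 - s4)"
   unfolding pf pd_vol by (simp add: algebra_simps)
  finally have "pd a (%x. vol x * f x) x = vol x * ((SUM b. \<Gamma> b b a x) * s1 + s2 + 2 * s3 - s4)" .
  then show ?thesis unfolding f_def s1_def s2_def s3_def s4_def .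
 qed
 have sw: "(SUM a. SUM c. SUM d. Kc a c x * (\<Gamma> c a d x * P d)) = (SUM a. SUM c. (SUM d. \<Gamma> d a c x * Kc a d x) * P c)"
  unfolding sum_distrib_right by (rule sum.cong[OF refl], subst sum.swap) (simp add: mult_ac)
 have dv: "(SUM c. divK c x * P c) = (SUM a. SUM c. (pd a (Kc a c) x + (SUM b. \<Gamma> b b a x) * Kc a c x - (SUM d. \<Gamma> d a c x * Kc a d x)) * P c)"
  unfolding divK_def sum_distrib_right[of _ _ "P _"] by (rule sum.swap)
 have sw': "(SUM a. SUM c. Kc a c x * (SUM d. \<Gamma> c a d x * P d))
   = (SUM a. SUM c. (SUM d. \<Gamma> d a c x * Kc a d x) * P c)"
  unfolding sw[symmetric] by (simp only: sum_distrib_left)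
 define V where "V a = (SUM b. \<Gamma> b b a x)" for a
 have g1: "(SUM a. V a * (SUM c. Kc a c x * P c)) = (SUM a. SUM c. V a * Kc a c x * P c)"
  by (simp add: sum_distrib_left mult.assoc)
 have L: "(SUM a. pd a (%x. vol x * (SUM c. Kc a c x * (psi x \<bullet> A c x (sig (psi x))))) x)
   = vol x * ((SUM a. SUM c. V a * Kc a c x * P c) + (SUM a. SUM c. pd a (Kc a c) x * P c)
    + 2 * Qk psi x - (SUM a. SUM c. (SUM d. \<Gamma> d a c x * Kc a d x) * P c))"
  unfolding * V_def[symmetric] Qk_def
  by (simp only: sum_distrib_left[symmetric] sum.distrib sum_subtractf g1 sw')
 have R: "(SUM c. divK c x * P c) = (SUM a. SUM c. pd a (Kc a c) x * P c)
   + (SUM a. SUM c. V a * Kc a c x * P c)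
   - (SUM a. SUM c. (SUM d. \<Gamma> d a c x * Kc a d x) * P c)"
  unfolding dv V_def[symmetric] by (simp only: distrib_right left_diff_distrib sum.distrib sum_subtractf)
 show ?thesis unfolding L P_def[symmetric] R by simp
qed

lemma divK_Jc: "divK c x - pd c (trk g k) x = Jc g k c x"
proof -
 have "(SUM a. pd a (Kc a c) x) = (SUM a. SUM b. pd a (%y. G a b y) x * k x $ b $ c) + (SUM a. SUM b. G a b x * pd a (%y. k y $ b $ c) x)"
 proof -
  have "pd a (Kc a c) x = (SUM b. pd a (%y. G a b y) x * k x $ b $ c + G a b x * pd a (%y. k y $ b $ c) x)" for a
   unfolding Kc_def[abs_def]
   by (subst pd_sum) (auto intro!: smooth_mult G_smooth k_smooth simp: pd_mult G_smooth k_smooth)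
  then show ?thesis by (simp add: sum.distrib)
 qed
 also have "(SUM a. SUM b. pd a (%y. G a b y) x * k x $ b $ c)
   = - (SUM a. SUM b. SUM m. \<Gamma> a a m x * G m b x * k x $ b $ c) - (SUM a. SUM b. SUM m. \<Gamma> b a m x * G a m x * k x $ b $ c)"
  unfolding pd_G by (simp add: left_diff_distrib sum_subtractf sum_negf sum_distrib_right)
 also have "(SUM a. SUM b. SUM m. \<Gamma> a a m x * G m b x * k x $ b $ c) = (SUM a. (SUM b. \<Gamma> b b a x) * Kc a c x)"
  unfolding Kc_def sum_product by (subst sum3_rotate) (simp add: mult_ac)
 also have "(SUM a. SUM b. SUM m. \<Gamma> b a m x * G a m x * k x $ b $ c)
   = (SUM j. SUM l. G j l x * (SUM m. \<Gamma> m l j x * k x $ m $ c))"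
 proof -
  have "(SUM a. SUM b. SUM m. \<Gamma> b a m x * G a m x * k x $ b $ c) = (SUM a. SUM m. SUM b. \<Gamma> b a m x * G a m x * k x $ b $ c)"
   by (rule sum.cong[OF refl], rule sum.swap)
  also have "... = (SUM j. SUM l. G j l x * (SUM m. \<Gamma> m l j x * k x $ m $ c))"
   unfolding sum_distrib_left
  proof (rule sum.cong[OF refl], rule sum.cong[OF refl], rule sum.cong[OF refl])
   fix a m b show "\<Gamma> b a m x * G a m x * k x $ b $ c = G a m x * (\<Gamma> b m a x * k x $ b $ c)"
    using christ_sym[of b a m x] by simp
  qed
  finally show ?thesis .
 qed
 finally have "(SUM a. pd a (Kc a c) x) + (SUM a. (SUM b. \<Gamma> b b a x) * Kc a c x)
   = (SUM a. SUM b. G a b x * pd a (%y. k y $ b $ c) x) - (SUM j. SUM l. G j l x * (SUM m. \<Gamma> m l j x * k x $ m $ c))"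
  by simp
 moreover have "(SUM a. SUM b. G a b x * pd a (%y. k y $ b $ c) x) = (SUM j. SUM l. G j l x * pd l (%y. k y $ j $ c) x)"
  by (subst sum.swap) (intro sum.cong refl, metis G_sym)
 moreover have "(SUM a. SUM d. \<Gamma> d a c x * Kc a d x) = (SUM j. SUM l. G j l x * (SUM m. \<Gamma> m l c x * k x $ j $ m))"
 proof -
  have "(SUM a. SUM d. \<Gamma> d a c x * Kc a d x) = (SUM a. SUM d. SUM b. \<Gamma> d a c x * (G a b x * k x $ b $ d))"
   unfolding Kc_def by (simp add: sum_distrib_left)
  also have "... = (SUM b. SUM a. SUM d. \<Gamma> d a c x * (G a b x * k x $ b $ d))"
   by (rule sum3_rotate)
  also have "... = (SUM j. SUM l. G j l x * (SUM m. \<Gamma> m l c x * k x $ j $ m))"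
   unfolding sum_distrib_left
  proof (rule sum.cong[OF refl], rule sum.cong[OF refl], rule sum.cong[OF refl])
   fix b a d show "\<Gamma> d a c x * (G a b x * k x $ b $ d) = G b a x * (\<Gamma> d a c x * k x $ b $ d)"
    using G_sym[where a=a and b=b and x=x] by simp
  qed
  finally show ?thesis .
 qed
 ultimately show ?thesis unfolding divK_def Jc_def
  by (simp add: sum.distrib sum_subtractf right_diff_distrib)
qed

definition flux :: "(real^'n => real^('n set)) => 'n => real^'n => real" where
 "flux psi a x = vol x * (- (psi x \<bullet> A a x (Dirac psi x)) - (SUM b. G a b x * (psi x \<bullet> nab b psi x))
  - 1/2 * (SUM c. Kc a c x * (psi x \<bullet> A c x (sig (psi x)))) + 1/2 * (tau x * (psi x \<bullet> A a x (sig (psi x)))))"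

lemma flux_smooth: "smooth_map psi ==> smooth_fun (flux psi a)"
 unfolding flux_def[abs_def]
 by (intro smooth_mult smooth_add smooth_diff smooth_minus smooth_sum smooth_const vol_smooth smooth_inner
   smooth_A smooth_Dirac smooth_nab smooth_sig G_smooth Kc_smooth tau_smooth)

text \<open>The two kinds of cross terms, with k and with its trace, become divergences whose
  remainders combine to \<open>J\<close>; the remaining scalars scal, |k|^2 and (tr k)^2 combine to
  twice \<open>mu\<close>. All divergences are collected in \<open>flux\<close>, whose boundary
  values have to be identified.\<close>

lemma Witten:
 assumes psi: "smooth_map psi"
 shows "vol x * (Dt psi x \<bullet> Dt psi x) = vol x * ((SUM a. SUM b. G a b x * (nabt a psi x \<bullet> nabt b psi x))
   + 1/2 * mu g k x * (psi x \<bullet> psi x) + 1/2 * (SUM c. Jc g k c x * (psi x \<bullet> A c x (sig (psi x)))))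
  + (SUM a. pd a (flux psi a) x)"
proof -
 define f1 where "f1 a x = vol x * (psi x \<bullet> A a x (Dirac psi x))" for a x
 define f2 where "f2 a x = vol x * (SUM b. G a b x * (psi x \<bullet> nab b psi x))" for a x
 define f3 where "f3 a x = vol x * (SUM c. Kc a c x * (psi x \<bullet> A c x (sig (psi x))))" for a x
 define f4 where "f4 a x = vol x * (tau x * (psi x \<bullet> A a x (sig (psi x))))" for a x
 have sm: "smooth_fun (f1 a)" "smooth_fun (f2 a)" "smooth_fun (f3 a)" "smooth_fun (f4 a)" for a
  unfolding f1_def[abs_def] f2_def[abs_def] f3_def[abs_def] f4_def[abs_def] using psi
  by (intro smooth_mult smooth_sum vol_smooth smooth_inner
   smooth_A smooth_Dirac smooth_nab smooth_sig G_smooth Kc_smooth tau_smooth; assumption)+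
 have fl: "flux psi a = (%x. - f1 a x - f2 a x - 1/2 * f3 a x + 1/2 * f4 a x)" for a
  by (rule ext) (simp add: flux_def f1_def f2_def f3_def f4_def algebra_simps)
 have "pd a (flux psi a) x = - pd a (f1 a) x - pd a (f2 a) x - 1/2 * pd a (f3 a) x + 1/2 * pd a (f4 a) x" for a
  unfolding fl by (rule has_pd_imp_pd, intro has_pd_add has_pd_diff has_pd_minus has_pd_cmult smooth_fun_has_pd sm)
 then have 0: "(SUM a. pd a (flux psi a) x) = - (SUM a. pd a (f1 a) x) - (SUM a. pd a (f2 a) x)
  - 1/2 * (SUM a. pd a (f3 a) x) + 1/2 * (SUM a. pd a (f4 a) x)"
  by (simp add: sum.distrib sum_subtractf sum_negf sum_divide_distrib)
 have 1: "vol x * (Dirac psi x \<bullet> Dirac psi x) = vol x * ((SUM a. SUM b. G a b x * (nab a psi x \<bullet> nab b psi x))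
   + 1/4 * scal g x * (psi x \<bullet> psi x)) - (SUM a. pd a (f1 a) x) - (SUM a. pd a (f2 a) x)"
  unfolding f1_def[abs_def] f2_def[abs_def] by (rule Lichnerowicz[OF psi])
 have 3: "(SUM a. pd a (f3 a) x) = vol x * (2 * Qk psi x + (SUM c. divK c x * (psi x \<bullet> A c x (sig (psi x)))))"
  unfolding f3_def[abs_def] by (rule divergence_Kc[OF psi])
 have 4: "(SUM a. pd a (f4 a) x) = vol x * ((SUM a. pd a (trk g k) x * (psi x \<bullet> A a x (sig (psi x)))) - 2 * tau x * (Dirac psi x \<bullet> sig (psi x)))"
 proof -
  obtain d where d: "!!a. has_pd a (%x. vol x * (tau x * (psi x \<bullet> A a x (ch e (psi x))))) (d a) x"
   "(SUM a. d a) = vol x * ((SUM a. pd a (trk g k) x * (psi x \<bullet> A a x (ch e (psi x)))) - 2 * tau x * (Dirac psi x \<bullet> ch e (psi x)))"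
   using divergence_A_ch[OF psi, of "trk g k" "%a. pd a (trk g k) x" x e] smooth_fun_has_pd[OF tau_smooth] by blast
  have "f4 a = (%x. - (vol x * (tau x * (psi x \<bullet> A a x (ch e (psi x))))))" for a
   by (rule ext) (simp add: f4_def sig_def A_simps)
  then have "pd a (f4 a) x = - d a" for a using has_pd_imp_pd[OF has_pd_minus[OF d(1)]] by simp
  then show ?thesis by (simp add: sum_negf d(2) sig_def A_simps algebra_simps)
 qed
 have J: "(SUM c. Jc g k c x * (psi x \<bullet> A c x (sig (psi x)))) = (SUM c. divK c x * (psi x \<bullet> A c x (sig (psi x)))) - (SUM a. pd a (trk g k) x * (psi x \<bullet> A a x (sig (psi x))))"
  unfolding divK_Jc[symmetric] by (simp add: left_diff_distrib sum_subtractf)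
 have D: "vol x * (Dt psi x \<bullet> Dt psi x) = vol x * (Dirac psi x \<bullet> Dirac psi x) - vol x * (tau x * (Dirac psi x \<bullet> sig (psi x))) + vol x * (1/4 * (tau x)\<^sup>2 * (psi x \<bullet> psi x))"
  unfolding inner_Dt by (simp add: algebra_simps)
 show ?thesis unfolding D 1 inner_nabt 0 3 4 J mu_def by (simp add: field_simps)
qed

text \<open>The exchange used in \<open>chi_cl_cl\<close>, now with a defect: \<open>bil f\<close>
  commutes with \<open>ch e\<close> but not with \<open>cl e\<close>. For the connection forms the
  defect is a component of the second fundamental form.\<close>

lemma chi_cl_bil:
 assumes u: "chi e u" and i: "i ~= e" and f: "!!i j. f i j = - f j i"
 shows "u \<bullet> cl e (cl i (bil f u)) = - 1/2 * f e i * (u \<bullet> u)"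
proof -
 have "u \<bullet> cl e (cl i (bil f u)) = - (cl e u \<bullet> cl i (bil f u))" by (simp add: inner_cl)
 also have "... = - (ch e u \<bullet> cl i (bil f u))" using u by (simp add: chi_def)
 also have "... = u \<bullet> cl i (ch e (bil f u))" by (simp add: inner_ch cl_ch)
 also have "... = u \<bullet> cl i (bil f (cl e u))" using u by (simp add: chi_def bil_ch)
 also have "... = u \<bullet> cl i (cl e (bil f u)) + (SUM j. f e j * (u \<bullet> cl i (cl j u)))"
  unfolding bil_cl[where f=f, OF f] by (simp add: cl_simps cl_sum inner_add_right inner_sum_right)
 also have "(SUM j. f e j * (u \<bullet> cl i (cl j u))) = (SUM j. (if i = j then 1 else 0) * (- (f e j * (u \<bullet> u))))"
  by (intro sum.cong refl) (simp add: inner_cl_cl)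
 also have "... = - (f e i * (u \<bullet> u))" by (rule sum_delta_left)
 also have "u \<bullet> cl i (cl e (bil f u)) = - (u \<bullet> cl e (cl i (bil f u)))" using cl_cl[OF i, of "bil f u"] by simp
 finally show ?thesis by simp
qed

text \<open>From the homotopy clause of \<open>frame_on\<close>: a nonpositive value would make (1 -
  t) + t E_ee vanish for some t in [0,1], and the e-th unit vector would lie in the kernel.\<close>

lemma E_ee_pos: "E e e x > 0"
proof (rule ccontr)
 assume neg: "\<not> E e e x > 0"
 define t where "t = 1 / (1 - E e e x)"
 have t: "t : {0..1}" "(1 - t) + t * E e e x = 0"
  using neg by (auto simp: t_def field_simps)
 define v where "v i = (if i = e then 1 else 0 :: real)" for i
 have "(1 - t) * v i + t * (SUM a. E i a x * v a) = 0" for i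
  using t(2) E_e[of i x] by (cases "i = e") (auto simp: v_def)
 then have "v e = 0" using frame t(1) unfolding frame_on_def by blast
 then show False by (simp add: v_def)
qed

lemma G_e: "G i e x = E e e x * E e i x"
proof -
 have "G i e x = (SUM j. E j i x * E j e x)" by (simp add: E_E)
 also have "... = (SUM j. (if j = e then 1 else 0) * (E e i x * E e e x))"
  by (intro sum.cong refl) (auto simp: E_e)
 finally show ?thesis unfolding sum_delta_left by simp
qed

lemma nu_E: "nu g e i = E e i"
proof
 fix x
 have "sqrt (G e e x) = E e e x" unfolding G_e using E_ee_pos[of x] by simp
 then show "nu g e i x = E e i x" unfolding nu_def G_e[where i=i] using E_ee_pos[of x] by simp
qed

lemma A_e: "A e x u = E e e x *R cl e u"
proof -
 have "A e x u = (SUM i. (if i = e then 1 else 0) *R E e e x *R cl e u)"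
  unfolding A_def by (intro sum.cong refl) (auto simp: E_e)
 then show ?thesis unfolding sum_scaleR_delta by simp
qed

lemma meancurv_om: "meancurv g e x = (SUM b. SUM i. E i b x * om b e i x)"
 unfolding meancurv_def nu_E E_om by (simp add: sum.distrib)

lemma chi_A_sig:
 assumes "chi e u" shows "u \<bullet> A c x (sig u) = E e c x * (u \<bullet> u)"
proof -
 have "u \<bullet> A c x (sig u) = - (SUM i. E i c x * (u \<bullet> cl i (cl e u)))"
 proof -
  have "sig u = - cl e u" using assms by (simp add: sig_def chi_def)
  then have "u \<bullet> A c x (sig u) = - (u \<bullet> A c x (cl e u))" by (simp add: A_simps)
  then show ?thesis by (simp add: A_def inner_sum_right)
 qed
 also have "(SUM i. E i c x * (u \<bullet> cl i (cl e u))) = (SUM i. (if i = e then 1 else 0) * (- (E i c x * (u \<bullet> u))))"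
  by (intro sum.cong refl) (simp add: inner_cl_cl)
 finally show ?thesis unfolding sum_delta_left by simp
qed

text \<open>Tangential derivatives drop out by \<open>chi_cl_cl\<close>; the term i = e cancels the
  derivative in the second summand of \<open>flux\<close>; the connection forms contribute half the
  mean curvature, and the terms with k give half of tr k - k(nu,nu). The factor
  \<open>E e e x\<close> is the length of dx_e, which enters because the flux passes through a
  coordinate face.\<close>

lemma flux_boundary:
 assumes u: "chi e (psi x)" and du: "!!b. b ~= e ==> chi e (pv b psi x)"
 shows "flux psi e x = vol x * (1/2 * E e e x * null_exp g k e x * (psi x \<bullet> psi x))"
proof -
 let ?u = "psi x"
 have 1: "?u \<bullet> A e x (Dirac psi x) + (SUM b. G e b x * (?u \<bullet> nab b psi x)) = - 1/2 * E e e x * meancurv g e x * (?u \<bullet> ?u)"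
 proof -
  have t: "E i b x * (?u \<bullet> cl e (cl i (nab b psi x))) =
    - 1/2 * (E i b x * om b e i x * (?u \<bullet> ?u)) - (if i = e then 1 else 0) * (E e b x * (?u \<bullet> nab b psi x))" for i b
  proof (cases "i = e")
   case True
   have "om b e e x = 0" using om_antisym[of b e e x] by simp
   with True show ?thesis by simp
  next
   case False
   have m1: "E i b x * (?u \<bullet> cl e (cl i (pv b psi x))) = 0"
    using E_e[OF False, of x] chi_cl_cl[OF u du False, of b] by (cases "b = e") auto
   have m2: "?u \<bullet> cl e (cl i (bil (%i j. om b i j x) ?u)) = - 1/2 * om b e i x * (?u \<bullet> ?u)"
    by (rule chi_cl_bil[OF u False om_antisym])
   have m3: "E i b x * (?u \<bullet> cl e (cl i (nab b psi x))) = E i b x * (?u \<bullet> cl e (cl i (pv b psi x)))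
     + E i b x * (?u \<bullet> cl e (cl i (bil (%i j. om b i j x) ?u)))"
    by (simp add: nab_def cl_simps inner_add_right distrib_left)
   show ?thesis unfolding m3 m1 m2 using False by simp
  qed
  have "?u \<bullet> A e x (Dirac psi x) = E e e x * (SUM b. SUM i. E i b x * (?u \<bullet> cl e (cl i (nab b psi x))))"
   unfolding A_e unfolding Dirac_def A_def by (simp add: cl_sum cl_simps inner_sum_right)
  also have "... = E e e x * (- 1/2 * (meancurv g e x * (?u \<bullet> ?u)) - (SUM b. E e b x * (?u \<bullet> nab b psi x)))"
   unfolding t sum_subtractf sum_delta_left meancurv_om by (simp add: sum_distrib_left sum_distrib_right mult_ac sum_negf)
  also have "... = - 1/2 * E e e x * meancurv g e x * (?u \<bullet> ?u) - (SUM b. G e b x * (?u \<bullet> nab b psi x))"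
  proof -
   have "G e b x = E e e x * E e b x" for b using G_e[where i=b and x=x] G_sym[where a=e and b=b and x=x] by simp
   then show ?thesis by (simp add: right_diff_distrib sum_distrib_left mult_ac)
  qed
  finally show ?thesis by simp
 qed
 have 2: "(SUM c. Kc e c x * (?u \<bullet> A c x (sig ?u))) = E e e x * (SUM i. SUM j. k x $ i $ j * nu g e i x * nu g e j x) * (?u \<bullet> ?u)"
 proof -
  have "Kc e c x = (SUM b. E e e x * E e b x * k x $ b $ c)" for c
   unfolding Kc_def using G_e G_sym[where a=e and x=x] by (intro sum.cong refl) metis
  then have "(SUM c. Kc e c x * (?u \<bullet> A c x (sig ?u))) = (SUM c. SUM b. E e e x * E e b x * k x $ b $ c * (E e c x * (?u \<bullet> ?u)))"
   unfolding chi_A_sig[OF u] by (simp add: sum_distrib_right)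
  also have "... = (SUM b. SUM c. E e e x * E e b x * k x $ b $ c * (E e c x * (?u \<bullet> ?u)))"
   by (rule sum.swap)
  finally show ?thesis unfolding nu_E by (simp add: sum_distrib_left sum_distrib_right mult_ac)
 qed
 have "flux psi e x = vol x * (- (?u \<bullet> A e x (Dirac psi x) + (SUM b. G e b x * (?u \<bullet> nab b psi x)))
  - 1/2 * (SUM c. Kc e c x * (?u \<bullet> A c x (sig ?u))) + 1/2 * (tau x * (?u \<bullet> A e x (sig ?u))))"
  by (simp add: flux_def)
 then show ?thesis unfolding 1 2 unfolding chi_A_sig[OF u] null_exp_def by (simp add: field_simps)
qed

text \<open>All potentials are multiples of different \<open>ch j\<close> (with \<open>sig\<close> =
  - \<open>ch e\<close>), which anticommute with each other and with Clifford multiplication. The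
  squares therefore add without cross terms among the potentials.\<close>

definition Bop :: "real => (real^'n => real) => ('n => real^'n => real) => (real^'n => real^('n set)) => real^'n => real^('n set)" where
 "Bop b h theta' psi x = Dirac psi x + (b * h x - tau x / 2) *R sig (psi x) + (\<Sum>j\<in>UNIV - {e}. theta' j x *R ch j (psi x))"

lemma inner_Bop:
 "Bop b h p psi x \<bullet> Bop b h p psi x = Dt psi x \<bullet> Dt psi x + 2 * b * h x * (Dirac psi x \<bullet> sig (psi x)) - b * h x * tau x * (psi x \<bullet> psi x)
  + 2 * (\<Sum>j\<in>UNIV - {e}. p j x * (Dirac psi x \<bullet> ch j (psi x))) + b\<^sup>2 * (h x)\<^sup>2 * (psi x \<bullet> psi x) + (\<Sum>j\<in>UNIV - {e}. (p j x)\<^sup>2) * (psi x \<bullet> psi x)"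
proof -
 let ?u = "psi x"
 define T where "T = (\<Sum>j\<in>UNIV - {e}. p j x *R ch j ?u)"
 have ch0: "ch i ?u \<bullet> ch j ?u = (if i = j then ?u \<bullet> ?u else 0)" for i j
 proof (cases "i = j")
  case False
  have "ch i ?u \<bullet> ch j ?u = ?u \<bullet> ch i (ch j ?u)" by (simp add: inner_ch)
  also have "... = - (?u \<bullet> ch j (ch i ?u))" using ch_ch[OF False, of ?u] by simp
  also have "... = - (ch j ?u \<bullet> ch i ?u)" by (simp add: inner_ch)
  finally show ?thesis using False by (simp add: inner_commute)
 qed (simp add: inner_ch)
 have sT: "sig ?u \<bullet> T = 0"
  unfolding T_def sig_def inner_sum_right by (intro sum.neutral) (auto simp: ch0)
 have TT: "T \<bullet> T = (\<Sum>j\<in>UNIV - {e}. (p j x)\<^sup>2) * (?u \<bullet> ?u)"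
 proof -
  have "T \<bullet> T = (\<Sum>i\<in>UNIV - {e}. \<Sum>j\<in>UNIV - {e}. if j = i then (p i x)\<^sup>2 * (?u \<bullet> ?u) else 0)"
   unfolding T_def inner_sum_left unfolding inner_sum_right by (intro sum.cong refl) (auto simp: ch0 power2_eq_square)
  then show ?thesis by (simp add: sum_distrib_right)
 qed
 have DT: "Dt psi x \<bullet> T = (\<Sum>j\<in>UNIV - {e}. p j x * (Dirac psi x \<bullet> ch j ?u))"
 proof -
  have "Dt psi x \<bullet> T = Dirac psi x \<bullet> T - tau x / 2 * (sig ?u \<bullet> T)" by (simp add: Dt_def inner_diff_left)
  then show ?thesis unfolding sT by (simp add: T_def inner_sum_right)
 qed
 have "Bop b h p psi x = Dt psi x + (b * h x) *R sig ?u + T"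
  unfolding Bop_def Dt_def T_def by (simp add: algebra_simps)
 then have "Bop b h p psi x \<bullet> Bop b h p psi x = Dt psi x \<bullet> Dt psi x + 2 * (b * h x) * (Dt psi x \<bullet> sig ?u) + 2 * (Dt psi x \<bullet> T)
   + (b * h x)\<^sup>2 * (?u \<bullet> ?u) + 2 * (b * h x) * (sig ?u \<bullet> T) + T \<bullet> T"
  by (simp add: inner_add_left inner_add_right inner_commute power2_eq_square algebra_simps)
 moreover have "Dt psi x \<bullet> sig ?u = Dirac psi x \<bullet> sig ?u - tau x / 2 * (?u \<bullet> ?u)"
  by (simp add: Dt_def inner_diff_left)
 ultimately show ?thesis unfolding sT TT DT by (simp add: power2_eq_square algebra_simps)
qed

text \<open>With D the square norm of \<open>Dt psi\<close>, |nabt psi|^2 \<ge> D/n is moved to the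
  left, and multiplication by q turns D - D/n back into D. The energy and flux terms are thereby
  multiplied by q.\<close>

lemma Dt_lower:
 assumes psi: "smooth_map psi" and n: "CARD('n) >= 2" and q: "q = real CARD('n) / (real CARD('n) - 1)"
 shows "vol x * (Dt psi x \<bullet> Dt psi x) >= vol x * (q / 2 * (mu g k x - normJ g k x) * (psi x \<bullet> psi x)) + q * (SUM a. pd a (flux psi a) x)"
proof -
 define N where "N = real CARD('n)"
 have N: "N >= 2" using n by (simp add: N_def)
 define S where "S = (SUM a. SUM b. G a b x * (nabt a psi x \<bullet> nabt b psi x))"
 define D where "D = Dt psi x \<bullet> Dt psi x"
 define J where "J = (SUM c. Jc g k c x * (psi x \<bullet> A c x (sig (psi x))))"
 define F where "F = (SUM a. pd a (flux psi a) x)"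
 define m where "m = mu g k x" define j where "j = normJ g k x" define p where "p = psi x \<bullet> psi x"
 have v: "vol x > 0" by (rule vol_pos)
 have W: "vol x * D = vol x * (S + 1/2 * m * p + 1/2 * J) + F"
  unfolding D_def S_def J_def F_def m_def p_def by (rule Witten[OF psi])
 have "D <= N * S" using Dirac_Cauchy_Schwarz[where x=x and phi="%a. nabt a psi x"] unfolding sum_A_nabt D_def S_def N_def .
 then have S: "D / N <= S" using N by (simp add: pos_divide_le_eq mult.commute)
 have "\<bar>J\<bar> <= j * (norm (psi x) * norm (sig (psi x)))"
  unfolding J_def j_def normJ_def by (rule A_bound)
 then have J: "J >= - (j * p)" by (simp add: p_def norm_eq_sqrt_inner)
 have "S + 1/2 * m * p + 1/2 * J >= D / N + 1/2 * (m - j) * p"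
 proof -
  have "1/2 * (m - j) * p = 1/2 * m * p - 1/2 * (j * p)" by (simp add: field_simps)
  then show ?thesis using S J by linarith
 qed
 then have "vol x * (S + 1/2 * m * p + 1/2 * J) >= vol x * (D / N + 1/2 * (m - j) * p)"
  using v by (intro mult_left_mono) auto
 then have "vol x * D - vol x * (D / N) >= vol x * (1/2 * (m - j) * p) + F"
  unfolding W by (simp add: distrib_left)
 then have "q * (vol x * D - vol x * (D / N)) >= q * (vol x * (1/2 * (m - j) * p) + F)"
  using N unfolding q N_def[symmetric] by (intro mult_left_mono) auto
 moreover have "q * (vol x * D - vol x * (D / N)) = vol x * D"
  using N unfolding q N_def[symmetric] by (simp add: field_simps)
 ultimately show ?thesis unfolding D_def m_def j_def p_def F_def by (simp add: algebra_simps)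
qed

text \<open>The first-order cross terms with the potentials are divergences at the cost of the
  derivatives of the potentials, bounded by their metric length. With b = q/2 everything involving h
  collects to q/2 times the Riccati expression. The divergences \<open>d2\<close> and
  \<open>d3\<close> are returned, because the boundary terms must be combined with
  \<open>flux\<close> before their sign is visible.\<close>

lemma Bop_lower:
 assumes psi: "smooth_map psi" and n: "CARD('n) >= 2" and q: "q = real CARD('n) / (real CARD('n) - 1)"
  and h: "!!a. has_pd a h (dh a) x"
  and p: "!!j a. j ~= e ==> has_pd a (p j) (if a = j then p' j else 0) x" "!!j. j ~= e ==> p' j >= 0"
 obtains d2 d3 where
  "!!a. has_pd a (%x. vol x * (h x * (psi x \<bullet> A a x (sig (psi x))))) (d2 a) x"
  "!!j a. j ~= e ==> has_pd a (%x. vol x * (p j x * (psi x \<bullet> A a x (ch j (psi x))))) (d3 j a) x"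
  "vol x * (Bop (q/2) h p psi x \<bullet> Bop (q/2) h p psi x) \<ge>
   vol x * ((q/2 * ((mu g k x - normJ g k x) + q/2 * (h x)\<^sup>2 - h x * tau x - sqrt (SUM a. SUM b. G a b x * dh a * dh b))
     + (\<Sum>j\<in>UNIV - {e}. (p j x)\<^sup>2 - p' j * sqrt (G j j x))) * (psi x \<bullet> psi x))
   + q * (SUM a. pd a (flux psi a) x) - q/2 * (SUM a. d2 a) - (\<Sum>j\<in>UNIV - {e}. SUM a. d3 j a)"
proof -
 let ?u = "psi x"
 have v: "vol x > 0" by (rule vol_pos)
 obtain d where d: "!!a. has_pd a (%x. vol x * (h x * (psi x \<bullet> A a x (ch e (psi x))))) (d a) x"
   "(SUM a. d a) = vol x * ((SUM a. dh a * (?u \<bullet> A a x (ch e ?u))) - 2 * h x * (Dirac psi x \<bullet> ch e ?u))"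
  using divergence_A_ch[OF psi, of h dh x e] h by blast
 define d2 where "d2 a = - d a" for a
 have d2: "has_pd a (%x. vol x * (h x * (psi x \<bullet> A a x (sig (psi x))))) (d2 a) x" for a
  using has_pd_minus[OF d(1)] by (simp add: d2_def sig_def A_simps)
 have d2s: "(SUM a. d2 a) = vol x * ((SUM a. dh a * (?u \<bullet> A a x (sig ?u))) - 2 * h x * (Dirac psi x \<bullet> sig ?u))"
  unfolding d2_def by (simp add: sum_negf d(2) sig_def A_simps algebra_simps)
 have "\<exists>d. j ~= e \<longrightarrow> (\<forall>a. has_pd a (%x. vol x * (p j x * (psi x \<bullet> A a x (ch j (psi x))))) (d a) x) \<and>
   (SUM a. d a) = vol x * (p' j * (?u \<bullet> A j x (ch j ?u)) - 2 * p j x * (Dirac psi x \<bullet> ch j ?u))" for j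
 proof (cases "j = e")
  case False
  have "(SUM a. (if a = j then p' j else 0) * (?u \<bullet> A a x (ch j ?u))) = (SUM a. (if a = j then 1 else 0) * (p' j * (?u \<bullet> A a x (ch j ?u))))"
   by (intro sum.cong refl) auto
  then have "(SUM a. (if a = j then p' j else 0) * (?u \<bullet> A a x (ch j ?u))) = p' j * (?u \<bullet> A j x (ch j ?u))"
   unfolding sum_delta_left .
  then show ?thesis using divergence_A_ch[OF psi, of "p j" "%a. if a = j then p' j else 0" x j] p(1)[OF False] by auto
 qed simp
 then have "\<exists>d3. \<forall>j. j ~= e \<longrightarrow> (\<forall>a. has_pd a (%x. vol x * (p j x * (psi x \<bullet> A a x (ch j (psi x))))) (d3 j a) x) \<and>
   (SUM a. d3 j a) = vol x * (p' j * (?u \<bullet> A j x (ch j ?u)) - 2 * p j x * (Dirac psi x \<bullet> ch j ?u))"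
  by (intro choice allI)
 then obtain d3 where d3: "!!j a. j ~= e ==> has_pd a (%x. vol x * (p j x * (psi x \<bullet> A a x (ch j (psi x))))) (d3 j a) x"
   "!!j. j ~= e ==> (SUM a. d3 j a) = vol x * (p' j * (?u \<bullet> A j x (ch j ?u)) - 2 * p j x * (Dirac psi x \<bullet> ch j ?u))"
  by blast
 define H where "H = sqrt (SUM a. SUM b. G a b x * dh a * dh b)"
 have uu: "?u \<bullet> ?u >= 0" by simp
 have nn: "norm ?u * norm ?u = ?u \<bullet> ?u" by (simp add: norm_eq_sqrt_inner)
 have "\<bar>SUM a. dh a * (?u \<bullet> A a x (sig ?u))\<bar> <= H * (norm ?u * norm (sig ?u))"
  unfolding H_def by (rule A_bound)
 then have hb: "(SUM a. dh a * (?u \<bullet> A a x (sig ?u))) >= - (H * (?u \<bullet> ?u))" using nn by simp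
 have pb: "p' j * (?u \<bullet> A j x (ch j ?u)) >= - (p' j * sqrt (G j j x) * (?u \<bullet> ?u))" if j: "j ~= e" for j
 proof -
  have "\<bar>?u \<bullet> A j x (ch j ?u)\<bar> <= norm ?u * norm (A j x (ch j ?u))" by (rule Cauchy_Schwarz_ineq2)
  also have "norm (A j x (ch j ?u)) = sqrt (G j j x) * norm ?u"
   unfolding norm_eq_sqrt_inner A_inner_A by (simp add: real_sqrt_mult inner_ch)
  also have "norm ?u * (sqrt (G j j x) * norm ?u) = sqrt (G j j x) * (norm ?u * norm ?u)" by simp
  finally have "\<bar>?u \<bullet> A j x (ch j ?u)\<bar> <= sqrt (G j j x) * (?u \<bullet> ?u)" unfolding nn .
  then have "?u \<bullet> A j x (ch j ?u) >= - (sqrt (G j j x) * (?u \<bullet> ?u))" by linarith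
  from mult_left_mono[OF this p(2)[OF j]] show ?thesis by (simp add: mult_ac)
 qed
 define q2 where "q2 = q / 2"
 have q2: "q2 >= 0" using n unfolding q2_def q by simp
 define X where "X = vol x * (q / 2 * (mu g k x - normJ g k x) * (?u \<bullet> ?u)) + q * (SUM a. pd a (flux psi a) x)"
 have DX: "vol x * (Dt psi x \<bullet> Dt psi x) >= X" unfolding X_def by (rule Dt_lower[OF psi n q])
 have h1: "vol x * (2 * q2 * h x * (Dirac psi x \<bullet> sig ?u)) >= - q2 * (vol x * (H * (?u \<bullet> ?u))) - q2 * (SUM a. d2 a)"
 proof -
  have "vol x * (2 * q2 * h x * (Dirac psi x \<bullet> sig ?u)) = q2 * (vol x * (SUM a. dh a * (?u \<bullet> A a x (sig ?u)))) - q2 * (SUM a. d2 a)"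
   unfolding d2s by (simp add: algebra_simps)
  moreover have "q2 * (vol x * (SUM a. dh a * (?u \<bullet> A a x (sig ?u)))) >= q2 * (vol x * (- (H * (?u \<bullet> ?u))))"
   using hb q2 v by (intro mult_left_mono) auto
  ultimately show ?thesis by simp
 qed
 have h2: "vol x * (2 * (\<Sum>j\<in>UNIV - {e}. p j x * (Dirac psi x \<bullet> ch j ?u)))
  >= - (\<Sum>j\<in>UNIV - {e}. vol x * (p' j * sqrt (G j j x) * (?u \<bullet> ?u))) - (\<Sum>j\<in>UNIV - {e}. SUM a. d3 j a)"
 proof -
  have "- vol x * (p' j * sqrt (G j j x) * (?u \<bullet> ?u)) - (SUM a. d3 j a) <= 2 * vol x * (p j x * (Dirac psi x \<bullet> ch j ?u))"
   if j: "j : UNIV - {e}" for j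
  proof -
   have "vol x * (p' j * (?u \<bullet> A j x (ch j ?u))) >= vol x * (- (p' j * sqrt (G j j x) * (?u \<bullet> ?u)))"
    using pb[of j] j v by (intro mult_left_mono) auto
   then show ?thesis using d3(2)[of j] j by (simp add: algebra_simps)
  qed
  from sum_mono[OF this, of "UNIV - {e}" "%j. j"] show ?thesis
   by (simp add: sum_subtractf sum_negf sum_distrib_left mult_ac)
 qed
 have "vol x * (Bop q2 h p psi x \<bullet> Bop q2 h p psi x) = vol x * (Dt psi x \<bullet> Dt psi x) + vol x * (2 * q2 * h x * (Dirac psi x \<bullet> sig ?u))
  - vol x * (q2 * h x * tau x * (?u \<bullet> ?u)) + vol x * (2 * (\<Sum>j\<in>UNIV - {e}. p j x * (Dirac psi x \<bullet> ch j ?u)))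
  + vol x * (q2\<^sup>2 * (h x)\<^sup>2 * (?u \<bullet> ?u)) + vol x * ((\<Sum>j\<in>UNIV - {e}. (p j x)\<^sup>2) * (?u \<bullet> ?u))"
  unfolding inner_Bop by (simp add: algebra_simps)
 also have "... >= X + (- q2 * (vol x * (H * (?u \<bullet> ?u))) - q2 * (SUM a. d2 a)) - vol x * (q2 * h x * tau x * (?u \<bullet> ?u))
  + (- (\<Sum>j\<in>UNIV - {e}. vol x * (p' j * sqrt (G j j x) * (?u \<bullet> ?u))) - (\<Sum>j\<in>UNIV - {e}. SUM a. d3 j a))
  + vol x * (q2\<^sup>2 * (h x)\<^sup>2 * (?u \<bullet> ?u)) + vol x * ((\<Sum>j\<in>UNIV - {e}. (p j x)\<^sup>2) * (?u \<bullet> ?u))"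
  by (intro add_right_mono add_mono diff_right_mono DX h1 h2)
 finally have fin: "vol x * (Bop q2 h p psi x \<bullet> Bop q2 h p psi x) >= X + (- q2 * (vol x * (H * (?u \<bullet> ?u))) - q2 * (SUM a. d2 a)) - vol x * (q2 * h x * tau x * (?u \<bullet> ?u))
  + (- (\<Sum>j\<in>UNIV - {e}. vol x * (p' j * sqrt (G j j x) * (?u \<bullet> ?u))) - (\<Sum>j\<in>UNIV - {e}. SUM a. d3 j a))
  + vol x * (q2\<^sup>2 * (h x)\<^sup>2 * (?u \<bullet> ?u)) + vol x * ((\<Sum>j\<in>UNIV - {e}. (p j x)\<^sup>2) * (?u \<bullet> ?u))" .
 show ?thesis
 proof (rule that[OF d2 d3(1)])
  have s: "(\<Sum>j\<in>UNIV - {e}. vol x * (p' j * sqrt (G j j x) * (?u \<bullet> ?u))) = vol x * ((\<Sum>j\<in>UNIV - {e}. p' j * sqrt (G j j x)) * (?u \<bullet> ?u))"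
   by (simp add: sum_distrib_left sum_distrib_right)
  have q: "q = 2 * q2" "q / 2 = q2" by (simp_all add: q2_def)
  have alg: "v * (q2 * M * U) + 2 * q2 * F + (- q2 * (v * (H * U)) - q2 * D2) - v * (q2 * h * t * U)
    + (- (v * (S3 * U)) - D3) + v * (q2\<^sup>2 * h\<^sup>2 * U) + v * (S2 * U)
   = v * ((q2 * (M + q2 * h\<^sup>2 - h * t - H) + (S2 - S3)) * U) + 2 * q2 * F - q2 * D2 - D3"
   for v M U F H D2 h t S3 D3 S2 :: real
   by (simp add: power2_eq_square algebra_simps)
  show "vol x * (Bop (q/2) h p psi x \<bullet> Bop (q/2) h p psi x) \<ge>
   vol x * ((q/2 * ((mu g k x - normJ g k x) + q/2 * (h x)\<^sup>2 - h x * tau x - sqrt (SUM a. SUM b. G a b x * dh a * dh b))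
     + (\<Sum>j\<in>UNIV - {e}. (p j x)\<^sup>2 - p' j * sqrt (G j j x))) * (psi x \<bullet> psi x))
   + q * (SUM a. pd a (flux psi a) x) - q/2 * (SUM a. d2 a) - (\<Sum>j\<in>UNIV - {e}. SUM a. d3 j a)"
   using fin unfolding H_def[symmetric] s X_def sum_subtractf q(2) unfolding q(1) alg .
 qed
qed

end

section \<open>The box and the domain of the operators\<close>

locale slab =
 fixes e :: "'n::finite" and L :: real and lam :: nat
 assumes L: "L > 0" and lam: "lam >= 2"
begin

definition lo :: "real^'n" where "lo = (\<chi> i. if i = e then -1 else - L)"
definition hi :: "real^'n" where "hi = (\<chi> i. if i = e then 1 else L)"
definition dl :: "'n => real" where "dl i = (if i = e then pi / 2 else pi / (2 * L))"
abbreviation "Q \<equiv> cbox lo hi"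

text \<open>A potential with poles on the side faces. Its derivative lam dl^2 (1 + tan^2) equals lam
  dl^2 + tn^2/lam, so a large \<open>lam\<close> lets the square of the potential dominate any fixed
  multiple of its derivative, up to a constant.\<close>

definition tn :: "'n => real^'n => real" where "tn j x = real lam * dl j * tan (dl j * x $ j)"
definition tn' :: "'n => real^'n => real" where "tn' j x = real lam * (dl j)\<^sup>2 + (tn j x)\<^sup>2 / real lam"

text \<open>Test fields are even, obey the chirality condition on x_e = -1 and x_e = 1, and are
  divisible by cos^2 in every torus direction. Divisibility, rather than mere vanishing, makes the
  product with the singular potential smooth and still zero on the side faces, so no weighted spaces
  are needed.\<close>

definition X :: "(real^'n => real^('n set)) set" where
 "X = {psi. smooth_map psi \<and> (\<forall>x. parity True (psi x)) \<and>
  (\<forall>j. j ~= e \<longrightarrow> (\<exists>phi. smooth_map phi \<and> psi = (%x. (cos (dl j * x $ j))\<^sup>2 *R phi x))) \<and>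
  (\<forall>x S. e : S \<longrightarrow> x $ e : {-1, 1} \<longrightarrow> psi x $ S = 0)}"

lemma lo_hi: "lo $ i < hi $ i" using L by (simp add: lo_def hi_def)
lemma dl_pos: "dl i > 0" using L by (simp add: dl_def)
lemma dl_hi: "dl i * hi $ i = pi / 2" "dl i * lo $ i = - (pi / 2)" using L by (simp_all add: dl_def hi_def lo_def)

lemma Q_face: "x : Q ==> x $ a = hi $ a \<or> x $ a = lo $ a ==> cos (dl a * x $ a) = 0"
 by (elim disjE) (simp_all only: dl_hi cos_pi_half cos_minus)

lemma interior_angle: "x : box lo hi ==> \<bar>dl i * x $ i\<bar> < pi / 2"
proof -
 assume "x : box lo hi"
 then have "lo $ i < x $ i" "x $ i < hi $ i" unfolding mem_box_cart by blast+
 then have "dl i * lo $ i < dl i * x $ i" "dl i * x $ i < dl i * hi $ i" using dl_pos[of i] by auto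
 then show ?thesis unfolding dl_hi by auto
qed

lemma interior_cos: "x : box lo hi ==> cos (dl i * x $ i) > 0"
 using interior_angle[of x i] by (intro cos_gt_zero_pi) auto

lemma tn'_nonneg: "tn' j x >= 0" by (simp add: tn'_def)

lemma has_pd_tn:
 assumes "x : box lo hi" shows "has_pd a (tn j) (if a = j then tn' j x else 0) x"
proof -
 have c: "cos (dl j * x $ j) ~= 0" using interior_cos[OF assms, of j] by simp
 have "((%s. real lam * dl j * tan (dl j * s)) has_real_derivative
   real lam * dl j * (inverse ((cos (dl j * x $ j))\<^sup>2) * dl j)) (at (x $ j))"
  using c by (auto intro!: derivative_eq_intros)
 also have "inverse ((cos (dl j * x $ j))\<^sup>2) = 1 + (tan (dl j * x $ j))\<^sup>2"
  using c by (simp add: tan_def power_divide field_simps sin_squared_eq)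
 also have "real lam * dl j * ((1 + (tan (dl j * x $ j))\<^sup>2) * dl j) = tn' j x"
  using lam by (simp add: tn'_def tn_def power2_eq_square field_simps)
 finally show ?thesis unfolding tn_def[abs_def] by (rule has_pd_comp_coord)
qed

lemma X_subspace: "subspace X"
proof (rule subspaceI)
 show "0 : X" unfolding X_def zero_fun_def
  by (auto simp: smooth_map_const intro!: exI[of _ "%x. 0"])
 fix psi phi and c :: real assume psi: "psi : X"
 show "c *R psi : X" unfolding X_def
 proof (intro CollectI conjI allI impI)
  show "smooth_map (c *R psi)" using psi unfolding X_def scaleR_fun_def by (auto intro: smooth_map_intros)
  show "parity True ((c *R psi) x)" for x using psi unfolding X_def by (auto intro: parity_scale)
  show "(c *R psi) x $ S = 0" if "e : S" "x $ e : {-1, 1}" for x S using psi that unfolding X_def by auto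
  fix j assume "j ~= e"
  then obtain \<eta> where "smooth_map \<eta>" "psi = (%x. (cos (dl j * x $ j))\<^sup>2 *R \<eta> x)" using psi unfolding X_def by blast
  then show "\<exists>phi. smooth_map phi \<and> c *R psi = (%x. (cos (dl j * x $ j))\<^sup>2 *R phi x)"
   by (intro exI[of _ "%x. c *R \<eta> x"]) (auto intro: smooth_map_intros simp: fun_eq_iff)
 qed
 assume phi: "phi : X"
 show "psi + phi : X" unfolding X_def
 proof (intro CollectI conjI allI impI)
  show "smooth_map (psi + phi)" using psi phi unfolding X_def plus_fun_def by (auto intro: smooth_map_intros)
  show "parity True ((psi + phi) x)" for x using psi phi unfolding X_def plus_fun_def by (auto intro: parity_add)
  show "(psi + phi) x $ S = 0" if "e : S" "x $ e : {-1, 1}" for x S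
   using psi phi that unfolding X_def plus_fun_def by auto
  fix j assume j: "j ~= e"
  then obtain \<eta> where 1: "smooth_map \<eta>" "psi = (%x. (cos (dl j * x $ j))\<^sup>2 *R \<eta> x)" using psi unfolding X_def by blast
  obtain \<eta>' where 2: "smooth_map \<eta>'" "phi = (%x. (cos (dl j * x $ j))\<^sup>2 *R \<eta>' x)" using phi j unfolding X_def by blast
  show "\<exists>phi'. smooth_map phi' \<and> psi + phi = (%x. (cos (dl j * x $ j))\<^sup>2 *R phi' x)"
   using 1 2 by (intro exI[of _ "%x. \<eta> x + \<eta>' x"]) (auto intro: smooth_map_intros simp: fun_eq_iff plus_fun_def scaleR_add_right)
 qed
qed

lemma X_smooth: "psi : X ==> smooth_map psi" unfolding X_def by blast

lemma X_bc: "psi : X ==> x $ e : {-1, 1} ==> e : S ==> psi x $ S = 0" unfolding X_def by blast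

lemma X_face: "psi : X ==> j ~= e ==> cos (dl j * x $ j) = 0 ==> psi x = 0"
proof -
 assume "psi : X" "j ~= e" and c: "cos (dl j * x $ j) = 0"
 then obtain phi where "psi = (%x. (cos (dl j * x $ j))\<^sup>2 *R phi x)" unfolding X_def by blast
 then have "psi x = (cos (dl j * x $ j))\<^sup>2 *R phi x" by simp
 then show ?thesis using c by simp
qed

text \<open>One factor of cos^2 cancels the pole of the tangent and the other remains; where the
  cosine vanishes both sides are 0.\<close>

lemma tn_smooth: "psi : X ==> j ~= e ==> smooth_map (%x. tn j x *R psi x)"
proof -
 assume "psi : X" "j ~= e"
 then obtain phi where phi: "smooth_map phi" "psi = (%x. (cos (dl j * x $ j))\<^sup>2 *R phi x)" unfolding X_def by blast
 have "tn j x *R psi x = (real lam * dl j * (sin (dl j * x $ j) * cos (dl j * x $ j))) *R phi x" for x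
  by (cases "cos (dl j * x $ j) = 0") (auto simp: phi(2) tn_def tan_def power2_eq_square)
 then have "(%x. tn j x *R psi x) = (%x. (real lam * dl j * (sin (dl j * x $ j) * cos (dl j * x $ j))) *R phi x)" by blast
 moreover have "smooth_map ..." by (intro smooth_map_scale phi smooth_mult smooth_const smooth_sin smooth_cos)
 ultimately show ?thesis by simp
qed

definition N :: "(real^'n => real^('n set)) => real" where
 "N y = sqrt (integral Q (%x. y x \<bullet> y x))"

definition C :: "(real^'n => real^('n set)) set" where
 "C = {y. continuous_on Q y \<and> (\<forall>x. parity False (y x))}"

lemma smooth_map_continuous: "smooth_map psi ==> continuous_on S psi"
 unfolding smooth_map_def by (intro continuous_on_vec_lambda[of S "%i x. psi x $ i" for S, simplified]) (auto intro: smooth_fun_continuous)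

lemma int_cont: "continuous_on Q f ==> f integrable_on Q" for f :: "real^'n => real"
 by (rule integrable_continuous)

lemma N_seminorm: "seminorm_on C N"
proof
 show "subspace C" unfolding C_def
  by (rule subspaceI) (auto simp: zero_fun_def plus_fun_def scaleR_fun_def intro!: continuous_intros parity_add parity_scale)
 fix x y :: "real^'n => real^('n set)" assume "x : C" "y : C"
 then have c: "continuous_on Q x" "continuous_on Q y" unfolding C_def by auto
 define a where "a = integral Q (%z. x z \<bullet> x z)" define b where "b = integral Q (%z. x z \<bullet> y z)"
 define d where "d = integral Q (%z. y z \<bullet> y z)"
 have nn: "a >= 0" "d >= 0" unfolding a_def d_def by (intro integral_nonneg int_cont continuous_intros c; simp)+
 have "b\<^sup>2 <= a * d" unfolding a_def b_def d_def by (rule integral_Cauchy_Schwarz[OF c])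
 then have "\<bar>b\<bar> <= sqrt (a * d)" by (simp add: real_le_rsqrt)
 then have b: "b <= sqrt a * sqrt d" by (simp add: real_sqrt_mult)
 have "((%z. (x z \<bullet> x z + 2 * (x z \<bullet> y z)) + y z \<bullet> y z) has_integral (a + 2 * b) + d) Q"
  unfolding a_def b_def d_def
  by (intro has_integral_add has_integral_mult_right integrable_integral int_cont continuous_intros c)
 moreover have "(x + y) z \<bullet> (x + y) z = (x z \<bullet> x z + 2 * (x z \<bullet> y z)) + y z \<bullet> y z" for z
  by (simp add: plus_fun_def inner_add_left inner_add_right inner_commute)
 ultimately have "integral Q (%z. (x + y) z \<bullet> (x + y) z) = a + 2 * b + d" by (simp add: integral_unique)
 also have "... <= (sqrt a + sqrt d)\<^sup>2" using b nn by (simp add: power2_sum)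
 finally show "N (x + y) <= N x + N y" unfolding N_def a_def[symmetric] d_def[symmetric]
  using nn by (intro real_le_lsqrt) auto
next
 fix x :: "real^'n => real^('n set)" and c assume "x : C"
 have "(%z. (c *R x) z \<bullet> (c *R x) z) = (%z. (c * c) * (x z \<bullet> x z))" by (auto simp: scaleR_fun_def)
 then show "N (c *R x) = \<bar>c\<bar> * N x" unfolding N_def by (simp add: real_sqrt_mult)
qed

lemma divergence_sign:
 fixes Y :: "'n => real^'n => real"
 assumes pd: "!!a x. has_pd a (Y a) (Y' a x) x" and c: "!!a. continuous_on UNIV (Y a)" "!!a. continuous_on UNIV (Y' a)"
  and tang: "!!a x. a ~= e ==> cos (dl a * x $ a) = 0 ==> Y a x = 0"
  and top: "!!x. x : Q ==> x $ e = 1 ==> Y e x >= 0" and bot: "!!x. x : Q ==> x $ e = -1 ==> Y e x <= 0"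
 shows "integral Q (%x. SUM a. Y' a x) >= 0"
proof -
 have "integral Q (Y' a) >= 0" for a
 proof (rule integral_pd_nonneg[OF pd c lo_hi])
  fix x assume x: "x : Q"
  have z: "Y a x = 0" if "x $ a = hi $ a \<or> x $ a = lo $ a" "a ~= e"
   using tang[OF that(2)] Q_face[OF x that(1)] by blast
  show "Y a x >= 0" if "x $ a = hi $ a"
   using z top[OF x] that by (cases "a = e") (auto simp: hi_def)
  show "Y a x <= 0" if "x $ a = lo $ a"
   using z bot[OF x] that by (cases "a = e") (auto simp: lo_def)
 qed
 moreover have "integral Q (%x. SUM a. Y' a x) = (SUM a. integral Q (Y' a))"
  by (rule integral_sum) (auto intro: int_cont continuous_on_subset[OF c(2)])
 ultimately show ?thesis by (simp add: sum_nonneg)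
qed

lemma divergence_zero:
 fixes Y :: "'n => real^'n => real"
 assumes pd: "!!a x. has_pd a (Y a) (Y' a x) x" and c: "!!a. continuous_on UNIV (Y a)" "!!a. continuous_on UNIV (Y' a)"
  and tang: "!!a x. a ~= e ==> cos (dl a * x $ a) = 0 ==> Y a x = 0"
  and bdry: "!!x. x : Q ==> x $ e : {-1, 1} ==> Y e x = 0"
 shows "integral Q (%x. SUM a. Y' a x) = 0"
proof -
 have "integral Q (%x. SUM a. Y' a x) >= 0"
  by (rule divergence_sign[OF pd c tang]) (auto simp: bdry)
 moreover have "integral Q (%x. SUM a. - Y' a x) >= 0"
  by (rule divergence_sign[where Y="%a x. - Y a x"])
   (auto simp: bdry tang intro: has_pd_minus pd continuous_intros c)
 ultimately show ?thesis by (simp add: sum_negf)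
qed

text \<open>The pointwise estimates hold only in the open box, because \<open>tn\<close> has no
  derivative on the side faces; the boundary has measure zero.\<close>

lemma integral_le_interior:
 fixes f h :: "real^'n => real"
 assumes "continuous_on Q f" "continuous_on Q h" "!!x. x : box lo hi ==> f x <= h x"
 shows "integral Q f <= integral Q h"
proof -
 have "f integrable_on box lo hi" "h integrable_on box lo hi"
  using int_cont[OF assms(1)] int_cont[OF assms(2)] by (simp_all add: integrable_on_open_interval)
 then have "integral (box lo hi) f <= integral (box lo hi) h" by (intro integral_le assms(3))
 then show ?thesis by (simp add: integral_open_interval)
qed

lemma X_chi: "psi : X ==> x $ e : {-1, 1} ==> chi e (psi x)"
 unfolding chi_iff using X_bc by blast

lemma X_chi_pv:
 assumes "psi : X" "x $ e : {-1, 1}" "b ~= e" shows "chi e (pv b psi x)"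
proof -
 have "pd b (%y. psi y $ S) x = 0" if "e : S" for S
 proof -
  have "(%t. psi (x + t *R axis b 1) $ S) = (%t. 0)"
   using assms that by (intro ext X_bc) (auto simp: axis_def)
  then show ?thesis unfolding pd_def by simp
 qed
 then show ?thesis unfolding chi_iff pv_def by simp
qed

subsection \<open>Garding's inequality\<close>

text \<open>The principal part with variable coefficients. For the coordinate frame it is the flat
  operator, for \<open>E\<close> the principal part of the Dirac operator, and along the homotopy
  the coefficients are interpolated.\<close>

definition Fop :: "('n => 'n => real^'n => real) => (real^'n => real^('n set)) => real^'n => real^('n set)" where
 "Fop F psi x = (SUM i. cl i (SUM a. F i a x *R pv a psi x))"

definition Th :: "(real^'n => real^('n set)) => real^'n => real^('n set)" where
 "Th psi x = (\<Sum>j\<in>UNIV - {e}. tn j x *R ch j (psi x))"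

definition grad_sq :: "(real^'n => real^('n set)) => real^'n => real" where
 "grad_sq psi x = (SUM a. pv a psi x \<bullet> pv a psi x)"

definition tn_sq :: "(real^'n => real^('n set)) => real^'n => real" where
 "tn_sq psi x = (\<Sum>j\<in>UNIV - {e}. (tn j x)\<^sup>2) * (psi x \<bullet> psi x)"

text \<open>The vector field whose divergence carries the mixed terms of the square of
  \<open>Fop\<close>; \<open>Yt\<close> below does the same for the cross term with the j-th tangent
  potential.\<close>

definition Yf :: "('n => 'n => real^'n => real) => (real^'n => real^('n set)) => 'n => real^'n => real" where
 "Yf F psi a x = (SUM b. SUM i. SUM j. (if i = j then 0 else 1) * (F i a x * F j b x * (psi x \<bullet> cl i (cl j (pv b psi x)))))"

definition Yt :: "('n => 'n => real^'n => real) => (real^'n => real^('n set)) => 'n => 'n => real^'n => real" where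
 "Yt F psi j a x = (SUM i. F i a x * ((tn j x *R psi x) \<bullet> cl i (ch j (psi x))))"

text \<open>The mixed products of first derivatives form a divergence up to two remainders. The one
  with second derivatives cancels, being symmetric in the derivatives and skew in the Clifford
  factors; the other contains only derivatives of the coefficients and one derivative of the
  field.\<close>

lemma Fop_sq:
 assumes psi: "smooth_map psi" and F: "!!i a. smooth_fun (F i a)"
 shows "Fop F psi x \<bullet> Fop F psi x = (SUM i. (SUM a. F i a x *R pv a psi x) \<bullet> (SUM a. F i a x *R pv a psi x))
  - (SUM a. pd a (Yf F psi a) x)
  + (SUM a. SUM b. SUM i. SUM j. (if i = j then 0 else 1) * (pd a (%x. F i a x * F j b x) x * (psi x \<bullet> cl i (cl j (pv b psi x)))))"
proof -
 define p where "p i = (SUM a. F i a x *R pv a psi x)" for i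
 define R where "R = (SUM a. SUM b. SUM i. SUM j. (if i = j then 0 else 1) * (pd a (%x. F i a x * F j b x) x * (psi x \<bullet> cl i (cl j (pv b psi x)))))"
 define M where "M = (SUM i. SUM j. (if i = j then 0 else 1) * (p i \<bullet> cl i (cl j (p j))))"
 have 1: "Fop F psi x \<bullet> Fop F psi x = (SUM i. p i \<bullet> p i) - M"
 proof -
  have "Fop F psi x \<bullet> Fop F psi x = (SUM i. SUM j. cl i (p i) \<bullet> cl j (p j))"
   unfolding Fop_def p_def[symmetric] inner_sum_left unfolding inner_sum_right ..
  also have "... = (SUM i. SUM j. (if i = j then 1 else 0) * (p i \<bullet> p i) - (if i = j then 0 else 1) * (p i \<bullet> cl i (cl j (p j))))"
   by (intro sum.cong refl) (auto simp: inner_cl)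
  finally show ?thesis unfolding sum_subtractf sum_delta_left M_def .
 qed
 have s1: "smooth_fun (%x. psi x \<bullet> cl i (cl j (pv b psi x)))" for i j b
  using psi by (intro smooth_inner smooth_map_intros)
 have pt: "pd a (%x. psi x \<bullet> cl i (cl j (pv b psi x))) x = pv a psi x \<bullet> cl i (cl j (pv b psi x)) + psi x \<bullet> cl i (cl j (pv a (pv b psi) x))" for a b i j
  using psi by (simp add: pd_inner smooth_map_intros pv_cl)
 have trm: "pd a (%x. (if i = j then 0 else 1) * (F i a x * F j b x * (psi x \<bullet> cl i (cl j (pv b psi x))))) x
  = (if i = j then 0 else 1) * (pd a (%x. F i a x * F j b x) x * (psi x \<bullet> cl i (cl j (pv b psi x))))
   + (if i = j then 0 else 1) * ((F i a x *R pv a psi x) \<bullet> cl i (cl j (F j b x *R pv b psi x)))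
   + (if i = j then 0 else 1) * (F i a x * F j b x * (psi x \<bullet> cl i (cl j (pv a (pv b psi) x))))" for a b i j
 proof -
  have "pd a (%x. (F i a x * F j b x) * (psi x \<bullet> cl i (cl j (pv b psi x)))) x
   = pd a (%x. F i a x * F j b x) x * (psi x \<bullet> cl i (cl j (pv b psi x)))
    + (F i a x * F j b x) * (pv a psi x \<bullet> cl i (cl j (pv b psi x)) + psi x \<bullet> cl i (cl j (pv a (pv b psi) x)))"
   unfolding pt[symmetric] by (rule pd_mult[OF smooth_mult[OF F F] s1])
  then show ?thesis by (auto simp: cl_simps distrib_left)
 qed
 have "(SUM a. pd a (Yf F psi a) x) = R
  + (SUM a. SUM b. SUM i. SUM j. (if i = j then 0 else 1) * ((F i a x *R pv a psi x) \<bullet> cl i (cl j (F j b x *R pv b psi x))))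
  + (SUM a. SUM b. SUM i. SUM j. (if i = j then 0 else 1) * (F i a x * F j b x * (psi x \<bullet> cl i (cl j (pv a (pv b psi) x)))))"
 proof -
  have "pd a (Yf F psi a) x = (SUM b. SUM i. SUM j. pd a (%x. (if i = j then 0 else 1) * (F i a x * F j b x * (psi x \<bullet> cl i (cl j (pv b psi x))))) x)" for a
  proof -
   have s: "smooth_fun (%x. (if i = j then 0 else 1) * (F i a x * F j b x * (psi x \<bullet> cl i (cl j (pv b psi x)))))" for i j b
    by (intro smooth_mult smooth_const F s1)
   show ?thesis unfolding Yf_def[abs_def]
    by (subst pd_sum, intro smooth_sum s, rule sum.cong[OF refl], subst pd_sum, intro smooth_sum s, rule sum.cong[OF refl], rule pd_sum, rule s)
  qed
  then show ?thesis unfolding trm R_def by (simp only: sum.distrib)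
 qed
 also have "(SUM a. SUM b. SUM i. SUM j. (if i = j then 0 else 1) * ((F i a x *R pv a psi x) \<bullet> cl i (cl j (F j b x *R pv b psi x)))) = M"
 proof -
  have "M = (SUM i. SUM j. SUM a. SUM b. (if i = j then 0 else 1) * ((F i a x *R pv a psi x) \<bullet> cl i (cl j (F j b x *R pv b psi x))))"
   unfolding M_def p_def cl_sum inner_sum_left unfolding inner_sum_right sum_distrib_left ..
  also have "... = (SUM a. SUM i. SUM j. SUM b. (if i = j then 0 else 1) * ((F i a x *R pv a psi x) \<bullet> cl i (cl j (F j b x *R pv b psi x))))"
   by (rule sum3_rotate)
  also have "... = (SUM a. SUM b. SUM i. SUM j. (if i = j then 0 else 1) * ((F i a x *R pv a psi x) \<bullet> cl i (cl j (F j b x *R pv b psi x))))"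
   by (rule sum.cong[OF refl], rule sum3_rotate)
  finally show ?thesis ..
 qed
 also have "(SUM a. SUM b. SUM i. SUM j. (if i = j then 0 else 1) * (F i a x * F j b x * (psi x \<bullet> cl i (cl j (pv a (pv b psi) x))))) = 0" (is "?Z = 0")
 proof -
  have "?Z = (SUM b. SUM a. SUM j. SUM i. (if i = j then 0 else 1) * (F i a x * F j b x * (psi x \<bullet> cl i (cl j (pv a (pv b psi) x)))))"
   by (subst sum.swap, rule sum.cong[OF refl], rule sum.cong[OF refl], rule sum.swap)
  also have "... = - ?Z"
   unfolding sum_negf[symmetric]
  proof (rule sum.cong[OF refl], rule sum.cong[OF refl], rule sum.cong[OF refl], rule sum.cong[OF refl])
   fix b a j i
   show "(if i = j then 0 else 1) * (F i a x * F j b x * (psi x \<bullet> cl i (cl j (pv a (pv b psi) x))))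
    = - ((if j = i then 0 else 1) * (F j b x * F i a x * (psi x \<bullet> cl j (cl i (pv b (pv a psi) x)))))"
   proof (cases "i = j")
    case False
    show ?thesis using cl_cl[OF False, of "pv a (pv b psi) x"] pv_commute[OF psi, of b a x] False by simp
   qed simp
  qed
  finally show ?thesis by simp
 qed
 finally have "M = (SUM a. pd a (Yf F psi a) x) - R" by simp
 then show ?thesis unfolding 1 R_def p_def by simp
qed

lemma smooth_cl_pv: "smooth_map psi ==> smooth_fun (%x. psi x \<bullet> cl i (cl j (pv b psi x)))"
 by (intro smooth_inner smooth_map_intros)

lemma Yf_smooth: "smooth_map psi ==> (!!i a. smooth_fun (F i a)) ==> smooth_fun (Yf F psi a)"
 unfolding Yf_def[abs_def] by (intro smooth_sum smooth_mult smooth_const smooth_cl_pv)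

lemma Yt_smooth: "psi : X ==> (!!i a. smooth_fun (F i a)) ==> j ~= e ==> smooth_fun (Yt F psi j a)"
 unfolding Yt_def[abs_def] by (intro smooth_sum smooth_mult smooth_inner tn_smooth smooth_map_intros X_smooth)

text \<open>On the faces of the band the triangular shape of F leaves only i = e. Among those terms
  the derivative in direction e has the coefficient F j e = 0, and tangential derivatives pair to
  zero by \<open>chi_cl_cl\<close>.\<close>

lemma Yf_zero: 
 assumes psi: "psi : X" and Fe: "!!i x. i ~= e ==> F i e x = 0"
 shows "a ~= e ==> cos (dl a * x $ a) = 0 ==> Yf F psi a x = 0" "x $ e : {-1, 1} ==> Yf F psi e x = 0"
proof -
 show "Yf F psi a x = 0" if "a ~= e" "cos (dl a * x $ a) = 0"
  using X_face[OF psi that] by (simp add: Yf_def)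
 assume x: "x $ e : {-1, 1}"
 show "Yf F psi e x = 0" unfolding Yf_def
 proof (intro sum.neutral ballI)
  fix b i j :: 'n
  consider "i = j" | "i ~= e" | "i = e" "j ~= e" "b = e" | "i = e" "j ~= e" "b ~= e" by blast
  then show "(if i = j then 0 else 1) * (F i e x * F j b x * (psi x \<bullet> cl i (cl j (pv b psi x)))) = 0"
  proof cases
   case 4
   then show ?thesis using chi_cl_cl[OF X_chi[OF psi x] X_chi_pv[OF psi x]] by simp
  qed (auto simp: Fe)
 qed
qed

lemma Yt_zero: 
 assumes psi: "psi : X" and Fe: "!!i x. i ~= e ==> F i e x = 0" and j: "j ~= e"
 shows "a ~= e ==> cos (dl a * x $ a) = 0 ==> Yt F psi j a x = 0" "x $ e : {-1, 1} ==> Yt F psi j e x = 0"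
proof -
 show "Yt F psi j a x = 0" if "a ~= e" "cos (dl a * x $ a) = 0"
  using X_face[OF psi that] by (simp add: Yt_def)
 assume x: "x $ e : {-1, 1}"
 show "Yt F psi j e x = 0" unfolding Yt_def
 proof (intro sum.neutral ballI)
  fix i
  show "F i e x * ((tn j x *R psi x) \<bullet> cl i (ch j (psi x))) = 0"
   using Fe[of i x] chi_cl_ch[OF X_chi[OF psi x] j] by (cases "i = e") auto
 qed
qed

lemma div_Yt:
 assumes psi: "psi : X" and F: "!!i a. smooth_fun (F i a)" and j: "j ~= e" and x: "x : box lo hi"
 shows "(SUM a. pd a (Yt F psi j a) x) = tn' j x * (SUM i. F i j x * (psi x \<bullet> cl i (ch j (psi x))))
  + tn j x * (SUM a. SUM i. pd a (F i a) x * (psi x \<bullet> cl i (ch j (psi x))))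
  - 2 * tn j x * (Fop F psi x \<bullet> ch j (psi x))"
proof -
 define H where "H i x = psi x \<bullet> cl i (ch j (psi x))" for i x
 have sH: "smooth_fun (H i)" for i unfolding H_def[abs_def] using X_smooth[OF psi] by (intro smooth_inner smooth_map_intros)
 have pH: "pd a (H i) x = 2 * (pv a psi x \<bullet> cl i (ch j (psi x)))" for a i
 proof -
  have "pd a (H i) x = pv a psi x \<bullet> cl i (ch j (psi x)) + psi x \<bullet> cl i (ch j (pv a psi x))"
   unfolding H_def[abs_def] using X_smooth[OF psi] by (simp add: pd_inner smooth_map_intros pv_cl pv_ch)
  also have "psi x \<bullet> cl i (ch j (pv a psi x)) = - (cl i (psi x) \<bullet> ch j (pv a psi x))" by (simp add: inner_cl)
  also have "... = - (ch j (cl i (psi x)) \<bullet> pv a psi x)" by (simp add: inner_ch)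
  also have "... = cl i (ch j (psi x)) \<bullet> pv a psi x" by (simp add: cl_ch)
  finally show ?thesis by (simp add: inner_commute)
 qed
 have "pd a (Yt F psi j a) x = (SUM i. pd a (F i a) x * (tn j x * H i x)
   + F i a x * ((if a = j then tn' j x else 0) * H i x + tn j x * pd a (H i) x))" for a
 proof -
  have E: "Yt F psi j a = (%x. SUM i. F i a x * (tn j x * H i x))"
   by (rule ext) (simp add: Yt_def H_def)
  show ?thesis unfolding E
  proof (rule has_pd_imp_pd)
   show "has_pd a (%x. SUM i. F i a x * (tn j x * H i x)) (SUM i. pd a (F i a) x * (tn j x * H i x)
   + F i a x * ((if a = j then tn' j x else 0) * H i x + tn j x * pd a (H i) x)) x"
   by (intro has_pd_sum has_pd_mult smooth_fun_has_pd F sH has_pd_tn x)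
  qed
 qed
 then have "(SUM a. pd a (Yt F psi j a) x) = tn j x * (SUM a. SUM i. pd a (F i a) x * H i x)
  + (SUM a. SUM i. (if a = j then tn' j x else 0) * (F i a x * H i x))
  + tn j x * (SUM a. SUM i. F i a x * pd a (H i) x)"
  by (simp add: distrib_left sum.distrib sum_distrib_left mult_ac)
 also have "(SUM a. SUM i. (if a = j then tn' j x else 0) * (F i a x * H i x))
  = (SUM a. (if a = j then 1 else 0) * (tn' j x * (SUM i. F i a x * H i x)))"
  by (intro sum.cong refl) (simp add: sum_distrib_left)
 also have "... = tn' j x * (SUM i. F i j x * H i x)" by (rule sum_delta_left)
 also have "(SUM a. SUM i. F i a x * pd a (H i) x) = - 2 * (Fop F psi x \<bullet> ch j (psi x))"
 proof -
  have "Fop F psi x \<bullet> ch j (psi x) = - (SUM i. SUM a. F i a x * (pv a psi x \<bullet> cl i (ch j (psi x))))"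
   unfolding Fop_def inner_sum_left by (simp add: inner_cl inner_sum_left sum_negf)
  also have "(SUM i. SUM a. F i a x * (pv a psi x \<bullet> cl i (ch j (psi x)))) = (SUM a. SUM i. F i a x * (pv a psi x \<bullet> cl i (ch j (psi x))))"
   by (rule sum.swap)
  finally show ?thesis unfolding pH by (simp add: sum_distrib_left mult_ac sum_negf)
 qed
 finally show ?thesis unfolding H_def by simp
qed

lemma young: "c > 0 ==> B * a * b <= c * a\<^sup>2 + B\<^sup>2 / (4 * c) * b\<^sup>2" for a b c B :: real
proof -
 assume c: "c > 0"
 have "0 <= (2 * c * a - B * b)\<^sup>2 / (4 * c)" using c by simp
 also have "... = c * a\<^sup>2 + B\<^sup>2 / (4 * c) * b\<^sup>2 - B * a * b" using c by (simp add: power2_eq_square field_simps)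
 finally show ?thesis by simp
qed

text \<open>On a fixed box it depends on the coefficients only through the bounds m, C0 and K, hence
  it is uniform along the homotopy.\<close>

definition garding_const :: "real => real => real => real" where
 "garding_const m C0 K = real CARD('n) * ((2 * C0\<^sup>2 * real CARD('n) ^ 3)\<^sup>2 / (4 * (m / 2)))
  + (\<Sum>j\<in>UNIV - {e}. K * real lam * (dl j)\<^sup>2 + (real CARD('n) ^ 2 * C0)\<^sup>2)"

text \<open>Half of the ellipticity m absorbs the derivatives of the coefficients. Of the square of
  the tangent potentials, one half pays for their derivatives, since K/lam \<le> 1/2, and one
  quarter for the derivatives of F in the cross term; one quarter is left.\<close>

lemma garding_pointwise:
 assumes psi: "psi : X" and F: "!!i a. smooth_fun (F i a)"
  and m: "m > 0" "!!xi. (SUM i. (SUM a. F i a x * xi a)\<^sup>2) >= m * (SUM a. (xi a)\<^sup>2)"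
  and C0: "!!i a. \<bar>F i a x\<bar> <= C0" "!!i a c. \<bar>pd c (F i a) x\<bar> <= C0"
  and K: "!!j. j ~= e ==> sqrt (SUM i. (F i j x)\<^sup>2) <= K" "2 * K <= real lam"
  and x: "x : box lo hi"
 shows "m / 2 * grad_sq psi x + 1/4 * tn_sq psi x - garding_const m C0 K * (psi x \<bullet> psi x)
   - (SUM a. pd a (Yf F psi a) x) - (\<Sum>j\<in>UNIV - {e}. SUM a. pd a (Yt F psi j a) x)
  <= (Fop F psi x + Th psi x) \<bullet> (Fop F psi x + Th psi x)"
proof -
 let ?u = "psi x" and ?n = "real CARD('n)"
 define U where "U = ?u \<bullet> ?u"
 have U: "U >= 0" "norm ?u * norm ?u = U" "(norm ?u)\<^sup>2 = U" by (simp_all add: U_def norm_eq_sqrt_inner)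
 have C00: "C0 >= 0" using C0(1)[of undefined undefined] by linarith
 define p where "p i = (SUM a. F i a x *R pv a psi x)" for i
 have "(SUM i. p i \<bullet> p i) = (SUM S. SUM i. (SUM a. F i a x * (pv a psi x $ S))\<^sup>2)"
  unfolding p_def inner_vec_def inner_real_def by (subst sum.swap) (simp add: power2_eq_square)
 also have "... >= (SUM S. m * (SUM a. (pv a psi x $ S)\<^sup>2))" by (intro sum_mono m(2))
 also have "(SUM S. m * (SUM a. (pv a psi x $ S)\<^sup>2)) = m * grad_sq psi x"
  unfolding grad_sq_def inner_vec_def inner_real_def sum_distrib_left[symmetric] by (subst sum.swap) (simp add: power2_eq_square)
 finally have P: "(SUM i. p i \<bullet> p i) >= m * grad_sq psi x" .
 define R where "R = (SUM a. SUM b. SUM i. SUM j. (if i = j then 0 else 1) * (pd a (%x. F i a x * F j b x) x * (?u \<bullet> cl i (cl j (pv b psi x)))))"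
 have Rb: "R >= - (m / 2 * grad_sq psi x + ?n * ((2 * C0\<^sup>2 * ?n ^ 3)\<^sup>2 / (4 * (m / 2))) * U)"
 proof -
  have t: "\<bar>(if i = j then 0 else 1) * (pd a (%x. F i a x * F j b x) x * (?u \<bullet> cl i (cl j (pv b psi x))))\<bar> <= 2 * C0\<^sup>2 * (norm ?u * norm (pv b psi x))" for a b i j
  proof -
   have "pd a (%x. F i a x * F j b x) x = pd a (F i a) x * F j b x + F i a x * pd a (F j b) x"
    by (rule pd_mult[OF F F])
   also have "\<bar>...\<bar> <= \<bar>pd a (F i a) x\<bar> * \<bar>F j b x\<bar> + \<bar>F i a x\<bar> * \<bar>pd a (F j b) x\<bar>"
    by (metis abs_mult abs_triangle_ineq)
   also have "... <= C0 * C0 + C0 * C0" by (intro add_mono mult_mono C0 abs_ge_zero C00)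
   finally have 1: "\<bar>pd a (%x. F i a x * F j b x) x\<bar> <= 2 * C0\<^sup>2" by (simp add: power2_eq_square)
   have "\<bar>?u \<bullet> cl i (cl j (pv b psi x))\<bar> <= norm ?u * norm (pv b psi x)"
    using Cauchy_Schwarz_ineq2[of ?u "cl i (cl j (pv b psi x))"] by simp
   with 1 have "\<bar>pd a (%x. F i a x * F j b x) x\<bar> * \<bar>?u \<bullet> cl i (cl j (pv b psi x))\<bar> <= 2 * C0\<^sup>2 * (norm ?u * norm (pv b psi x))"
    by (intro mult_mono) auto
   then show ?thesis using C00 by (auto simp: abs_mult)
  qed
  have "\<bar>R\<bar> <= (\<Sum>a::'n\<in>UNIV. SUM b. \<Sum>i::'n\<in>UNIV. \<Sum>j::'n\<in>UNIV. 2 * C0\<^sup>2 * (norm ?u * norm (pv b psi x)))"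
   unfolding R_def by (intro order_trans[OF sum_abs] sum_mono t)
  also have "... = (SUM b. 2 * C0\<^sup>2 * ?n ^ 3 * norm (pv b psi x) * norm ?u)"
   by (simp add: sum_distrib_left power3_eq_cube mult_ac)
  also have "... <= (SUM b. m / 2 * (norm (pv b psi x))\<^sup>2 + (2 * C0\<^sup>2 * ?n ^ 3)\<^sup>2 / (4 * (m / 2)) * (norm ?u)\<^sup>2)"
   using m(1) by (intro sum_mono young) simp
  also have "... = m / 2 * grad_sq psi x + ?n * ((2 * C0\<^sup>2 * ?n ^ 3)\<^sup>2 / (4 * (m / 2))) * U"
   unfolding U(3) grad_sq_def by (simp add: sum.distrib sum_distrib_left power2_norm_eq_inner)
  finally show ?thesis by linarith
 qed
 define V where "V j = (SUM a. pd a (Yt F psi j a) x)" for j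
 have Vb: "2 * (tn j x * (Fop F psi x \<bullet> ch j ?u)) >= - V j - 3/4 * (tn j x)\<^sup>2 * U - (K * real lam * (dl j)\<^sup>2 + (?n ^ 2 * C0)\<^sup>2) * U" if j: "j ~= e" for j
 proof -
  define s1 where "s1 = (SUM i. F i j x * (?u \<bullet> cl i (ch j ?u)))"
  define s2 where "s2 = (SUM a. SUM i. pd a (F i a) x * (?u \<bullet> cl i (ch j ?u)))"
  have V: "V j = tn' j x * s1 + tn j x * s2 - 2 * (tn j x * (Fop F psi x \<bullet> ch j ?u))"
   unfolding V_def s1_def s2_def using div_Yt[OF psi F j x] by simp
  have s1: "\<bar>s1\<bar> <= K * U"
  proof -
   define z where "z = (SUM i. F i j x *R cl i (ch j ?u))"
   have "z \<bullet> z = (SUM i. SUM k. (if i = k then 1 else 0) * (F i j x * F k j x * U))"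
    unfolding z_def inner_sum_left unfolding inner_sum_right
    by (intro sum.cong refl) (simp add: inner_cl inner_cl_cl inner_ch U_def)
   also have "... = (SUM i. (F i j x)\<^sup>2) * U"
    unfolding sum_delta_left by (simp add: sum_distrib_right power2_eq_square)
   finally have "norm z = sqrt (SUM i. (F i j x)\<^sup>2) * norm ?u"
    by (simp add: norm_eq_sqrt_inner real_sqrt_mult U_def)
   then have "norm z <= K * norm ?u" using K(1)[OF j] by (simp add: mult_right_mono)
   moreover have "s1 = ?u \<bullet> z" by (simp add: s1_def z_def inner_sum_right)
   ultimately have "\<bar>s1\<bar> <= norm ?u * (K * norm ?u)"
    using Cauchy_Schwarz_ineq2[of ?u z] mult_left_mono[of "norm z" "K * norm ?u" "norm ?u"] by simp
   also have "... = K * U" unfolding U(2)[symmetric] by simp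
   finally show ?thesis .
  qed
  have "\<bar>s2\<bar> <= (\<Sum>a::'n\<in>UNIV. \<Sum>i::'n\<in>UNIV. C0 * U)"
   unfolding s2_def
  proof (intro order_trans[OF sum_abs] sum_mono)
   fix a i
   have "\<bar>?u \<bullet> cl i (ch j ?u)\<bar> <= U" using Cauchy_Schwarz_ineq2[of ?u "cl i (ch j ?u)"] U(2) by simp
   then show "\<bar>pd a (F i a) x * (?u \<bullet> cl i (ch j ?u))\<bar> <= C0 * U"
    unfolding abs_mult by (intro mult_mono C0 C00) auto
  qed
  then have s2: "\<bar>s2\<bar> <= ?n ^ 2 * C0 * U" by (simp add: power2_eq_square mult_ac)
  have lam0: "real lam > 0" using lam by simp
  have K0: "K >= 0" using K(1)[OF j] by (meson order_trans real_sqrt_ge_zero sum_nonneg zero_le_power2)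
  have a1: "- (tn' j x * s1) <= (K * real lam * (dl j)\<^sup>2 + 1/2 * (tn j x)\<^sup>2) * U"
  proof -
   have "tn' j x * - s1 <= tn' j x * (K * U)" using s1 tn'_nonneg by (intro mult_left_mono) auto
   also have "... = (K * real lam * (dl j)\<^sup>2 + K / real lam * (tn j x)\<^sup>2) * U" by (simp add: tn'_def algebra_simps)
   also have "... <= (K * real lam * (dl j)\<^sup>2 + 1/2 * (tn j x)\<^sup>2) * U"
    using K(2) lam0 U(1) by (intro mult_right_mono add_left_mono) (auto simp: divide_le_eq)
   finally show ?thesis by simp
  qed
  have a2: "- (tn j x * s2) <= (1/4 * (tn j x)\<^sup>2 + (?n ^ 2 * C0)\<^sup>2) * U"
  proof -
   have "- (tn j x * s2) <= \<bar>tn j x\<bar> * \<bar>s2\<bar>" by (metis abs_ge_minus_self abs_mult)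
   also have "... <= \<bar>tn j x\<bar> * (?n ^ 2 * C0 * U)" using s2 by (intro mult_left_mono) auto
   also have "... = (?n ^ 2 * C0 * \<bar>tn j x\<bar> * 1) * U" by simp
   also have "... <= (1/4 * \<bar>tn j x\<bar>\<^sup>2 + (?n ^ 2 * C0)\<^sup>2 / (4 * (1/4)) * 1\<^sup>2) * U"
    using U(1) by (intro mult_right_mono young) auto
   finally show ?thesis by simp
  qed
  have gen: "- v - 3/4 * t * u - (a + b) * u <= 2 * w" if "v = p + r - 2 * w" "- p <= (a + 1/2 * t) * u" "- r <= (1/4 * t + b) * u"
   for v t u a b w p r :: real
  proof -
   from that show ?thesis by (simp add: algebra_simps)
  qed
  show ?thesis by (rule gen[OF V a1 a2])
 qed
 have Th2: "Th psi x \<bullet> Th psi x = tn_sq psi x"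
 proof -
  have ch0: "ch i ?u \<bullet> ch j ?u = (if i = j then U else 0)" for i j
  proof (cases "i = j")
   case False
   have "ch i ?u \<bullet> ch j ?u = ?u \<bullet> ch i (ch j ?u)" by (simp add: inner_ch)
   also have "... = - (?u \<bullet> ch j (ch i ?u))" using ch_ch[OF False, of ?u] by simp
   also have "... = - (ch j ?u \<bullet> ch i ?u)" by (simp add: inner_ch)
   finally show ?thesis using False by (simp add: inner_commute)
  qed (simp add: inner_ch U_def)
  have "Th psi x \<bullet> Th psi x = (\<Sum>i\<in>UNIV - {e}. \<Sum>j\<in>UNIV - {e}. if j = i then (tn i x)\<^sup>2 * U else 0)"
   unfolding Th_def inner_sum_left unfolding inner_sum_right by (intro sum.cong refl) (auto simp: ch0 power2_eq_square)
  then show ?thesis by (simp add: sum_distrib_right tn_sq_def U_def)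
 qed
 have FT: "2 * (Fop F psi x \<bullet> Th psi x) >= - (\<Sum>j\<in>UNIV - {e}. V j) - 3/4 * tn_sq psi x - (\<Sum>j\<in>UNIV - {e}. K * real lam * (dl j)\<^sup>2 + (?n ^ 2 * C0)\<^sup>2) * U"
 proof -
  have "2 * (Fop F psi x \<bullet> Th psi x) = (\<Sum>j\<in>UNIV - {e}. 2 * (tn j x * (Fop F psi x \<bullet> ch j ?u)))"
   unfolding Th_def inner_sum_right sum_distrib_left by simp
  also have "... >= (\<Sum>j\<in>UNIV - {e}. - V j - 3/4 * (tn j x)\<^sup>2 * U - (K * real lam * (dl j)\<^sup>2 + (?n ^ 2 * C0)\<^sup>2) * U)"
   using Vb by (intro sum_mono) auto
  also have "(\<Sum>j\<in>UNIV - {e}. - V j - 3/4 * (tn j x)\<^sup>2 * U - (K * real lam * (dl j)\<^sup>2 + (?n ^ 2 * C0)\<^sup>2) * U)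
   = - (\<Sum>j\<in>UNIV - {e}. V j) - 3/4 * tn_sq psi x - (\<Sum>j\<in>UNIV - {e}. K * real lam * (dl j)\<^sup>2 + (?n ^ 2 * C0)\<^sup>2) * U"
   unfolding tn_sq_def U_def[symmetric] sum_subtractf sum_negf sum_distrib_right sum_distrib_left by (simp add: mult.assoc)
  finally show ?thesis .
 qed
 have "(Fop F psi x + Th psi x) \<bullet> (Fop F psi x + Th psi x) = Fop F psi x \<bullet> Fop F psi x + 2 * (Fop F psi x \<bullet> Th psi x) + tn_sq psi x"
  unfolding Th2[symmetric] by (simp add: inner_add_left inner_add_right inner_commute)
 moreover have "Fop F psi x \<bullet> Fop F psi x = (SUM i. p i \<bullet> p i) - (SUM a. pd a (Yf F psi a) x) + R"
  unfolding R_def p_def by (rule Fop_sq[OF X_smooth[OF psi] F])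
 moreover have "garding_const m C0 K * (psi x \<bullet> psi x) = ?n * ((2 * C0\<^sup>2 * ?n ^ 3)\<^sup>2 / (4 * (m / 2))) * U
   + (\<Sum>j\<in>UNIV - {e}. K * real lam * (dl j)\<^sup>2 + (?n ^ 2 * C0)\<^sup>2) * U"
  unfolding garding_const_def U_def[symmetric] by (rule distrib_right)
 ultimately show ?thesis using P Rb FT unfolding V_def by linarith
qed

lemma Fop_smooth: "smooth_map psi ==> (!!i a. smooth_fun (F i a)) ==> smooth_map (Fop F psi)"
 unfolding Fop_def[abs_def] by (intro smooth_map_intros)

lemma Th_smooth: "psi : X ==> smooth_map (Th psi)"
proof -
 assume psi: "psi : X"
 have "Th psi = (%x. \<Sum>j\<in>UNIV - {e}. ch j (tn j x *R psi x))"
  by (rule ext) (simp add: Th_def ch_simps)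
 moreover have "smooth_map ..." using psi by (intro smooth_map_sum smooth_map_ch tn_smooth) auto
 ultimately show ?thesis by simp
qed

lemma grad_sq_smooth: "smooth_map psi ==> smooth_fun (grad_sq psi)"
 unfolding grad_sq_def[abs_def] by (intro smooth_sum smooth_inner smooth_map_pv)

lemma tn_sq_smooth: "psi : X ==> smooth_fun (tn_sq psi)"
proof -
 assume psi: "psi : X"
 have "tn_sq psi = (%x. \<Sum>j\<in>UNIV - {e}. (tn j x *R psi x) \<bullet> (tn j x *R psi x))"
  by (rule ext) (simp add: tn_sq_def sum_distrib_left power2_eq_square mult_ac)
 moreover have "smooth_fun ..." using psi by (intro smooth_sum smooth_inner tn_smooth) auto
 ultimately show ?thesis by simp
qed

lemma garding:
 assumes psi: "psi : X" and F: "!!i a. smooth_fun (F i a)" and Fe: "!!i x. i ~= e ==> F i e x = 0"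
  and m: "m > 0" "!!x xi. x : Q ==> (SUM i. (SUM a. F i a x * xi a)\<^sup>2) >= m * (SUM a. (xi a)\<^sup>2)"
  and C0: "!!x i a. x : Q ==> \<bar>F i a x\<bar> <= C0" "!!x i a c. x : Q ==> \<bar>pd c (F i a) x\<bar> <= C0"
  and K: "!!x j. x : Q ==> j ~= e ==> sqrt (SUM i. (F i j x)\<^sup>2) <= K" "2 * K <= real lam"
 shows "m / 2 * integral Q (grad_sq psi) + 1/4 * integral Q (tn_sq psi)
   - garding_const m C0 K * integral Q (%x. psi x \<bullet> psi x) <= integral Q (%x. (Fop F psi x + Th psi x) \<bullet> (Fop F psi x + Th psi x))"
proof -
 let ?c = "garding_const m C0 K"
 note sm = X_smooth[OF psi]
 have zf: "integral Q (%x. SUM a. pd a (Yf F psi a) x) = 0"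
  by (rule divergence_zero[where Y="Yf F psi"])
   (auto intro: smooth_fun_has_pd smooth_fun_continuous smooth_fun_pd Yf_smooth sm F Yf_zero[where F=F, OF psi Fe])
 have zt: "integral Q (%x. SUM a. pd a (Yt F psi j a) x) = 0" if j: "j ~= e" for j
  by (rule divergence_zero[where Y="Yt F psi j"])
   (auto intro: smooth_fun_has_pd smooth_fun_continuous smooth_fun_continuous[OF smooth_fun_pd[OF Yt_smooth[OF psi F j]]] Yt_smooth[OF psi F j] Yt_zero[where F=F, OF psi Fe j])
 have c: "continuous_on Q (grad_sq psi)" "continuous_on Q (tn_sq psi)" "continuous_on Q (%x. psi x \<bullet> psi x)"
  "continuous_on Q (%x. SUM a. pd a (Yf F psi a) x)"
  "continuous_on Q (%x. \<Sum>j\<in>UNIV - {e}. SUM a. pd a (Yt F psi j a) x)"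
  using psi sm F
  by (auto intro!: smooth_fun_continuous grad_sq_smooth tn_sq_smooth smooth_inner smooth_sum smooth_fun_pd Yf_smooth Yt_smooth)
 have "((%x. m / 2 * grad_sq psi x + 1/4 * tn_sq psi x - ?c * (psi x \<bullet> psi x)
   - (SUM a. pd a (Yf F psi a) x) - (\<Sum>j\<in>UNIV - {e}. SUM a. pd a (Yt F psi j a) x)) has_integral
  (m / 2 * integral Q (grad_sq psi) + 1/4 * integral Q (tn_sq psi) - ?c * integral Q (%x. psi x \<bullet> psi x)
   - integral Q (%x. SUM a. pd a (Yf F psi a) x)
   - integral Q (%x. \<Sum>j\<in>UNIV - {e}. SUM a. pd a (Yt F psi j a) x))) Q"
  by (intro has_integral_add has_integral_diff has_integral_mult_right integrable_integral int_cont c)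
 moreover have "integral Q (%x. \<Sum>j\<in>UNIV - {e}. SUM a. pd a (Yt F psi j a) x) = 0"
 proof -
  have "integral Q (%x. \<Sum>j\<in>UNIV - {e}. SUM a. pd a (Yt F psi j a) x)
   = (\<Sum>j\<in>UNIV - {e}. integral Q (%x. SUM a. pd a (Yt F psi j a) x))"
   using psi F by (intro integral_sum) (auto intro!: int_cont smooth_fun_continuous smooth_sum smooth_fun_pd Yt_smooth)
  also have "... = 0" by (intro sum.neutral ballI zt) auto
  finally show ?thesis .
 qed
 ultimately have "m / 2 * integral Q (grad_sq psi) + 1/4 * integral Q (tn_sq psi) - ?c * integral Q (%x. psi x \<bullet> psi x)
  = integral Q (%x. m / 2 * grad_sq psi x + 1/4 * tn_sq psi x - ?c * (psi x \<bullet> psi x)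
   - (SUM a. pd a (Yf F psi a) x) - (\<Sum>j\<in>UNIV - {e}. SUM a. pd a (Yt F psi j a) x))"
  using zf by (simp add: integral_unique)
 also have "... <= integral Q (%x. (Fop F psi x + Th psi x) \<bullet> (Fop F psi x + Th psi x))"
 proof (rule integral_le_interior)
  show "continuous_on Q (%x. m / 2 * grad_sq psi x + 1/4 * tn_sq psi x - ?c * (psi x \<bullet> psi x)
   - (SUM a. pd a (Yf F psi a) x) - (\<Sum>j\<in>UNIV - {e}. SUM a. pd a (Yt F psi j a) x))"
   by (intro continuous_intros c)
  show "continuous_on Q (%x. (Fop F psi x + Th psi x) \<bullet> (Fop F psi x + Th psi x))"
   by (intro smooth_fun_continuous smooth_inner smooth_map_add Fop_smooth Th_smooth psi sm F)
  fix x assume x: "x : box lo hi"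
  then have xQ: "x : Q" using box_subset_cbox by blast
  show "m / 2 * grad_sq psi x + 1/4 * tn_sq psi x - ?c * (psi x \<bullet> psi x)
   - (SUM a. pd a (Yf F psi a) x) - (\<Sum>j\<in>UNIV - {e}. SUM a. pd a (Yt F psi j a) x)
   <= (Fop F psi x + Th psi x) \<bullet> (Fop F psi x + Th psi x)"
   by (rule garding_pointwise[OF psi F m(1) m(2)[OF xQ] C0(1)[OF xQ] C0(2)[OF xQ] K(1)[OF xQ] K(2) x])
 qed
 finally show ?thesis .
qed

end

lemma lin_on_sum:
 assumes "subspace X" "lin_on X T" "!!i. i : I ==> f i : X"
 shows "T (\<Sum>i\<in>I. f i) = (\<Sum>i\<in>I. T (f i))"
proof -
 have T0: "T 0 = 0" using assms(2) subspace_0[OF assms(1)] unfolding lin_on_def by (metis scaleR_zero_left)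
 show ?thesis using assms(3)
 proof (induction I rule: infinite_finite_induct)
  case (insert x F)
  then have "(\<Sum>i\<in>F. f i) : X" by (intro subspace_sum[OF assms(1)]) auto
  then show ?case using insert assms(2) unfolding lin_on_def by auto
 qed (simp_all add: T0)
qed

lemma sum_fun_apply: "(\<Sum>i\<in>I. f i) x = (\<Sum>i\<in>I. f i x)"
 by (induction I rule: infinite_finite_induct) auto

context slab begin

subsection \<open>The model operator\<close>

definition T0 :: "(real^'n => real^('n set)) => real^'n => real^('n set)" where
 "T0 psi x = (SUM a. cl a (pv a psi x)) + Th psi x"

lemma Th_lin: "Th (psi + phi) = Th psi + Th phi" "Th (c *R psi) = c *R Th psi"
 by (auto simp: fun_eq_iff Th_def plus_fun_def scaleR_fun_def ch_simps scaleR_add_right sum.distrib scaleR_sum_right mult.commute)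

lemma pv_fun: "smooth_map psi ==> smooth_map phi ==> pv a (psi + phi) x = pv a psi x + pv a phi x"
 "smooth_map psi ==> pv a (c *R psi) x = c *R pv a psi x"
 using pv_scale[of "%x. c" psi a x] by (auto simp: plus_fun_def scaleR_fun_def pv_add)

lemma T0_lin: "lin_on X T0"
 unfolding lin_on_def fun_eq_iff
 by (auto simp: T0_def pv_fun X_smooth Th_lin plus_fun_def[of "T0 _"] scaleR_fun_def[of _ "T0 _"] plus_fun_def[of "Th _"] scaleR_fun_def[of _ "Th _"]
   cl_simps sum.distrib scaleR_sum_right scaleR_add_right)

definition le :: "'n => nat" where "le a = (if a = e then 0 else lam)"
text \<open>Powers of the cosine encode the boundary conditions. In a torus direction cos^lam solves
  f' = - tn f, so it is annihilated by the one-dimensional model; the additional cosine for a in S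
  makes the components containing e vanish on the faces of the band. Powers of the sine make the
  family rich enough for density.\<close>

definition fac :: "'n set => ('n => nat) => 'n => real^'n => real" where
 "fac S al a x = cos (dl a * x $ a) ^ (le a + of_bool (a : S)) * sin (dl a * x $ a) ^ al a"
definition Pr :: "'n set => ('n => nat) => real^'n => real" where "Pr S al x = (\<Prod>a\<in>UNIV. fac S al a x)"
definition bs :: "'n set => ('n => nat) => real^'n => real^('n set)" where "bs S al x = Pr S al x *R axis S 1"

lemma Pr_split: "Pr S al x = fac S al a x * (\<Prod>c\<in>UNIV - {a}. fac S al c x)"
 unfolding Pr_def by (rule prod.remove) auto

lemma fac_smooth: "smooth_fun (fac S al a)" and Pr_smooth: "smooth_fun (Pr S al)"
 unfolding fac_def[abs_def] Pr_def[abs_def] by (intro smooth_intros)+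

lemma bs_X:
 assumes "even (card S)" shows "bs S al : X"
 unfolding X_def
proof (intro CollectI conjI allI impI)
 show "smooth_map (bs S al)" unfolding bs_def[abs_def] by (intro smooth_map_intros Pr_smooth)
 show "parity True (bs S al x)" for x using assms by (auto simp: parity_def bs_def axis_def)
 show "bs S al x $ R = 0" if "e : R" "x $ e : {-1, 1}" for x R
 proof (cases "R = S")
  case True
  have "cos (dl e * x $ e) = 0" using that(2) by (auto simp: dl_def)
  then have "fac S al e x = 0" using that(1) True by (simp add: fac_def le_def)
  then show ?thesis unfolding bs_def Pr_split[where a=e] by simp
 qed (simp add: bs_def axis_def)
 fix j assume j: "j ~= e"
 define h where "h x = cos (dl j * x $ j) ^ (le j + of_bool (j : S) - 2) * sin (dl j * x $ j) ^ al j * (\<Prod>c\<in>UNIV - {j}. fac S al c x)" for x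
 have "le j + of_bool (j : S) = 2 + (le j + of_bool (j : S) - 2)" using lam j by (simp add: le_def)
 then have p: "y ^ (le j + of_bool (j : S)) = y\<^sup>2 * y ^ (le j + of_bool (j : S) - 2)" for y :: real by (metis power_add)
 have "Pr S al x = (cos (dl j * x $ j))\<^sup>2 * h x" for x unfolding Pr_split[where a=j] fac_def[of S al j] h_def p by simp
 then have "bs S al = (%x. (cos (dl j * x $ j))\<^sup>2 *R (h x *R axis S 1))" by (simp add: bs_def fun_eq_iff)
 moreover have "smooth_map (%x. h x *R axis S 1 :: real^('n set))"
  unfolding h_def by (intro smooth_map_intros smooth_intros fac_smooth)
 ultimately show "\<exists>phi. smooth_map phi \<and> bs S al = (%x. (cos (dl j * x $ j))\<^sup>2 *R phi x)" by blast
qed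

lemma pd_Pr: "pd a (Pr S al) x = dl a * (real (al a) * cos (dl a * x $ a) ^ (le a + of_bool (a : S) + 1) * sin (dl a * x $ a) ^ (al a - 1)
  - real (le a + of_bool (a : S)) * cos (dl a * x $ a) ^ (le a + of_bool (a : S) - 1) * sin (dl a * x $ a) ^ (al a + 1))
  * (\<Prod>c\<in>UNIV - {a}. fac S al c x)"
proof (rule has_pd_imp_pd)
 define m where "m = le a + of_bool (a : S)"
 define B where "B = dl a * (real (al a) * cos (dl a * x $ a) ^ (m + 1) * sin (dl a * x $ a) ^ (al a - 1)
  - real m * cos (dl a * x $ a) ^ (m - 1) * sin (dl a * x $ a) ^ (al a + 1))"
 have "((%z. cos (dl a * z) ^ m * sin (dl a * z) ^ al a) has_real_derivative B) (at (x $ a))"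
  unfolding B_def by (auto intro!: derivative_eq_intros simp: algebra_simps)
 then have "has_pd a (fac S al a) B x"
  unfolding fac_def[abs_def] m_def[symmetric] using has_pd_comp_coord[of _ B x a a] by simp
 moreover have "has_pd a (%x. \<Prod>c\<in>UNIV - {a}. fac S al c x) 0 x"
 proof -
  have "(\<Prod>c\<in>UNIV - {a}. fac S al c (x + t *R axis a 1)) = (\<Prod>c\<in>UNIV - {a}. fac S al c x)" for t
   by (intro prod.cong refl) (simp add: fac_def axis_def)
  then show ?thesis unfolding has_pd_def by simp
 qed
 ultimately show "has_pd a (Pr S al) (B * (\<Prod>c\<in>UNIV - {a}. fac S al c x)) x"
  unfolding Pr_split[abs_def, where a=a] using has_pd_mult by fastforce
qed

text \<open>The coefficients with which the a-th part of the model operator raises or lowers the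
  exponent of sin(dl_a x_a) while flipping a in S. For exponent 0 the lowering coefficient is 0, so
  truncated subtraction does no harm.\<close>

definition cu :: "bool => 'n => nat => real" where "cu p a k = (if p then 2 * real (le a) + 1 + real k else 0)"
definition cv :: "bool => nat => real" where "cv p k = (if p then - real k else real k)"
definition da :: "'n => 'n set => ('n => nat) => real^'n => real^('n set)" where
 "da a S al = (sg a S * dl a) *R (cu (a : S) a (al a) *R bs (flip a S) (al(a := al a + 1))
   + cv (a : S) (al a) *R bs (flip a S) (al(a := al a - 1)))"

lemma cl_axis: "cl a (axis S 1) = (- mem_sign a S * sg a S) *R axis (flip a S) 1"
 and ch_axis: "ch a (axis S 1) = sg a S *R axis (flip a S) 1"
proof -
 have "flip a R = S \<longleftrightarrow> R = flip a S" for R by (metis flip_flip)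
 then have "axis S 1 $ flip a R = axis (flip a S) (1::real) $ R" for R by (simp add: axis_def)
 then show "cl a (axis S 1) = (- mem_sign a S * sg a S) *R axis (flip a S) 1" "ch a (axis S 1) = sg a S *R axis (flip a S) 1"
  by (auto simp: vec_eq_iff cl_def ch_def axis_def mem_sign_flip)
qed

text \<open>The condition on m takes care of c = 0, where s / c is 0: for m = 1 the factor c^(m - 1)
  would not vanish there and the second identity would fail.\<close>

lemma model_1d:
 fixes c s :: real assumes cs: "s\<^sup>2 = 1 - c\<^sup>2" and m: "m = 0 \<or> m >= 2"
 shows "p ==> - (real k * c ^ (m + 1 + 1) * s ^ (k - 1) - real (m + 1) * c ^ m * s ^ (k + 1)) + real m * (s / c) * (c ^ (m + 1) * s ^ k)
  = (2 * real m + 1 + real k) * (c ^ m * s ^ (k + 1)) + - real k * (c ^ m * s ^ (k - 1))" (is "_ ==> ?A")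
 and "real k * c ^ (m + 1) * s ^ (k - 1) - real m * c ^ (m - 1) * s ^ (k + 1) + real m * (s / c) * (c ^ m * s ^ k)
  = real k * (c ^ (m + 1) * s ^ (k - 1))" (is ?B)
proof -
 have 1: "real m * (s / c) * (c ^ (m + 1) * s ^ k) = real m * c ^ m * s ^ (k + 1)"
  using m by (cases "c = 0") (auto simp: field_simps)
 have 2: "real k * c ^ (m + 1 + 1) * s ^ (k - 1) = real k * c ^ m * s ^ (k - 1) - real k * c ^ m * s ^ (k + 1)"
 proof (cases k)
  case (Suc l)
  have "c ^ (m + 1 + 1) = c ^ m * c\<^sup>2" by (simp add: power2_eq_square)
  moreover have "s ^ (k + 1) = s ^ l * s\<^sup>2" using Suc by (simp add: power2_eq_square)
  moreover have "c\<^sup>2 = 1 - s\<^sup>2" using cs by simp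
  ultimately show ?thesis using Suc by (simp only:) (simp add: algebra_simps del: power_Suc)
 qed simp
 show ?A if p using 1 2 by (simp add: algebra_simps)
 have "real m * (s / c) * (c ^ m * s ^ k) = real m * c ^ (m - 1) * s ^ (k + 1)"
 proof (cases "c = 0 \<or> m = 0")
  case False
  then obtain l where "m = Suc l" by (cases m) auto
  then show ?thesis using False by (simp add: field_simps)
 qed (use m in \<open>auto simp: power_0_left\<close>)
 then show ?B by simp
qed

lemma T0_bs: "T0 (bs S al) = (SUM a. da a S al)"
proof
 fix x
 define ta where "ta a = real (le a) * dl a * (sin (dl a * x $ a) / cos (dl a * x $ a))" for a
 have Th: "Th (bs S al) x = (SUM a. ta a *R ch a (bs S al x))"
 proof -
  have "(SUM a. ta a *R ch a (bs S al x)) = ta e *R ch e (bs S al x) + (\<Sum>a\<in>UNIV - {e}. ta a *R ch a (bs S al x))"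
   by (rule sum.remove) auto
  also have "... = Th (bs S al) x" unfolding Th_def by (simp add: ta_def le_def tn_def tan_def)
  finally show ?thesis ..
 qed
 have pvb: "pv a (bs S al) x = pd a (Pr S al) x *R axis S 1" for a
  using pv_scale[OF Pr_smooth smooth_map_const, of a S al "axis S 1" x] by (simp add: bs_def[abs_def])
 have oth: "(\<Prod>c\<in>UNIV - {a}. fac (flip a S) (al(a := k)) c x) = (\<Prod>c\<in>UNIV - {a}. fac S al c x)" for a k
  by (intro prod.cong refl) (auto simp: fac_def)
 have main: "- mem_sign a S * pd a (Pr S al) x + ta a * Pr S al x
   = dl a * (cu (a : S) a (al a) * Pr (flip a S) (al(a := al a + 1)) x + cv (a : S) (al a) * Pr (flip a S) (al(a := al a - 1)) x)" for a
 proof -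
  define c s where "c = cos (dl a * x $ a)" and "s = sin (dl a * x $ a)"
  define R where "R = (\<Prod>c\<in>UNIV - {a}. fac S al c x)"
  have cs: "s\<^sup>2 = 1 - c\<^sup>2" unfolding c_def s_def by (simp add: sin_squared_eq)
  have m: "le a = 0 \<or> le a >= 2" using lam by (simp add: le_def)
  note P = Pr_split[where a=a] oth R_def[symmetric] fac_def[of _ _ a] pd_Pr c_def[symmetric] s_def[symmetric] ta_def
  show ?thesis
  proof (cases "a : S")
   case True
   have "- mem_sign a S * pd a (Pr S al) x + ta a * Pr S al x
    = dl a * (- (real (al a) * c ^ (le a + 1 + 1) * s ^ (al a - 1) - real (le a + 1) * c ^ le a * s ^ (al a + 1)) + real (le a) * (s / c) * (c ^ (le a + 1) * s ^ al a)) * R"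
    unfolding P using True by (simp add: mem_sign_def algebra_simps)
   also have "... = dl a * (cu (a : S) a (al a) * Pr (flip a S) (al(a := al a + 1)) x + cv (a : S) (al a) * Pr (flip a S) (al(a := al a - 1)) x)"
    unfolding model_1d(1)[OF cs m TrueI] unfolding P using True by (simp add: cu_def cv_def algebra_simps)
   finally show ?thesis .
  next
   case False
   have "- mem_sign a S * pd a (Pr S al) x + ta a * Pr S al x
    = dl a * (real (al a) * c ^ (le a + 1) * s ^ (al a - 1) - real (le a) * c ^ (le a - 1) * s ^ (al a + 1) + real (le a) * (s / c) * (c ^ le a * s ^ al a)) * R"
    unfolding P using False by (simp add: mem_sign_def algebra_simps)
   also have "... = dl a * (cu (a : S) a (al a) * Pr (flip a S) (al(a := al a + 1)) x + cv (a : S) (al a) * Pr (flip a S) (al(a := al a - 1)) x)"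
    unfolding model_1d(2)[OF cs m] unfolding P using False by (simp add: cu_def cv_def)
   finally show ?thesis .
  qed
 qed
 have "T0 (bs S al) x = (SUM a. (sg a S * (- mem_sign a S * pd a (Pr S al) x + ta a * Pr S al x)) *R axis (flip a S) 1)"
  unfolding T0_def Th pvb sum.distrib[symmetric]
  by (intro sum.cong refl) (simp add: bs_def cl_simps ch_simps cl_axis ch_axis algebra_simps)
 also have "... = (SUM a. da a S al x)"
  unfolding main by (intro sum.cong refl) (simp add: da_def bs_def scaleR_fun_def plus_fun_def algebra_simps)
 finally show "T0 (bs S al) x = (SUM a. da a S al) x" by (simp add: sum_fun_apply)
qed

text \<open>The a-th part of the model operator followed by the c-th part. For different directions
  these anticommute, so the square of the model operator is a sum of one-dimensional second-order
  operators.\<close>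

definition dda :: "'n => 'n => 'n set => ('n => nat) => real^'n => real^('n set)" where
 "dda c a S al = (sg a S * dl a) *R (cu (a : S) a (al a) *R da c (flip a S) (al(a := al a + 1))
   + cv (a : S) (al a) *R da c (flip a S) (al(a := al a - 1)))"

lemma dda_anti: assumes ac: "a ~= c" shows "dda c a S al = - dda a c S al"
proof -
 have f: "flip c (flip a S) = flip a (flip c S)" by (rule flip_commute)
 have s: "sg c (flip a S) * sg a S = - (sg a (flip c S) * sg c S)"
  using ac by (auto simp: sg_flip dest: injD[OF inj_to_nat])
 define k where "k = sg c (flip a S) * sg a S * dl a * dl c"
 define w where "w = (%i j. bs (flip a (flip c S)) (al(c := j, a := i)))"
 have 1: "dda c a S al = k *R (cu (a : S) a (al a) *R (cu (c : S) c (al c) *R w (al a + 1) (al c + 1) + cv (c : S) (al c) *R w (al a + 1) (al c - 1))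
  + cv (a : S) (al a) *R (cu (c : S) c (al c) *R w (al a - 1) (al c + 1) + cv (c : S) (al c) *R w (al a - 1) (al c - 1)))"
  unfolding dda_def da_def w_def f k_def using ac by (simp add: scaleR_add_right mult_ac fun_upd_twist[OF ac])
 have 2: "dda a c S al = (- k) *R (cu (c : S) c (al c) *R (cu (a : S) a (al a) *R w (al a + 1) (al c + 1) + cv (a : S) (al a) *R w (al a - 1) (al c + 1))
  + cv (c : S) (al c) *R (cu (a : S) a (al a) *R w (al a + 1) (al c - 1) + cv (a : S) (al a) *R w (al a - 1) (al c - 1)))"
  unfolding dda_def da_def w_def k_def s using ac by (simp add: scaleR_add_right mult_ac)
 show ?thesis unfolding 1 2 by (simp add: scaleR_add_right mult_ac)
qed

text \<open>The diagonal coefficient of the one-dimensional second-order operator, which is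
  triangular in the degree of the sine. It is never negative, and it is positive whenever a is in
  S.\<close>

definition kk :: "'n set => ('n => nat) => 'n => real" where
 "kk S al a = (dl a)\<^sup>2 * (if a : S then (2 * real (le a) + 1 + real (al a)) * (real (al a) + 1) else real (al a) * (2 * real (le a) + real (al a)))"

lemma dda_diag: "dda a a S al = kk S al a *R bs S al - ((dl a)\<^sup>2 * (real (al a) * (real (al a) - 1))) *R bs S (al(a := al a - 2))"
proof -
 have s: "sg a S * (sg a S * z) = z" for z by (simp add: mult.assoc[symmetric])
 show ?thesis
 proof (cases "a : S")
  case True
  then show ?thesis by (cases "al a")
   (simp_all add: dda_def da_def kk_def cu_def cv_def scaleR_add_right s power2_eq_square mult_ac fun_upd_idem, simp add: algebra_simps)
 next
  case False
  then show ?thesis by (cases "al a")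
   (simp_all add: dda_def da_def kk_def cu_def cv_def scaleR_add_right s power2_eq_square mult_ac fun_upd_idem, simp only: scaleR_diff_right scaleR_scaleR,
    intro arg_cong2[where f=minus] arg_cong2[where f=scaleR] refl, simp_all add: algebra_simps)
 qed
qed

text \<open>Induction on the total degree in the sines. Applying the model operator to the sum of
  the \<open>da a S al\<close> returns \<open>bs S al\<close> times the sum of the
  \<open>kk\<close>, minus fields of degree smaller by two. A set S of odd size is nonempty, so the
  factor is positive and can be divided out. For S empty and all exponents 0 it vanishes: that is
  the kernel vector of \<open>bs_kernel\<close>.\<close>

lemma bs_range:
 assumes "odd (card S)" shows "bs S al : T0 ` X"
 using assms
proof (induction "SUM a. al a" arbitrary: al rule: less_induct)
 case less
 define W where "W = T0 ` X"
 have W: "subspace W" unfolding W_def by (rule subspace_image_lin_on[OF X_subspace T0_lin])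
 have fl: "bs (flip a S) be : X" for a be using less.prems by (intro bs_X) (simp add: even_card_flip)
 then have dX: "da a S al : X" for a
  unfolding da_def by (intro subspace_scale[OF X_subspace] subspace_add[OF X_subspace])
 have lin: "p : X ==> r : X ==> T0 (p + r) = T0 p + T0 r" "p : X ==> T0 (k *R p) = k *R T0 p" for p r k
  using T0_lin unfolding lin_on_def by auto
 have T0d: "T0 (da a S al) = (SUM c. dda c a S al)" for a
 proof -
  have "T0 (da a S al) = (sg a S * dl a) *R (cu (a : S) a (al a) *R T0 (bs (flip a S) (al(a := al a + 1)))
   + cv (a : S) (al a) *R T0 (bs (flip a S) (al(a := al a - 1))))"
   unfolding da_def by (simp only: lin fl subspace_scale[OF X_subspace] subspace_add[OF X_subspace])
  then show ?thesis unfolding T0_bs dda_def by (simp add: scaleR_sum_right sum.distrib[symmetric])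
 qed
 have "T0 (SUM a. da a S al) = (SUM a. SUM c. dda c a S al)"
  unfolding T0d[symmetric] by (rule lin_on_sum[OF X_subspace T0_lin dX])
 also have "... = (SUM a. dda a a S al)"
 proof -
  define off where "off a c = (if a = c then 0 else dda c a S al)" for a c
  have "(SUM a. SUM c. off a c) = (SUM a. SUM c. off c a)" by (rule sum.swap)
  also have "... = - (SUM a. SUM c. off a c)"
   unfolding sum_negf[symmetric] by (intro sum.cong refl) (auto simp: off_def intro: dda_anti)
  finally have z: "(SUM a. SUM c. off a c) = 0" by (simp add: eq_neg_iff_add_eq_0 scaleR_2[symmetric])
  have "(SUM c. dda c a S al) = (SUM c. off a c) + dda a a S al" for a
  proof -
   have "(SUM c. dda c a S al) = (SUM c. off a c + (if c = a then dda a a S al else 0))"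
    by (intro sum.cong refl) (auto simp: off_def)
   then show ?thesis by (simp add: sum.distrib)
  qed
  then show ?thesis using z by (simp add: sum.distrib)
 qed
 also have "... = (SUM a. kk S al a) *R bs S al - (SUM a. ((dl a)\<^sup>2 * (real (al a) * (real (al a) - 1))) *R bs S (al(a := al a - 2)))"
  unfolding dda_diag sum_subtractf scaleR_sum_left ..
 finally have eq: "(SUM a. kk S al a) *R bs S al
  = T0 (SUM a. da a S al) + (SUM a. ((dl a)\<^sup>2 * (real (al a) * (real (al a) - 1))) *R bs S (al(a := al a - 2)))" by simp
 have "T0 (SUM a. da a S al) : W" unfolding W_def by (intro imageI subspace_sum[OF X_subspace] dX)
 moreover have "((dl a)\<^sup>2 * (real (al a) * (real (al a) - 1))) *R bs S (al(a := al a - 2)) : W" for a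
 proof (cases "al a < 2")
  case True
  \<comment> \<open>The exponent al a - 2 is truncated here, but its coefficient al a (al a - 1) is
    zero.\<close>
  then have "al a = 0 \<or> al a = 1" by linarith
  then have z0: "real (al a) * (real (al a) - 1) = 0" by auto
  show ?thesis unfolding z0 using subspace_0[OF W] by simp
 next
  case False
  have "(SUM c. (al(a := al a - 2)) c) < (SUM c. al c)"
   using False by (intro sum_strict_mono_ex1) (auto intro!: exI[of _ a])
  then show ?thesis unfolding W_def[symmetric] using less.hyps[OF _ less.prems] subspace_scale[OF W] unfolding W_def by blast
 qed
 ultimately have m: "(SUM a. kk S al a) *R bs S al : W" unfolding eq by (intro subspace_add[OF W] subspace_sum[OF W])
 have "S ~= {}" using less.prems by auto
 then obtain a where a: "a : S" by blast
 have "kk S al a > 0" using a dl_pos[of a] by (simp add: kk_def)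
 moreover have "kk S al c >= 0" for c by (simp add: kk_def)
 ultimately have "(SUM a. kk S al a) > 0" by (intro sum_pos2[of _ a]) auto
 then have "bs S al = (1 / (SUM a. kk S al a)) *R ((SUM a. kk S al a) *R bs S al)" by simp
 then show ?case using subspace_scale[OF W m] unfolding W_def by metis
qed

lemma bs_kernel: "bs {} (%a. 0) : X" "T0 (bs {} (%a. 0)) = 0" "N (bs {} (%a. 0)) > 0"
proof -
 let ?b = "bs {} (%a. 0)"
 show X: "?b : X" by (rule bs_X) simp
 show "T0 ?b = 0" unfolding T0_bs da_def by (simp add: cu_def cv_def)
 have c: "continuous_on Q (%x. ?b x \<bullet> ?b x)" by (intro continuous_intros smooth_map_continuous X_smooth X)
 have b0: "?b 0 ~= 0" by (simp add: bs_def Pr_def fac_def axis_eq_0_iff)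
 have "0 : Q" "box lo hi ~= {}" using L by (auto simp: mem_box_cart lo_def hi_def interval_ne_empty_cart lo_hi)
 then have "integral Q (%x. ?b x \<bullet> ?b x) ~= 0"
  using integral_cbox_eq_0_iff[OF c] b0 by auto
 moreover have "integral Q (%x. ?b x \<bullet> ?b x) >= 0" by (intro integral_nonneg int_cont c) simp
 ultimately show "N ?b > 0" unfolding N_def by simp
qed

lemma closed_angle: "x : Q ==> - (pi / 2) <= dl a * x $ a \<and> dl a * x $ a <= pi / 2"
proof -
 assume "x : Q"
 then have "dl a * lo $ a <= dl a * x $ a" "dl a * x $ a <= dl a * hi $ a"
  using dl_pos[of a] unfolding mem_box_cart by (auto intro: mult_left_mono)
 then show ?thesis unfolding dl_hi by blast
qed

lemma sin_angle_inj:
 assumes "x : Q" "y : Q" "x ~= y" obtains a where "sin (dl a * x $ a) ~= sin (dl a * y $ a)"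
proof -
 obtain a where a: "x $ a ~= y $ a" using assms(3) by (auto simp: vec_eq_iff)
 have "sin (dl a * x $ a) = sin (dl a * y $ a) ==> dl a * x $ a = dl a * y $ a"
  using closed_angle[OF assms(1), of a] closed_angle[OF assms(2), of a] by (rule_tac sin_inj_pi) auto
 then show ?thesis using a dl_pos[of a] by (intro that[of a]) auto
qed

text \<open>Multiplication by a weight vanishing only on the boundary does not destroy density in \<open>L\<^sup>2\<close>: divide
 by the regularised weight \<open>w + kap / w\<close> and use dominated convergence.\<close>

lemma weight_approx:
 fixes f w :: "real^'n => real"
 assumes f: "continuous_on Q f" and w: "continuous_on Q w" "!!x. x : Q ==> 0 <= w x \<and> w x <= 1" "!!x. x : box lo hi ==> w x > 0"
  and P: "!!h eps. continuous_on Q h ==> eps > 0 ==> \<exists>p\<in>P. continuous_on Q p \<and> (\<forall>x\<in>Q. \<bar>h x - p x\<bar> < eps)" and eps: "eps > (0::real)"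
 obtains p where "p : P" "continuous_on Q p" "integral Q (%x. (f x - p x * w x)\<^sup>2) < eps"
proof -
 define d where "d k x = (w x)\<^sup>2 + 1 / (real k + 1)" for k x
 have d: "d k x > 0" for k x unfolding d_def by (intro add_nonneg_pos) auto
 \<comment> \<open>The error f - (f w / d k) w of division by the regularised weight; it tends to 0
   wherever w is positive and is dominated by f.\<close>
 define g where "g k x = f x * (1 / (real k + 1)) / d k x" for k x
 have cd: "continuous_on Q (d k)" for k unfolding d_def by (intro continuous_intros w)
 have cg: "continuous_on Q (g k)" for k unfolding g_def using d by (intro continuous_intros cd f) (simp add: less_imp_neq[symmetric])
 have gb: "norm ((g k x)\<^sup>2) <= (f x)\<^sup>2" if "x : box lo hi" for k x
 proof -
  have "(1 / (real k + 1)) / d k x <= 1" using d[of k x] by (subst divide_le_eq_1_pos) (auto simp: d_def)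
  moreover have "(1 / (real k + 1)) / d k x >= 0" using d[of k x] by simp
  ultimately have "\<bar>g k x\<bar> <= \<bar>f x\<bar> * 1"
   unfolding g_def times_divide_eq_right[symmetric] abs_mult mult.assoc by (intro mult_left_mono) auto
  then show ?thesis by (simp add: abs_le_square_iff)
 qed
 have "(%k. integral (box lo hi) (%x. (g k x)\<^sup>2)) \<longlonglongrightarrow> integral (box lo hi) (%x. 0)"
 proof (rule dominated_convergence(2)[OF _ _ gb])
  show "(%x. (g k x)\<^sup>2) integrable_on box lo hi" for k
   unfolding integrable_on_open_interval by (intro int_cont continuous_intros cg)
  show "(%x. (f x)\<^sup>2) integrable_on box lo hi"
   unfolding integrable_on_open_interval by (intro int_cont continuous_intros f)
  fix x assume "x : box lo hi"
  then have wx: "w x ~= 0" using w(3) by force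
  have k0: "(%k. 1 / (real k + 1)) \<longlonglongrightarrow> 0" using LIMSEQ_inverse_real_of_nat by (simp add: inverse_eq_divide add.commute)
  have "(%k. (f x * (1 / (real k + 1)) / ((w x)\<^sup>2 + 1 / (real k + 1)))\<^sup>2) \<longlonglongrightarrow> (f x * 0 / ((w x)\<^sup>2 + 0))\<^sup>2"
   by (intro tendsto_intros k0) (use wx in auto)
  then show "(%k. (g k x)\<^sup>2) \<longlonglongrightarrow> 0" by (simp add: g_def d_def)
 qed
 then have "eventually (%k. integral (box lo hi) (%x. (g k x)\<^sup>2) < eps / 4) sequentially"
  using eps order_tendstoD(2)[of _ "integral (box lo hi) (%x. 0)" sequentially "eps / 4"] by simp
 then obtain k where "integral (box lo hi) (%x. (g k x)\<^sup>2) < eps / 4"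
  using eventually_happens sequentially_bot by blast
 then have k: "integral Q (%x. (g k x)\<^sup>2) < eps / 4" by (simp add: integral_open_interval)
 define V where "V = measure lborel Q"
 \<comment> \<open>Chosen so that the uniform error contributes at most 2 r^2 V \<le> eps/2 to the
   integral.\<close>
 define r where "r = sqrt (eps / (4 * (V + 1)))"
 have V: "V >= 0" by (simp add: V_def)
 have r: "r > 0" "r\<^sup>2 * V <= eps / 4"
 proof -
  have "eps / (4 * (V + 1)) > 0" using eps V by simp
  then have "r > 0" "r\<^sup>2 = eps / (4 * (V + 1))" unfolding r_def by auto
  moreover have "V / (V + 1) <= 1" using V by simp
  then have "eps / 4 * (V / (V + 1)) <= eps / 4 * 1" using eps by (intro mult_left_mono) auto
  ultimately show "r > 0" "r\<^sup>2 * V <= eps / 4" by simp_all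
 qed
 have cq: "continuous_on Q (%x. f x * w x / d k x)" using d by (intro continuous_intros f w cd) (simp add: less_imp_neq[symmetric])
 obtain p where p: "p : P" "continuous_on Q p" "!!x. x : Q ==> \<bar>f x * w x / d k x - p x\<bar> < r" using P[OF cq r(1)] by blast
 have pt: "(f x - p x * w x)\<^sup>2 <= 2 * (g k x)\<^sup>2 + 2 * r\<^sup>2" if x: "x : Q" for x
 proof -
  have dk: "d k x ~= 0" using d[of k x] by simp
  have "g k x = f x * (d k x - (w x)\<^sup>2) / d k x" by (simp add: g_def d_def)
  then have "f x - p x * w x = g k x + (f x * w x / d k x - p x) * w x"
   using dk by (simp add: field_simps power2_eq_square)
  moreover have "\<bar>(f x * w x / d k x - p x) * w x\<bar> <= r * 1" unfolding abs_mult using p(3)[OF x] w(2)[OF x] r(1) by (intro mult_mono) auto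
  then have "((f x * w x / d k x - p x) * w x)\<^sup>2 <= r\<^sup>2" using r(1) by (simp add: abs_le_square_iff[symmetric])
  moreover have "(y + z)\<^sup>2 <= 2 * y\<^sup>2 + 2 * z\<^sup>2" for y z :: real using zero_le_power2[of "y - z"] by (simp add: power2_eq_square algebra_simps)
  ultimately show ?thesis by (smt (verit))
 qed
 have "integral Q (%x. (f x - p x * w x)\<^sup>2) <= integral Q (%x. 2 * (g k x)\<^sup>2 + 2 * r\<^sup>2)"
  by (intro integral_le int_cont continuous_intros f p(2) w(1) cg pt)
 also have "((%x. 2 * (g k x)\<^sup>2 + 2 * r\<^sup>2) has_integral (2 * integral Q (%x. (g k x)\<^sup>2) + V *R (2 * r\<^sup>2))) Q"
  unfolding V_def by (intro has_integral_add has_integral_mult_right has_integral_const integrable_integral int_cont continuous_intros cg)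
 then have "integral Q (%x. 2 * (g k x)\<^sup>2 + 2 * r\<^sup>2) = 2 * integral Q (%x. (g k x)\<^sup>2) + V * (2 * r\<^sup>2)" by (simp add: integral_unique)
 also have "... < eps" using k r(2) by (simp add: mult.commute)
 finally show ?thesis by (rule that[OF p(1,2)])
qed

text \<open>The continuous functions whose multiplication preserves the span of the products
  \<open>Pr S\<close> form an algebra. It contains the functions sin(dl_a x_a), which separate the
  points of the closed box, so Stone--Weierstrass makes it uniformly dense. Multiplying by
  \<open>w = Pr S (%a. 0)\<close>, which is positive in the open box, leads back into the span, and
  \<open>weight_approx\<close> gives density in L^2.\<close>

lemma Pr_approx:
 assumes f: "continuous_on Q f" and eps: "eps > 0"
 obtains p where "p : span (range (Pr S))" "integral Q (%x. (f x - p x)\<^sup>2) < eps"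
proof -
 define W where "W = span (range (Pr S))"
 define P where "P h \<longleftrightarrow> continuous_on Q h \<and> (\<forall>q\<in>W. (%x. h x * q x) : W)" for h :: "real^'n => real"
 define w where "w = Pr S (%a. 0)"
 have W: "subspace W" unfolding W_def by (rule subspace_span)
 have Psin: "P (%x. sin (dl a * x $ a))" for a
  unfolding P_def
 proof (intro conjI ballI)
  show "continuous_on Q (%x. sin (dl a * x $ a))" by (intro smooth_fun_continuous smooth_sin)
  fix q assume "q : W"
  then show "(%x. sin (dl a * x $ a) * q x) : W" unfolding W_def
  proof (induction rule: span_induct_alt)
   case base then show ?case using span_0[of "range (Pr S)"] by (simp add: zero_fun_def)
  next
   case (step c p q)
   then obtain al where al: "p = Pr S al" by blast
   have "sin (dl a * x $ a) * Pr S al x = Pr S (al(a := al a + 1)) x" for x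
   proof -
    have "(\<Prod>c\<in>UNIV - {a}. fac S (al(a := al a + 1)) c x) = (\<Prod>c\<in>UNIV - {a}. fac S al c x)"
     by (intro prod.cong refl) (auto simp: fac_def)
    then show ?thesis unfolding Pr_split[where a=a] by (simp add: fac_def)
   qed
   then have eq: "(%x. sin (dl a * x $ a) * (c *R p + q) x) = c *R Pr S (al(a := al a + 1)) + (%x. sin (dl a * x $ a) * q x)"
    by (auto simp: fun_eq_iff al plus_fun_def scaleR_fun_def algebra_simps)
   show ?case unfolding eq by (rule span_add[OF span_scale[OF span_base[OF rangeI]] step(2)])
  qed
 qed
 have SW: "\<exists>p\<in>Collect P. continuous_on Q p \<and> (\<forall>x\<in>Q. \<bar>h x - p x\<bar> < r)" if h: "continuous_on Q h" and r: "r > 0" for h r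
 proof -
  have "\<exists>p. P p \<and> (\<forall>x\<in>Q. \<bar>h x - p x\<bar> < r)"
  proof (rule Stone_Weierstrass_HOL[OF compact_cbox _ _ _ _ _ h r])
   show "P (%x. c)" for c unfolding P_def using subspace_scale[OF W] by (auto simp: scaleR_fun_def)
   show "P p ==> continuous_on Q p" for p by (simp add: P_def)
   show "P p \<and> P q ==> P (%x. p x + q x)" for p q
    unfolding P_def using subspace_add[OF W] by (auto simp: plus_fun_def distrib_right intro: continuous_on_add)
   show "P p \<and> P q ==> P (%x. p x * q x)" for p q
    unfolding P_def by (auto simp: mult.assoc intro: continuous_on_mult)
   show "x : Q \<and> y : Q \<and> x ~= y ==> \<exists>p. P p \<and> p x ~= p y" for x y
   proof -
    assume "x : Q \<and> y : Q \<and> x ~= y"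
    then obtain a where "sin (dl a * x $ a) ~= sin (dl a * y $ a)" using sin_angle_inj by blast
    then show ?thesis using Psin[of a] by (intro exI[of _ "%x. sin (dl a * x $ a)"] conjI)
   qed
  qed
  then show ?thesis unfolding P_def by blast
 qed
 have w: "continuous_on Q w" unfolding w_def by (intro smooth_fun_continuous Pr_smooth)
 have w01: "0 <= w x \<and> w x <= 1" if x: "x : Q" for x
 proof -
  have "cos (dl a * x $ a) >= 0" for a using closed_angle[OF x, of a] by (intro cos_ge_zero) auto
  then have "0 <= fac S (%a. 0) a x \<and> fac S (%a. 0) a x <= 1" for a by (simp add: fac_def power_le_one)
  then show ?thesis unfolding w_def Pr_def by (auto intro: prod_nonneg prod_le_1)
 qed
 have wpos: "w x > 0" if "x : box lo hi" for x
  unfolding w_def Pr_def fac_def using interior_cos[OF that] by (intro prod_pos) auto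
 obtain p where "p : Collect P" "integral Q (%x. (f x - p x * w x)\<^sup>2) < eps"
  by (rule weight_approx[OF f w w01 wpos SW eps])
 moreover have "w : W" unfolding W_def w_def by (intro span_base) auto
 ultimately show ?thesis using that[of "%x. p x * w x"] unfolding P_def W_def by blast
qed

lemma T0_dense:
 assumes y: "y : C" and eps: "eps > 0" shows "\<exists>psi\<in>X. N (y - T0 psi) < eps"
proof -
 define W where "W = T0 ` X"
 have W: "subspace W" unfolding W_def by (rule subspace_image_lin_on[OF X_subspace T0_lin])
 define n where "n = real CARD('n set)"
 have n: "n > 0" by (simp add: n_def)
 have yc: "continuous_on Q (%x. y x $ S)" for S using y unfolding C_def by (auto intro: continuous_intros)
 have ex: "\<exists>p. (%x. p x *R axis S 1) : W \<and> continuous_on Q p \<and> integral Q (%x. (y x $ S - p x)\<^sup>2) < eps\<^sup>2 / n" for S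
 proof (cases "even (card S)")
  case True
  then have "y x $ S = 0" for x using y unfolding C_def parity_def by auto
  then show ?thesis using eps n subspace_0[OF W] by (intro exI[of _ "%x. 0"]) (auto simp: zero_fun_def)
 next
  case False
  have en: "eps\<^sup>2 / n > 0" using eps n by simp
  obtain p where p: "p : span (range (Pr S))" "integral Q (%x. (y x $ S - p x)\<^sup>2) < eps\<^sup>2 / n"
   by (rule Pr_approx[OF yc en])
  have "(%x. p x *R axis S 1) : W \<and> continuous_on Q p" using p(1)
  proof (induction rule: span_induct_alt)
   case base then show ?case using subspace_0[OF W] by (simp add: zero_fun_def)
  next
   case (step c q r)
   then obtain al where al: "q = Pr S al" by blast
   have eq: "(%x. (c *R q + r) x *R axis S 1) = c *R bs S al + (%x. r x *R axis S 1)"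
    by (auto simp: fun_eq_iff al bs_def plus_fun_def scaleR_fun_def scaleR_add_left)
   have b: "bs S al : W" unfolding W_def by (rule bs_range[OF False])
   have "continuous_on Q (%x. c *R Pr S al x + r x)"
    using step(2) by (intro continuous_on_add continuous_on_scaleR continuous_on_const smooth_fun_continuous[OF Pr_smooth]) auto
   then have "continuous_on Q (c *R q + r)" unfolding plus_fun_def scaleR_fun_def al .
   then show ?case unfolding eq using step(2) subspace_add[OF W subspace_scale[OF W b]] by blast
  qed
  then show ?thesis using p(2) by blast
 qed
 have "\<forall>S. \<exists>p. (%x. p x *R axis S 1) : W \<and> continuous_on Q p \<and> integral Q (%x. (y x $ S - p x)\<^sup>2) < eps\<^sup>2 / n" by (intro allI ex)
 from choice[OF this] obtain p where p: "!!S. (%x. p S x *R axis S 1) : W" "!!S. continuous_on Q (p S)"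
  "!!S. integral Q (%x. (y x $ S - p S x)\<^sup>2) < eps\<^sup>2 / n" by blast
 have "(SUM S. (%x. p S x *R axis S 1)) : W" by (intro subspace_sum[OF W] p)
 then obtain psi where psi: "psi : X" "T0 psi = (SUM S. (%x. p S x *R axis S 1))" unfolding W_def by auto
 have "T0 psi x $ S = p S x" for x S
  unfolding psi(2) sum_fun_apply by (simp add: axis_def if_distrib cong: if_cong)
 then have "integral Q (%x. (y - T0 psi) x \<bullet> (y - T0 psi) x) = integral Q (%x. SUM S. (y x $ S - p S x)\<^sup>2)"
  by (simp add: inner_vec_def power2_eq_square)
 also have "... = (SUM S. integral Q (%x. (y x $ S - p S x)\<^sup>2))"
  by (intro integral_sum int_cont continuous_intros yc p) auto
 also have "... < (\<Sum>S\<in>(UNIV::'n set set). eps\<^sup>2 / n)" by (intro sum_strict_mono p) auto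
 also have "... = eps\<^sup>2" using n by (simp add: n_def)
 finally have "sqrt (integral Q (%x. (y - T0 psi) x \<bullet> (y - T0 psi) x)) < sqrt (eps\<^sup>2)" by (rule real_sqrt_less_mono)
 then show ?thesis using psi(1) eps unfolding N_def by auto
qed

end

subsection \<open>Averaging\<close>

text \<open>Averaging successively over segments in the coordinate directions of \<open>I\<close> makes a continuous
 function continuously differentiable in these directions.\<close>

lemma directional_average:
 fixes f :: "real^'n::finite => real"
 assumes f: "continuous_on UNIV f" and s: "s > 0"
 obtains F F' where "!!x. has_pd i F (F' x) x" "continuous_on UNIV F'" "continuous_on UNIV F"
  "!!x y c. (!!t. \<bar>t\<bar> <= s ==> f (y + t *R axis i 1) - f (x + t *R axis i 1) <= c) ==> F y - F x <= c"
  "!!x c. (!!t. \<bar>t\<bar> <= s ==> f (x + t *R axis i 1) <= c) ==> F x <= c"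
  "!!x c. (!!t. \<bar>t\<bar> <= s ==> f (x + t *R axis i 1) >= c) ==> F x >= c"
  "!!a f'. (!!x. has_pd a f (f' x) x) ==> continuous_on UNIV f' ==>
   \<exists>d. continuous_on UNIV d \<and> (\<forall>x. has_pd a F (d x) x)"
proof -
 define A where "A h x = integral {-s..s} (%t. h (x + t *R axis i 1)) / (2 * s)" for h :: "real^'n => real" and x
 have cl: "continuous_on S (%t. h (x + t *R axis i 1))" if "continuous_on UNIV h" for h :: "real^'n => real" and x S
  by (rule continuous_on_compose2[OF that]) (auto intro!: continuous_intros)
 have ci: "(%t. h (x + t *R axis i 1)) integrable_on {-s..s}" if "continuous_on UNIV h" for h :: "real^'n => real" and x
  by (intro integrable_continuous_interval cl that)
 have cA: "continuous_on UNIV (A h)" if h: "continuous_on UNIV h" for h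
 proof -
  have "continuous_on (UNIV \<times> cbox (-s) s) (%(x, t). h (x + t *R axis i 1))"
   unfolding split_beta by (rule continuous_on_compose2[OF h]) (auto intro!: continuous_intros)
  from integral_continuous_on_param[OF this] have "continuous_on UNIV (%x. integral {-s..s} (%t. h (x + t *R axis i 1)))" by simp
  then show ?thesis unfolding A_def[abs_def] using s by (intro continuous_intros) auto
 qed
 have int_le: "integral {-s..s} h <= c * (2 * s)" if "h integrable_on {-s..s}" "!!t. \<bar>t\<bar> <= s ==> h t <= c" for h c
 proof -
  have "integral {-s..s} h <= integral {-s..s} (%t. c)" by (intro integral_le that) auto
  then show ?thesis using s by (simp add: mult.commute)
 qed
 show ?thesis
 proof (rule that[of "A f" "%x. (f (x + s *R axis i 1) - f (x - s *R axis i 1)) / (2 * s)"])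
  show "continuous_on UNIV (A f)" by (rule cA[OF f])
  show "continuous_on UNIV (%x. (f (x + s *R axis i 1) - f (x - s *R axis i 1)) / (2 * s))"
   using s by (intro continuous_intros continuous_on_compose2[OF f]) auto
  show "A f y - A f x <= c" if "!!t. \<bar>t\<bar> <= s ==> f (y + t *R axis i 1) - f (x + t *R axis i 1) <= c" for x y c
  proof -
   have "integral {-s..s} (%t. f (y + t *R axis i 1)) - integral {-s..s} (%t. f (x + t *R axis i 1))
    = integral {-s..s} (%t. f (y + t *R axis i 1) - f (x + t *R axis i 1))"
    by (rule integral_diff[symmetric]) (rule ci[OF f])+
   also have "... <= c * (2 * s)" by (intro int_le integrable_diff ci[OF f] that)
   finally show ?thesis using s unfolding A_def diff_divide_distrib[symmetric] by (simp add: pos_divide_le_eq)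
  qed
  show "A f x <= c" if "!!t. \<bar>t\<bar> <= s ==> f (x + t *R axis i 1) <= c" for x c
   using int_le[OF ci[OF f] that] s unfolding A_def by (simp add: pos_divide_le_eq)
  show "A f x >= c" if "!!t. \<bar>t\<bar> <= s ==> f (x + t *R axis i 1) >= c" for x c
  proof -
   have "integral {-s..s} (%t. - f (x + t *R axis i 1)) <= (- c) * (2 * s)"
    by (rule int_le) (use that ci[OF f] in \<open>auto intro: integrable_neg\<close>)
   then show ?thesis using s unfolding A_def by (simp add: pos_le_divide_eq)
  qed
  show "has_pd i (A f) ((f (x + s *R axis i 1) - f (x - s *R axis i 1)) / (2 * s)) x" for x
  proof -
   define k where "k t = f (x + t *R axis i 1)" for t
   have ck: "continuous_on S k" for S unfolding k_def by (rule cl[OF f])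
   \<comment> \<open>The primitive lives on a larger interval, so that the averaging window may be
     shifted by any |h| < 1.\<close>
   obtain K where K: "!!t. t : {-s-1..s+1} ==> (K has_vector_derivative k t) (at t within {-s-1..s+1})"
    using antiderivative_continuous[OF ck[of "{-s-1..s+1}"]] by metis
   have Kat: "(K has_real_derivative k t) (at t)" if "-s-1 < t" "t < s+1" for t
    using K[of t] that at_within_Icc_at[of "-s-1" t "s+1"] by (simp add: has_real_derivative_iff_has_vector_derivative)
   have eq: "A f (x + h *R axis i 1) = (K (s + h) - K (- s + h)) / (2 * s)" if "\<bar>h\<bar> < 1" for h
   proof -
    have "((%t. k (t + h)) has_integral (K (s + h) - K (- s + h))) {-s..s}"
    proof (rule fundamental_theorem_of_calculus)
     show "- s <= s" using s by simp
     fix t assume t: "t : {-s..s}"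
     have "(K has_real_derivative k (t + h)) (at (t + h))" using t that by (intro Kat) auto
     then have "((%t. K (t + h)) has_real_derivative k (t + h)) (at t)" unfolding DERIV_shift .
     then show "((%t. K (t + h)) has_vector_derivative k (t + h)) (at t within {-s..s})"
      unfolding has_real_derivative_iff_has_vector_derivative by (rule has_vector_derivative_at_within)
    qed
    moreover have "k (t + h) = f (x + h *R axis i 1 + t *R axis i 1)" for t
     by (simp add: k_def scaleR_add_left add_ac)
    ultimately show ?thesis unfolding A_def by (simp add: integral_unique)
   qed
   have "((%h. (K (s + h) - K (- s + h)) / (2 * s)) has_real_derivative (k s - k (- s)) / (2 * s)) (at 0)"
   proof (intro DERIV_cdivide DERIV_diff)
    show "((%h. K (s + h)) has_real_derivative k s) (at 0)"
     using Kat[of s] s DERIV_shift[of K "k s" 0 s] by (simp add: add.commute)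
    show "((%h. K (- s + h)) has_real_derivative k (- s)) (at 0)"
     using Kat[of "-s"] s DERIV_shift[of K "k (-s)" 0 "-s"] by (simp add: add.commute)
   qed
   then have "((%h. A f (x + h *R axis i 1)) has_real_derivative (k s - k (- s)) / (2 * s)) (at 0)"
    by (rule has_field_derivative_transform_within_open[of _ _ _ "{-1<..<1}"]) (auto simp: eq)
   then show ?thesis unfolding has_pd_def k_def by simp
  qed
  fix a f' assume f': "!!x. has_pd a f (f' x) x" "continuous_on UNIV f'"
  have "has_pd a (A f) (A f' x) x" for x
  proof -
   have "((%h. integral (cbox (-s) s) (%t. f ((x + t *R axis i 1) + h *R axis a 1))) has_field_derivative
    integral (cbox (-s) s) (%t. f' ((x + t *R axis i 1) + 0 *R axis a 1))) (at 0 within UNIV)"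
   proof (rule leibniz_rule_field_derivative)
    show "((%h. f ((x + t *R axis i 1) + h *R axis a 1)) has_field_derivative f' ((x + t *R axis i 1) + h *R axis a 1)) (at h within UNIV)" for h t
     using f'(1) unfolding has_pd_shift[symmetric] by simp
    show "(%t. f ((x + t *R axis i 1) + h *R axis a 1)) integrable_on cbox (- s) s" for h
     by (intro integrable_continuous continuous_on_compose2[OF f] continuous_intros) auto
    show "continuous_on (UNIV \<times> cbox (- s) s) (%(h, t). f' ((x + t *R axis i 1) + h *R axis a 1))"
     unfolding split_beta by (intro continuous_on_compose2[OF f'(2)] continuous_intros) auto
   qed auto
   moreover have "x + t *R axis i 1 + h *R axis a 1 = (x + h *R axis a 1) + t *R axis i 1" for t h by simp
   ultimately have "((%h. integral {-s..s} (%t. f (x + h *R axis a 1 + t *R axis i 1))) has_real_derivative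
    integral {-s..s} (%t. f' (x + t *R axis i 1))) (at 0)" by simp
   then show ?thesis unfolding has_pd_def A_def using s by (intro DERIV_cdivide) auto
  qed
  then show "\<exists>d. continuous_on UNIV d \<and> (\<forall>x. has_pd a (A f) (d x) x)" using cA[OF f'(2)] by blast
 qed
qed

text \<open>Bounds are transported in the form that an estimate valid for all common translates
  passes to the average. This form is stable under repeated averaging, and it covers values as well
  as differences of values. \<open>B I\<close> is the set of offsets that occur after averaging in
  the directions of I.\<close>

lemma average:
 fixes f :: "real^'n::finite => real"
 assumes f: "continuous_on UNIV f" and s: "s > 0"
 obtains F F' where "!!a x. has_pd a F (F' a x) x" "!!a. continuous_on UNIV (F' a)"
  "!!x y c. (!!z. (!!i. \<bar>z $ i\<bar> <= s) ==> f (y + z) - f (x + z) <= c) ==> F y - F x <= c"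
  "!!x c. (!!z. (!!i. \<bar>z $ i\<bar> <= s) ==> f (x + z) <= c) ==> F x <= c"
  "!!x c. (!!z. (!!i. \<bar>z $ i\<bar> <= s) ==> f (x + z) >= c) ==> F x >= c"
proof -
 define B where "B I = {z::real^'n. \<forall>i. \<bar>z $ i\<bar> <= (if i : I then s else 0)}" for I :: "'n set"
 have "\<exists>F. continuous_on UNIV F \<and> (\<forall>a\<in>I. \<exists>d. continuous_on UNIV d \<and> (\<forall>x. has_pd a F (d x) x)) \<and>
  (\<forall>x y c. (\<forall>z\<in>B I. f (y + z) - f (x + z) <= c) \<longrightarrow> F y - F x <= c) \<and>
  (\<forall>x c. (\<forall>z\<in>B I. f (x + z) <= c) \<longrightarrow> F x <= c) \<and> (\<forall>x c. (\<forall>z\<in>B I. f (x + z) >= c) \<longrightarrow> F x >= c)" (is "\<exists>F. ?P I F") for I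
 proof (induction I rule: finite_induct[OF finite])
  case 1
  have "0 : B {}" by (simp add: B_def)
  then show ?case using f by (intro exI[of _ f]) force
 next
  case (2 i I)
  then obtain F where F: "?P I F" by blast
  then have cF: "continuous_on UNIV F" by blast
  obtain H H' where H: "!!x. has_pd i H (H' x) x" "continuous_on UNIV H'" "continuous_on UNIV H"
   "!!x y c. (!!t. \<bar>t\<bar> <= s ==> F (y + t *R axis i 1) - F (x + t *R axis i 1) <= c) ==> H y - H x <= c"
   "!!x c. (!!t. \<bar>t\<bar> <= s ==> F (x + t *R axis i 1) <= c) ==> H x <= c"
   "!!x c. (!!t. \<bar>t\<bar> <= s ==> F (x + t *R axis i 1) >= c) ==> H x >= c"
   "!!a f'. (!!x. has_pd a F (f' x) x) ==> continuous_on UNIV f' ==> \<exists>d. continuous_on UNIV d \<and> (\<forall>x. has_pd a H (d x) x)"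
   using directional_average[OF cF s, of i] by blast
  have B: "t *R axis i 1 + z : B (insert i I)" if "\<bar>t\<bar> <= s" "z : B I" for t z
   unfolding B_def
  proof (intro CollectI allI)
   fix j
   have "\<bar>z $ j\<bar> <= (if j : I then s else 0)" using that(2) unfolding B_def by blast
   then show "\<bar>(t *R axis i 1 + z) $ j\<bar> <= (if j : insert i I then s else 0)"
    using that(1) 2(2) by (cases "j = i") (auto simp: axis_def)
  qed
  have "?P (insert i I) H"
  proof (intro conjI allI impI ballI)
   show "continuous_on UNIV H" by (rule H(3))
   show "\<exists>d. continuous_on UNIV d \<and> (\<forall>x. has_pd a H (d x) x)" if "a : insert i I" for a
    using that H(1,2,7) F by (metis insertE)
   show "H y - H x <= c" if *: "\<forall>z\<in>B (insert i I). f (y + z) - f (x + z) <= c" for x y c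
   proof (rule H(4))
    fix t assume t: "\<bar>t\<bar> <= s"
    have "\<forall>z\<in>B I. f (y + t *R axis i 1 + z) - f (x + t *R axis i 1 + z) <= c"
     using * B[OF t] by (simp add: add.assoc)
    then show "F (y + t *R axis i 1) - F (x + t *R axis i 1) <= c" using F by blast
   qed
   show "H x <= c" if *: "\<forall>z\<in>B (insert i I). f (x + z) <= c" for x c
   proof (rule H(5))
    fix t assume t: "\<bar>t\<bar> <= s"
    have "\<forall>z\<in>B I. f (x + t *R axis i 1 + z) <= c" using * B[OF t] by (simp add: add.assoc)
    then show "F (x + t *R axis i 1) <= c" using F by blast
   qed
   show "H x >= c" if *: "\<forall>z\<in>B (insert i I). f (x + z) >= c" for x c
   proof (rule H(6))
    fix t assume t: "\<bar>t\<bar> <= s"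
    have "\<forall>z\<in>B I. f (x + t *R axis i 1 + z) >= c" using * B[OF t] by (simp add: add.assoc)
    then show "F (x + t *R axis i 1) >= c" using F by blast
   qed
  qed
  then show ?case by blast
 qed
 from this[of UNIV] obtain F where F: "?P UNIV F" by blast
 then have "\<forall>a. \<exists>d. continuous_on UNIV d \<and> (\<forall>x. has_pd a F (d x) x)" by blast
 from choice[OF this] obtain F' where F': "!!a. continuous_on UNIV (F' a)" "!!a x. has_pd a F (F' a x) x" by blast
 have B: "z : B UNIV \<longleftrightarrow> (\<forall>i. \<bar>z $ i\<bar> <= s)" for z by (simp add: B_def)
 show ?thesis by (rule that[OF F'(2,1)]) (use F B in blast)+
qed

subsection \<open>Periodicity\<close>

definition cell_shift :: "'n::finite => real^'n => real^'n" where
 "cell_shift e x = (\<chi> j. if j = e then 0 else - of_int \<lfloor>x $ j\<rfloor>)"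

definition cell :: "'n::finite => (real^'n) set" where
 "cell e = cbox (\<chi> j. if j = e then -1 else 0) 1"

lemma cell_shift: "x : band e ==> x + cell_shift e x : cell e"
 unfolding cell_def mem_box_cart cell_shift_def band_def by (auto simp: le_floor_iff) linarith+

lemma periodic_cell_shift:
 fixes F :: "real^'n::finite => 'b"
 assumes "periodic_in e F" shows "F (w + cell_shift e x) = F w"
proof -
 have 1: "F (w + axis j (real m)) = F w" if "j ~= e" for j m w
 proof (induction m)
  case (Suc m)
  have "w + axis j (real (Suc m)) = (w + axis j (real m)) + axis j 1" by (simp add: vec_eq_iff axis_def)
  then show ?case using assms that Suc unfolding periodic_in_def by metis
 qed (simp add: axis_def vec_eq_iff[symmetric] zero_vec_def[symmetric])
 have 2: "F (w + axis j (of_int m)) = F w" if "j ~= e" for j w and m :: int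
 proof (cases "m >= 0")
  case True
  then show ?thesis using 1[OF that, of w "nat m"] by simp
 next
  case False
  have eq: "w + axis j (of_int m) + axis j (real (nat (- m))) = w" using False by (simp add: vec_eq_iff axis_def)
  show ?thesis using 1[OF that, of "w + axis j (of_int m)" "nat (- m)"] unfolding eq by simp
 qed
 have "F (w + (\<Sum>j\<in>I. axis j (cell_shift e x $ j))) = F w" if "e \<notin> I" for I
  using finite[of I] that
 proof (induction I arbitrary: w rule: finite_induct)
  case (insert j I)
  have "cell_shift e x $ j = of_int (- \<lfloor>x $ j\<rfloor>)" using insert by (auto simp: cell_shift_def)
  then have "F (w + axis j (cell_shift e x $ j)) = F w" using 2[of j w] insert by (metis insertI1)
  moreover have "F (w + axis j (cell_shift e x $ j) + (\<Sum>j\<in>I. axis j (cell_shift e x $ j))) = F (w + axis j (cell_shift e x $ j))"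
   using insert by (intro insert.IH) auto
  ultimately show ?case using insert(1,2) by (simp add: add.assoc)
 qed simp
 moreover have "(\<Sum>j\<in>UNIV - {e}. axis j (cell_shift e x $ j)) = cell_shift e x"
  by (auto simp: vec_eq_iff axis_def cell_shift_def)
 ultimately show ?thesis by (metis Diff_iff insertI1)
qed

lemma periodic_bounded:
 fixes F :: "real^'n::finite => real"
 assumes "periodic_in e F" "continuous_on UNIV F" obtains B where "B > 0" "!!x. x : band e ==> \<bar>F x\<bar> <= B"
proof -
 have "compact (F ` cell e)" unfolding cell_def by (intro compact_continuous_image continuous_on_subset[OF assms(2)]) auto
 then have "bounded (F ` cell e)" by (rule compact_imp_bounded)
 then obtain B where B: "B > 0" "\<forall>y\<in>F ` cell e. norm y <= B" unfolding bounded_pos by blast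
 show ?thesis
 proof (rule that[OF B(1)])
  fix x assume "x : band e"
  then have "norm (F (x + cell_shift e x)) <= B" using B(2) cell_shift by blast
  then show "\<bar>F x\<bar> <= B" unfolding periodic_cell_shift[OF assms(1)] by simp
 qed
qed

lemma periodic_uniformly_continuous:
 fixes F :: "real^'n::finite => real"
 assumes "periodic_in e F" "continuous_on UNIV F" "eps > 0"
 obtains r where "r > 0" "!!x y. x : band e ==> norm (y - x) < r ==> \<bar>F y - F x\<bar> < eps"
proof -
 define Z where "Z = (cbox (\<chi> j. -2) (\<chi> j. 2) :: (real^'n) set)"
 have "uniformly_continuous_on Z F" unfolding Z_def by (intro compact_uniformly_continuous continuous_on_subset[OF assms(2)]) auto
 then obtain r where r: "r > 0" "!!x y. x : Z ==> y : Z ==> dist y x < r ==> dist (F y) (F x) < eps"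
  unfolding uniformly_continuous_on_def using assms(3) by metis
 show ?thesis
 proof (rule that[of "min r 1"])
  show "min r 1 > 0" using r by simp
  fix x y assume x: "x : band e" and y: "norm (y - x) < min r 1"
  define w where "w = cell_shift e x"
  have c: "x + w : cell e" unfolding w_def by (rule cell_shift[OF x])
  then have 1: "-1 <= (x + w) $ i \<and> (x + w) $ i <= 1" for i
   unfolding cell_def mem_box_cart by (cases "i = e") (auto dest: spec[of _ i])
  have 2: "\<bar>(y + w) $ i - (x + w) $ i\<bar> <= 1" for i
   using component_le_norm_cart[of "y - x" i] y by simp
  have "-2 <= (x + w) $ i \<and> (x + w) $ i <= 2 \<and> -2 <= (y + w) $ i \<and> (y + w) $ i <= 2" for i
   using 1[of i] 2[of i] by linarith
  then have "x + w : Z" "y + w : Z" by (simp_all add: Z_def mem_box_cart)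
  moreover have "dist (y + w) (x + w) < r" using y by (simp add: dist_norm)
  ultimately have "dist (F (y + w)) (F (x + w)) < eps" using r(2) by blast
  then show "\<bar>F y - F x\<bar> < eps" unfolding w_def periodic_cell_shift[OF assms(1)] dist_real_def .
 qed
qed

subsection \<open>The distance from the bottom face\<close>

lemma DERIV_max_sq: "((%t. (max 0 t)\<^sup>2) has_real_derivative 2 * max 0 t) (at t)" for t :: real
proof -
 consider "t > 0" | "t < 0" | "t = 0" by linarith
 then show ?thesis
 proof cases
  case 1
  have "((%t. t\<^sup>2) has_real_derivative 2 * max 0 t) (at t)" using 1 by (auto intro!: derivative_eq_intros)
  then show ?thesis by (rule has_field_derivative_transform_within_open[of _ _ _ "{0<..}"]) (use 1 in auto)
 next
  case 2
  have "((%t. 0) has_real_derivative 2 * max 0 t) (at t)" using 2 by auto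
  then show ?thesis by (rule has_field_derivative_transform_within_open[of _ _ _ "{..<0}"]) (use 2 in auto)
 next
  case 3
  have "((%h. (max 0 h)\<^sup>2 / h) \<longlongrightarrow> 0) (at (0::real))"
  proof (rule Lim_null_comparison)
   show "\<forall>\<^sub>F h in at 0. norm ((max 0 h)\<^sup>2 / h) <= \<bar>h\<bar>" by (auto simp: max_def power2_eq_square)
   show "(abs \<longlongrightarrow> 0) (at (0::real))" by (rule tendsto_rabs_zero) (rule tendsto_ident_at)
  qed
  then show ?thesis unfolding 3 DERIV_def by simp
 qed
qed

text \<open>\<open>step01\<close> is the primitive of \<open>tent\<close>: a C^1 reparametrisation
  of the unit interval with zero velocity at both ends, so that concatenated curves remain C^1, as
  the curves in \<open>width\<close> must be.\<close>

definition tent :: "real => real" where "tent t = 4 * max 0 t - 8 * max 0 (t - 1/2) + 4 * max 0 (t - 1)"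
definition step01 :: "real => real" where "step01 t = 2 * (max 0 t)\<^sup>2 - 4 * (max 0 (t - 1/2))\<^sup>2 + 2 * (max 0 (t - 1))\<^sup>2"

lemma DERIV_step01: "(step01 has_real_derivative tent t) (at t)"
proof -
 have "((%t. (max 0 (t - c))\<^sup>2) has_real_derivative 2 * max 0 (t - c)) (at t)" for c
  using DERIV_max_sq[of "t - c"] DERIV_shift[of "%t. (max 0 t)\<^sup>2" _ t "-c"] by simp
 from DERIV_add[OF DERIV_diff[OF DERIV_cmult[OF this[of 0], of 2] DERIV_cmult[OF this[of "1/2"], of 4]] DERIV_cmult[OF this[of 1], of 2]]
 show ?thesis by (simp add: step01_def[abs_def] tent_def)
qed

lemma tent_nonneg: "tent t >= 0" and tent_outside: "t <= 0 \<or> t >= 1 ==> tent t = 0"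
 and step01_low: "t <= 0 ==> step01 t = 0" and step01_high: "t >= 1 ==> step01 t = 1"
 by (auto simp: tent_def step01_def max_def power2_eq_square algebra_simps)

lemma continuous_tent: "continuous_on S tent"
 unfolding tent_def[abs_def] by (intro continuous_intros)

lemma step01_bounds: "0 <= step01 t" "step01 t <= 1"
proof -
 have m: "mono step01"
  by (rule monoI) (rule DERIV_nonneg_imp_nondecreasing, auto intro: DERIV_step01 tent_nonneg)
 show "0 <= step01 t" using monoD[OF m, of "min t 0" t] step01_low[of "min t 0"] by simp
 show "step01 t <= 1" using monoD[OF m, of t "max t 1"] step01_high[of "max t 1"] by simp
qed

lemma tent_integral: "(tent has_integral 1) {0..1}"
proof -
 have "(tent has_integral (step01 1 - step01 0)) {0..1}"
  by (rule fundamental_theorem_of_calculus)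
   (auto simp: has_real_derivative_iff_has_vector_derivative[symmetric] intro: DERIV_step01 has_field_derivative_at_within)
 then show ?thesis using step01_low[of 0] step01_high[of 1] by simp
qed

context riemannian begin

definition gn :: "real^'n => real^'n => real" where "gn x v = sqrt (v \<bullet> (g x *v v))"

lemma gn_quad: "v \<bullet> (g x *v v) = (SUM i. SUM j. v $ i * v $ j * g x $ i $ j)"
 by (simp add: inner_vec_def matrix_vector_mult_def sum_distrib_left mult_ac)

lemma quad_nonneg: "v \<bullet> (g x *v v) >= 0"
 using g_pos[of v x] by (cases "v = 0") auto

lemma gn_nonneg: "gn x v >= 0" by (simp add: gn_def quad_nonneg)

lemma gn_scale: "gn x (c *R v) = \<bar>c\<bar> * gn x v"
proof -
 have "(c *R v) \<bullet> (g x *v (c *R v)) = c\<^sup>2 * (v \<bullet> (g x *v v))"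
  by (simp add: gn_quad sum_distrib_left power2_eq_square mult_ac)
 then show ?thesis by (simp add: gn_def real_sqrt_mult)
qed

lemma continuous_gn:
 assumes "continuous_on S p" "continuous_on S v" shows "continuous_on S (%t. gn (p t) (v t))"
proof -
 have cg: "continuous_on S (%t. g (p t) $ i $ j)" for i j
  by (rule continuous_on_compose2[OF smooth_fun_continuous[OF g_smooth] assms(1)]) auto
 have cv: "continuous_on S (%t. v t $ i)" for i by (intro continuous_intros assms)
 show ?thesis unfolding gn_def gn_quad by (intro continuous_on_real_sqrt continuous_on_sum continuous_on_mult cg cv)
qed

text \<open>Curves are defined on the whole line and rest outside the unit interval. Concatenation
  is then simply a sum of two rescaled curves minus the common point, and its derivative needs no
  case distinction at the junction.\<close>

definition curve :: "(real => real^'n) => (real => real^'n) => bool" where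
 "curve p p' \<longleftrightarrow> (\<forall>t. (p has_vector_derivative p' t) (at t)) \<and> continuous_on UNIV p' \<and>
  (\<forall>t. t <= 0 \<or> t >= 1 \<longrightarrow> p' t = 0) \<and> range p \<subseteq> band e"

definition len :: "(real => real^'n) => (real => real^'n) => real" where
 "len p p' = integral {0..1} (%t. gn (p t) (p' t))"

definition lens :: "real^'n => real set" where
 "lens x = {len p p' | p p'. curve p p' \<and> p 0 $ e = -1 \<and> p 1 = x}"

definition dist_bot :: "real^'n => real" where "dist_bot x = Inf (lens x)"

lemma curve_cont: "curve p p' ==> continuous_on S p"
 unfolding curve_def by (intro continuous_at_imp_continuous_on ballI) (blast intro: has_vector_derivative_continuous)

lemma curve_int: "curve p p' ==> continuous_on S (%t. gn (p t) (p' t))"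
 by (rule continuous_gn[OF curve_cont]) (auto simp: curve_def intro: continuous_on_subset)

lemma len_nonneg: "curve p p' ==> len p p' >= 0"
 unfolding len_def by (intro integral_nonneg integrable_continuous_interval curve_int gn_nonneg)

lemma curve_const:
 assumes "curve p p'" shows "t <= 0 ==> p t = p 0" "t >= 1 ==> p t = p 1"
proof -
 have "(p has_vector_derivative 0) (at s within S)" if "s <= 0 \<or> s >= 1" for s S
  using assms that unfolding curve_def by (metis has_vector_derivative_at_within)
 then obtain c d where "!!s. s : {..0} ==> p s = c" "!!s. s : {1..} ==> p s = d"
  using has_vector_derivative_zero_constant[of "{..0}" p] has_vector_derivative_zero_constant[of "{1..}" p] by (metis atMost_iff atLeast_iff convex_real_interval(1,2))
 then show "t <= 0 ==> p t = p 0" "t >= 1 ==> p t = p 1" by simp_all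
qed

lemma curve_concat:
 assumes p: "curve p p'" and r: "curve r r'" and j: "p 1 = r 0"
 obtains c c' where "curve c c'" "c 0 = p 0" "c 1 = r 1" "len c c' = len p p' + len r r'"
proof -
 let ?c = "%t. p (2 * t) + r (2 * t - 1) - r 0" and ?c' = "%t. 2 *R p' (2 * t) + 2 *R r' (2 * t - 1)"
 note pc = curve_const[OF p] and rc = curve_const[OF r]
 have z: "!!t. t <= 0 \<or> t >= 1 ==> p' t = 0" "!!t. t <= 0 \<or> t >= 1 ==> r' t = 0" using p r unfolding curve_def by auto
 have c1: "?c t = p (2 * t)" "?c' t = 2 *R p' (2 * t)" if "t <= 1/2" for t using rc(1)[of "2 * t - 1"] z(2)[of "2 * t - 1"] that by auto
 have c2: "?c t = r (2 * t - 1)" "?c' t = 2 *R r' (2 * t - 1)" if "t >= 1/2" for t using pc(2)[of "2 * t"] z(1)[of "2 * t"] j that by auto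
 have "(?c has_vector_derivative ?c' t) (at t)" for t
 proof -
  have d: "((%t. 2 * t + c) has_vector_derivative 2) (at t)" for c :: real
   unfolding has_real_derivative_iff_has_vector_derivative[symmetric] by (auto intro!: derivative_eq_intros)
  have "(p has_vector_derivative p' (2 * t + 0)) (at (2 * t + 0))" "(r has_vector_derivative r' (2 * t + - 1)) (at (2 * t + - 1))"
   using p r unfolding curve_def by blast+
  from this[THEN vector_diff_chain_at[OF d]]
  have "((%t. p (2 * t)) has_vector_derivative 2 *R p' (2 * t)) (at t)"
   "((%t. r (2 * t - 1)) has_vector_derivative 2 *R r' (2 * t - 1)) (at t)" by (simp_all add: o_def)
  then show ?thesis by (auto intro!: derivative_eq_intros)
 qed
 moreover have "continuous_on UNIV ?c'"
 proof -
  have "continuous_on UNIV p'" "continuous_on UNIV r'" using p r unfolding curve_def by blast+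
  then have "continuous_on UNIV (%t. p' (2 * t))" "continuous_on UNIV (%t. r' (2 * t - 1))"
   by (auto intro!: continuous_on_compose2[of UNIV p'] continuous_on_compose2[of UNIV r'] continuous_on_diff continuous_on_mult continuous_on_const continuous_on_id)
  then show ?thesis by (intro continuous_on_add continuous_on_scaleR continuous_on_const)
 qed
 moreover have "?c t : band e" for t
  using c1(1)[of t] c2(1)[of t] p r unfolding curve_def by (cases "t <= 1/2") auto
 ultimately have c: "curve ?c ?c'" using z unfolding curve_def by auto
 have i: "((%t. gn (p t) (p' t)) has_integral len p p') {0..1}" "((%t. gn (r t) (r' t)) has_integral len r r') {0..1}"
  unfolding len_def by (intro integrable_integral integrable_continuous_interval curve_int p r)+
 have aff: "((%t. f (2 * t + b)) has_integral (1/2) * l) {- (b/2)..1/2 - b/2}" if "(f has_integral l) {0..1}" for f :: "real => real" and l b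
 proof -
  have "(%x. (1/2) *R x + - ((1/2) *R b)) ` cbox 0 1 = {- (b/2)..1/2 - b/2}"
   using image_affinity_atLeastAtMost[of "1/2" "- (b/2)" 0 "1::real"] by simp
  then show ?thesis using has_integral_affinity[of f l 0 1 2 b] that by simp
 qed
 have "((%t. gn (?c t) (?c' t)) has_integral len p p') {0..1/2}"
 proof -
  have "((%t. gn (p (2 * t)) (p' (2 * t))) has_integral (1/2) * len p p') {0..1/2}"
   using aff[OF i(1), of 0] by simp
  from has_integral_mult_right[OF this, of 2] have E1: "((%t. 2 * gn (p (2 * t)) (p' (2 * t))) has_integral len p p') {0..1/2}" by simp
  have E2: "2 * gn (p (2 * t)) (p' (2 * t)) = gn (?c t) (?c' t)" if "t <= 1/2" for t unfolding c1[OF that] gn_scale by simp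
  show ?thesis by (rule has_integral_eq[OF _ E1]) (rule E2, simp)
 qed
 moreover have "((%t. gn (?c t) (?c' t)) has_integral len r r') {1/2..1}"
 proof -
  have "((%t. gn (r (2 * t - 1)) (r' (2 * t - 1))) has_integral (1/2) * len r r') {1/2..1}"
   using aff[OF i(2), of "-1"] by simp
  from has_integral_mult_right[OF this, of 2] have E1: "((%t. 2 * gn (r (2 * t - 1)) (r' (2 * t - 1))) has_integral len r r') {1/2..1}" by simp
  have E2: "2 * gn (r (2 * t - 1)) (r' (2 * t - 1)) = gn (?c t) (?c' t)" if "t >= 1/2" for t unfolding c2[OF that] gn_scale by simp
  show ?thesis by (rule has_integral_eq[OF _ E1]) (rule E2, simp)
 qed
 ultimately have "((%t. gn (?c t) (?c' t)) has_integral len p p' + len r r') {0..1}"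
  by (intro has_integral_combine) auto
 then have "len ?c ?c' = len p p' + len r r'" unfolding len_def[of ?c] by (rule integral_unique)
 then show ?thesis using c1(1)[of 0] c2(1)[of 1] by (intro that[OF c]) auto
qed

lemma convex_band: "convex (band e)"
proof -
 have "band e = {x. axis e 1 \<bullet> x >= -1} \<inter> {x. axis e 1 \<bullet> x <= (1::real)}"
  by (auto simp: band_def inner_axis' )
 then show ?thesis by (metis convex_Int convex_halfspace_ge convex_halfspace_le)
qed

lemma curve_segment:
 assumes xy: "x : band e" "y : band e" and B: "!!z. z : closed_segment x y ==> gn z (y - x) <= B"
 obtains p p' where "curve p p'" "p 0 = x" "p 1 = y" "len p p' <= B"
proof -
 define p where "p t = x + step01 t *R (y - x)" for t
 define p' where "p' t = tent t *R (y - x)" for t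
 have seg: "p t : closed_segment x y" for t
  unfolding closed_segment_def p_def using step01_bounds[of t] by (auto simp: algebra_simps intro!: exI[of _ "step01 t"])
 have "(p has_vector_derivative p' t) (at t)" for t
  unfolding p_def p'_def using DERIV_step01[of t] unfolding has_real_derivative_iff_has_vector_derivative
  by (auto intro!: derivative_eq_intros has_vector_derivative_scaleR simp: has_real_derivative_iff_has_vector_derivative)
 moreover have "continuous_on UNIV p'" unfolding p'_def by (intro continuous_intros continuous_tent)
 moreover have "range p \<subseteq> band e" using seg closed_segment_subset[OF xy convex_band] by blast
 ultimately have c: "curve p p'" unfolding curve_def using tent_outside by (auto simp: p'_def)
 have "len p p' <= integral {0..1} (%t. B * tent t)"
  unfolding len_def
 proof (rule integral_le)
  show "(%t. gn (p t) (p' t)) integrable_on {0..1}" by (intro integrable_continuous_interval curve_int c)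
  show "(%t. B * tent t) integrable_on {0..1}" by (intro integrable_continuous_interval continuous_intros continuous_tent)
  fix t :: real
  show "gn (p t) (p' t) <= B * tent t"
   using mult_left_mono[OF B[OF seg[of t]] tent_nonneg[of t]] tent_nonneg[of t] by (simp add: p'_def gn_scale mult.commute)
 qed
 also have "((%t. B * tent t) has_integral B) {0..1}" using has_integral_mult_right[OF tent_integral, of B] by simp
 then have "integral {0..1} (%t. B * tent t) = B" by (rule integral_unique)
 finally have l: "len p p' <= B" .
 show ?thesis by (rule that[OF c _ _ l]) (simp_all add: p_def step01_low step01_high)
qed

lemma lens_bdd: "bdd_below (lens x)"
 unfolding bdd_below_def lens_def using len_nonneg by blast

lemma lens_ne: assumes "x : band e" shows "lens x ~= {}"
proof -
 define b where "b = (\<chi> i. if i = e then -1 else x $ i)"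
 have b: "b : band e" "b $ e = -1" by (simp_all add: b_def band_def)
 have "bounded ((%z. gn z (x - b)) ` closed_segment b x)"
  by (intro compact_imp_bounded compact_continuous_image continuous_gn continuous_intros compact_segment)
 then obtain B where "\<forall>y\<in>(%z. gn z (x - b)) ` closed_segment b x. norm y <= B" unfolding bounded_iff ..
 then have nB: "norm (gn z (x - b)) <= B" if "z : closed_segment b x" for z using that by blast
 have "gn z (x - b) <= B" if "z : closed_segment b x" for z using nB[OF that] by simp
 then obtain p p' where "curve p p'" "p 0 = b" "p 1 = x" by (rule curve_segment[OF b(1) assms])
 then have "len p p' : lens x" using b(2) unfolding lens_def by blast
 then show ?thesis by blast
qed

lemma dist_bot_step:
 assumes xy: "x : band e" "y : band e" and B: "!!z. z : closed_segment x y ==> gn z (y - x) <= B"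
 shows "dist_bot y <= dist_bot x + B"
proof -
 obtain r r' where r: "curve r r'" "r 0 = x" "r 1 = y" "len r r' <= B" by (rule curve_segment[OF xy B])
 have "dist_bot y - B <= l" if l: "l : lens x" for l
 proof -
  obtain p p' where p: "curve p p'" "p 0 $ e = -1" "p 1 = x" "l = len p p'" using l unfolding lens_def by blast
  have j: "p 1 = r 0" using p r by simp
  obtain c c' where c: "curve c c'" "c 0 = p 0" "c 1 = r 1" "len c c' = len p p' + len r r'"
   by (rule curve_concat[OF p(1) r(1) j])
  then have "len p p' + len r r' : lens y" unfolding lens_def using p(2) r(3) by (intro CollectI exI[of _ c] exI[of _ c']) auto
  then have "dist_bot y <= len p p' + len r r'" unfolding dist_bot_def by (rule cInf_lower[OF _ lens_bdd])
  then show ?thesis using p r by simp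
 qed
 then have "dist_bot y - B <= dist_bot x" unfolding dist_bot_def[of x] by (intro cInf_greatest lens_ne xy)
 then show ?thesis by simp
qed

lemma dist_bot_bottom: assumes "x $ e = -1" shows "dist_bot x <= 0"
proof -
 have "curve (%t. x) (%t. 0)" using assms by (auto simp: curve_def band_def)
 then have "len (%t. x) (%t. 0) : lens x" unfolding lens_def using assms by blast
 moreover have "len (%t. x) (%t. 0) = 0" by (simp add: len_def gn_def)
 ultimately show ?thesis unfolding dist_bot_def by (metis cInf_lower lens_bdd)
qed

lemma dist_bot_top: assumes x: "x $ e = 1" shows "width g e <= dist_bot x"
proof -
 define W where "W = {curve_len g gam | gam. gam C1_differentiable_on {0..1} \<and> gam ` {0..1} \<subseteq> band e \<and> gam 0 $ e = -1 \<and> gam 1 $ e = 1}"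
 have "x : band e" using x by (simp add: band_def)
 have sub: "lens x \<subseteq> W"
 proof
  fix l assume "l : lens x"
  then obtain p p' where p: "curve p p'" "p 0 $ e = -1" "p 1 = x" "l = len p p'" unfolding lens_def by blast
  have "vector_derivative p (at t within {0..1}) = p' t" if "t : {0..1}" for t
   using p(1) that unfolding curve_def by (intro vector_derivative_at_within_ivl) auto
  then have "l = curve_len g p" unfolding p(4) len_def curve_len_def gn_def by (intro integral_cong) simp
  moreover have "p C1_differentiable_on {0..1}"
   using p(1) unfolding curve_def C1_differentiable_on_def by (meson continuous_on_subset subset_UNIV)
  ultimately show "l : W" using p x unfolding W_def curve_def by blast
 qed
 have "bdd_below W"
 proof -
  have "curve_len g gam >= 0" for gam
   unfolding curve_len_def by (cases "(%t. sqrt (vector_derivative gam (at t within {0..1}) \<bullet> (g (gam t) *v vector_derivative gam (at t within {0..1})))) integrable_on {0..1}")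
    (auto intro!: integral_nonneg simp: quad_nonneg not_integrable_integral)
  then show ?thesis unfolding bdd_below_def W_def by blast
 qed
 then show ?thesis unfolding dist_bot_def width_def W_def[symmetric]
  by (intro cInf_superset_mono lens_ne sub \<open>x : band e\<close>)
qed

lemma periodic_g: "periodic_in e (%x. g x $ i $ j)"
 using metric unfolding riem_metric_def smooth_sym_field_def periodic_in_def by simp

lemma gn_upper: obtains B where "B > 0" "!!x v. x : band e ==> gn x v <= B * norm v"
proof -
 have "\<forall>p. \<exists>B. B > 0 \<and> (\<forall>x\<in>band e. \<bar>g x $ fst p $ snd p\<bar> <= B)"
  using periodic_bounded[OF periodic_g smooth_fun_continuous[OF g_smooth]] by metis
 from choice[OF this] obtain b where b: "!!p. b p > 0" "!!p x. x : band e ==> \<bar>g x $ fst p $ snd p\<bar> <= b p" by blast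
 define B where "B = (SUM i. SUM j. b (i, j))"
 have B: "B > 0" unfolding B_def by (intro sum_pos b) auto
 have "gn x v <= sqrt B * norm v" if "x : band e" for x v
 proof -
  have "v \<bullet> (g x *v v) <= (SUM i. SUM j. (norm v * norm v) * b (i, j))"
   unfolding gn_quad
  proof (intro sum_mono)
   fix i j
   have "v $ i * v $ j * g x $ i $ j <= \<bar>v $ i\<bar> * \<bar>v $ j\<bar> * \<bar>g x $ i $ j\<bar>" by (metis abs_ge_self abs_mult)
   also have "... <= (norm v * norm v) * b (i, j)"
    using b(2)[OF that, of "(i, j)"] by (intro mult_mono component_le_norm_cart) auto
   finally show "v $ i * v $ j * g x $ i $ j <= (norm v * norm v) * b (i, j)" .
  qed
  also have "... = B * (norm v)\<^sup>2" by (simp add: B_def sum_distrib_left power2_eq_square mult_ac)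
  finally have "gn x v <= sqrt (B * (norm v)\<^sup>2)" unfolding gn_def by (rule real_sqrt_le_mono)
  then show ?thesis by (simp add: real_sqrt_mult)
 qed
 then show ?thesis using that[of "sqrt B"] B by simp
qed

lemma g_lower: obtains m where "m > 0" "!!x v. x : band e ==> v \<bullet> (g x *v v) >= m * (norm v)\<^sup>2"
proof -
 let ?S = "cell e \<times> sphere (0::real^'n) 1"
 let ?f = "%p. snd p \<bullet> (g (fst p) *v snd p)"
 have c: "continuous_on ?S (%p. gn (fst p) (snd p))" by (intro continuous_gn continuous_intros)
 have sq: "?f p = (gn (fst p) (snd p))\<^sup>2" for p by (simp add: gn_def quad_nonneg)
 have "(0 :: real^'n) : cell e" by (simp add: cell_def mem_box_cart)
 moreover have "axis e 1 : sphere (0::real^'n) 1" by simp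
 ultimately have ne: "?S ~= {}" by blast
 have "compact ?S" unfolding cell_def by (intro compact_Times) auto
 moreover have "continuous_on ?S ?f" unfolding sq by (intro continuous_on_power c)
 ultimately obtain p where p: "p : ?S" "!!q. q : ?S ==> ?f p <= ?f q"
  using continuous_attains_inf[of ?S ?f] ne by blast
 have "snd p ~= 0" using p(1) by auto
 then have m: "?f p > 0" by (rule g_pos)
 show ?thesis
 proof (rule that[OF m])
  fix x v :: "real^'n" assume x: "x : band e"
  show "?f p * (norm v)\<^sup>2 <= v \<bullet> (g x *v v)"
  proof (cases "v = 0")
   case False
   define u where "u = v /\<^sub>R norm v"
   have "?f p <= u \<bullet> (g (x + cell_shift e x) *v u)" using p(2)[of "(x + cell_shift e x, u)"] cell_shift[OF x] False by (simp add: u_def)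
   also have "g (x + cell_shift e x) = g x"
    using metric unfolding riem_metric_def smooth_sym_field_def by (intro periodic_cell_shift) blast
   also have "u \<bullet> (g x *v u) = (v \<bullet> (g x *v v)) / (norm v)\<^sup>2"
    by (simp add: u_def gn_quad sum_distrib_left sum_divide_distrib power2_eq_square field_simps)
   finally show ?thesis using False by (simp add: pos_le_divide_eq)
  qed simp
 qed
qed

lemma gn_uniform:
 assumes eps: "eps > 0"
 obtains r where "r > 0" "!!x y v. x : band e ==> norm (y - x) < r ==> gn y v <= (1 + eps) * gn x v"
proof -
 obtain m where m: "m > 0" "!!x v. x : band e ==> v \<bullet> (g x *v v) >= m * (norm v)\<^sup>2" by (rule g_lower) blast
 define n where "n = real CARD('n)"
 have n: "n > 0" by (simp add: n_def)
 \<comment> \<open>There are n^2 entries, each changing by less than \<open>dlt\<close>; the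
   quadratic form then changes by at most eps m |v|^2, which the lower bound m turns into a relative
   error.\<close>
 define dlt where "dlt = eps * m / n\<^sup>2"
 have dlt: "dlt > 0" using eps m n by (simp add: dlt_def)
 have "\<forall>p. \<exists>r. r > 0 \<and> (\<forall>x y. x : band e \<longrightarrow> norm (y - x) < r \<longrightarrow> \<bar>g y $ fst p $ snd p - g x $ fst p $ snd p\<bar> < dlt)"
  using periodic_uniformly_continuous[OF periodic_g smooth_fun_continuous[OF g_smooth] dlt] by metis
 from choice[OF this] obtain r where r: "!!p. r p > 0"
  "!!p x y. x : band e ==> norm (y - x) < r p ==> \<bar>g y $ fst p $ snd p - g x $ fst p $ snd p\<bar> < dlt" by blast
 show ?thesis
 proof (rule that[of "Min (range r)"])
  show "Min (range r) > 0" using r(1) by (subst Min_gr_iff) auto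
  fix x y v :: "real^'n" assume x: "x : band e" and y: "norm (y - x) < Min (range r)"
  have yp: "norm (y - x) < r p" for p by (rule order_less_le_trans[OF y Min_le]) auto
  have "v \<bullet> (g y *v v) - v \<bullet> (g x *v v) = (SUM i. SUM j. v $ i * v $ j * (g y $ i $ j - g x $ i $ j))"
   unfolding gn_quad by (simp add: sum_subtractf right_diff_distrib)
  also have "... <= (\<Sum>i::'n\<in>UNIV. \<Sum>j::'n\<in>UNIV. (norm v * norm v) * dlt)"
  proof (intro sum_mono)
   fix i j
   have "v $ i * v $ j * (g y $ i $ j - g x $ i $ j) <= \<bar>v $ i\<bar> * \<bar>v $ j\<bar> * \<bar>g y $ i $ j - g x $ i $ j\<bar>" by (metis abs_ge_self abs_mult)
   also have "... <= (norm v * norm v) * dlt"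
    using r(2)[OF x yp, of "(i, j)"] by (intro mult_mono component_le_norm_cart) auto
   finally show "v $ i * v $ j * (g y $ i $ j - g x $ i $ j) <= (norm v * norm v) * dlt" .
  qed
  also have "... = eps * (m * (norm v)\<^sup>2)" using n by (simp add: dlt_def n_def[symmetric] power2_eq_square)
  also have "... <= eps * (v \<bullet> (g x *v v))" using m(2)[OF x] eps by (intro mult_left_mono) auto
  finally have 1: "v \<bullet> (g y *v v) <= (1 + eps) * (v \<bullet> (g x *v v))" by (simp add: algebra_simps)
  have "(1 + eps) * 1 <= (1 + eps) * (1 + eps)" using eps by (intro mult_left_mono) auto
  then have "(1 + eps) * (v \<bullet> (g x *v v)) <= (1 + eps)\<^sup>2 * (v \<bullet> (g x *v v))"
   by (intro mult_right_mono quad_nonneg) (simp add: power2_eq_square)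
  with 1 have "gn y v <= sqrt ((1 + eps)\<^sup>2 * (v \<bullet> (g x *v v)))" unfolding gn_def by (intro real_sqrt_le_mono) linarith
  then show "gn y v <= (1 + eps) * gn x v" using eps by (simp add: gn_def real_sqrt_mult)
 qed
qed

text \<open>At the top the distance from the bottom is at least tp - tm + 4 r1. Discarding r1 at
  either end and rescaling the rest to [tm, tp] still leaves slope a < 1, and the result is constant
  near both faces, so averaging will not disturb its boundary values.\<close>

lemma clamped_distance:
 assumes D: "tm < tp" and w: "tp - tm < width g e"
 obtains f :: "real^'n => real" and d a where "continuous_on UNIV f" "d > 0" "0 < a" "a < 1"
  "!!x. tm <= f x" "!!x. f x <= tp" "!!x. x $ e <= -1 + d ==> f x = tm" "!!x. x $ e >= 1 - d ==> f x = tp"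
  "!!x y B. x : band e ==> y : band e ==> (!!z. z : closed_segment x y ==> gn z (y - x) <= B) ==> f y - f x <= a * B"
proof -
 define r1 where "r1 = (width g e - (tp - tm)) / 4"
 define a where "a = (tp - tm) / (tp - tm + 2 * r1)"
 have r1: "r1 > 0" using w by (simp add: r1_def)
 have a: "0 < a" "a < 1" "a * (tp - tm + 2 * r1) = tp - tm" using r1 D by (simp_all add: a_def)
 obtain K where K: "K > 0" "!!x v. x : band e ==> gn x v <= K * norm v" by (rule gn_upper) blast
 \<comment> \<open>A coordinate distance d from a face corresponds to metric length at most
   r1.\<close>
 define d where "d = r1 / K"
 have d: "d > 0" "K * d = r1" using r1 K by (simp_all add: d_def)
 define p where "p r = max tm (min tp (tm + a * (r - r1)))" for r
 \<comment> \<open>Clamping x_e extends f to all of R^n, which the averaging requires.\<close>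
 define pr where "pr x = (\<chi> i. if i = e then max (-1) (min 1 (x $ e)) else x $ i)" for x :: "real^'n"
 define f where "f x = p (dist_bot (pr x))" for x
 have prb: "pr x : band e" for x by (simp add: pr_def band_def)
 have pr_id: "pr x = x" if "x : band e" for x using that by (auto simp: pr_def band_def vec_eq_iff)
 have lip: "dist_bot y <= dist_bot x + K * norm (y - x)" if "x : band e" "y : band e" for x y
  by (rule dist_bot_step[OF that K(2)]) (use closed_segment_subset[OF that convex_band] in blast)
 have "K-lipschitz_on (band e) dist_bot"
 proof (rule lipschitz_onI)
  fix x y assume "x : band e" "y : band e"
  then show "dist (dist_bot x) (dist_bot y) <= K * dist x y"
   using lip[of x y] lip[of y x] by (simp add: dist_norm norm_minus_commute abs_le_iff)
 qed (use K in simp)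
 then have cu: "continuous_on (band e) dist_bot" by (rule lipschitz_on_continuous_on)
 have cp: "continuous_on UNIV pr"
  unfolding pr_def
 proof (rule continuous_on_vec_lambda)
  fix i
  have "continuous_on UNIV (%x::real^'n. max (-1) (min 1 (x $ e)))" "continuous_on UNIV (%x::real^'n. x $ i)"
   by (intro continuous_on_max continuous_on_min continuous_on_const linear_continuous_on bounded_linear_vec_nth)+
  then show "continuous_on UNIV (%x::real^'n. if i = e then max (-1) (min 1 (x $ e)) else x $ i)" by (cases "i = e") auto
 qed
 have "continuous_on UNIV (%x. dist_bot (pr x))" by (rule continuous_on_compose2[OF cu cp]) (use prb in auto)
 then have cf: "continuous_on UNIV f" unfolding f_def p_def by (intro continuous_intros)
 have pb: "tm <= p r" "p r <= tp" for r using D by (auto simp: p_def)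
 have pl: "p r = tm" if "r <= r1" for r
 proof -
  have "a * (r - r1) <= 0" using that a by (simp add: mult_nonneg_nonpos)
  then show ?thesis using D by (simp add: p_def)
 qed
 have ph: "p r = tp" if "r >= width g e - r1" for r
 proof -
  have "tp - tm + 2 * r1 <= r - r1" using that by (simp add: r1_def field_simps)
  then have "a * (tp - tm + 2 * r1) <= a * (r - r1)" using a by (intro mult_left_mono) auto
  then show ?thesis using a D by (simp add: p_def)
 qed
 have pinc: "p r' - p r <= a * B" if "r' <= r + B" "B >= 0" for r r' B
 proof -
  have "a * (r' - r1) <= a * (r + B - r1)" using a that by (intro mult_left_mono) auto
  moreover have "a * (r + B - r1) = a * (r - r1) + a * B" by (simp add: algebra_simps)
  moreover have "a * B >= 0" using a that by simp
  ultimately show ?thesis unfolding p_def by linarith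
 qed
 show ?thesis
 proof (rule that[OF cf d(1) a(1,2)])
  show "tm <= f x" "f x <= tp" for x unfolding f_def by (rule pb)+
  show "f x = tm" if x: "x $ e <= -1 + d" for x
  proof -
   define b where "b = (\<chi> i. if i = e then -1 else x $ i)"
   have b: "b : band e" "b $ e = -1" by (simp_all add: b_def band_def)
   have "pr x - b = (max (-1) (min 1 (x $ e)) + 1) *R axis e 1" by (auto simp: pr_def b_def vec_eq_iff axis_def)
   then have "norm (pr x - b) <= d" using x d by auto
   then have "K * norm (pr x - b) <= r1" unfolding d(2)[symmetric] using K by (intro mult_left_mono) auto
   then have "dist_bot (pr x) <= r1" using lip[OF b(1) prb, of x] dist_bot_bottom[OF b(2)] by linarith
   then show ?thesis unfolding f_def by (rule pl)
  qed
  show "f x = tp" if x: "x $ e >= 1 - d" for x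
  proof -
   define b where "b = (\<chi> i. if i = e then 1 else x $ i)"
   have b: "b : band e" "b $ e = 1" by (simp_all add: b_def band_def)
   have "b - pr x = (1 - max (-1) (min 1 (x $ e))) *R axis e 1" by (auto simp: pr_def b_def vec_eq_iff axis_def)
   then have "norm (b - pr x) <= d" using x d by auto
   then have "K * norm (b - pr x) <= r1" unfolding d(2)[symmetric] using K by (intro mult_left_mono) auto
   then have "dist_bot (pr x) >= width g e - r1" using lip[OF prb b(1), of x] dist_bot_top[OF b(2)] by linarith
   then show ?thesis unfolding f_def by (rule ph)
  qed
  fix x y B assume xy: "x : band e" "y : band e" and B: "!!z. z : closed_segment x y ==> gn z (y - x) <= B"
  have "B >= 0" using B[of x] gn_nonneg[of x "y - x"] by simp
  then show "f y - f x <= a * B" unfolding f_def pr_id[OF xy(1)] pr_id[OF xy(2)] by (intro pinc dist_bot_step[OF xy B])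
 qed
qed

text \<open>Average the clamped distance over cubes so small that the metric varies by at most a
  factor 1 + kap. The slope grows from a to a (1 + kap), still at most 1 - kap. A directional
  derivative exceeding this bound would contradict the difference estimate for small
  displacements.\<close>

lemma band_function:
 assumes D: "tm < tp" and w: "tp - tm < width g e"
 obtains rho :: "real^'n => real" and rho' kap where "0 < kap" "kap < 1" "!!a x. has_pd a rho (rho' a x) x" "!!a. continuous_on UNIV (rho' a)"
  "!!x. tm <= rho x" "!!x. rho x <= tp" "!!x. x $ e = -1 ==> rho x = tm" "!!x. x $ e = 1 ==> rho x = tp"
  "!!x. x : band e ==> sqrt (SUM a. SUM b. G a b x * rho' a x * rho' b x) <= 1 - kap"
proof -
 obtain f d a where f: "continuous_on UNIV f" and d: "d > 0" and a: "0 < a" "a < 1"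
  and fb: "!!x. tm <= f x" "!!x. f x <= tp" "!!x. x $ e <= -1 + d ==> f x = tm" "!!x. x $ e >= 1 - d ==> f x = tp"
  and fl: "!!x y B. x : band e ==> y : band e ==> (!!z. z : closed_segment x y ==> gn z (y - x) <= B) ==> f y - f x <= a * B"
  by (rule clamped_distance[OF D w]) blast
 \<comment> \<open>With a = 1 - 2 kap one has a (1 + kap) \<le> a + kap = 1 - kap.\<close>
 define kap where "kap = (1 - a) / 2"
 have kap: "0 < kap" "kap < 1" "a * (1 + kap) <= 1 - kap"
 proof -
  have "a * kap <= 1 * kap" using a by (intro mult_right_mono) (auto simp: kap_def)
  then show "a * (1 + kap) <= 1 - kap" by (simp add: kap_def field_simps)
 qed (use a in \<open>auto simp: kap_def\<close>)
 obtain r where r: "r > 0" "!!x y v. x : band e ==> norm (y - x) < r ==> gn y v <= (1 + kap) * gn x v"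
  using gn_uniform[OF kap(1)] by blast
 define n where "n = real CARD('n)"
 have n: "n > 0" by (simp add: n_def)
 define s where "s = min (d / 4) (r / (2 * n))"
 have s: "s > 0" "s <= d / 4" "n * s <= r / 2" using d r n by (auto simp: s_def min_def field_simps)
 obtain rho rho' where rho: "!!a x. has_pd a rho (rho' a x) x" "!!a. continuous_on UNIV (rho' a)"
  "!!x y c. (!!z. (!!i. \<bar>z $ i\<bar> <= s) ==> f (y + z) - f (x + z) <= c) ==> rho y - rho x <= c"
  "!!x c. (!!z. (!!i. \<bar>z $ i\<bar> <= s) ==> f (x + z) <= c) ==> rho x <= c"
  "!!x c. (!!z. (!!i. \<bar>z $ i\<bar> <= s) ==> f (x + z) >= c) ==> rho x >= c"
  by (rule average[OF f s(1)]) blast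
 have nz: "norm z <= r / 2" if "!!i. \<bar>z $ i\<bar> <= s" for z :: "real^'n"
 proof -
  have "norm z <= (SUM i. \<bar>z $ i\<bar>)" by (rule norm_le_l1_cart)
  also have "... <= (\<Sum>i::'n\<in>UNIV. s)" by (intro sum_mono that)
  finally show ?thesis using s(3) by (simp add: n_def)
 qed
 have dir: "(SUM i. v $ i * rho' i x) <= a * (1 + kap) * gn x v" if x: "x : band e" for x v
 proof (rule ccontr)
  define c where "c = a * (1 + kap) * gn x v"
  have c0: "c >= 0" using a kap gn_nonneg by (simp add: c_def)
  assume "\<not> (SUM i. v $ i * rho' i x) <= a * (1 + kap) * gn x v"
  then have gt: "(SUM i. v $ i * rho' i x) - c > 0" by (simp add: c_def)
  have "((%h. rho (x + h *R v)) has_derivative (%h. SUM i. (h *R v) $ i * rho' i (x + 0 *R v))) (at 0)"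
   by (rule has_derivative_compose[OF _ has_derivative_partials[OF rho(1,2)]]) (auto intro!: derivative_eq_intros)
  moreover have "(%h. SUM i. (h *R v) $ i * rho' i (x + 0 *R v)) = (*) (SUM i. v $ i * rho' i x)"
   by (rule ext) (simp add: sum_distrib_left sum_distrib_right mult_ac)
  ultimately have "((%h. rho (x + h *R v)) has_real_derivative (SUM i. v $ i * rho' i x)) (at 0)"
   unfolding has_field_derivative_def by simp
  from DERIV_diff[OF this DERIV_cmult[OF DERIV_ident, of c]]
  have "((%h. rho (x + h *R v) - c * h) has_real_derivative (SUM i. v $ i * rho' i x) - c) (at 0)" by simp
  from DERIV_pos_inc_right[OF this gt] obtain dlt where dlt: "dlt > 0" "!!h. h > 0 ==> h < dlt ==> rho x < rho (x + h *R v) - c * h" by auto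
  define h where "h = min (dlt / 2) (min (d / 4) (r / 4) / (norm v + 1))"
  have nv: "norm v + 1 > 0" by (simp add: add_nonneg_pos)
  have h: "h > 0" "h < dlt" using dlt(1) d r nv by (auto simp: h_def min_less_iff_disj)
  have "h * norm v <= min (d / 4) (r / 4)"
  proof -
   have "h * norm v <= (min (d / 4) (r / 4) / (norm v + 1)) * (norm v + 1)" using h nv by (intro mult_mono) (auto simp: h_def)
   then show ?thesis using nv by simp
  qed
  then have hv: "h * norm v <= d / 4" "h * norm v <= r / 4" by auto
  have "rho (x + h *R v) - rho x <= h * c"
  proof (rule rho(3))
   fix z :: "real^'n" assume z: "!!i. \<bar>z $ i\<bar> <= s"
   have ze: "\<bar>z $ e\<bar> <= d / 4" using z[of e] s by linarith
   have "\<bar>(h *R v) $ e\<bar> <= h * norm v" using h component_le_norm_cart[of "h *R v" e] by simp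
   then have ve: "\<bar>(h *R v) $ e\<bar> <= d / 4" using hv by linarith
   define y0 y where "y0 = x + z" and "y = x + h *R v + z"
   have y0e: "y0 $ e = x $ e + z $ e" and ye: "y $ e = x $ e + (h *R v) $ e + z $ e" by (simp_all add: y0_def y_def)
   \<comment> \<open>Near either face f is constant at both points, even if they leave the band;
     otherwise both points and the segment between them lie in the band, where the metric estimate
     applies.\<close>
   consider "x $ e < -1 + d / 2" | "x $ e > 1 - d / 2" | "-1 + d / 2 <= x $ e" "x $ e <= 1 - d / 2" by linarith
   then have "f y - f y0 <= h * c"
   proof cases
    case 1
    then have "y $ e <= -1 + d" "y0 $ e <= -1 + d" using ze ve y0e ye by linarith+
    then show ?thesis using fb(3) h c0 by simp
   next
    case 2
    then have "y $ e >= 1 - d" "y0 $ e >= 1 - d" using ze ve y0e ye by linarith+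
    then show ?thesis using fb(4) h c0 by simp
   next
    case 3
    then have yb: "y0 : band e" "y : band e" using ze ve y0e ye d unfolding band_def by auto
    have "f y - f y0 <= a * (h * ((1 + kap) * gn x v))"
    proof (rule fl[OF yb])
     fix p assume "p : closed_segment y0 y"
     then obtain u where u: "0 <= u" "u <= 1" "p = (1 - u) *R y0 + u *R y" unfolding closed_segment_def by blast
     have "p - x = z + (u * h) *R v" unfolding u(3) y0_def y_def by (simp add: algebra_simps)
     then have "norm (p - x) <= norm z + norm ((u * h) *R v)" by (metis norm_triangle_ineq)
     also have "norm ((u * h) *R v) <= 1 * (h * norm v)" using u h mult_right_mono[of u 1 "h * norm v"] by (simp add: abs_mult mult.assoc)
     finally have "norm (p - x) < r" using nz[OF z] hv r by simp
     then have "gn p v <= (1 + kap) * gn x v" by (rule r(2)[OF x])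
     moreover have "y - y0 = h *R v" by (simp add: y_def y0_def)
     ultimately show "gn p (y - y0) <= h * ((1 + kap) * gn x v)" using h by (simp add: gn_scale)
    qed
    then show ?thesis by (simp add: c_def mult_ac)
   qed
   then show "f (x + h *R v + z) - f (x + z) <= h * c" by (simp add: y_def y0_def)
  qed
  then show False using dlt(2)[OF h] by (simp add: mult.commute)
 qed
 show ?thesis
 proof (rule that[OF kap(1,2) rho(1,2)])
  show "tm <= rho x" "rho x <= tp" for x by (intro rho(4,5) fb)+
  show "rho x = tm" if x: "x $ e = -1" for x
  proof -
   have "f (x + z) = tm" if "!!i. \<bar>z $ i\<bar> <= s" for z using that[of e] s x d by (intro fb(3)) auto
   then show ?thesis using rho(4)[of x tm] rho(5)[of tm x] by (intro antisym) auto
  qed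
  show "rho x = tp" if x: "x $ e = 1" for x
  proof -
   have "f (x + z) = tp" if "!!i. \<bar>z $ i\<bar> <= s" for z using that[of e] s x d by (intro fb(4)) auto
   then show ?thesis using rho(4)[of x tp] rho(5)[of tp x] by (intro antisym) auto
  qed
  fix x assume x: "x : band e"
  \<comment> \<open>Testing with the metric gradient of \<open>rho\<close>: its norm and the
    derivative in its direction are both expressed by q, so the bound on the derivative becomes a
    bound on the norm.\<close>
  define v where "v = ginv g x *v (\<chi> b. rho' b x)"
  define q where "q = (SUM a. SUM b. G a b x * rho' a x * rho' b x)"
  have q: "q = (SUM i. v $ i * rho' i x)"
   by (simp add: q_def v_def matrix_vector_mult_def sum_distrib_right sum_distrib_left mult_ac)
  have "g x *v v = (\<chi> b. rho' b x)" by (simp add: v_def matrix_vector_mul_assoc ginv_mult)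
  then have gq: "gn x v = sqrt q" unfolding q gn_def by (simp add: inner_vec_def)
  have q0: "q >= 0" using gn_nonneg[of x v] unfolding gq by simp
  have qq: "sqrt q * sqrt q <= a * (1 + kap) * sqrt q" using dir[OF x, of v] q0 unfolding q[symmetric] gq by simp
  have "sqrt q <= a * (1 + kap)"
  proof (cases "q = 0")
   case False
   then have "sqrt q > 0" using q0 by simp
   then show ?thesis by (rule mult_right_le_imp_le[OF qq])
  qed (use a kap in auto)
  then show "sqrt (SUM a. SUM b. G a b x * rho' a x * rho' b x) <= 1 - kap" using kap(3) unfolding q_def by linarith
 qed
qed

end

section \<open>The segment of operators and its uniform estimates\<close>

lemma finite_bound:
 fixes f :: "'p::finite => 'a::topological_space => real"
 assumes "compact S" "!!p. continuous_on S (f p)" obtains B where "B > 0" "!!p x. x : S ==> \<bar>f p x\<bar> <= B"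
proof -
 have "bounded (\<Union>p. f p ` S)" by (intro bounded_UN finite ballI compact_imp_bounded compact_continuous_image assms)
 then obtain B where B: "B > 0" "\<forall>y\<in>(\<Union>p. f p ` S). norm y <= B" unfolding bounded_pos by blast
 show ?thesis
 proof (rule that[OF B(1)])
  fix p x assume "x : S"
  then have "norm (f p x) <= B" using B(2) by blast
  then show "\<bar>f p x\<bar> <= B" by simp
 qed
qed

text \<open>\<open>gam\<close> is the gap supplied by the potential h, and \<open>small\<close> says
  that the tangent potentials use up at most half of it. \<open>top\<close> and \<open>bot\<close>
  give the boundary density its sign, and \<open>K\<close> bounds the metric length of the
  coordinate covectors, including the flat value 1.\<close>

locale witten_slab = initial_data e g E k + slab e L lam
 for e :: "'n::finite" and g E k L lam +
 fixes h :: "real^'n => real" and h' :: "'n => real^'n => real" and q K gam :: real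
 assumes n2: "CARD('n) >= 2" and q: "q = real CARD('n) / (real CARD('n) - 1)"
  and h: "!!a x. has_pd a h (h' a x) x" "!!a. continuous_on UNIV (h' a)"
  and K: "K >= 1" "!!x j. x : Q ==> sqrt (G j j x) <= K" "2 * K <= real lam"
  and gam: "gam > 0" "!!x. x : Q ==> gam <= q/2 * ((mu g k x - normJ g k x) + q/2 * (h x)\<^sup>2 - h x * tau x
    - sqrt (SUM a. SUM b. G a b x * h' a x * h' b x))"
  and small: "(\<Sum>j\<in>UNIV - {e}. real lam * K * (dl j)\<^sup>2) <= gam / 2"
  and top: "!!x. x $ e = 1 ==> h x <= null_exp g k e x" and bot: "!!x. x $ e = -1 ==> null_exp g k e x <= h x"
begin

lemma h_cont: "continuous_on S h"
 by (intro continuous_at_imp_continuous_on ballI has_derivative_continuous[OF has_derivative_partials[OF h]])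

abbreviation T1 :: "(real^'n => real^('n set)) => real^'n => real^('n set)" where "T1 \<equiv> Bop (q / 2) h tn"

text \<open>The zeroth-order part of \<open>T1\<close> apart from the tangent potentials; the
  connection terms appear as the Dirac operator applied to a constant field.\<close>

definition Z :: "real^('n set) => real^'n => real^('n set)" where
 "Z u x = Dirac (%_. u) x + (q / 2 * h x - tau x / 2) *R sig u"

definition Fr :: "real => 'n => 'n => real^'n => real" where
 "Fr t i a x = (1 - t) * (if i = a then 1 else 0) + t * E i a x"

lemma Fr_smooth: "smooth_fun (Fr t i a)"
 unfolding Fr_def[abs_def] by (intro smooth_intros E_smooth)

lemma Dirac_const: "Dirac (%_. u) x = (SUM a. A a x (bil (%i j. om a i j x) u))"
 by (simp add: Dirac_def nab_def)

lemma Dirac_eq: "Dirac psi x = Fop E psi x + Dirac (%_. psi x) x"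
proof -
 have "Fop E psi x = (SUM i. SUM a. E i a x *R cl i (pv a psi x))"
  unfolding Fop_def cl_sum by (simp add: cl_simps)
 also have "... = (SUM a. A a x (pv a psi x))" unfolding A_def by (rule sum.swap)
 finally show ?thesis unfolding Dirac_const unfolding Dirac_def nab_def A_simps sum.distrib by simp
qed

lemma T1_eq: "T1 psi x = Fop E psi x + Th psi x + Z (psi x) x"
 unfolding Bop_def Z_def Th_def Dirac_eq[of psi] by simp

lemma T0_eq: "T0 psi x = Fop (%i a x. if i = a then 1 else 0) psi x + Th psi x"
proof -
 have "(SUM a. (if i = a then 1 else 0) *R pv a psi x) = pv i psi x" for i
  by (simp add: if_distrib[of "%z. z *R _"] cong: if_cong)
 then show ?thesis by (simp add: T0_def Fop_def)
qed

lemma Fop_Fr: "Fop (Fr t) psi x = (1 - t) *R Fop (%i a x. if i = a then 1 else 0) psi x + t *R Fop E psi x"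
 unfolding Fop_def Fr_def
 by (simp add: scaleR_add_left sum.distrib cl_simps scaleR_sum_right[symmetric] flip: scaleR_scaleR)

text \<open>Every operator of the segment has the shape covered by the Garding inequality, with
  coefficients \<open>Fr t\<close> and the same tangent potentials, up to a bounded zeroth-order
  term.\<close>

lemma Tt_eq: "(1 - t) *R T0 psi x + t *R T1 psi x = Fop (Fr t) psi x + Th psi x + t *R Z (psi x) x"
 unfolding T0_eq T1_eq Fop_Fr by (simp add: algebra_simps)

lemma Z_linear: "linear (%u. Z u x)"
 by (rule linearI) (simp_all add: Z_def Dirac_const A_simps bil_simps sig_def ch_simps sum.distrib scaleR_sum_right algebra_simps)

lemma Z_bound: obtains B where "B > 0" "!!x u. x : Q ==> norm (Z u x) <= B * norm u"
proof -
 have "continuous_on Q (%x. norm (Z (axis S 1) x))" for S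
  unfolding Z_def by (intro continuous_intros smooth_map_continuous smooth_Dirac smooth_map_const h_cont smooth_fun_continuous tau_smooth) simp
 then obtain b where b: "b > 0" "!!S x. x : Q ==> \<bar>norm (Z (axis S 1) x)\<bar> <= b"
  using finite_bound[OF compact_cbox, of lo hi "%S x. norm (Z (axis S 1) x)"] by blast
 show ?thesis
 proof (rule that[of "real CARD('n set) * b"])
  show "real CARD('n set) * b > 0" using b by simp
  fix x and u :: "real^('n set)" assume x: "x : Q"
  have "u = (SUM S. u $ S *R axis S 1)" using basis_expansion[of u] by (simp add: scalar_mult_eq_scaleR)
  then have "Z u x = Z (SUM S. u $ S *R axis S 1) x" by simp
  also have "... = (SUM S. u $ S *R Z (axis S 1) x)"
   unfolding linear_sum[OF Z_linear] linear_scale[OF Z_linear] ..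
  also have "norm ... <= (\<Sum>S\<in>(UNIV::'n set set). norm u * b)"
  proof (rule order_trans[OF norm_sum sum_mono])
   fix S
   show "norm (u $ S *R Z (axis S 1) x) <= norm u * b"
    using b(2)[OF x, of S] component_le_norm_cart[of u S] by (simp add: mult_mono)
  qed
  finally show "norm (Z u x) <= real CARD('n set) * b * norm u" by (simp add: mult_ac)
 qed
qed

text \<open>Uniform ellipticity: a minimum over the compact set of all t, points of the box and unit
  vectors, positive by the homotopy clause of \<open>frame_on\<close>.\<close>

lemma Fr_lower: obtains m where "m > 0"
 "!!t x xi. 0 <= t ==> t <= 1 ==> x : Q ==> m * (SUM a. (xi a)\<^sup>2) <= (SUM i. (SUM a. Fr t i a x * xi a)\<^sup>2)"
proof -
 let ?S = "{0..1::real} \<times> (Q \<times> sphere (0::real^'n) 1)"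
 define f where "f p = (SUM i. (SUM a. Fr (fst p) i a (fst (snd p)) * (snd (snd p) :: real^'n) $ a)\<^sup>2)" for p
 have cE: "continuous_on ?S (%p. E i a (fst (snd p)))" for i a
  by (rule continuous_on_compose2[OF smooth_fun_continuous[OF E_smooth]]) (auto intro!: continuous_intros)
 have c: "continuous_on ?S f" unfolding f_def Fr_def by (intro continuous_intros cE)
 have "(0 :: real^'n) : Q" using L by (simp add: mem_box_cart lo_def hi_def)
 moreover have "axis e 1 : sphere (0::real^'n) 1" by simp
 ultimately have ne: "?S ~= {}" by fastforce
 have "compact ?S" by (intro compact_Times compact_cbox compact_sphere compact_Icc)
 then obtain p where p: "p : ?S" "!!r. r : ?S ==> f p <= f r" using continuous_attains_inf[OF _ ne c] by blast
 obtain t x v where txv: "p = (t, x, v)" by (metis prod.collapse)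
 have "f p > 0"
 proof (rule ccontr)
  assume "\<not> f p > 0"
  then have "f p = 0" unfolding f_def by (meson not_less order_antisym sum_nonneg zero_le_power2)
  then have "(SUM a. Fr t i a x * v $ a) = 0" for i
   unfolding f_def txv by (subst (asm) sum_nonneg_eq_0_iff) auto
  moreover have "(SUM a. Fr t i a x * v $ a) = (1 - t) * v $ i + t * (SUM a. E i a x * v $ a)" for i
  proof -
   have "Fr t i a x * v $ a = (if i = a then 1 else 0) * ((1 - t) * v $ a) + t * (E i a x * v $ a)" for a
    by (simp add: Fr_def algebra_simps)
   then show ?thesis by (simp only: sum.distrib sum_delta_left sum_distrib_left)
  qed
  ultimately have "\<forall>i\<in>UNIV. (1 - t) * v $ i + t * (SUM a. E i a x * v $ a) = 0" by simp
  moreover have "t : {0..1}" using p(1) txv by simp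
  ultimately have "\<forall>a\<in>UNIV. v $ a = 0" using frame unfolding frame_on_def by blast
  then have "v = 0" by (simp add: vec_eq_iff)
  then show False using p(1) txv by simp
 qed
 then show ?thesis
 proof (rule that)
  fix t :: real and x and xi :: "'n => real" assume tx: "0 <= t" "t <= 1" "x : Q"
  define w :: "real^'n" where "w = (\<chi> a. xi a)"
  have w2: "(SUM a. (xi a)\<^sup>2) = (norm w)\<^sup>2"
   unfolding power2_norm_eq_inner by (simp add: w_def inner_vec_def power2_eq_square)
  show "f p * (SUM a. (xi a)\<^sup>2) <= (SUM i. (SUM a. Fr t i a x * xi a)\<^sup>2)"
  proof (cases "w = 0")
   case False
   have "f p <= f (t, x, w /\<^sub>R norm w)" using tx False by (intro p(2)) auto
   also have "... = (SUM i. (SUM a. Fr t i a x * xi a)\<^sup>2) / (norm w)\<^sup>2"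
   proof -
    have "(SUM a. Fr t i a x * (w /\<^sub>R norm w) $ a) = inverse (norm w) * (SUM a. Fr t i a x * xi a)" for i
     unfolding sum_distrib_left by (intro sum.cong refl) (simp add: w_def)
    then show ?thesis unfolding f_def fst_conv snd_conv
     by (simp add: power_mult_distrib divide_inverse power_inverse mult.commute flip: sum_distrib_left)
   qed
   finally show ?thesis unfolding w2 using False by (simp add: pos_le_divide_eq)
  qed (simp add: w2 sum_nonneg)
 qed
qed

lemma Fr_bound: obtains C0 where "C0 > 0" "!!x i a. x : Q ==> \<bar>E i a x\<bar> <= C0"
 "!!t x i a. 0 <= t ==> t <= 1 ==> x : Q ==> \<bar>Fr t i a x\<bar> <= C0"
 "!!t x i a c. 0 <= t ==> t <= 1 ==> x : Q ==> \<bar>pd c (Fr t i a) x\<bar> <= C0"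
proof -
 obtain B where B: "B > 0" "!!p x. x : Q ==> \<bar>(%(i, a) x. E i a x) p x\<bar> <= B"
  by (rule finite_bound[of Q "%(i, a) x. E i a x"]) (auto intro: smooth_fun_continuous E_smooth)
 obtain D where D: "D > 0" "!!p x. x : Q ==> \<bar>(%(i, a, c) x. pd c (E i a) x) p x\<bar> <= D"
  by (rule finite_bound[of Q "%(i, a, c) x. pd c (E i a) x"]) (auto intro: smooth_fun_continuous smooth_fun_pd E_smooth)
 have B': "\<bar>E i a x\<bar> <= B" if "x : Q" for x i a using B(2)[OF that, of "(i, a)"] by simp
 have D': "\<bar>pd c (E i a) x\<bar> <= D" if "x : Q" for x i a c using D(2)[OF that, of "(i, a, c)"] by simp
 show ?thesis
 proof (rule that[of "1 + B + D"])
  show "1 + B + D > 0" using B D by simp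
  show "\<bar>E i a x\<bar> <= 1 + B + D" if "x : Q" for x i a using B'[OF that, of i a] D by simp
  fix t :: real and x i a assume t: "0 <= t" "t <= 1" and x: "x : Q"
  have "\<bar>Fr t i a x\<bar> <= \<bar>(1 - t) * (if i = a then 1 else 0)\<bar> + \<bar>t * E i a x\<bar>" unfolding Fr_def by (rule abs_triangle_ineq)
  also have "\<bar>t * E i a x\<bar> <= 1 * B" unfolding abs_mult using t B'[OF x, of i a] by (intro mult_mono) auto
  finally show "\<bar>Fr t i a x\<bar> <= 1 + B + D" using t D by (auto split: if_splits)
  fix c
  have "has_pd c (Fr t i a) (0 + t * pd c (E i a) x) x"
   unfolding Fr_def[abs_def] by (intro has_pd_add has_pd_const has_pd_cmult smooth_fun_has_pd E_smooth)
  then have "\<bar>pd c (Fr t i a) x\<bar> = \<bar>t\<bar> * \<bar>pd c (E i a) x\<bar>" by (simp add: has_pd_imp_pd abs_mult)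
  also have "... <= 1 * D" using t D'[OF x, of c i a] by (intro mult_mono) auto
  finally show "\<bar>pd c (Fr t i a) x\<bar> <= 1 + B + D" using B by simp
 qed
qed

lemma Fr_K: assumes t: "0 <= t" "t <= 1" and x: "x : Q" shows "sqrt (SUM i. (Fr t i j x)\<^sup>2) <= K"
proof -
 have "sqrt (SUM i. (Fr t i j x)\<^sup>2) <= L2_set (%i. (1 - t) * (if i = j then 1 else 0)) UNIV + L2_set (%i. t * E i j x) UNIV"
  using L2_set_triangle_ineq[of "%i. (1 - t) * (if i = j then 1 else 0)" "%i. t * E i j x" UNIV] by (simp add: L2_set_def Fr_def)
 also have "L2_set (%i. (1 - t) * (if i = j then 1 else 0)) UNIV = 1 - t"
 proof -
  have "((1 - t) * (if i = j then 1 else 0))\<^sup>2 = (if i = j then 1 else 0) * (1 - t)\<^sup>2" for i by simp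
  then show ?thesis unfolding L2_set_def sum_delta_left using t by (simp add: sum_delta_left)
 qed
 also have "L2_set (%i. t * E i j x) UNIV = t * sqrt (G j j x)"
 proof -
  have "(SUM i. (t * E i j x)\<^sup>2) = t\<^sup>2 * G j j x"
   unfolding E_E[symmetric] by (simp add: sum_distrib_left power2_eq_square mult_ac)
  then show ?thesis unfolding L2_set_def using t by (simp add: real_sqrt_mult)
 qed
 also have "(1 - t) + t * sqrt (G j j x) <= (1 - t) * K + t * K"
  using t K(1) K(2)[OF x, of j] mult_left_mono[of 1 K "1 - t"] mult_left_mono[of "sqrt (G j j x)" K t] by simp
 finally show ?thesis by (simp add: algebra_simps)
qed

definition Iu where "Iu psi = integral Q (%x. psi x \<bullet> psi x)"
definition NX where "NX psi = sqrt (integral Q (grad_sq psi) + integral Q (tn_sq psi) + Iu psi)"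

lemma N_sq: "continuous_on Q y ==> (N y)\<^sup>2 = integral Q (%x. y x \<bullet> y x)"
 unfolding N_def by (intro real_sqrt_pow2 integral_nonneg int_cont continuous_intros) auto

lemma cont_T0: "psi : X ==> continuous_on Q (T0 psi)"
 unfolding T0_def[abs_def] by (intro smooth_map_continuous smooth_map_add smooth_map_sum smooth_map_cl smooth_map_pv X_smooth Th_smooth)

lemma cont_T1: "psi : X ==> continuous_on Q (T1 psi)"
 unfolding Bop_def[abs_def] Th_def[symmetric]
 by (intro continuous_on_add continuous_on_scaleR continuous_on_diff continuous_on_mult continuous_on_divide continuous_on_const
   smooth_map_continuous smooth_Dirac Th_smooth X_smooth h_cont smooth_fun_continuous tau_smooth smooth_sig) auto

lemma cont_Iu: "psi : X ==> continuous_on Q (%x. psi x \<bullet> psi x)"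
 by (intro smooth_fun_continuous smooth_inner X_smooth)

lemma I_nonneg: assumes "psi : X" shows "Iu psi >= 0" "integral Q (grad_sq psi) >= 0" "integral Q (tn_sq psi) >= 0"
 unfolding Iu_def using assms
 by (intro integral_nonneg int_cont cont_Iu smooth_fun_continuous grad_sq_smooth tn_sq_smooth X_smooth;
   auto simp: grad_sq_def tn_sq_def intro!: sum_nonneg mult_nonneg_nonneg)+

lemma NX_sq: "psi : X ==> (NX psi)\<^sup>2 = integral Q (grad_sq psi) + integral Q (tn_sq psi) + Iu psi"
 unfolding NX_def using I_nonneg[of psi] by simp

lemma norm_sq_diff_le: "(u - w) \<bullet> (u - w) <= 2 * (u \<bullet> u) + 2 * (w \<bullet> w)" for u w :: "'z::real_inner"
 using inner_ge_zero[of "u + w"] by (simp add: inner_diff_left inner_diff_right inner_add_left inner_add_right inner_commute)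

lemma fredholm: obtains m M where "m > 0" "M > 0"
 "!!t psi. 0 <= t ==> t <= 1 ==> psi : X ==> m / 2 * integral Q (grad_sq psi) + 1/4 * integral Q (tn_sq psi)
  <= 2 * (N ((1 - t) *R T0 psi + t *R T1 psi))\<^sup>2 + M * Iu psi"
proof -
 obtain m where m: "m > 0" "!!t x xi. 0 <= t ==> t <= 1 ==> x : Q ==> m * (SUM a. (xi a)\<^sup>2) <= (SUM i. (SUM a. Fr t i a x * xi a)\<^sup>2)"
  by (rule Fr_lower) blast
 obtain C0 where C0: "C0 > 0" "!!x i a. x : Q ==> \<bar>E i a x\<bar> <= C0"
  "!!t x i a. 0 <= t ==> t <= 1 ==> x : Q ==> \<bar>Fr t i a x\<bar> <= C0"
  "!!t x i a c. 0 <= t ==> t <= 1 ==> x : Q ==> \<bar>pd c (Fr t i a) x\<bar> <= C0" by (rule Fr_bound) blast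
 obtain B where B: "B > 0" "!!x u. x : Q ==> norm (Z u x) <= B * norm u" by (rule Z_bound) blast
 define gc where "gc = garding_const m C0 K"
 show ?thesis
 proof (rule that[OF m(1), of "\<bar>gc\<bar> + 2 * B\<^sup>2 + 1"])
  show "\<bar>gc\<bar> + 2 * B\<^sup>2 + 1 > 0" by (simp add: add_nonneg_pos)
  fix t :: real and psi assume t: "0 <= t" "t <= 1" and psi: "psi : X"
  define Tt where "Tt = (1 - t) *R T0 psi + t *R T1 psi"
  have Tt: "Tt x = Fop (Fr t) psi x + Th psi x + t *R Z (psi x) x" for x
   unfolding Tt_eq[symmetric] by (simp add: Tt_def plus_fun_def scaleR_fun_def)
  have cT: "continuous_on Q Tt" unfolding Tt_def plus_fun_def scaleR_fun_def by (intro continuous_intros cont_T0 cont_T1 psi)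
  have "m / 2 * integral Q (grad_sq psi) + 1/4 * integral Q (tn_sq psi) - gc * Iu psi
   <= integral Q (%x. (Fop (Fr t) psi x + Th psi x) \<bullet> (Fop (Fr t) psi x + Th psi x))"
   unfolding gc_def Iu_def
   by (rule garding[OF psi Fr_smooth _ m(1) m(2)[OF t] C0(3)[OF t] C0(4)[OF t] Fr_K[OF t] K(3)]) (auto simp: Fr_def E_e)
  also have "... <= integral Q (%x. 2 * (Tt x \<bullet> Tt x) + 2 * B\<^sup>2 * (psi x \<bullet> psi x))"
  proof (rule integral_le)
   show "(%x. (Fop (Fr t) psi x + Th psi x) \<bullet> (Fop (Fr t) psi x + Th psi x)) integrable_on Q"
    using X_smooth[OF psi] by (intro int_cont smooth_fun_continuous smooth_inner smooth_map_add Fop_smooth Th_smooth psi Fr_smooth)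
   show "(%x. 2 * (Tt x \<bullet> Tt x) + 2 * B\<^sup>2 * (psi x \<bullet> psi x)) integrable_on Q"
    by (intro int_cont continuous_on_add continuous_on_mult continuous_on_const continuous_on_inner cT cont_Iu psi)
   fix x assume x: "x : Q"
   have "norm (t *R Z (psi x) x) <= 1 * (B * norm (psi x))"
    unfolding norm_scaleR using t B(2)[OF x, of "psi x"] by (intro mult_mono) auto
   then have "(norm (t *R Z (psi x) x))\<^sup>2 <= (B * norm (psi x))\<^sup>2" by (intro power_mono) auto
   then have "(t *R Z (psi x) x) \<bullet> (t *R Z (psi x) x) <= B\<^sup>2 * (psi x \<bullet> psi x)"
    unfolding power_mult_distrib power2_norm_eq_inner .
   moreover have eq: "Fop (Fr t) psi x + Th psi x = Tt x - t *R Z (psi x) x" by (simp add: Tt)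
   ultimately show "(Fop (Fr t) psi x + Th psi x) \<bullet> (Fop (Fr t) psi x + Th psi x) <= 2 * (Tt x \<bullet> Tt x) + 2 * B\<^sup>2 * (psi x \<bullet> psi x)"
    unfolding eq using norm_sq_diff_le[of "Tt x" "t *R Z (psi x) x"] by linarith
  qed
  also have "... = 2 * (N Tt)\<^sup>2 + 2 * B\<^sup>2 * Iu psi"
   unfolding N_sq[OF cT] Iu_def
   by (intro integral_unique has_integral_add has_integral_mult_right integrable_integral int_cont continuous_on_inner cT cont_Iu psi)
  finally have "m / 2 * integral Q (grad_sq psi) + 1/4 * integral Q (tn_sq psi) <= 2 * (N Tt)\<^sup>2 + (gc + 2 * B\<^sup>2) * Iu psi"
   by (simp add: algebra_simps)
  also have "(gc + 2 * B\<^sup>2) * Iu psi <= (\<bar>gc\<bar> + 2 * B\<^sup>2 + 1) * Iu psi" using I_nonneg[OF psi] by (intro mult_right_mono) auto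
  finally show "m / 2 * integral Q (grad_sq psi) + 1/4 * integral Q (tn_sq psi)
   <= 2 * (N ((1 - t) *R T0 psi + t *R T1 psi))\<^sup>2 + (\<bar>gc\<bar> + 2 * B\<^sup>2 + 1) * Iu psi" unfolding Tt_def[symmetric] by simp
 qed
qed

subsection \<open>The mass gap\<close>

text \<open>The whole boundary density: the Witten flux contributes the null expansion, the
  potential contributes - h with the same positive weight, and the tangent potentials vanish. Its
  sign is that of the null expansion minus h.\<close>

lemma chi_sig_flux:
 assumes psi: "psi : X" and x: "x $ e : {-1, 1}"
 shows "q * flux psi e x - q/2 * (vol x * (h x * (psi x \<bullet> A e x (sig (psi x))))) - (\<Sum>j\<in>UNIV - {e}. vol x * (tn j x * (psi x \<bullet> A e x (ch j (psi x)))))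
  = q/2 * (vol x * (E e e x * (psi x \<bullet> psi x))) * (null_exp g k e x - h x)"
proof -
 note chi = X_chi[OF psi x]
 have "(\<Sum>j\<in>UNIV - {e}. vol x * (tn j x * (psi x \<bullet> A e x (ch j (psi x))))) = 0"
  by (intro sum.neutral ballI) (simp add: A_e chi_cl_ch[OF chi])
 moreover have fb: "flux psi e x = vol x * (1/2 * E e e x * null_exp g k e x * (psi x \<bullet> psi x))"
  by (rule flux_boundary[where psi=psi and x=x, OF chi]) (rule X_chi_pv[OF psi x])
 ultimately show ?thesis unfolding fb chi_A_sig[OF chi]
  by (simp add: algebra_simps)
qed

text \<open>With the square root bounded by K, each term is at least (1 - K/lam) tn^2 - lam K dl^2,
  and the first part is nonnegative.\<close>

lemma tn_weight:
 assumes x: "x : Q" shows "(\<Sum>j\<in>UNIV - {e}. (tn j x)\<^sup>2 - tn' j x * sqrt (G j j x)) >= - (gam / 2)"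
proof -
 have "(tn j x)\<^sup>2 - tn' j x * sqrt (G j j x) >= - (real lam * K * (dl j)\<^sup>2)" for j
 proof -
  have l: "real lam > 0" using lam by simp
  have "tn' j x * sqrt (G j j x) <= tn' j x * K" using K(2)[OF x, of j] tn'_nonneg by (intro mult_left_mono) auto
  also have "... = real lam * K * (dl j)\<^sup>2 + (K / real lam) * (tn j x)\<^sup>2" by (simp add: tn'_def algebra_simps)
  also have "(K / real lam) * (tn j x)\<^sup>2 <= 1 * (tn j x)\<^sup>2" using l K by (intro mult_right_mono) (auto simp: divide_le_eq)
  finally show ?thesis by simp
 qed
 then have "(\<Sum>j\<in>UNIV - {e}. (tn j x)\<^sup>2 - tn' j x * sqrt (G j j x)) >= (\<Sum>j\<in>UNIV - {e}. - (real lam * K * (dl j)\<^sup>2))" by (intro sum_mono)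
 then show ?thesis using small by (simp add: sum_negf)
qed

text \<open>Integrate \<open>Bop_lower\<close>: the divergences have nonnegative integral by the
  boundary conditions, and the potential is at least gam - gam/2. The bounds \<open>v0\<close> and
  \<open>v1\<close> compare the Riemannian density with Lebesgue measure, in which the seminorm is
  taken.\<close>

lemma mass_gap: obtains c where "c > 0" "!!psi. psi : X ==> Iu psi <= c * (N (T1 psi))\<^sup>2"
proof -
 obtain v1 where v1: "v1 > 0" "!!p x. x : Q ==> \<bar>(%_::unit. vol) p x\<bar> <= v1"
  by (rule finite_bound[of Q "%_::unit. vol"]) (auto intro: smooth_fun_continuous vol_smooth)
 obtain v0 where v0: "v0 > 0" "!!p x. x : Q ==> \<bar>(%(_::unit) x. inverse (vol x)) p x\<bar> <= v0"
  by (rule finite_bound[of Q "%(_::unit) x. inverse (vol x)"])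
   (use vol_pos in \<open>auto intro!: smooth_fun_continuous smooth_inverse vol_smooth simp: less_imp_neq[symmetric]\<close>)
 have vb: "vol x <= v1" "1 / v0 <= vol x" if "x : Q" for x
 proof -
  show "vol x <= v1" using v1(2)[OF that] vol_pos[of x] by simp
  have "inverse (vol x) <= v0" using v0(2)[OF that] vol_pos[of x] by simp
  then show "1 / v0 <= vol x" using vol_pos[of x] v0(1) by (simp add: field_simps)
 qed
 show ?thesis
 proof (rule that[of "v1 * v0 * 2 / gam"])
  show "v1 * v0 * 2 / gam > 0" using v0 v1 gam by simp
  fix psi assume psi: "psi : X"
  note sm = X_smooth[OF psi]
  define w2 where "w2 a x = vol x * (psi x \<bullet> A a x (sig (psi x)))" for a x
  define Hf where "Hf a x = vol x * (h x * (psi x \<bullet> A a x (sig (psi x))))" for a x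
  define Hd where "Hd a x = h' a x * w2 a x + h x * pd a (w2 a) x" for a x
  define w3 where "w3 j a x = vol x * (tn j x * (psi x \<bullet> A a x (ch j (psi x))))" for j a x
  have s2: "smooth_fun (w2 a)" for a
   unfolding w2_def[abs_def] by (intro smooth_mult vol_smooth smooth_inner sm smooth_A smooth_sig)
  have Hpd: "has_pd a (Hf a) (Hd a x) x" for a x
  proof -
   have "has_pd a (%x. h x * w2 a x) (Hd a x) x" unfolding Hd_def by (intro has_pd_mult h smooth_fun_has_pd s2)
   moreover have "(%x. h x * w2 a x) = Hf a" by (simp add: fun_eq_iff w2_def Hf_def)
   ultimately show ?thesis by simp
  qed
  have s3: "smooth_fun (w3 j a)" if "j ~= e" for j a
  proof -
   have "w3 j a = (%x. vol x * ((tn j x *R psi x) \<bullet> A a x (ch j (psi x))))" by (simp add: fun_eq_iff w3_def)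
   moreover have "smooth_fun ..." by (intro smooth_mult vol_smooth smooth_inner tn_smooth[OF psi that] smooth_A smooth_map_ch sm)
   ultimately show ?thesis by simp
  qed
  define Y where "Y a x = q * flux psi a x - q/2 * Hf a x - (\<Sum>j\<in>UNIV - {e}. w3 j a x)" for a x
  define Y' where "Y' a x = q * pd a (flux psi a) x - q/2 * Hd a x - (\<Sum>j\<in>UNIV - {e}. pd a (w3 j a) x)" for a x
  have cHd: "continuous_on S (Hd a)" for S a
   unfolding Hd_def by (intro continuous_on_add continuous_on_mult continuous_on_subset[OF h(2)] h_cont smooth_fun_continuous s2 smooth_fun_pd) auto
  have cY': "continuous_on S (Y' a)" for S a
   unfolding Y'_def by (intro continuous_on_diff continuous_on_mult continuous_on_const continuous_on_sum cHd smooth_fun_continuous smooth_fun_pd flux_smooth sm s3) auto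
  have div: "integral Q (%x. SUM a. Y' a x) >= 0"
  proof (rule divergence_sign)
   show "has_pd a (Y a) (Y' a x) x" for a x
    unfolding Y_def Y'_def by (intro has_pd_diff has_pd_cmult has_pd_sum smooth_fun_has_pd Hpd flux_smooth sm s3) auto
   show "continuous_on UNIV (Y a)" for a
    unfolding Y_def Hf_def w2_def[symmetric]
    by (intro continuous_on_diff continuous_on_mult continuous_on_const continuous_on_sum h_cont smooth_fun_continuous flux_smooth sm s3
      vol_smooth smooth_inner smooth_A smooth_sig) auto
   show "continuous_on UNIV (Y' a)" for a by (rule cY')
   show "Y a x = 0" if "a ~= e" "cos (dl a * x $ a) = 0" for a x
    using X_face[OF psi that] by (simp add: Y_def flux_def Hf_def w3_def)
   have Ye: "Y e x = q/2 * (vol x * (E e e x * (psi x \<bullet> psi x))) * (null_exp g k e x - h x)" if "x $ e : {-1, 1}" for x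
    unfolding Y_def Hf_def w3_def by (rule chi_sig_flux[OF psi that])
   have pos: "q/2 * (vol x * (E e e x * (psi x \<bullet> psi x))) >= 0" for x
    using n2 vol_pos[of x] E_ee_pos[of x] by (intro mult_nonneg_nonneg) (auto simp: q)
   show "Y e x >= 0" if "x $ e = 1" for x
   proof -
    have m: "x $ e : {-1, 1}" using that by simp
    show ?thesis unfolding Ye[OF m] using top[OF that] by (intro mult_nonneg_nonneg pos) simp
   qed
   show "Y e x <= 0" if "x $ e = -1" for x
   proof -
    have m: "x $ e : {-1, 1}" using that by simp
    show ?thesis unfolding Ye[OF m] using bot[OF that] by (intro mult_nonneg_nonpos pos) simp
   qed
  qed
  have pt: "gam / 2 / v0 * (psi x \<bullet> psi x) + (SUM a. Y' a x) <= v1 * (T1 psi x \<bullet> T1 psi x)" if xb: "x : box lo hi" for x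
  proof -
   have x: "x : Q" using xb box_subset_cbox by blast
   obtain d2 d3 where d2: "!!a. has_pd a (%x. vol x * (h x * (psi x \<bullet> A a x (sig (psi x))))) (d2 a) x"
    and d3: "!!j a. j ~= e ==> has_pd a (%x. vol x * (tn j x * (psi x \<bullet> A a x (ch j (psi x))))) (d3 j a) x"
    and low: "vol x * (T1 psi x \<bullet> T1 psi x) \<ge>
     vol x * ((q/2 * ((mu g k x - normJ g k x) + q/2 * (h x)\<^sup>2 - h x * tau x - sqrt (SUM a. SUM b. G a b x * h' a x * h' b x))
       + (\<Sum>j\<in>UNIV - {e}. (tn j x)\<^sup>2 - tn' j x * sqrt (G j j x))) * (psi x \<bullet> psi x))
     + q * (SUM a. pd a (flux psi a) x) - q/2 * (SUM a. d2 a) - (\<Sum>j\<in>UNIV - {e}. SUM a. d3 j a)"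
    by (rule Bop_lower[where psi=psi and q=q and h=h and dh="%a. h' a x" and x=x and p=tn and p'="%j. tn' j x", OF sm n2 q h(1) has_pd_tn[OF xb] tn'_nonneg]) blast
   have "d2 a = Hd a x" for a using has_pd_imp_pd[OF d2[of a]] has_pd_imp_pd[OF Hpd[of a x, unfolded Hf_def[abs_def]]] by simp
   moreover have "d3 j a = pd a (w3 j a) x" if "j ~= e" for j a using has_pd_imp_pd[OF d3[OF that]] unfolding w3_def[abs_def] by simp
   ultimately have "q * (SUM a. pd a (flux psi a) x) - q/2 * (SUM a. d2 a) - (\<Sum>j\<in>UNIV - {e}. SUM a. d3 j a)
    = (SUM a. q * pd a (flux psi a) x) - (SUM a. q/2 * Hd a x) - (SUM a. \<Sum>j\<in>UNIV - {e}. pd a (w3 j a) x)"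
    by (subst (2) sum.swap) (simp add: sum_distrib_left)
   also have "... = (SUM a. Y' a x)" unfolding Y'_def by (simp add: sum_subtractf)
   finally have S: "q * (SUM a. pd a (flux psi a) x) - q/2 * (SUM a. d2 a) - (\<Sum>j\<in>UNIV - {e}. SUM a. d3 j a) = (SUM a. Y' a x)" .
   define b1 where "b1 = q/2 * ((mu g k x - normJ g k x) + q/2 * (h x)\<^sup>2 - h x * tau x - sqrt (SUM a. SUM b. G a b x * h' a x * h' b x))"
   define b2 where "b2 = (\<Sum>j\<in>UNIV - {e}. (tn j x)\<^sup>2 - tn' j x * sqrt (G j j x))"
   have "gam / 2 <= b1 + b2" using gam(2)[OF x] tn_weight[OF x] unfolding b1_def b2_def by linarith
   then have gg: "gam / 2 * (psi x \<bullet> psi x) <= (b1 + b2) * (psi x \<bullet> psi x)" by (intro mult_right_mono) auto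
   have "1 / v0 * (gam / 2 * (psi x \<bullet> psi x)) <= vol x * ((b1 + b2) * (psi x \<bullet> psi x))"
    by (rule mult_mono) (use gg vb(2)[OF x] vol_pos[of x] gam(1) in auto)
   moreover have "vol x * (T1 psi x \<bullet> T1 psi x) >= vol x * ((b1 + b2) * (psi x \<bullet> psi x)) + (SUM a. Y' a x)"
    using low S unfolding b1_def[symmetric] b2_def[symmetric] by linarith
   moreover have "vol x * (T1 psi x \<bullet> T1 psi x) <= v1 * (T1 psi x \<bullet> T1 psi x)" using vb(1)[OF x] by (intro mult_right_mono) auto
   ultimately show ?thesis by simp
  qed
  have cy: "continuous_on Q (%x. SUM a. Y' a x)" by (intro continuous_on_sum cY')
  have c1: "continuous_on Q (%x. T1 psi x \<bullet> T1 psi x)" by (intro continuous_on_inner cont_T1 psi)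
  have "gam / 2 / v0 * Iu psi + integral Q (%x. SUM a. Y' a x) = integral Q (%x. gam / 2 / v0 * (psi x \<bullet> psi x) + (SUM a. Y' a x))"
   unfolding Iu_def by (intro integral_unique[symmetric] has_integral_add has_integral_mult_right integrable_integral int_cont cont_Iu psi cy)
  also have "... <= integral Q (%x. v1 * (T1 psi x \<bullet> T1 psi x))"
   by (intro integral_le_interior pt continuous_on_add continuous_on_mult continuous_on_const cont_Iu psi cy c1)
  also have "... = v1 * (N (T1 psi))\<^sup>2" unfolding N_sq[OF cont_T1[OF psi]] by simp
  finally have "gam / 2 / v0 * Iu psi <= v1 * (N (T1 psi))\<^sup>2" using div by linarith
  then show "Iu psi <= v1 * v0 * 2 / gam * (N (T1 psi))\<^sup>2" using v0(1) gam(1) by (simp add: field_simps)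
 qed
qed

subsection \<open>The contradiction\<close>

lemma parity_pv: "(!!x. parity p (psi x)) ==> parity p (pv a psi x)"
 unfolding parity_def pv_def by simp

lemma into_C: assumes psi: "psi : X" shows "T0 psi : C" "T1 psi : C"
proof -
 have p: "parity True (psi x)" for x using psi unfolding X_def by simp
 have f: "parity True u ==> parity False (cl i u)" "parity True u ==> parity False (ch i u)" for u and i :: 'n
  using parity_cl[of True u i] parity_ch[of True u i] by simp_all
 have f': "parity False u ==> parity True (cl i u)" for u and i :: 'n using parity_cl[of False u i] by simp
 have Th: "parity False (Th psi x)" for x unfolding Th_def by (intro parity_sum parity_scale f p)
 have "parity False (T0 psi x)" for x unfolding T0_def by (intro parity_add parity_sum f(1) Th parity_pv p)
 then show "T0 psi : C" unfolding C_def using cont_T0[OF psi] by simp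
 have b: "parity True (nab a psi x)" for a x
  unfolding nab_def bil_def by (intro parity_add parity_pv parity_scale parity_sum f' f(1) p)
 have sg: "parity False (sig (psi x))" for x using f(2)[OF p[of x], of e] by (simp add: sig_def parity_def)
 have "parity False (T1 psi x)" for x
  unfolding Bop_def Dirac_def A_def Th_def[symmetric] by (intro parity_add parity_sum parity_scale f(1) b sg Th)
 then show "T1 psi : C" unfolding C_def using cont_T1[OF psi] by simp
qed

lemma T1_lin: "lin_on X T1"
proof -
 have F: "Fop E (psi + phi) x = Fop E psi x + Fop E phi x" if "psi : X" "phi : X" for psi phi x
  using that by (simp add: Fop_def pv_fun X_smooth scaleR_add_right sum.distrib cl_simps)
 have Fc: "Fop E (c *R psi) x = c *R Fop E psi x" if "psi : X" for psi c x
 proof -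
  have eq: "(SUM a. E i a x *R pv a (c *R psi) x) = c *R (SUM a. E i a x *R pv a psi x)" for i
   unfolding scaleR_sum_right pv_fun(2)[OF X_smooth[OF that]] by (intro sum.cong refl scaleR_left_commute)
  show ?thesis unfolding Fop_def eq by (simp only: cl_simps(2) scaleR_sum_right[symmetric])
 qed
 show ?thesis unfolding lin_on_def fun_eq_iff
 proof (intro conjI ballI allI)
  fix psi phi x assume psi: "psi : X" and phi: "phi : X"
  show "T1 (psi + phi) x = (T1 psi + T1 phi) x"
   unfolding plus_fun_def[of "T1 psi"] T1_eq F[OF psi phi] Th_lin
   by (simp add: plus_fun_def linear_add[OF Z_linear])
 next
  fix psi x and c :: real assume psi: "psi : X"
  show "T1 (c *R psi) x = (c *R T1 psi) x"
   unfolding scaleR_fun_def[of c "T1 psi"] T1_eq Fc[OF psi] Th_lin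
   by (simp add: scaleR_fun_def linear_scale[OF Z_linear] scaleR_add_right)
 qed
qed

text \<open>The singular potentials \<open>Th\<close> are common to both operators and cancel,
  leaving a first-order operator with bounded coefficients.\<close>

lemma T1_T0_bound: obtains c where "c > 0" "!!psi. psi : X ==> N (T1 psi - T0 psi) <= c * NX psi"
proof -
 obtain C0 where C0: "C0 > 0" "!!x i a. x : Q ==> \<bar>E i a x\<bar> <= C0"
  "!!t x i a. 0 <= t ==> t <= 1 ==> x : Q ==> \<bar>Fr t i a x\<bar> <= C0"
  "!!t x i a c. 0 <= t ==> t <= 1 ==> x : Q ==> \<bar>pd c (Fr t i a) x\<bar> <= C0" by (rule Fr_bound) blast
 obtain B where B: "B > 0" "!!x u. x : Q ==> norm (Z u x) <= B * norm u" by (rule Z_bound) blast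
 define n where "n = real CARD('n)"
 define b where "b = n * C0 + 1"
 define c2 where "c2 = 2 * (b\<^sup>2 * n) + 2 * B\<^sup>2"
 have n: "n > 0" by (simp add: n_def)
 have c2: "c2 > 0" using B n C0 by (simp add: c2_def add_nonneg_pos)
 show ?thesis
 proof (rule that[of "sqrt c2"])
  show "sqrt c2 > 0" using c2 by simp
  fix psi assume psi: "psi : X"
  define R where "R = T1 psi - T0 psi"
  have cR: "continuous_on Q R"
   unfolding R_def fun_diff_def by (intro continuous_on_diff cont_T0 cont_T1 psi)
  have pt: "R x \<bullet> R x <= c2 * (grad_sq psi x + tn_sq psi x + psi x \<bullet> psi x)" if x: "x : Q" for x
  proof -
   define s where "s = (SUM a. norm (pv a psi x))"
   define P where "P = Fop E psi x - (SUM a. cl a (pv a psi x))"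
   have "norm (Fop E psi x) <= (\<Sum>i::'n\<in>UNIV. C0 * s)"
    unfolding Fop_def
   proof (rule order_trans[OF norm_sum sum_mono])
    fix i
    have "norm (cl i (SUM a. E i a x *R pv a psi x)) <= (SUM a. norm (E i a x *R pv a psi x))"
     unfolding norm_cl by (rule norm_sum)
    also have "... <= (SUM a. C0 * norm (pv a psi x))" using C0(2)[OF x] by (intro sum_mono) (simp add: mult_right_mono)
    finally show "norm (cl i (SUM a. E i a x *R pv a psi x)) <= C0 * s" by (simp add: s_def sum_distrib_left)
   qed
   moreover have "norm (SUM a. cl a (pv a psi x)) <= s" unfolding s_def by (rule order_trans[OF norm_sum]) simp
   moreover have "norm P <= norm (Fop E psi x) + norm (SUM a. cl a (pv a psi x))" unfolding P_def by (rule norm_triangle_ineq4)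
   moreover have "(\<Sum>i::'n\<in>UNIV. C0 * s) = n * (C0 * s)" by (simp add: n_def)
   ultimately have "norm P <= n * (C0 * s) + s" by linarith
   then have "norm P <= b * s" by (simp add: b_def algebra_simps)
   then have "(norm P)\<^sup>2 <= (b * s)\<^sup>2" by (intro power_mono) auto
   also have "(b * s)\<^sup>2 = b\<^sup>2 * s\<^sup>2" by (rule power_mult_distrib)
   also have "... <= b\<^sup>2 * (grad_sq psi x * n)"
    using sum_squared_le_sum_of_squares[of "%a. norm (pv a psi x)" UNIV]
    by (intro mult_left_mono) (simp_all add: s_def grad_sq_def n_def power2_norm_eq_inner)
   finally have P: "P \<bullet> P <= b\<^sup>2 * n * grad_sq psi x" by (simp add: power2_norm_eq_inner mult_ac)
   have "(norm (Z (psi x) x))\<^sup>2 <= (B * norm (psi x))\<^sup>2" using B(2)[OF x] by (intro power_mono) auto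
   then have Zb: "Z (psi x) x \<bullet> Z (psi x) x <= B\<^sup>2 * (psi x \<bullet> psi x)" unfolding power_mult_distrib power2_norm_eq_inner .
   have eq: "R x = P - (- Z (psi x) x)" by (simp add: R_def T1_eq T0_def P_def)
   have nn: "grad_sq psi x >= 0" "tn_sq psi x >= 0" by (auto simp: grad_sq_def tn_sq_def intro!: sum_nonneg mult_nonneg_nonneg)
   have "R x \<bullet> R x <= 2 * (b\<^sup>2 * n) * grad_sq psi x + 2 * B\<^sup>2 * (psi x \<bullet> psi x)"
    unfolding eq using norm_sq_diff_le[of P "- Z (psi x) x"] P Zb by simp
   also have "... <= c2 * grad_sq psi x + c2 * (psi x \<bullet> psi x)"
    using nn n by (intro add_mono mult_right_mono) (auto simp: c2_def)
   also have "... <= c2 * (grad_sq psi x + tn_sq psi x + psi x \<bullet> psi x)" using nn c2 by (simp add: algebra_simps)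
   finally show ?thesis .
  qed
  have cc: "continuous_on Q (grad_sq psi)" "continuous_on Q (tn_sq psi)"
   using grad_sq_smooth[OF X_smooth[OF psi]] tn_sq_smooth[OF psi] by (auto intro: smooth_fun_continuous)
  have "integral Q (%x. R x \<bullet> R x) <= integral Q (%x. c2 * (grad_sq psi x + tn_sq psi x + psi x \<bullet> psi x))"
   by (intro integral_le int_cont continuous_on_inner continuous_on_mult continuous_on_const continuous_on_add cR cc cont_Iu psi pt)
  also have "... = c2 * (NX psi)\<^sup>2"
   unfolding NX_sq[OF psi] Iu_def
   by (intro integral_unique has_integral_mult_right has_integral_add integrable_integral int_cont cc cont_Iu psi)
  finally have "N R <= sqrt (c2 * (NX psi)\<^sup>2)" unfolding N_def by (rule real_sqrt_le_mono)
  also have "... = sqrt c2 * NX psi" using I_nonneg[OF psi] by (simp add: real_sqrt_mult NX_def)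
  finally show "N (T1 psi - T0 psi) <= sqrt c2 * NX psi" unfolding R_def .
 qed
qed

text \<open>\<open>rellich\<close> applied to each component of the spinor; the functionals are the
  integrals of the components over the pieces.\<close>

lemma compactness:
 assumes eps: "eps > 0"
 obtains M :: nat and F and c where "c > 0" "!!j. lin_on X (F j)" "!!j psi. psi : X ==> \<bar>F j psi\<bar> <= c * NX psi"
  "!!psi. psi : X ==> Iu psi <= eps * integral Q (grad_sq psi) + c * (\<Sum>j<M. \<bar>F j psi\<bar>)\<^sup>2"
proof -
 obtain m :: nat and Kb :: "nat => (real^'n) set" and c where Kb: "c > 0" "!!i. \<exists>a b. Kb i = cbox a b" "!!i. Kb i \<subseteq> Q"
  "!!u u'. (!!i x. has_pd i u (u' i x) x) ==> continuous_on UNIV u ==> (!!i. continuous_on UNIV (u' i)) ==>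
   integral Q (%x. (u x)\<^sup>2) <= eps * integral Q (%x. SUM i. (u' i x)\<^sup>2) + c * (\<Sum>i<m. (integral (Kb i) u)\<^sup>2)"
  by (rule rellich[OF eps, of lo hi]) blast
 let ?P = "{..<m} \<times> (UNIV :: 'n set set)"
 have fP: "finite ?P" by simp
 \<comment> \<open>Enumerates the pairs of a piece and a component. Outside the range the value of b
   is arbitrary, but \<open>F j\<close> is still linear and bounded because every
   \<open>Kb i\<close> is a box inside \<open>Q\<close>.\<close>
 obtain b where b: "bij_betw b {..<card ?P} ?P" using ex_bij_betw_nat_finite[OF fP] by (metis atLeast0LessThan)
 define F where "F j psi = integral (Kb (fst (b j))) (%x. psi x $ snd (b j))" for j and psi :: "real^'n => real^('n set)"
 have sc: "smooth_fun (%x. psi x $ S)" if "psi : X" for psi S using X_smooth[OF that] by (rule smooth_map_component)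
 have ci: "(%x. psi x $ S) integrable_on Kb i" if "psi : X" for psi S i
  using Kb(2)[of i] sc[OF that, of S] by (auto intro!: integrable_continuous smooth_fun_continuous)
 define V where "V = measure lborel Q"
 have V: "V >= 0" by (simp add: V_def)
 show ?thesis
 proof (rule that[of "c + sqrt V" F "card ?P"])
  show "c + sqrt V > 0" using Kb(1) V by (simp add: add_pos_nonneg)
  show "lin_on X (F j)" for j
   unfolding lin_on_def F_def by (auto simp: plus_fun_def scaleR_fun_def ci integral_add)
  show "\<bar>F j psi\<bar> <= (c + sqrt V) * NX psi" if psi: "psi : X" for j psi
  proof -
   obtain l u where lu: "Kb (fst (b j)) = cbox l u" using Kb(2) by blast
   have sub: "cbox l u \<subseteq> Q" using Kb(3)[of "fst (b j)"] lu by simp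
   have cS: "continuous_on S (%x. psi x $ snd (b j))" for S by (rule smooth_fun_continuous[OF sc[OF psi]])
   have "(F j psi)\<^sup>2 <= measure lborel (cbox l u) * integral (cbox l u) (%x. (psi x $ snd (b j))\<^sup>2)"
    unfolding F_def lu by (rule integral_sq_le[OF cS])
   also have "... <= V * Iu psi"
   proof (intro mult_mono)
    show "measure lborel (cbox l u) <= V" unfolding V_def using sub by (intro measure_mono_fmeasurable) auto
    have "integral (cbox l u) (%x. (psi x $ snd (b j))\<^sup>2) <= integral Q (%x. (psi x $ snd (b j))\<^sup>2)"
     by (intro integral_subset_le[OF sub] integrable_continuous continuous_on_power cS) auto
    also have "... <= Iu psi" unfolding Iu_def
    proof (intro integral_le int_cont continuous_on_power cS cont_Iu psi)
     fix x
     have "\<bar>psi x $ snd (b j)\<bar> <= norm (psi x)" by (rule component_le_norm_cart)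
     then show "(psi x $ snd (b j))\<^sup>2 <= psi x \<bullet> psi x" using abs_le_square_iff[of "psi x $ snd (b j)" "norm (psi x)"] by (simp add: power2_norm_eq_inner)
    qed
    finally show "integral (cbox l u) (%x. (psi x $ snd (b j))\<^sup>2) <= Iu psi" .
   qed (use V in \<open>auto intro!: integral_nonneg integrable_continuous continuous_on_power cS\<close>)
   also have "... <= V * (NX psi)\<^sup>2" using I_nonneg[OF psi] V by (intro mult_left_mono) (auto simp: NX_sq[OF psi])
   finally have "sqrt ((F j psi)\<^sup>2) <= sqrt (V * (NX psi)\<^sup>2)" by (rule real_sqrt_le_mono)
   then have "\<bar>F j psi\<bar> <= sqrt V * NX psi" using I_nonneg[OF psi] by (simp add: real_sqrt_mult NX_def)
   also have "... <= (c + sqrt V) * NX psi" using Kb(1) I_nonneg[OF psi] by (intro mult_right_mono) (auto simp: NX_def)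
   finally show ?thesis .
  qed
  fix psi assume psi: "psi : X"
  have cS: "continuous_on S (%x. psi x $ T)" for S T by (rule smooth_fun_continuous[OF sc[OF psi]])
  have cp: "continuous_on S (%x. pv i psi x $ T)" for S T i
   by (rule smooth_fun_continuous[OF smooth_map_component[OF smooth_map_pv[OF X_smooth[OF psi]]]])
  have "Iu psi = (SUM S. integral Q (%x. (psi x $ S)\<^sup>2))"
  proof -
   have "Iu psi = integral Q (%x. SUM S. (psi x $ S)\<^sup>2)" by (simp add: Iu_def inner_vec_def power2_eq_square)
   then show ?thesis by (simp add: integral_sum int_cont continuous_on_power cS)
  qed
  also have "... <= (SUM S. eps * integral Q (%x. SUM i. (pv i psi x $ S)\<^sup>2) + c * (\<Sum>i<m. (integral (Kb i) (%x. psi x $ S))\<^sup>2))"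
  proof (rule sum_mono)
   fix S
   show "integral Q (%x. (psi x $ S)\<^sup>2) <= eps * integral Q (%x. SUM i. (pv i psi x $ S)\<^sup>2) + c * (\<Sum>i<m. (integral (Kb i) (%x. psi x $ S))\<^sup>2)"
    by (rule Kb(4)) (use smooth_fun_has_pd[OF sc[OF psi]] cS cp in \<open>auto simp: pv_def\<close>)
  qed
  also have "... = eps * integral Q (grad_sq psi) + c * (\<Sum>j<card ?P. (F j psi)\<^sup>2)"
  proof -
   have "(SUM S. integral Q (%x. SUM i. (pv i psi x $ S)\<^sup>2)) = integral Q (%x. SUM S. SUM i. (pv i psi x $ S)\<^sup>2)"
    by (rule integral_sum[symmetric]) (auto intro!: int_cont continuous_on_sum continuous_on_power cp)
   also have "(%x. SUM S. SUM i. (pv i psi x $ S)\<^sup>2) = grad_sq psi"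
    by (rule ext, subst sum.swap) (simp add: grad_sq_def inner_vec_def power2_eq_square)
   finally have 1: "(SUM S. integral Q (%x. SUM i. (pv i psi x $ S)\<^sup>2)) = integral Q (grad_sq psi)" .
   have "(\<Sum>j<card ?P. (F j psi)\<^sup>2) = (\<Sum>p\<in>?P. (integral (Kb (fst p)) (%x. psi x $ snd p))\<^sup>2)"
    unfolding F_def by (rule sum.reindex_bij_betw[OF b])
   also have "... = (\<Sum>i<m. SUM S. (integral (Kb i) (%x. psi x $ S))\<^sup>2)"
    unfolding sum.cartesian_product by (simp add: split_beta)
   also have "... = (SUM S. \<Sum>i<m. (integral (Kb i) (%x. psi x $ S))\<^sup>2)" by (rule sum.swap)
   finally have 2: "(SUM S. \<Sum>i<m. (integral (Kb i) (%x. psi x $ S))\<^sup>2) = (\<Sum>j<card ?P. (F j psi)\<^sup>2)" ..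
   show ?thesis unfolding sum.distrib sum_distrib_left[symmetric] 1 2 ..
  qed
  also have "c * (\<Sum>j<card ?P. (F j psi)\<^sup>2) <= (c + sqrt V) * (\<Sum>j<card ?P. \<bar>F j psi\<bar>)\<^sup>2"
  proof (intro mult_mono)
   have "(\<Sum>j<card ?P. (F j psi)\<^sup>2) = (L2_set (%j. F j psi) {..<card ?P})\<^sup>2" unfolding L2_set_def by (simp add: sum_nonneg)
   also have "... <= (\<Sum>j<card ?P. \<bar>F j psi\<bar>)\<^sup>2" by (intro power_mono L2_set_le_sum_abs L2_set_nonneg)
   finally show "(\<Sum>j<card ?P. (F j psi)\<^sup>2) <= (\<Sum>j<card ?P. \<bar>F j psi\<bar>)\<^sup>2" .
  qed (use Kb(1) V in \<open>auto intro: sum_nonneg\<close>)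
  finally show "Iu psi <= eps * integral Q (grad_sq psi) + (c + sqrt V) * (\<Sum>j<card ?P. \<bar>F j psi\<bar>)\<^sup>2" by simp
 qed
qed

lemma contradiction: False
proof -
 obtain m M where mM: "m > 0" "M > 0" and fr: "!!t psi. 0 <= t ==> t <= 1 ==> psi : X ==> m / 2 * integral Q (grad_sq psi) + 1/4 * integral Q (tn_sq psi)
  <= 2 * (N ((1 - t) *R T0 psi + t *R T1 psi))\<^sup>2 + M * Iu psi" by (rule fredholm) blast
 \<comment> \<open>Replacing (M + 1) \<open>Iu psi\<close> by the compactness estimate then costs
   m/4 of the gradient term, half of what the Fredholm estimate provides.\<close>
 define eps where "eps = m / (4 * (M + 1))"
 have M1: "M + 1 > 0" using mM by simp
 have eps: "eps > 0" "(M + 1) * eps = m / 4" using mM M1 unfolding eps_def by (simp_all add: field_simps)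
 obtain Mn :: nat and F :: "nat => (real^'n => real^('n set)) => real" and c where c: "c > 0" and Flin: "!!j. lin_on X (F j)" and Fb: "!!j psi. psi : X ==> \<bar>F j psi\<bar> <= c * NX psi"
  and comp: "!!psi. psi : X ==> Iu psi <= eps * integral Q (grad_sq psi) + c * (\<Sum>j<Mn. \<bar>F j psi\<bar>)\<^sup>2"
  by (rule compactness[OF eps(1)]) blast
 obtain c1 where c1: "c1 > 0" "!!psi. psi : X ==> Iu psi <= c1 * (N (T1 psi))\<^sup>2" by (rule mass_gap) blast
 obtain c2 where c2: "c2 > 0" "!!psi. psi : X ==> N (T1 psi - T0 psi) <= c2 * NX psi" by (rule T1_T0_bound) blast
 define d where "d = min (m / 4) (1/4)"
 have d: "d > 0" "d <= m / 4" "d <= 1/4" "d <= 1" using mM by (auto simp: d_def)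
 have NXd: "d * (NX psi)\<^sup>2 <= m / 4 * integral Q (grad_sq psi) + 1/4 * integral Q (tn_sq psi) + Iu psi" if psi: "psi : X" for psi
  unfolding NX_sq[OF psi] distrib_left using I_nonneg[OF psi] d mult_right_mono[of d 1 "Iu psi"] by (intro add_mono mult_right_mono) auto
 define K1 where "K1 = sqrt ((2 + (M + 1) * c) / d)"
 define K2 where "K2 = sqrt ((2 + (M + 1) * c1) / d)"
 have NN: "N y >= 0" if "continuous_on Q y" for y :: "real^'n => real^('n set)"
  unfolding N_def by (intro real_sqrt_ge_zero integral_nonneg int_cont continuous_on_inner that) auto
 have le_sqrt: "NX psi <= sqrt (a / d) * w" if "d * (NX psi)\<^sup>2 <= a * w\<^sup>2" "w >= 0" for psi a w
 proof -
  have "(NX psi)\<^sup>2 <= a / d * w\<^sup>2" using that(1) d(1) by (simp add: field_simps)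
  then have "\<bar>NX psi\<bar> <= sqrt (a / d * w\<^sup>2)" by (rule real_le_rsqrt[where x="\<bar>NX psi\<bar>", simplified])
  moreover have "sqrt (a / d * w\<^sup>2) = sqrt (a / d) * w" unfolding real_sqrt_mult[of "a / d"] using that(2) by simp
  ultimately show ?thesis by linarith
 qed
 have fred: "NX psi <= K1 * (N ((1 - t) *R T0 psi + t *R T1 psi) + (\<Sum>j<Mn. \<bar>F j psi\<bar>))" if t: "0 <= t" "t <= 1" and psi: "psi : X" for t psi
  unfolding K1_def
 proof (rule le_sqrt)
  define y where "y = N ((1 - t) *R T0 psi + t *R T1 psi)"
  define s where "s = (\<Sum>j<Mn. \<bar>F j psi\<bar>)"
  have y: "y >= 0" unfolding y_def plus_fun_def scaleR_fun_def
   by (intro NN continuous_on_add continuous_on_scaleR continuous_on_const cont_T0 cont_T1 psi)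
  have s: "s >= 0" by (simp add: s_def sum_nonneg)
  show "N ((1 - t) *R T0 psi + t *R T1 psi) + (\<Sum>j<Mn. \<bar>F j psi\<bar>) >= 0" using y s unfolding y_def s_def by simp
  have "(M + 1) * Iu psi <= (M + 1) * (eps * integral Q (grad_sq psi) + c * s\<^sup>2)"
   using comp[OF psi] mM unfolding s_def by (intro mult_left_mono) auto
  also have "... = m / 4 * integral Q (grad_sq psi) + (M + 1) * c * s\<^sup>2" unfolding eps(2)[symmetric] by (simp add: algebra_simps)
  finally have "d * (NX psi)\<^sup>2 <= 2 * y\<^sup>2 + (M + 1) * c * s\<^sup>2"
   using NXd[OF psi] fr[OF t psi] unfolding y_def[symmetric] by (simp add: algebra_simps)
  also have "... <= (2 + (M + 1) * c) * (y + s)\<^sup>2"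
  proof -
   have "y\<^sup>2 <= (y + s)\<^sup>2" "s\<^sup>2 <= (y + s)\<^sup>2" using y s by (auto intro: power_mono)
   then have "2 * y\<^sup>2 <= 2 * (y + s)\<^sup>2" "(M + 1) * c * s\<^sup>2 <= (M + 1) * c * (y + s)\<^sup>2" using mM c by (auto intro!: mult_left_mono)
   then show ?thesis unfolding distrib_right[of 2] by linarith
  qed
  finally show "d * (NX psi)\<^sup>2 <= (2 + (M + 1) * c) * (N ((1 - t) *R T0 psi + t *R T1 psi) + (\<Sum>j<Mn. \<bar>F j psi\<bar>))\<^sup>2"
   unfolding y_def s_def .
 qed
 have inj: "NX psi <= K2 * N (T1 psi)" if psi: "psi : X" for psi
  unfolding K2_def
 proof (rule le_sqrt[OF _ NN[OF cont_T1[OF psi]]])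
  have "(1 - 1) *R T0 psi + 1 *R T1 psi = T1 psi" by simp
  then have "m / 2 * integral Q (grad_sq psi) + 1/4 * integral Q (tn_sq psi) <= 2 * (N (T1 psi))\<^sup>2 + M * Iu psi" using fr[of 1 psi] psi by simp
  moreover have "(M + 1) * Iu psi <= (M + 1) * (c1 * (N (T1 psi))\<^sup>2)" using c1(2)[OF psi] mM by (intro mult_left_mono) auto
  moreover have "m / 4 * integral Q (grad_sq psi) <= m / 2 * integral Q (grad_sq psi)" using I_nonneg[OF psi] mM by (intro mult_right_mono) auto
  ultimately show "d * (NX psi)\<^sup>2 <= (2 + (M + 1) * c1) * (N (T1 psi))\<^sup>2" using NXd[OF psi] by (simp add: algebra_simps)
 qed
 define K' where "K' = K1 + K2 + c + c2"
 have nnK: "K1 >= 0" "K2 >= 0" using mM c c1 d by (auto simp: K1_def K2_def)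
 have K': "K' > 0" "K1 <= K'" "K2 <= K'" "c <= K'" "c2 <= K'" using nnK c c2 by (auto simp: K'_def)
 have NXn: "NX psi >= 0" if "psi : X" for psi using I_nonneg[OF that] by (simp add: NX_def)
 have cTt: "continuous_on Q ((1 - t) *R T0 psi + t *R T1 psi)" if "psi : X" for t psi
  unfolding plus_fun_def scaleR_fun_def by (intro continuous_on_add continuous_on_scaleR continuous_on_const cont_T0 cont_T1 that)
 show False
 proof (rule index_obstruction[OF X_subspace N_seminorm T0_lin T1_lin Flin into_C K'(1), where NX=NX and m=Mn and ?x0.0="bs {} (%a. 0)"])
  show "NX psi <= K' * (N ((1 - t) *R T0 psi + t *R T1 psi) + (\<Sum>i<Mn. \<bar>F i psi\<bar>))" if "0 <= t" "t <= 1" "psi : X" for t psi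
   using fred[OF that] mult_right_mono[OF K'(2), of "N ((1 - t) *R T0 psi + t *R T1 psi) + (\<Sum>i<Mn. \<bar>F i psi\<bar>)"]
    NN[OF cTt[OF that(3)], of t] by (auto simp: sum_nonneg intro: order_trans)
  show "N (T1 psi - T0 psi) <= K' * NX psi" if "psi : X" for psi
   using c2(2)[OF that] mult_right_mono[OF K'(5) NXn[OF that]] by linarith
  show "\<bar>F i psi\<bar> <= K' * NX psi" if "psi : X" for i psi
   using Fb[OF that, of i] mult_right_mono[OF K'(4) NXn[OF that]] by linarith
  show "NX psi <= K' * N (T1 psi)" if "psi : X" for psi
   using inj[OF that] mult_right_mono[OF K'(3) NN[OF cont_T1[OF that]]] by linarith
  show "bs {} (%a. 0) : X" "T0 (bs {} (%a. 0)) = 0" by (rule bs_kernel)+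
  have "Iu (bs {} (%a. 0)) > 0"
   using bs_kernel(3) unfolding N_def Iu_def by simp
  then show "NX (bs {} (%a. 0)) > 0"
   unfolding NX_def using I_nonneg[OF bs_kernel(1)] by simp
 qed (use T0_dense in auto)
qed

end

section \<open>Frame, bounds and Riccati equation for the given data\<close>

lemma (in riemannian) frame_exists:
 obtains E where "frame_on UNIV (%a b x. G a b x) E" "!!i x. i ~= e ==> E i e x = 0"
proof -
 have U: "insert e (UNIV - {e}) = UNIV" by auto
 \<comment> \<open>The index e is eliminated before all others, so that its column has a single
   nonzero entry and the remaining frame vectors are tangent to the level sets of x_e.\<close>
 have "\<exists>E. frame_on (insert e (UNIV - {e})) (%a b x. G a b x) E \<and> (\<forall>i x. i ~= e \<longrightarrow> E i e x = 0)"
 proof (rule cholesky_step)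
  show "posdef_on (insert e (UNIV - {e})) (%a b x. G a b x)" unfolding U by (rule G_posdef)
  show "\<exists>E'. frame_on (UNIV - {e}) h' E'" if "posdef_on (UNIV - {e}) h'" "!!a b. smooth_fun (h' a b)" for h'
   by (rule cholesky[OF finite that])
 qed (auto intro: G_smooth)
 then show ?thesis unfolding U using that by blast
qed

lemma (in riemannian) G_diag_bound: obtains K where "K >= 1" "!!x j. x : band e ==> sqrt (G j j x) <= K"
proof -
 have per: "periodic_in e (%x. G j j x)" for j
  using metric unfolding riem_metric_def smooth_sym_field_def periodic_in_def ginv_def by simp
 have "\<forall>j. \<exists>B. B > 0 \<and> (\<forall>x\<in>band e. \<bar>G j j x\<bar> <= B)"
  using periodic_bounded[OF per smooth_fun_continuous[OF G_smooth]] by metis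
 from choice[OF this] obtain b where b: "!!j. b j > 0" "!!j x. x : band e ==> \<bar>G j j x\<bar> <= b j" by blast
 show ?thesis
 proof (rule that[of "1 + (SUM j. sqrt (b j))"])
  show "1 + (SUM j. sqrt (b j)) >= 1" using b(1) by (simp add: sum_nonneg less_imp_le)
  fix x j assume x: "x : band e"
  have "sqrt (G j j x) <= sqrt (b j)" using b(2)[OF x, of j] by simp
  also have "... <= (SUM j. sqrt (b j))" by (rule member_le_sum) (use b(1) in \<open>auto intro: less_imp_le\<close>)
  finally show "sqrt (G j j x) <= 1 + (SUM j. sqrt (b j))" by simp
 qed
qed

text \<open>\<open>eta\<close> solves the Riccati equation that makes the potential term of the Witten operator vanish.\<close>

lemma eta_ode:
 assumes n: "n >= 2" and sig: "\<sigma> > (n - 1) / n * \<Lambda>\<^sup>2" and t: "t : eta_dom n \<Lambda> \<sigma>" and q: "q = n / (n - 1)"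
 shows "(eta n \<Lambda> \<sigma> has_real_derivative - (\<sigma> / 2 + q / 2 * (eta n \<Lambda> \<sigma> t)\<^sup>2 - \<Lambda> * eta n \<Lambda> \<sigma> t)) (at t)"
  and "q / 2 * (eta_s n \<Lambda> \<sigma>)\<^sup>2 <= \<sigma> / 2 + q / 2 * (eta n \<Lambda> \<sigma> t)\<^sup>2 - \<Lambda> * eta n \<Lambda> \<sigma> t"
  and "eta_s n \<Lambda> \<sigma> > 0"
proof -
 have q0: "q > 0" using n q by simp
 have iq: "(n - 1) / n = 1 / q" using n by (simp add: q)
 have hq: "n / (2 * (n - 1)) = q / 2" by (simp add: q)
 define s where "s = eta_s n \<Lambda> \<sigma>"
 have arg: "(n - 1) / n * (\<sigma> - (n - 1) / n * \<Lambda>\<^sup>2) > 0" using n sig by simp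
 show s0: "eta_s n \<Lambda> \<sigma> > 0" unfolding eta_s_def using arg by simp
 have s2: "s\<^sup>2 = 1 / q * (\<sigma> - 1 / q * \<Lambda>\<^sup>2)" unfolding s_def eta_s_def using arg unfolding iq by simp
 define u where "u = s * tan (q / 2 * s * t)"
 have eta: "eta n \<Lambda> \<sigma> t = 1 / q * \<Lambda> - s * tan (q / 2 * s * t)" for t unfolding eta_def iq hq s_def ..
 have P: "\<sigma> / 2 + q / 2 * (eta n \<Lambda> \<sigma> t)\<^sup>2 - \<Lambda> * eta n \<Lambda> \<sigma> t = q / 2 * (s\<^sup>2 + u\<^sup>2)"
  unfolding eta u_def[symmetric] s2 using q0 by (simp add: field_simps power2_eq_square)
 then show "q / 2 * (eta_s n \<Lambda> \<sigma>)\<^sup>2 <= \<sigma> / 2 + q / 2 * (eta n \<Lambda> \<sigma> t)\<^sup>2 - \<Lambda> * eta n \<Lambda> \<sigma> t"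
  unfolding P s_def[symmetric] using q0 by (intro mult_left_mono) auto
 have "\<bar>q / 2 * s * t\<bar> < pi / 2" using t unfolding eta_dom_def hq s_def by simp
 then have "- (pi / 2) < q / 2 * s * t \<and> q / 2 * s * t < pi / 2" unfolding abs_less_iff by linarith
 then have "cos (q / 2 * s * t) > 0" using cos_gt_zero_pi by blast
 then have c: "cos (q / 2 * s * t) ~= 0" by linarith
 have "((%t. 1 / q * \<Lambda> - s * tan (q / 2 * s * t)) has_real_derivative - (s * (inverse ((cos (q / 2 * s * t))\<^sup>2) * (q / 2 * s)))) (at t)"
  using c by (auto intro!: derivative_eq_intros)
 also have "inverse ((cos (q / 2 * s * t))\<^sup>2) = 1 + (tan (q / 2 * s * t))\<^sup>2"
  using c by (simp add: tan_def power_divide field_simps sin_squared_eq)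
 also have "- (s * ((1 + (tan (q / 2 * s * t))\<^sup>2) * (q / 2 * s))) = - (q / 2 * (s\<^sup>2 + u\<^sup>2))"
  by (simp add: u_def power2_eq_square algebra_simps)
 finally show "(eta n \<Lambda> \<sigma> has_real_derivative - (\<sigma> / 2 + q / 2 * (eta n \<Lambda> \<sigma> t)\<^sup>2 - \<Lambda> * eta n \<Lambda> \<sigma> t)) (at t)"
  unfolding P unfolding eta[abs_def] .
qed

lemma eta_between:
 assumes n: "n >= 2" and sig: "\<sigma> > (n - 1) / n * \<Lambda>\<^sup>2"
  and dom: "tm : eta_dom n \<Lambda> \<sigma>" "tp : eta_dom n \<Lambda> \<sigma>" and t: "tm <= t" "t <= tp"
 shows "t : eta_dom n \<Lambda> \<sigma>" "eta n \<Lambda> \<sigma> tp <= eta n \<Lambda> \<sigma> t"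
proof -
 have s0: "eta_s n \<Lambda> \<sigma> > 0" using eta_ode(3)[OF n sig dom(1) refl] .
 define c where "c = n / (2 * (n - 1)) * eta_s n \<Lambda> \<sigma>"
 have c: "c > 0" using n s0 by (simp add: c_def)
 have "c * tm <= c * t" "c * t <= c * tp" using c t by (auto intro: mult_left_mono)
 moreover have "\<bar>c * tm\<bar> < pi / 2" "\<bar>c * tp\<bar> < pi / 2" using dom unfolding eta_dom_def c_def by auto
 ultimately have b: "- (pi / 2) < c * t" "c * t <= c * tp" "c * tp < pi / 2" by auto
 then have "\<bar>c * t\<bar> < pi / 2" unfolding abs_less_iff by linarith
 then show "t : eta_dom n \<Lambda> \<sigma>" unfolding eta_dom_def mem_Collect_eq c_def[symmetric] .
 have "tan (c * t) <= tan (c * tp)"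
  using tan_monotone[of "c * t" "c * tp"] b by (cases "c * t = c * tp") auto
 then show "eta n \<Lambda> \<sigma> tp <= eta n \<Lambda> \<sigma> t" unfolding eta_def c_def[symmetric] using s0 by (simp add: mult_left_mono)
qed

theorem theorem2p7:
  fixes g k :: "real^'n::finite \<Rightarrow> real^'n^'n" and e :: 'n
    and \<Lambda> \<sigma> tm tp :: real
  assumes n2: "CARD('n) \<ge> 2"
    and sig: "\<sigma> > (real CARD('n) - 1) / real CARD('n) * \<Lambda>\<^sup>2"
    and g: "riem_metric e g"
    and k: "smooth_sym_field e k"
    and tr: "\<forall>x\<in>band e. trk g k x \<le> \<Lambda>"
    and dec: "\<forall>x\<in>band e. mu g k x - normJ g k x \<ge> \<sigma> / 2"
    and tdom: "tm \<in> eta_dom (real CARD('n)) \<Lambda> \<sigma>" "tp \<in> eta_dom (real CARD('n)) \<Lambda> \<sigma>"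
    and tlt: "tm < tp"
    and etapos: "eta (real CARD('n)) \<Lambda> \<sigma> tm > 0" "eta (real CARD('n)) \<Lambda> \<sigma> tp > 0"
    and bminus: "\<forall>x. x $ e = -1 \<longrightarrow> null_exp g k e x \<le> eta (real CARD('n)) \<Lambda> \<sigma> tm"
    and bplus: "\<forall>x. x $ e = 1 \<longrightarrow> null_exp g k e x \<ge> eta (real CARD('n)) \<Lambda> \<sigma> tp"
  shows "width g e \<le> tp - tm"
proof (rule ccontr)
 assume "\<not> width g e <= tp - tm"
 then have w: "tp - tm < width g e" by simp
 interpret R: riemannian e g by (rule riemannian.intro[OF g])
 define n where "n = real CARD('n)"
 define q where "q = n / (n - 1)"
 have n: "n >= 2" using n2 by (simp add: n_def)
 have q0: "q > 0" using n by (simp add: q_def)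
 note hyps = sig[folded n_def] tdom[folded n_def] etapos[folded n_def]
 define \<eta> where "\<eta> = eta n \<Lambda> \<sigma>"
 define s where "s = eta_s n \<Lambda> \<sigma>"
 \<comment> \<open>The Riccati polynomial: the derivative of eta is minus its value along eta, and
   it is bounded below by (q/2) s^2.\<close>
 define P where "P y = \<sigma> / 2 + q / 2 * y\<^sup>2 - \<Lambda> * y" for y
 obtain rho rho' kap where kap: "0 < kap" "kap < 1" and rho: "!!a x. has_pd a rho (rho' a x) x" "!!a. continuous_on UNIV (rho' a)"
  "!!x. tm <= rho x" "!!x. rho x <= tp" "!!x. x $ e = -1 ==> rho x = tm" "!!x. x $ e = 1 ==> rho x = tp"
  "!!x. x : band e ==> sqrt (SUM a. SUM b. ginv g x $ a $ b * rho' a x * rho' b x) <= 1 - kap"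
  by (rule R.band_function[OF tlt w]) blast
 have dom: "rho x : eta_dom n \<Lambda> \<sigma>" and hpos: "\<eta> (rho x) > 0" for x
  using eta_between[OF n hyps(1) hyps(2,3) rho(3)[of x] rho(4)[of x]] hyps(5) unfolding \<eta>_def by auto
 have ode: "(\<eta> has_real_derivative - P (\<eta> t)) (at t)" and Ps: "q / 2 * s\<^sup>2 <= P (\<eta> t)" and s0: "s > 0" if "t : eta_dom n \<Lambda> \<sigma>" for t
  using eta_ode[OF n hyps(1) that q_def] unfolding P_def \<eta>_def s_def by auto
 define h where "h x = \<eta> (rho x)" for x
 define h' where "h' a x = - P (h x) * rho' a x" for a x
 have hd: "has_pd a h (h' a x) x" for a x
  unfolding h_def[abs_def] h'_def using has_pd_chain[OF rho(1) ode[OF dom]] by simp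
 have ch: "continuous_on UNIV h"
 proof -
  have crho: "continuous_on UNIV rho"
   by (intro continuous_at_imp_continuous_on ballI has_derivative_continuous[OF has_derivative_partials[OF rho(1,2)]])
  have c\<eta>: "continuous_on (eta_dom n \<Lambda> \<sigma>) \<eta>"
   by (intro continuous_at_imp_continuous_on ballI DERIV_isCont[OF ode])
  show ?thesis unfolding h_def[abs_def] by (rule continuous_on_compose2[OF c\<eta> crho]) (use dom in auto)
 qed
 have ch': "continuous_on UNIV (h' a)" for a
  unfolding h'_def[abs_def] P_def by (intro continuous_intros ch rho(2))
 obtain E where E: "frame_on UNIV (%a b x. ginv g x $ a $ b) E" "!!i x. i ~= e ==> E i e x = 0" by (rule R.frame_exists) blast
 obtain K where K: "K >= 1" "!!x j. x : band e ==> sqrt (ginv g x $ j $ j) <= K" by (rule R.G_diag_bound) blast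
 \<comment> \<open>The first summand makes the Garding inequality work, which needs 2 K \<le> lam;
   the second gives the exponent 2 demanded by divisibility by cos^2.\<close>
 define lam where "lam = nat \<lceil>2 * K\<rceil> + 2"
 have lam: "lam >= 2" "2 * K <= real lam" using real_nat_ceiling_ge[of "2 * K"] by (auto simp: lam_def)
 \<comment> \<open>The part of P that the gradient bound 1 - kap leaves over, multiplied by
   q/2.\<close>
 define gam where "gam = q / 2 * (kap * (q / 2 * s\<^sup>2))"
 have gam: "gam > 0" using q0 kap s0[OF dom[of 0]] by (simp add: gam_def)
 have gap: "gam <= q/2 * ((mu g k x - normJ g k x) + q/2 * (h x)\<^sup>2 - h x * trk g k x
   - sqrt (SUM a. SUM b. ginv g x $ a $ b * h' a x * h' b x))" if x: "x : band e" for x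
 proof -
  have P0: "q / 2 * s\<^sup>2 <= P (h x)" unfolding h_def by (rule Ps[OF dom])
  then have Pp: "P (h x) >= 0" using q0 by (intro order_trans[OF _ P0]) simp
  have "(SUM a. SUM b. ginv g x $ a $ b * h' a x * h' b x)
   = (P (h x))\<^sup>2 * (SUM a. SUM b. ginv g x $ a $ b * rho' a x * rho' b x)"
   by (simp add: h'_def sum_distrib_left power2_eq_square mult_ac)
  then have "sqrt (SUM a. SUM b. ginv g x $ a $ b * h' a x * h' b x)
   = P (h x) * sqrt (SUM a. SUM b. ginv g x $ a $ b * rho' a x * rho' b x)" using Pp by (simp add: real_sqrt_mult)
  also have "... <= P (h x) * (1 - kap)" by (rule mult_left_mono[OF rho(7)[OF x] Pp])
  finally have 1: "sqrt (SUM a. SUM b. ginv g x $ a $ b * h' a x * h' b x) <= P (h x) - kap * P (h x)" by (simp add: algebra_simps)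
  \<comment> \<open>Positivity of h enters here: it allows the bound on the trace of k to be
    multiplied by h.\<close>
  have 2: "h x * trk g k x <= \<Lambda> * h x" using tr x hpos[of x] mult_left_mono[of "trk g k x" \<Lambda> "h x"] by (simp add: h_def mult.commute)
  have 3: "kap * (q / 2 * s\<^sup>2) <= kap * P (h x)" using P0 kap by (intro mult_left_mono) auto
  have 4: "\<sigma> / 2 <= mu g k x - normJ g k x" using dec x by blast
  have "kap * (q / 2 * s\<^sup>2) <= (mu g k x - normJ g k x) + q/2 * (h x)\<^sup>2 - h x * trk g k x
   - sqrt (SUM a. SUM b. ginv g x $ a $ b * h' a x * h' b x)"
   using 1 2 3 4 P_def[of "h x"] by linarith
  then show ?thesis unfolding gam_def using q0 by (intro mult_left_mono) auto
 qed
 \<comment> \<open>The total cost of the tangent potentials is at most c0/L^2, hence at most c0/L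
   for L \<ge> 1; the choice of L brings it below gam/2. Neither \<open>lam\<close> nor
   \<open>gam\<close> depends on L.\<close>
 define c0 where "c0 = n * (real lam * K * (pi / 2)\<^sup>2)"
 define L where "L = max 1 (2 * c0 / gam)"
 have L1: "L >= 1" by (simp add: L_def)
 interpret S: slab e L lam by unfold_locales (use L1 lam in auto)
 have Qb: "x : band e" if "x : cbox S.lo S.hi" for x
 proof -
  have "S.lo $ e <= x $ e \<and> x $ e <= S.hi $ e" using that unfolding mem_box_cart by blast
  then show ?thesis by (simp add: band_def S.lo_def S.hi_def)
 qed
 have small: "(\<Sum>j\<in>UNIV - {e}. real lam * K * (S.dl j)\<^sup>2) <= gam / 2"
 proof -
  have c0: "c0 >= 0" using K n by (simp add: c0_def)
  have "(\<Sum>j\<in>UNIV - {e}. real lam * K * (S.dl j)\<^sup>2) <= (\<Sum>j::'n\<in>UNIV. real lam * K * ((pi / 2)\<^sup>2 / L\<^sup>2))"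
  proof (rule order_trans[OF _ sum_mono2[where A="UNIV - {e}"]])
   show "(\<Sum>j\<in>UNIV - {e}. real lam * K * (S.dl j)\<^sup>2) <= (\<Sum>j\<in>UNIV - {e}. real lam * K * ((pi / 2)\<^sup>2 / L\<^sup>2))"
    by (intro sum_mono) (simp add: S.dl_def power_divide power_mult_distrib)
  qed (use K in auto)
  also have "... = c0 / L\<^sup>2" by (simp add: c0_def n_def)
  also have "... <= c0 / L" using L1 c0 by (intro divide_left_mono) (auto simp: power2_eq_square)
  also have "... <= gam / 2"
  proof -
   have "2 * c0 / gam <= L" by (simp add: L_def)
   then show ?thesis using gam L1 by (simp add: field_simps)
  qed
  finally show ?thesis .
 qed
 interpret W: witten_slab e g E k L lam h h' q K gam
 proof unfold_locales
  show "frame_on UNIV (%a b x. ginv g x $ a $ b) E" by (rule E(1))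
  show "E i e x = 0" if "i ~= e" for i x using E(2)[OF that] .
  show "smooth_sym_field e k" by (rule k)
  show "CARD('n) >= 2" by (rule n2)
  show "q = real CARD('n) / (real CARD('n) - 1)" by (simp add: q_def n_def)
  show "has_pd a h (h' a x) x" for a x by (rule hd)
  show "continuous_on UNIV (h' a)" for a by (rule ch')
  show "1 <= K" by (rule K(1))
  show "sqrt (ginv g x $ j $ j) <= K" if "x : cbox S.lo S.hi" for x j by (rule K(2)[OF Qb[OF that]])
  show "2 * K <= real lam" by (rule lam(2))
  show "gam > 0" by (rule gam)
  show "gam <= q/2 * ((mu g k x - normJ g k x) + q/2 * (h x)\<^sup>2 - h x * trk g k x
   - sqrt (SUM a. SUM b. ginv g x $ a $ b * h' a x * h' b x))" if "x : cbox S.lo S.hi" for x by (rule gap[OF Qb[OF that]])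
  show "(\<Sum>j\<in>UNIV - {e}. real lam * K * (S.dl j)\<^sup>2) <= gam / 2" by (rule small)
  show "h x <= null_exp g k e x" if "x $ e = 1" for x using bplus that rho(6)[OF that] by (simp add: h_def \<eta>_def n_def)
  show "null_exp g k e x <= h x" if "x $ e = -1" for x using bminus that rho(5)[OF that] by (simp add: h_def \<eta>_def n_def)
 qed
 show False by (rule W.contradiction)
qed

end
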